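(* Let $k$ be a field of characteristic $0$, and let $A=A(\alpha,\beta)$ with $\alpha,\beta\in k$, $\beta\ne0$, be a PI noetherian graded down-up algebra with center $Z(A)$ and canonical element $\mathfrak b=\Omega_1\Omega_2$ (defined in the context). Then $A$ is Calabi--Yau if and only if $\mathfrak b\in Z(A)$.
   Context: For $\alpha,\beta\in k$ with $\beta\ne0$, the noetherian graded down-up algebra $A(\alpha,\beta)$ is the $k$-algebra generated by $x,y$ (both in degree $1$) with relations $x^2y-\alpha xyx-\beta yx^2=0$ and $xy^2-\alpha yxy-\beta y^2x=0$. It is Artin--Schelter regular of dimension $3$. Let $\omega_1,\omega_2$ be the roots (in an algebraic closure of $k$) of $w^2-\alpha w-\beta=0$, let $\Omega_i=xy-\omega_iyx$ for $i=1,2$, and let $\mathfrak b=\Omega_1\Omega_2$, which lies in $A$ (as $xy$ and $yx$ commute, $\mathfrak b=(xy)^2-\alpha(xy)(yx)-\beta(yx)^2$). PI means that $A$ satisfies a polynomial identity; this holds if and only if both $\omega_1,\omega_2$ are roots of unity. With $A^e=A\otimes A^{\mathrm{op}}$ there is a graded automorphism $\mu$ of $A$ (Nakayama automorphism) with $\operatorname{Ext}^3_{A^e}(A,A^e)\cong{}^\mu A$, where ${}^\mu A$ is $A$ with action $(a\otimes b)\cdot c=\mu(a)cb$. $A$ is Calabi--Yau when $\mu=\mathrm{Id}$. *)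

theory Defs
  imports
    "HOL-Algebra.Algebraic_Closure_Type"
    "HOL-Computational_Algebra.Polynomial"
    "HOL-Library.FuncSet"
begin

text \<open>
  An algebra over a field, given as a type \<open>'k\<close> of class \<^class>\<open>field\<close>, is a ring with a scalar
  multiplication by \<open>'k\<close>, carried by the record \<open>('k, 'a) module\<close> of \<open>HOL-Algebra\<close>. The same record
  is used for left modules over a noncommutative ring and for bimodules; for these the fields
  \<open>mult\<close> and \<open>one\<close> have no meaning and are left undefined.
\<close>

section \<open>Associative algebras\<close>

definition monoid_algebra :: "('m, 'x) monoid_scheme \<Rightarrow> ('k::field, 'm \<Rightarrow> 'k) module" where
  "monoid_algebra M =
    \<lparr>carrier = {f. finite {m. f m \<noteq> 0} \<and> {m. f m \<noteq> 0} \<subseteq> carrier M},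
     monoid.mult = (\<lambda>f g m. \<Sum>(u, v) \<in> {u. f u \<noteq> 0} \<times> {v. g v \<noteq> 0}.
                        if u \<otimes>\<^bsub>M\<^esub> v = m then f u * g v else 0),
     monoid.one = (\<lambda>m. if m = \<one>\<^bsub>M\<^esub> then 1 else 0),
     ring.zero = (\<lambda>m. 0),
     ring.add = (\<lambda>f g m. f m + g m),
     module.smult = (\<lambda>c f m. c * f m)\<rparr>"

definition basis_elem :: "'m \<Rightarrow> 'm \<Rightarrow> 'k::field" where
  "basis_elem m = (\<lambda>m'. if m' = m then 1 else 0)"

definition word_monoid :: "'v list monoid" where
  "word_monoid = \<lparr>carrier = UNIV, monoid.mult = (@), monoid.one = []\<rparr>"

abbreviation free_algebra :: "('k::field, 'v list \<Rightarrow> 'k) module" where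
  "free_algebra \<equiv> monoid_algebra word_monoid"

definition quotient_algebra :: "('k::field, 'a) module \<Rightarrow> 'a set \<Rightarrow> ('k, 'a set) module" where
  "quotient_algebra A I =
    ring.extend (A Quot I) (module.fields (\<lambda>c U. \<Union>u\<in>U. I +>\<^bsub>A\<^esub> (c \<odot>\<^bsub>A\<^esub> u)))"

definition opposite_algebra :: "('k::field, 'a) module \<Rightarrow> ('k, 'a) module" where
  "opposite_algebra A = A\<lparr>monoid.mult := (\<lambda>a b. b \<otimes>\<^bsub>A\<^esub> a)\<rparr>"

definition algebra_center :: "('k::field, 'a) module \<Rightarrow> 'a set" where
  "algebra_center A = {z \<in> carrier A. \<forall>a \<in> carrier A. z \<otimes>\<^bsub>A\<^esub> a = a \<otimes>\<^bsub>A\<^esub> z}"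

text \<open>
  The tensor product over \<open>'k\<close> is the free vector space on \<open>A \<times> B\<close> modulo the bilinearity relations.
  The free vector space is the monoid algebra of the product of the multiplicative monoids; the span
  of the relations is stable under multiplication by pairs \<open>(a, b)\<close>, so it is the two-sided ideal
  they generate, and the quotient carries the product \<open>(a \<otimes> b)(a' \<otimes> b') = aa' \<otimes> bb'\<close>.
\<close>

definition tensor_relations ::
    "('k::field, 'a) module \<Rightarrow> ('k, 'b) module \<Rightarrow> ('a \<times> 'b \<Rightarrow> 'k) set" where
  "tensor_relations A B = (let F = monoid_algebra (A \<times>\<times> B) in
     {basis_elem (a \<oplus>\<^bsub>A\<^esub> a', b) \<ominus>\<^bsub>F\<^esub> (basis_elem (a, b) \<oplus>\<^bsub>F\<^esub> basis_elem (a', b)) | a a' b.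
        a \<in> carrier A \<and> a' \<in> carrier A \<and> b \<in> carrier B} \<union>
     {basis_elem (a, b \<oplus>\<^bsub>B\<^esub> b') \<ominus>\<^bsub>F\<^esub> (basis_elem (a, b) \<oplus>\<^bsub>F\<^esub> basis_elem (a, b')) | a b b'.
        a \<in> carrier A \<and> b \<in> carrier B \<and> b' \<in> carrier B} \<union>
     {basis_elem (c \<odot>\<^bsub>A\<^esub> a, b) \<ominus>\<^bsub>F\<^esub> c \<odot>\<^bsub>F\<^esub> basis_elem (a, b) | c a b.
        a \<in> carrier A \<and> b \<in> carrier B} \<union>
     {basis_elem (a, c \<odot>\<^bsub>B\<^esub> b) \<ominus>\<^bsub>F\<^esub> c \<odot>\<^bsub>F\<^esub> basis_elem (a, b) | c a b.
        a \<in> carrier A \<and> b \<in> carrier B})"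

definition tensor_ideal ::
    "('k::field, 'a) module \<Rightarrow> ('k, 'b) module \<Rightarrow> ('a \<times> 'b \<Rightarrow> 'k) set" where
  "tensor_ideal A B = Idl\<^bsub>monoid_algebra (A \<times>\<times> B)\<^esub> (tensor_relations A B)"

definition tensor_algebra ::
    "('k::field, 'a) module \<Rightarrow> ('k, 'b) module \<Rightarrow> ('k, ('a \<times> 'b \<Rightarrow> 'k) set) module" where
  "tensor_algebra A B = quotient_algebra (monoid_algebra (A \<times>\<times> B)) (tensor_ideal A B)"

definition pure_tensor ::
    "('k::field, 'a) module \<Rightarrow> ('k, 'b) module \<Rightarrow> 'a \<Rightarrow> 'b \<Rightarrow> ('a \<times> 'b \<Rightarrow> 'k) set" where
  "pure_tensor A B a b =
     tensor_ideal A B +>\<^bsub>monoid_algebra (A \<times>\<times> B)\<^esub> basis_elem (a, b)"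

abbreviation enveloping_algebra ::
    "('k::field, 'a) module \<Rightarrow> ('k, ('a \<times> 'a \<Rightarrow> 'k) set) module" where
  "enveloping_algebra A \<equiv> tensor_algebra A (opposite_algebra A)"

text \<open>
  A polynomial identity is a nonzero element of the free algebra on countably many variables that
  vanishes under every substitution.
\<close>

definition free_eval :: "('k::field, 'a) module \<Rightarrow> ('v \<Rightarrow> 'a) \<Rightarrow> ('v list \<Rightarrow> 'k) \<Rightarrow> 'a" where
  "free_eval A \<rho> p =
     (\<Oplus>\<^bsub>A\<^esub> w \<in> {w. p w \<noteq> 0}. p w \<odot>\<^bsub>A\<^esub> foldr (\<lambda>v a. \<rho> v \<otimes>\<^bsub>A\<^esub> a) w \<one>\<^bsub>A\<^esub>)"

definition polynomial_identity_algebra :: "('k::field, 'a) module \<Rightarrow> bool" where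
  "polynomial_identity_algebra A \<longleftrightarrow>
     (\<exists>p \<in> carrier (free_algebra :: ('k, nat list \<Rightarrow> 'k) module).
        p \<noteq> \<zero>\<^bsub>free_algebra\<^esub> \<and> (\<forall>\<rho> \<in> UNIV \<rightarrow> carrier A. free_eval A \<rho> p = \<zero>\<^bsub>A\<^esub>))"


section \<open>Ext of left modules\<close>

definition left_module_hom ::
    "('r, 'x) ring_scheme \<Rightarrow> ('r, 'm) module \<Rightarrow> ('r, 'n) module \<Rightarrow> ('m \<Rightarrow> 'n) set" where
  "left_module_hom R M N =
    {f \<in> carrier M \<rightarrow>\<^sub>E carrier N.
       (\<forall>u \<in> carrier M. \<forall>v \<in> carrier M. f (u \<oplus>\<^bsub>M\<^esub> v) = f u \<oplus>\<^bsub>N\<^esub> f v) \<and>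
       (\<forall>r \<in> carrier R. \<forall>u \<in> carrier M. f (r \<odot>\<^bsub>M\<^esub> u) = r \<odot>\<^bsub>N\<^esub> f u)}"

definition free_left_module :: "('r, 'x) ring_scheme \<Rightarrow> 'i set \<Rightarrow> ('r, 'i \<Rightarrow> 'r) module" where
  "free_left_module R B =
    \<lparr>carrier = {f. finite {i. f i \<noteq> \<zero>\<^bsub>R\<^esub>} \<and> (\<forall>i. f i \<in> carrier R) \<and> (\<forall>i. i \<notin> B \<longrightarrow> f i = \<zero>\<^bsub>R\<^esub>)},
     monoid.mult = undefined,
     monoid.one = undefined,
     ring.zero = (\<lambda>i. \<zero>\<^bsub>R\<^esub>),
     ring.add = (\<lambda>f g i. f i \<oplus>\<^bsub>R\<^esub> g i),
     module.smult = (\<lambda>r f i. r \<otimes>\<^bsub>R\<^esub> f i)\<rparr>"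

definition regular_left_module :: "('r, 'x) ring_scheme \<Rightarrow> ('r, 'r) module" where
  "regular_left_module R =
    \<lparr>carrier = carrier R, monoid.mult = undefined, monoid.one = undefined,
     ring.zero = \<zero>\<^bsub>R\<^esub>, ring.add = ring.add R, module.smult = monoid.mult R\<rparr>"

text \<open>
  An exact sequence of free left modules ending in \<open>M\<close>, with bases \<open>B n\<close>, augmentation \<open>\<epsilon>\<close> from
  degree \<open>0\<close> to \<open>M\<close>, and differential \<open>d n\<close> from degree \<open>n + 1\<close> to degree \<open>n\<close>.
\<close>

definition free_resolution ::
    "('r, 'x) ring_scheme \<Rightarrow> ('r, 'm) module \<Rightarrow> (nat \<Rightarrow> 'i set) \<Rightarrow>
     (nat \<Rightarrow> ('i \<Rightarrow> 'r) \<Rightarrow> ('i \<Rightarrow> 'r)) \<Rightarrow> (('i \<Rightarrow> 'r) \<Rightarrow> 'm) \<Rightarrow> bool" where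
  "free_resolution R M B d \<epsilon> \<longleftrightarrow>
     \<epsilon> \<in> left_module_hom R (free_left_module R (B 0)) M \<and>
     (\<forall>n. d n \<in> left_module_hom R (free_left_module R (B (Suc n))) (free_left_module R (B n))) \<and>
     \<epsilon> ` carrier (free_left_module R (B 0)) = carrier M \<and>
     {p \<in> carrier (free_left_module R (B 0)). \<epsilon> p = \<zero>\<^bsub>M\<^esub>} =
       d 0 ` carrier (free_left_module R (B (Suc 0))) \<and>
     (\<forall>n. {p \<in> carrier (free_left_module R (B (Suc n))). d n p = \<zero>\<^bsub>free_left_module R (B n)\<^esub>} =
       d (Suc n) ` carrier (free_left_module R (B (Suc (Suc n)))))"

text \<open>
  \<open>act\<close> is a further action of a set of scalars \<open>'s\<close> on \<open>N\<close>, commuting with that of \<open>R\<close>; the groups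
  of homomorphisms into \<open>N\<close>, and hence the Ext groups, inherit it.
\<close>

definition hom_module ::
    "('r, 'x) ring_scheme \<Rightarrow> ('r, 'm) module \<Rightarrow> ('r, 'n) module \<Rightarrow> ('s \<Rightarrow> 'n \<Rightarrow> 'n) \<Rightarrow>
     ('s, 'm \<Rightarrow> 'n) module" where
  "hom_module R M N act =
    \<lparr>carrier = left_module_hom R M N,
     monoid.mult = undefined,
     monoid.one = undefined,
     ring.zero = (\<lambda>u \<in> carrier M. \<zero>\<^bsub>N\<^esub>),
     ring.add = (\<lambda>f g. \<lambda>u \<in> carrier M. f u \<oplus>\<^bsub>N\<^esub> g u),
     module.smult = (\<lambda>s f. \<lambda>u \<in> carrier M. act s (f u))\<rparr>"

definition quotient_module :: "('s, 'm) module \<Rightarrow> 'm set \<Rightarrow> ('s, 'm set) module" where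
  "quotient_module M N =
    \<lparr>carrier = a_rcosets\<^bsub>M\<^esub> N,
     monoid.mult = undefined,
     monoid.one = undefined,
     ring.zero = N,
     ring.add = set_add M,
     module.smult = (\<lambda>s U. \<Union>u\<in>U. N +>\<^bsub>M\<^esub> (s \<odot>\<^bsub>M\<^esub> u))\<rparr>"

definition cocycle_module ::
    "('r, 'x) ring_scheme \<Rightarrow> ('r, 'n) module \<Rightarrow> ('s \<Rightarrow> 'n \<Rightarrow> 'n) \<Rightarrow> (nat \<Rightarrow> 'i set) \<Rightarrow>
     (nat \<Rightarrow> ('i \<Rightarrow> 'r) \<Rightarrow> ('i \<Rightarrow> 'r)) \<Rightarrow> nat \<Rightarrow> ('s, ('i \<Rightarrow> 'r) \<Rightarrow> 'n) module" where
  "cocycle_module R N act B d n =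
    (hom_module R (free_left_module R (B n)) N act)
      \<lparr>carrier := {f \<in> left_module_hom R (free_left_module R (B n)) N.
                    \<forall>p \<in> carrier (free_left_module R (B (Suc n))). f (d n p) = \<zero>\<^bsub>N\<^esub>}\<rparr>"

definition coboundaries ::
    "('r, 'x) ring_scheme \<Rightarrow> ('r, 'n) module \<Rightarrow> (nat \<Rightarrow> 'i set) \<Rightarrow>
     (nat \<Rightarrow> ('i \<Rightarrow> 'r) \<Rightarrow> ('i \<Rightarrow> 'r)) \<Rightarrow> nat \<Rightarrow> (('i \<Rightarrow> 'r) \<Rightarrow> 'n) set" where
  "coboundaries R N B d n = (case n of
      0 \<Rightarrow> {\<lambda>p \<in> carrier (free_left_module R (B 0)). \<zero>\<^bsub>N\<^esub>}
    | Suc m \<Rightarrow> (\<lambda>g. \<lambda>p \<in> carrier (free_left_module R (B (Suc m))). g (d m p)) `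
                left_module_hom R (free_left_module R (B m)) N)"

definition cohomology_module ::
    "('r, 'x) ring_scheme \<Rightarrow> ('r, 'n) module \<Rightarrow> ('s \<Rightarrow> 'n \<Rightarrow> 'n) \<Rightarrow> (nat \<Rightarrow> 'i set) \<Rightarrow>
     (nat \<Rightarrow> ('i \<Rightarrow> 'r) \<Rightarrow> ('i \<Rightarrow> 'r)) \<Rightarrow> nat \<Rightarrow> ('s, (('i \<Rightarrow> 'r) \<Rightarrow> 'n) set) module" where
  "cohomology_module R N act B d n =
     quotient_module (cocycle_module R N act B d n) (coboundaries R N B d n)"

definition equivariant_iso ::
    "'s set \<Rightarrow> ('s, 'm) module \<Rightarrow> ('s, 'n) module \<Rightarrow> ('m \<Rightarrow> 'n) set" where
  "equivariant_iso S M N =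
    {\<phi>. bij_betw \<phi> (carrier M) (carrier N) \<and>
        (\<forall>u \<in> carrier M. \<forall>v \<in> carrier M. \<phi> (u \<oplus>\<^bsub>M\<^esub> v) = \<phi> u \<oplus>\<^bsub>N\<^esub> \<phi> v) \<and>
        (\<forall>s \<in> S. \<forall>u \<in> carrier M. \<phi> (s \<odot>\<^bsub>M\<^esub> u) = s \<odot>\<^bsub>N\<^esub> \<phi> u)}"

text \<open>
  \<open>Ext\<^sup>n\<^sub>R(M, N) \<cong> E\<close>, compatibly with the extra action of the scalars in \<open>S\<close>. Ext is determined up to
  such isomorphism by any free resolution of \<open>M\<close>. Indexing the bases by lists over \<open>'r \<times> 'm\<close> is no
  restriction: this type is infinite and at least as large as \<open>R\<close> and \<open>M\<close>, so every \<open>M\<close> has a free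
  resolution with bases in it.
\<close>

definition Ext_isomorphic ::
    "('r, 'x) ring_scheme \<Rightarrow> nat \<Rightarrow> ('r, 'm) module \<Rightarrow> ('r, 'n) module \<Rightarrow>
     's set \<Rightarrow> ('s \<Rightarrow> 'n \<Rightarrow> 'n) \<Rightarrow> ('s, 'e) module \<Rightarrow> bool" where
  "Ext_isomorphic R n M N S act E \<longleftrightarrow>
     (\<exists>(B :: nat \<Rightarrow> ('r \<times> 'm) list set) d \<epsilon>. free_resolution R M B d \<epsilon> \<and>
        equivariant_iso S (cohomology_module R N act B d n) E \<noteq> {})"


section \<open>Nakayama automorphisms and the Calabi--Yau property\<close>

text \<open>
  \<open>A\<close> as a left module over the enveloping algebra, \<open>(a \<otimes> b) \<cdot> c = acb\<close>. The value on an element of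
  the enveloping algebra is computed from any of its representatives \<open>f\<close>.
\<close>

definition diagonal_module ::
    "('k::field, 'a) module \<Rightarrow> (('a \<times> 'a \<Rightarrow> 'k) set, 'a) module" where
  "diagonal_module A =
    \<lparr>carrier = carrier A, monoid.mult = undefined, monoid.one = undefined,
     ring.zero = \<zero>\<^bsub>A\<^esub>, ring.add = ring.add A,
     module.smult = (\<lambda>t c. the_elem
       ((\<lambda>f. \<Oplus>\<^bsub>A\<^esub> u \<in> {u. f u \<noteq> 0}. f u \<odot>\<^bsub>A\<^esub> (fst u \<otimes>\<^bsub>A\<^esub> c \<otimes>\<^bsub>A\<^esub> snd u)) ` t))\<rparr>"

text \<open>
  Bimodules over \<open>A\<close> are given by the action of pairs \<open>(a, b)\<close>, standing for \<open>a \<otimes> b\<close>; as these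
  generate the enveloping algebra additively, additive maps commuting with the pairs are the same
  as isomorphisms over the enveloping algebra. The enveloping algebra is a module over itself by
  left multiplication (the outer structure \<open>a \<cdot> (u \<otimes> v) \<cdot> b = au \<otimes> vb\<close>); the right
  multiplications commute with it and give the inner structure \<open>a \<cdot> (u \<otimes> v) \<cdot> b = ub \<otimes> av\<close>,
  which is right multiplication by \<open>b \<otimes> a\<close>.
\<close>

definition inner_action ::
    "('k::field, 'a) module \<Rightarrow> 'a \<times> 'a \<Rightarrow> ('a \<times> 'a \<Rightarrow> 'k) set \<Rightarrow> ('a \<times> 'a \<Rightarrow> 'k) set" where
  "inner_action A = (\<lambda>(a, b) t.
     t \<otimes>\<^bsub>enveloping_algebra A\<^esub> pure_tensor A (opposite_algebra A) b a)"

definition twisted_bimodule ::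
    "('k::field, 'a) module \<Rightarrow> ('a \<Rightarrow> 'a) \<Rightarrow> ('a \<times> 'a, 'a) module" where
  "twisted_bimodule A \<mu> =
    \<lparr>carrier = carrier A, monoid.mult = undefined, monoid.one = undefined,
     ring.zero = \<zero>\<^bsub>A\<^esub>, ring.add = ring.add A,
     module.smult = (\<lambda>(a, b) c. \<mu> a \<otimes>\<^bsub>A\<^esub> c \<otimes>\<^bsub>A\<^esub> b)\<rparr>"

definition graded_automorphism ::
    "('k::field, 'a) module \<Rightarrow> (nat \<Rightarrow> 'a set) \<Rightarrow> ('a \<Rightarrow> 'a) \<Rightarrow> bool" where
  "graded_automorphism A gr \<mu> \<longleftrightarrow>
     \<mu> \<in> ring_iso A A \<and>
     (\<forall>c. \<forall>a \<in> carrier A. \<mu> (c \<odot>\<^bsub>A\<^esub> a) = c \<odot>\<^bsub>A\<^esub> \<mu> a) \<and>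
     (\<forall>n. \<mu> ` gr n = gr n)"

definition nakayama_automorphism ::
    "nat \<Rightarrow> ('k::field, 'a) module \<Rightarrow> (nat \<Rightarrow> 'a set) \<Rightarrow> ('a \<Rightarrow> 'a) \<Rightarrow> bool" where
  "nakayama_automorphism d A gr \<mu> \<longleftrightarrow>
     graded_automorphism A gr \<mu> \<and>
     Ext_isomorphic (enveloping_algebra A) d
       (diagonal_module A) (regular_left_module (enveloping_algebra A))
       (carrier A \<times> carrier A) (inner_action A) (twisted_bimodule A \<mu>)"

definition calabi_yau :: "nat \<Rightarrow> ('k::field, 'a) module \<Rightarrow> (nat \<Rightarrow> 'a set) \<Rightarrow> bool" where
  "calabi_yau d A gr \<longleftrightarrow>
     (\<exists>\<mu>. nakayama_automorphism d A gr \<mu> \<and> (\<forall>a \<in> carrier A. \<mu> a = a))"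


section \<open>Graded down-up algebras\<close>

datatype generator = GenX | GenY

definition down_up_relations ::
    "'k::field \<Rightarrow> 'k \<Rightarrow> (generator list \<Rightarrow> 'k) set" where
  "down_up_relations \<alpha> \<beta> =
    {basis_elem [GenX, GenX, GenY]
       \<ominus>\<^bsub>free_algebra\<^esub> \<alpha> \<odot>\<^bsub>free_algebra\<^esub> basis_elem [GenX, GenY, GenX]
       \<ominus>\<^bsub>free_algebra\<^esub> \<beta> \<odot>\<^bsub>free_algebra\<^esub> basis_elem [GenY, GenX, GenX],
     basis_elem [GenX, GenY, GenY]
       \<ominus>\<^bsub>free_algebra\<^esub> \<alpha> \<odot>\<^bsub>free_algebra\<^esub> basis_elem [GenY, GenX, GenY]
       \<ominus>\<^bsub>free_algebra\<^esub> \<beta> \<odot>\<^bsub>free_algebra\<^esub> basis_elem [GenY, GenY, GenX]}"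

definition down_up_ideal :: "'k::field \<Rightarrow> 'k \<Rightarrow> (generator list \<Rightarrow> 'k) set" where
  "down_up_ideal \<alpha> \<beta> = Idl\<^bsub>free_algebra\<^esub> (down_up_relations \<alpha> \<beta>)"

definition down_up_algebra ::
    "'k::field \<Rightarrow> 'k \<Rightarrow> ('k, (generator list \<Rightarrow> 'k) set) module" where
  "down_up_algebra \<alpha> \<beta> = quotient_algebra free_algebra (down_up_ideal \<alpha> \<beta>)"

definition down_up_generator ::
    "'k::field \<Rightarrow> 'k \<Rightarrow> generator \<Rightarrow> (generator list \<Rightarrow> 'k) set" where
  "down_up_generator \<alpha> \<beta> g = down_up_ideal \<alpha> \<beta> +>\<^bsub>free_algebra\<^esub> basis_elem [g]"

definition down_up_degree ::
    "'k::field \<Rightarrow> 'k \<Rightarrow> nat \<Rightarrow> (generator list \<Rightarrow> 'k) set set" where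
  "down_up_degree \<alpha> \<beta> n =
    {down_up_ideal \<alpha> \<beta> +>\<^bsub>free_algebra\<^esub> f | f.
       f \<in> carrier free_algebra \<and> (\<forall>w. f w \<noteq> 0 \<longrightarrow> length w = n)}"

definition down_up_Omega :: "'k::field \<Rightarrow> 'k \<Rightarrow> 'k \<Rightarrow> (generator list \<Rightarrow> 'k) set" where
  "down_up_Omega \<alpha> \<beta> \<omega> =
    (let A = down_up_algebra \<alpha> \<beta>;
         x = down_up_generator \<alpha> \<beta> GenX;
         y = down_up_generator \<alpha> \<beta> GenY
     in x \<otimes>\<^bsub>A\<^esub> y \<ominus>\<^bsub>A\<^esub> \<omega> \<odot>\<^bsub>A\<^esub> (y \<otimes>\<^bsub>A\<^esub> x))"

text \<open>
  The inclusion of \<open>A(\<alpha>, \<beta>)\<close> into the down-up algebra with the same parameters over the algebraic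
  closure.
\<close>

definition down_up_to_ac ::
    "'k::field \<Rightarrow> 'k \<Rightarrow> (generator list \<Rightarrow> 'k) set \<Rightarrow> (generator list \<Rightarrow> 'k alg_closure) set" where
  "down_up_to_ac \<alpha> \<beta> U =
     (\<Union>f\<in>U. down_up_ideal (to_ac \<alpha>) (to_ac \<beta>) +>\<^bsub>free_algebra\<^esub> (to_ac \<circ> f))"

text \<open>
  \<open>b = \<Omega>\<^sub>1\<Omega>\<^sub>2\<close> with \<open>\<Omega>\<^sub>i = xy - \<omega>\<^sub>iyx\<close>. The product is formed over the algebraic closure, where the
  roots of \<open>w\<^sup>2 - \<alpha>w - \<beta>\<close> (with multiplicity) live, and \<open>b\<close> is the element of \<open>A(\<alpha>, \<beta>)\<close> mapping to it.
\<close>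

definition is_canonical_element ::
    "'k::field \<Rightarrow> 'k \<Rightarrow> (generator list \<Rightarrow> 'k) set \<Rightarrow> bool" where
  "is_canonical_element \<alpha> \<beta> b \<longleftrightarrow>
     b \<in> carrier (down_up_algebra \<alpha> \<beta>) \<and>
     (\<exists>\<omega>\<^sub>1 \<omega>\<^sub>2.
        [: - to_ac \<beta>, - to_ac \<alpha>, 1 :] = [: - \<omega>\<^sub>1, 1 :] * [: - \<omega>\<^sub>2, 1 :] \<and>
        down_up_to_ac \<alpha> \<beta> b =
          down_up_Omega (to_ac \<alpha>) (to_ac \<beta>) \<omega>\<^sub>1
            \<otimes>\<^bsub>down_up_algebra (to_ac \<alpha>) (to_ac \<beta>)\<^esub> down_up_Omega (to_ac \<alpha>) (to_ac \<beta>) \<omega>\<^sub>2)"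

end

theory Submission
  imports Defs
begin

text \<open>
  The Fox derivatives of the two relations and of their overlap \<open>x\<^sup>2y\<^sup>2\<close> give a free bimodule resolution of
  \<open>A\<close> with ranks \<open>1, 2, 2, 1\<close>, whose last map is \<open>t \<mapsto> (t\<kappa>\<^sub>1, - t\<kappa>\<^sub>2)\<close> for
  \<open>\<kappa>\<^sub>1 = 1 \<otimes> y + \<beta> (y \<otimes> 1)\<close> and \<open>\<kappa>\<^sub>2 = x \<otimes> 1 + \<beta> (1 \<otimes> x)\<close>; exactness is read off a faithful representation
  of \<open>A\<close> in a skew Laurent ring. So the third cohomology is the enveloping algebra modulo the right ideal
  generated by \<open>\<kappa>\<^sub>1\<close> and \<open>\<kappa>\<^sub>2\<close>. For \<open>\<beta> = - 1\<close> the map \<open>u \<otimes> v \<mapsto> vu\<close> identifies this quotient with \<open>A\<close>.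
  Conversely, an isomorphism with \<open>A\<close> yields a generating class \<open>c\<close> with \<open>xc = cx\<close>, and the coefficients of
  \<open>c\<close> in degrees \<open>0\<close> and \<open>1\<close> then force \<open>1 + \<beta> = 0\<close>. On the other side \<open>x\<Omega>\<^sub>1\<Omega>\<^sub>2 = - \<beta> \<Omega>\<^sub>1\<Omega>\<^sub>2x\<close> and
  \<open>\<Omega>\<^sub>1\<Omega>\<^sub>2y = - \<beta> y\<Omega>\<^sub>1\<Omega>\<^sub>2\<close>, so \<open>\<Omega>\<^sub>1\<Omega>\<^sub>2\<close> is central iff \<open>\<beta> = - 1\<close> as well.
\<close>

section \<open>Left modules and linear combinations\<close>

text \<open>Two obstacles shape the proof. The first: A and its enveloping algebra are quotients by
  ideals given through generators, so every map out of them needs a proof that it respects the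
  ideal. One device does this throughout: a linear map kills the ideal as soon as it belongs to a
  family of linear maps that is stable under translation of the argument and kills the generators.
  The second: \<open>Ext_isomorphic\<close> only asserts that some resolution works, so the converse
  direction must compare an unknown resolution with the explicit one; hence the chain map and
  homotopy theorems.

  Exactness at the start of the resolution is formal Fox calculus. The remaining places rest on
  right division by x: the quotient and remainder operators rewrite a kernel element as an
  expression in itself of lower filtration level, which forces it to vanish.

  The number 1 + \<beta> has the same source on both sides: modulo the last differential x tensor 1
  equals -\<beta> (1 tensor x), and moving x past the two factors of the canonical element costs the
  two roots, whose product is -\<beta>.\<close>

definition field_ring :: "'k::field ring" where
  "field_ring = \<lparr>carrier = UNIV, monoid.mult = (*), one = 1, zero = 0, add = (+)\<rparr>"

lemma field_ring_simps [simp]: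
  "carrier field_ring = UNIV" "a \<otimes>\<^bsub>field_ring\<^esub> b = a * b" "\<one>\<^bsub>field_ring\<^esub> = 1"
  "\<zero>\<^bsub>field_ring\<^esub> = 0" "a \<oplus>\<^bsub>field_ring\<^esub> b = a + b"
  by (simp_all add: field_ring_def)

lemma ring_field_ring: "ring (field_ring :: 'k::field ring)"
proof (rule ringI)
  show "abelian_group (field_ring :: 'k ring)"
    by (rule abelian_groupI) (auto simp: algebra_simps intro: exI [of _ "- x" for x])
  show "Group.monoid (field_ring :: 'k ring)"
    by (rule monoidI) (auto simp: algebra_simps)
qed (auto simp: algebra_simps)

text \<open>The scalars form an arbitrary ring because the enveloping algebra is not commutative.
  With \<open>field_ring\<close> as scalars the same locale covers vector spaces, so one
  construction of linear combinations serves k-linear maps and bimodule maps alike.\<close>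

locale left_module = M: abelian_group M
  for R :: "('r, 'x) ring_scheme" and M :: "('r, 'm) module" +
  assumes ring_scalars: "ring R"
    and smult_closed [simp, intro]:
      "r \<in> carrier R \<Longrightarrow> u \<in> carrier M \<Longrightarrow> r \<odot>\<^bsub>M\<^esub> u \<in> carrier M"
    and smult_l_distr: "r \<in> carrier R \<Longrightarrow> s \<in> carrier R \<Longrightarrow> u \<in> carrier M \<Longrightarrow>
      (r \<oplus>\<^bsub>R\<^esub> s) \<odot>\<^bsub>M\<^esub> u = r \<odot>\<^bsub>M\<^esub> u \<oplus>\<^bsub>M\<^esub> s \<odot>\<^bsub>M\<^esub> u"
    and smult_r_distr: "r \<in> carrier R \<Longrightarrow> u \<in> carrier M \<Longrightarrow> v \<in> carrier M \<Longrightarrow>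
      r \<odot>\<^bsub>M\<^esub> (u \<oplus>\<^bsub>M\<^esub> v) = r \<odot>\<^bsub>M\<^esub> u \<oplus>\<^bsub>M\<^esub> r \<odot>\<^bsub>M\<^esub> v"
    and smult_assoc: "r \<in> carrier R \<Longrightarrow> s \<in> carrier R \<Longrightarrow> u \<in> carrier M \<Longrightarrow>
      (r \<otimes>\<^bsub>R\<^esub> s) \<odot>\<^bsub>M\<^esub> u = r \<odot>\<^bsub>M\<^esub> (s \<odot>\<^bsub>M\<^esub> u)"
    and smult_one [simp]: "u \<in> carrier M \<Longrightarrow> \<one>\<^bsub>R\<^esub> \<odot>\<^bsub>M\<^esub> u = u"
begin

lemma smult_zero_left [simp]: "u \<in> carrier M \<Longrightarrow> \<zero>\<^bsub>R\<^esub> \<odot>\<^bsub>M\<^esub> u = \<zero>\<^bsub>M\<^esub>"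
  using smult_l_distr [of "\<zero>\<^bsub>R\<^esub>" "\<zero>\<^bsub>R\<^esub>" u]
  by (simp add: ring.ring_simprules [OF ring_scalars])

lemma smult_zero_right [simp]: "r \<in> carrier R \<Longrightarrow> r \<odot>\<^bsub>M\<^esub> \<zero>\<^bsub>M\<^esub> = \<zero>\<^bsub>M\<^esub>"
  using smult_r_distr [of r "\<zero>\<^bsub>M\<^esub>" "\<zero>\<^bsub>M\<^esub>"] by simp

lemma smult_minus_right:
  "r \<in> carrier R \<Longrightarrow> u \<in> carrier M \<Longrightarrow> r \<odot>\<^bsub>M\<^esub> (\<ominus>\<^bsub>M\<^esub> u) = \<ominus>\<^bsub>M\<^esub> (r \<odot>\<^bsub>M\<^esub> u)"
  using smult_r_distr [of r "\<ominus>\<^bsub>M\<^esub> u" u] M.minus_equality [of "r \<odot>\<^bsub>M\<^esub> (\<ominus>\<^bsub>M\<^esub> u)" "r \<odot>\<^bsub>M\<^esub> u"]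
  by (simp add: M.l_neg)

end

text \<open>The value at \<open>c\<close> of the linear map that sends the i-th basis vector of a
  free module to \<open>g i\<close>. With \<open>field_ring\<close> as scalars it also gives the
  linear maps out of monoid algebras.\<close>

definition lin_comb ::
    "('r, 'x) ring_scheme \<Rightarrow> ('r, 'm) module \<Rightarrow> ('i \<Rightarrow> 'm) \<Rightarrow> ('i \<Rightarrow> 'r) \<Rightarrow> 'm" where
  "lin_comb R M g c = (\<Oplus>\<^bsub>M\<^esub> i \<in> {i. c i \<noteq> \<zero>\<^bsub>R\<^esub>}. c i \<odot>\<^bsub>M\<^esub> g i)"

lemma free_left_module_simps [simp]:
  "f \<oplus>\<^bsub>free_left_module R B\<^esub> g = (\<lambda>i. f i \<oplus>\<^bsub>R\<^esub> g i)"
  "r \<odot>\<^bsub>free_left_module R B\<^esub> f = (\<lambda>i. r \<otimes>\<^bsub>R\<^esub> f i)"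
  "\<zero>\<^bsub>free_left_module R B\<^esub> = (\<lambda>i. \<zero>\<^bsub>R\<^esub>)"
  by (simp_all add: free_left_module_def)

lemma carrier_free_left_module:
  "f \<in> carrier (free_left_module R B) \<longleftrightarrow>
     finite {i. f i \<noteq> \<zero>\<^bsub>R\<^esub>} \<and> (\<forall>i. f i \<in> carrier R) \<and> (\<forall>i. i \<notin> B \<longrightarrow> f i = \<zero>\<^bsub>R\<^esub>)"
  by (simp add: free_left_module_def)

lemma left_module_free:
  fixes R :: "('a, 'x) ring_scheme" and B :: "'b set"
  assumes "ring R"
  shows "left_module R (free_left_module R B)"
proof -
  interpret R: ring R by fact
  have fin: "finite {i. f i \<noteq> \<zero>\<^bsub>R\<^esub>} \<Longrightarrow> finite {i. g i \<noteq> \<zero>\<^bsub>R\<^esub>} \<Longrightarrow>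
      (\<And>i. f i = \<zero>\<^bsub>R\<^esub> \<Longrightarrow> g i = \<zero>\<^bsub>R\<^esub> \<Longrightarrow> h i = \<zero>\<^bsub>R\<^esub>) \<Longrightarrow> finite {i. h i \<noteq> \<zero>\<^bsub>R\<^esub>}" for f g h :: "'b \<Rightarrow> 'a"
    by (rule finite_subset [of _ "{i. f i \<noteq> \<zero>\<^bsub>R\<^esub>} \<union> {i. g i \<noteq> \<zero>\<^bsub>R\<^esub>}"]) auto
  have "abelian_group (free_left_module R B)"
  proof (rule abelian_groupI)
    fix f assume f: "f \<in> carrier (free_left_module R B)"
    have "(\<lambda>i. \<ominus>\<^bsub>R\<^esub> f i) \<in> carrier (free_left_module R B)"
      using f by (auto simp: carrier_free_left_module intro: fin [of f f])
    moreover have "(\<lambda>i. \<ominus>\<^bsub>R\<^esub> f i) \<oplus>\<^bsub>free_left_module R B\<^esub> f = \<zero>\<^bsub>free_left_module R B\<^esub>"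
      using f by (auto simp: carrier_free_left_module R.l_neg)
    ultimately show "\<exists>g\<in>carrier (free_left_module R B).
        g \<oplus>\<^bsub>free_left_module R B\<^esub> f = \<zero>\<^bsub>free_left_module R B\<^esub>" by blast
  qed (auto simp: carrier_free_left_module R.a_ac intro: fin)
  then show ?thesis
    by (intro left_module.intro left_module_axioms.intro \<open>ring R\<close>)
      (auto simp: carrier_free_left_module R.l_distr R.r_distr R.m_assoc intro: fin)
qed

lemma left_module_regular: "ring R \<Longrightarrow> left_module R (regular_left_module R)"
proof -
  assume "ring R"
  then interpret R: ring R .
  have "abelian_group (regular_left_module R)"
    by (rule abelian_groupI)
      (auto simp: regular_left_module_def R.a_ac intro: bexI [of _ "\<ominus>\<^bsub>R\<^esub> x" for x] R.l_neg)
  then show ?thesis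
    by (intro left_module.intro left_module_axioms.intro \<open>ring R\<close>)
      (auto simp: regular_left_module_def R.l_distr R.r_distr R.m_assoc)
qed

context left_module
begin

text \<open>Two coefficient functions have different supports in general; extending the sum by zero
  terms lets them be compared over a common finite index set.\<close>

lemma lin_comb_superset:
  assumes "c \<in> carrier (free_left_module R B)" "g \<in> B \<rightarrow> carrier M"
    and "finite S" "{i. c i \<noteq> \<zero>\<^bsub>R\<^esub>} \<subseteq> S" "S \<subseteq> B"
  shows "lin_comb R M g c = (\<Oplus>\<^bsub>M\<^esub> i \<in> S. c i \<odot>\<^bsub>M\<^esub> g i)"
  unfolding lin_comb_def
  by (rule M.add.finprod_mono_neutral_cong_left) 
    (use assms in \<open>auto simp: carrier_free_left_module intro!: smult_zero_left smult_closed\<close>)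

lemma lin_comb_closed [intro]:
  assumes "c \<in> carrier (free_left_module R B)" "g \<in> B \<rightarrow> carrier M"
  shows "lin_comb R M g c \<in> carrier M"
  unfolding lin_comb_def
  by (rule M.finsum_closed) (use assms in \<open>auto simp: carrier_free_left_module Pi_iff\<close>)

lemma lin_comb_add:
  assumes c: "c \<in> carrier (free_left_module R B)" and d: "d \<in> carrier (free_left_module R B)"
    and g: "g \<in> B \<rightarrow> carrier M"
  shows "lin_comb R M g (\<lambda>i. c i \<oplus>\<^bsub>R\<^esub> d i) = lin_comb R M g c \<oplus>\<^bsub>M\<^esub> lin_comb R M g d"
proof -
  let ?S = "{i. c i \<noteq> \<zero>\<^bsub>R\<^esub>} \<union> {i. d i \<noteq> \<zero>\<^bsub>R\<^esub>}"
  interpret F: left_module R "free_left_module R B" by (rule left_module_free [OF ring_scalars])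
  have cd: "(\<lambda>i. c i \<oplus>\<^bsub>R\<^esub> d i) \<in> carrier (free_left_module R B)"
    using F.M.a_closed [OF c d] by simp
  have S: "finite ?S" "?S \<subseteq> B" using c d by (auto simp: carrier_free_left_module)
  have c_cl: "c i \<in> carrier R" "d i \<in> carrier R" for i
    using c d by (auto simp: carrier_free_left_module)
  have "lin_comb R M g (\<lambda>i. c i \<oplus>\<^bsub>R\<^esub> d i) = (\<Oplus>\<^bsub>M\<^esub> i \<in> ?S. (c i \<oplus>\<^bsub>R\<^esub> d i) \<odot>\<^bsub>M\<^esub> g i)"
    by (rule lin_comb_superset [OF cd g S(1) _ S(2)])
      (use c_cl ring.ring_simprules [OF ring_scalars] in auto)
  also have "\<dots> = (\<Oplus>\<^bsub>M\<^esub> i \<in> ?S. c i \<odot>\<^bsub>M\<^esub> g i \<oplus>\<^bsub>M\<^esub> d i \<odot>\<^bsub>M\<^esub> g i)"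
    by (rule M.finsum_cong') (use g S c_cl in \<open>auto simp: smult_l_distr Pi_iff\<close>)
  also have "\<dots> = (\<Oplus>\<^bsub>M\<^esub> i \<in> ?S. c i \<odot>\<^bsub>M\<^esub> g i) \<oplus>\<^bsub>M\<^esub> (\<Oplus>\<^bsub>M\<^esub> i \<in> ?S. d i \<odot>\<^bsub>M\<^esub> g i)"
    by (rule M.finsum_addf) (use g S c_cl in \<open>auto simp: Pi_iff\<close>)
  also have "(\<Oplus>\<^bsub>M\<^esub> i \<in> ?S. c i \<odot>\<^bsub>M\<^esub> g i) = lin_comb R M g c"
    by (rule lin_comb_superset [symmetric, OF c g S(1) _ S(2)]) auto
  also have "(\<Oplus>\<^bsub>M\<^esub> i \<in> ?S. d i \<odot>\<^bsub>M\<^esub> g i) = lin_comb R M g d"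
    by (rule lin_comb_superset [symmetric, OF d g S(1) _ S(2)]) auto
  finally show ?thesis .
qed

lemma smult_finsum:
  assumes "r \<in> carrier R" "finite S" "h \<in> S \<rightarrow> carrier M"
  shows "r \<odot>\<^bsub>M\<^esub> (\<Oplus>\<^bsub>M\<^esub> i \<in> S. h i) = (\<Oplus>\<^bsub>M\<^esub> i \<in> S. r \<odot>\<^bsub>M\<^esub> h i)"
  using assms(2,3)
  by (induction S) (use assms(1) in \<open>auto simp: smult_r_distr Pi_iff M.finsum_closed\<close>)

lemma lin_comb_smult:
  assumes r: "r \<in> carrier R" and c: "c \<in> carrier (free_left_module R B)" and g: "g \<in> B \<rightarrow> carrier M"
  shows "lin_comb R M g (\<lambda>i. r \<otimes>\<^bsub>R\<^esub> c i) = r \<odot>\<^bsub>M\<^esub> lin_comb R M g c"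
proof -
  let ?S = "{i. c i \<noteq> \<zero>\<^bsub>R\<^esub>}"
  interpret F: left_module R "free_left_module R B" by (rule left_module_free [OF ring_scalars])
  have rc: "(\<lambda>i. r \<otimes>\<^bsub>R\<^esub> c i) \<in> carrier (free_left_module R B)"
    using F.smult_closed [OF r c] by simp
  have S: "finite ?S" "?S \<subseteq> B" and c_cl: "c i \<in> carrier R" for i
    using c by (auto simp: carrier_free_left_module)
  have "lin_comb R M g (\<lambda>i. r \<otimes>\<^bsub>R\<^esub> c i) = (\<Oplus>\<^bsub>M\<^esub> i \<in> ?S. (r \<otimes>\<^bsub>R\<^esub> c i) \<odot>\<^bsub>M\<^esub> g i)"
    by (rule lin_comb_superset [OF rc g S(1) _ S(2)])
      (use r ring.ring_simprules [OF ring_scalars] in auto)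
  also have "\<dots> = (\<Oplus>\<^bsub>M\<^esub> i \<in> ?S. r \<odot>\<^bsub>M\<^esub> (c i \<odot>\<^bsub>M\<^esub> g i))"
    by (rule M.finsum_cong') (use g S c_cl r in \<open>auto simp: smult_assoc Pi_iff\<close>)
  also have "\<dots> = r \<odot>\<^bsub>M\<^esub> lin_comb R M g c"
    unfolding lin_comb_def
    by (rule smult_finsum [symmetric]) (use g S c_cl r in \<open>auto simp: Pi_iff\<close>)
  finally show ?thesis .
qed

lemma lin_comb_single:
  assumes "r \<in> carrier R" "g i \<in> carrier M"
  shows "lin_comb R M g (\<lambda>j. if j = i then r else \<zero>\<^bsub>R\<^esub>) = r \<odot>\<^bsub>M\<^esub> g i"
proof (cases "r = \<zero>\<^bsub>R\<^esub>")
  case False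
  then have "{j. (if j = i then r else \<zero>\<^bsub>R\<^esub>) \<noteq> \<zero>\<^bsub>R\<^esub>} = {i}" by auto
  then show ?thesis using assms by (simp add: lin_comb_def)
qed (use assms in \<open>simp add: lin_comb_def\<close>)

lemma lin_comb_zero [simp]: "lin_comb R M g (\<lambda>i. \<zero>\<^bsub>R\<^esub>) = \<zero>\<^bsub>M\<^esub>"
  by (simp add: lin_comb_def)

lemma lin_comb_hom:
  assumes "g \<in> B \<rightarrow> carrier M"
  shows "restrict (lin_comb R M g) (carrier (free_left_module R B))
    \<in> left_module_hom R (free_left_module R B) M"
proof -
  interpret F: left_module R "free_left_module R B" by (rule left_module_free [OF ring_scalars])
  show ?thesis
    using assms F.M.a_closed F.smult_closed
    by (auto simp: left_module_hom_def lin_comb_add lin_comb_smult lin_comb_closed)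
qed

end

section \<open>Algebras over a field\<close>

locale k_algebra = ring A for A :: "('k::field, 'a) module" (structure) +
  assumes smult_closed [simp, intro]: "a \<in> carrier A \<Longrightarrow> c \<odot> a \<in> carrier A"
    and smult_l_distr: "a \<in> carrier A \<Longrightarrow> (c + d) \<odot> a = c \<odot> a \<oplus> d \<odot> a"
    and smult_r_distr: "a \<in> carrier A \<Longrightarrow> b \<in> carrier A \<Longrightarrow> c \<odot> (a \<oplus> b) = c \<odot> a \<oplus> c \<odot> b"
    and smult_assoc: "a \<in> carrier A \<Longrightarrow> (c * d) \<odot> a = c \<odot> (d \<odot> a)"
    and smult_one [simp]: "a \<in> carrier A \<Longrightarrow> 1 \<odot> a = a"
    and smult_mult_left: "a \<in> carrier A \<Longrightarrow> b \<in> carrier A \<Longrightarrow> (c \<odot> a) \<otimes> b = c \<odot> (a \<otimes> b)"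
    and smult_mult_right: "a \<in> carrier A \<Longrightarrow> b \<in> carrier A \<Longrightarrow> a \<otimes> (c \<odot> b) = c \<odot> (a \<otimes> b)"
begin

lemma left_module_field: "left_module field_ring A"
  by (intro left_module.intro left_module_axioms.intro ring_field_ring abelian_group_axioms)
    (auto simp: smult_l_distr smult_r_distr smult_assoc)

lemma smult_zero_left [simp]: "a \<in> carrier A \<Longrightarrow> 0 \<odot> a = \<zero>"
  using left_module.smult_zero_left [OF left_module_field] by simp

lemma smult_zero_right [simp]: "c \<odot> \<zero> = \<zero>"
  using left_module.smult_zero_right [OF left_module_field] by simp

lemma smult_minus: "a \<in> carrier A \<Longrightarrow> c \<odot> (\<ominus> a) = \<ominus> (c \<odot> a)"
  using left_module.smult_minus_right [OF left_module_field] by simp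

lemma smult_uminus: "a \<in> carrier A \<Longrightarrow> (- c) \<odot> a = \<ominus> (c \<odot> a)"
  using smult_l_distr [of a "- c" c] minus_equality [of "(- c) \<odot> a" "c \<odot> a"] by simp

lemma smult_via_one: "a \<in> carrier A \<Longrightarrow> c \<odot> a = (c \<odot> \<one>) \<otimes> a"
  by (simp add: smult_mult_left)

text \<open>A scalar acts as multiplication by its multiple of 1, so an ideal of the underlying ring
  is automatically a subspace.\<close>

lemma ideal_smult: "ideal I A \<Longrightarrow> a \<in> I \<Longrightarrow> c \<odot> a \<in> I"
  using smult_via_one [of a c] ideal.I_l_closed [of I A a "c \<odot> \<one>"] ideal.Icarr [of I A a] by simp

end

lemma ring_extend:
  assumes "ring A" shows "ring (ring.extend A m)"
proof -
  interpret A: ring A by fact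
  have "abelian_group (ring.extend A m)"
  proof (rule abelian_groupI)
    fix x assume "x \<in> carrier (ring.extend A m)"
    then have "\<ominus>\<^bsub>A\<^esub> x \<in> carrier A" "\<ominus>\<^bsub>A\<^esub> x \<oplus>\<^bsub>A\<^esub> x = \<zero>\<^bsub>A\<^esub>"
      by (simp_all add: ring.defs A.l_neg)
    then show "\<exists>y\<in>carrier (ring.extend A m). y \<oplus>\<^bsub>ring.extend A m\<^esub> x = \<zero>\<^bsub>ring.extend A m\<^esub>"
      by (intro bexI [of _ "\<ominus>\<^bsub>A\<^esub> x"]) (simp_all add: ring.defs)
  qed (simp_all add: ring.defs A.a_ac)
  moreover have "Group.monoid (ring.extend A m)"
    by (rule monoidI) (simp_all add: ring.defs A.m_assoc)
  ultimately show ?thesis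
    by (rule ringI) (simp_all add: ring.defs A.l_distr A.r_distr)
qed

section \<open>Monoid algebras\<close>

lemma monoid_algebra_simps [simp]:
  "\<one>\<^bsub>monoid_algebra M\<^esub> = basis_elem \<one>\<^bsub>M\<^esub>"
  "\<zero>\<^bsub>monoid_algebra M\<^esub> = (\<lambda>m. 0)"
  "f \<oplus>\<^bsub>monoid_algebra M\<^esub> g = (\<lambda>m. f m + g m)"
  "c \<odot>\<^bsub>monoid_algebra M\<^esub> f = (\<lambda>m. c * f m)"
  by (simp_all add: monoid_algebra_def basis_elem_def)

lemma carrier_monoid_algebra:
  "f \<in> carrier (monoid_algebra M) \<longleftrightarrow> finite {m. f m \<noteq> 0} \<and> (\<forall>m. m \<notin> carrier M \<longrightarrow> f m = 0)"
  by (auto simp: monoid_algebra_def)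

text \<open>As a vector space the monoid algebra is free on the monoid, so linear extension from
  basis elements becomes an instance of \<open>lin_comb\<close>.\<close>

lemma carrier_monoid_algebra_free:
  "carrier (monoid_algebra M) = carrier (free_left_module field_ring (carrier M))"
  by (auto simp: carrier_monoid_algebra carrier_free_left_module)

text \<open>Letting the convolution run over any finite rectangle that contains both supports makes
  products of elements with different supports comparable.\<close>

lemma monoid_algebra_mult_superset:
  fixes f g :: "'m \<Rightarrow> 'k::field"
  assumes "finite S" "{u. f u \<noteq> 0} \<subseteq> S" "finite T" "{u. g u \<noteq> 0} \<subseteq> T"
  shows "(f \<otimes>\<^bsub>monoid_algebra M\<^esub> g) m =
    (\<Sum>(u, v) \<in> S \<times> T. if u \<otimes>\<^bsub>M\<^esub> v = m then f u * g v else 0)"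
  unfolding monoid_algebra_def monoid.simps
  by (rule sum.mono_neutral_left) (use assms in \<open>auto split: if_splits\<close>)

lemma basis_elem_closed [simp, intro]: "u \<in> carrier M \<Longrightarrow> basis_elem u \<in> carrier (monoid_algebra M)"
  by (auto simp: carrier_monoid_algebra basis_elem_def)

lemma supp_basis_elem [simp]: "{m. (basis_elem u m :: 'k::field) \<noteq> 0} = {u}"
  by (auto simp: basis_elem_def)

lemma basis_elem_mult:
  "basis_elem u \<otimes>\<^bsub>monoid_algebra M\<^esub> basis_elem v = basis_elem (u \<otimes>\<^bsub>M\<^esub> v)"
  by (rule ext, subst monoid_algebra_mult_superset [of "{u}" _ "{v}"]) (auto simp: basis_elem_def)

lemma monoid_algebra_mult_closed:
  fixes f g :: "'m \<Rightarrow> 'k::field"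
  assumes "Group.monoid M" "f \<in> carrier (monoid_algebra M)" "g \<in> carrier (monoid_algebra M)"
  shows "f \<otimes>\<^bsub>monoid_algebra M\<^esub> g \<in> carrier (monoid_algebra M)"
    and "{m. (f \<otimes>\<^bsub>monoid_algebra M\<^esub> g) m \<noteq> 0}
      \<subseteq> (\<lambda>(u, v). u \<otimes>\<^bsub>M\<^esub> v) ` ({u. f u \<noteq> 0} \<times> {v. g v \<noteq> 0})"
proof -
  let ?S = "{u. f u \<noteq> 0}" and ?T = "{v. g v \<noteq> 0}"
  have fin: "finite ?S" "finite ?T" and sub: "?S \<subseteq> carrier M" "?T \<subseteq> carrier M"
    using assms by (auto simp: carrier_monoid_algebra)
  show *: "{m. (f \<otimes>\<^bsub>monoid_algebra M\<^esub> g) m \<noteq> 0} \<subseteq> (\<lambda>(u, v). u \<otimes>\<^bsub>M\<^esub> v) ` (?S \<times> ?T)"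
  proof
    fix m assume "m \<in> {m. (f \<otimes>\<^bsub>monoid_algebra M\<^esub> g) m \<noteq> 0}"
    then have "(\<Sum>(u, v) \<in> ?S \<times> ?T. if u \<otimes>\<^bsub>M\<^esub> v = m then f u * g v else 0) \<noteq> 0"
      by (simp add: monoid_algebra_mult_superset [OF fin(1) subset_refl fin(2) subset_refl])
    then obtain p where "p \<in> ?S \<times> ?T" "(case p of (u, v) \<Rightarrow> if u \<otimes>\<^bsub>M\<^esub> v = m then f u * g v else 0) \<noteq> 0"
      by (rule sum.not_neutral_contains_not_neutral)
    then show "m \<in> (\<lambda>(u, v). u \<otimes>\<^bsub>M\<^esub> v) ` (?S \<times> ?T)" by (force split: if_splits)
  qed
  have "finite ((\<lambda>(u, v). u \<otimes>\<^bsub>M\<^esub> v) ` (?S \<times> ?T))"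
    "(\<lambda>(u, v). u \<otimes>\<^bsub>M\<^esub> v) ` (?S \<times> ?T) \<subseteq> carrier M"
    using fin sub monoid.m_closed [OF assms(1)] by auto
  with * show "f \<otimes>\<^bsub>monoid_algebra M\<^esub> g \<in> carrier (monoid_algebra M)"
    by (auto simp: carrier_monoid_algebra intro: finite_subset)
qed

text \<open>In a triple product the inner factor is summed over its value p and again over the pairs
  j whose product \<open>q j\<close> is p. The Kronecker delta removes the summation over p.\<close>

lemma sum_pairs_delta:
  assumes "finite P" "\<And>j. j \<in> J \<Longrightarrow> q j \<in> P"
  shows "(\<Sum>(p, w) \<in> P \<times> W. \<Sum>j \<in> J. if p = q j then t p w j else (0 :: 'a::comm_monoid_add)) =
    (\<Sum>w \<in> W. \<Sum>j \<in> J. t (q j) w j)"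
proof -
  have "(\<Sum>(p, w) \<in> P \<times> W. \<Sum>j \<in> J. if p = q j then t p w j else 0) =
      (\<Sum>p \<in> P. \<Sum>w \<in> W. \<Sum>j \<in> J. if p = q j then t p w j else 0)"
    by (rule sum.cartesian_product [symmetric])
  also have "\<dots> = (\<Sum>w \<in> W. \<Sum>p \<in> P. \<Sum>j \<in> J. if p = q j then t p w j else 0)"
    by (rule sum.swap)
  also have "\<dots> = (\<Sum>w \<in> W. \<Sum>j \<in> J. \<Sum>p \<in> P. if p = q j then t p w j else 0)"
    by (intro sum.cong refl sum.swap)
  also have "\<dots> = (\<Sum>w \<in> W. \<Sum>j \<in> J. t (q j) w j)"
    by (intro sum.cong refl) (use assms in \<open>simp add: sum.delta\<close>)
  finally show ?thesis .
qed

text \<open>Both bracketings are expanded into the sum over triples (u, v, w) with product m. The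
  supports of the inner products are enlarged to \<open>?P\<close> and \<open>?Q\<close>, the sets
  of all products of support elements, so that the delta sum applies.\<close>

lemma monoid_algebra_mult_assoc:
  fixes f g h :: "'m \<Rightarrow> 'k::field"
  assumes M: "Group.monoid M" and f: "f \<in> carrier (monoid_algebra M)"
    and g: "g \<in> carrier (monoid_algebra M)" and h: "h \<in> carrier (monoid_algebra M)"
  shows "(f \<otimes>\<^bsub>monoid_algebra M\<^esub> g) \<otimes>\<^bsub>monoid_algebra M\<^esub> h =
    f \<otimes>\<^bsub>monoid_algebra M\<^esub> (g \<otimes>\<^bsub>monoid_algebra M\<^esub> h)"
proof
  fix m
  interpret M: Group.monoid M by fact
  let ?S = "{u. f u \<noteq> 0}" and ?T = "{v. g v \<noteq> 0}" and ?W = "{w. h w \<noteq> 0}"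
  let ?P = "(\<lambda>(u, v). u \<otimes>\<^bsub>M\<^esub> v) ` (?S \<times> ?T)" and ?Q = "(\<lambda>(u, v). u \<otimes>\<^bsub>M\<^esub> v) ` (?T \<times> ?W)"
  have fin: "finite ?S" "finite ?T" "finite ?W" "finite ?P" "finite ?Q"
    and sub: "?S \<subseteq> carrier M" "?T \<subseteq> carrier M" "?W \<subseteq> carrier M"
    using f g h by (auto simp: carrier_monoid_algebra)
  have "((f \<otimes>\<^bsub>monoid_algebra M\<^esub> g) \<otimes>\<^bsub>monoid_algebra M\<^esub> h) m =
    (\<Sum>(p, w) \<in> ?P \<times> ?W. if p \<otimes>\<^bsub>M\<^esub> w = m then (f \<otimes>\<^bsub>monoid_algebra M\<^esub> g) p * h w else 0)"
    by (rule monoid_algebra_mult_superset) (use fin monoid_algebra_mult_closed(2) [OF M f g] in auto)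
  also have "\<dots> = (\<Sum>(p, w) \<in> ?P \<times> ?W. \<Sum>j \<in> ?S \<times> ?T. if p = fst j \<otimes>\<^bsub>M\<^esub> snd j
      then (if p \<otimes>\<^bsub>M\<^esub> w = m then f (fst j) * g (snd j) * h w else 0) else 0)"
    by (intro sum.cong refl)
      (auto simp: monoid_algebra_mult_superset [OF fin(1) subset_refl fin(2) subset_refl]
        sum_distrib_right split_def if_distrib intro!: sum.cong)
  also have "\<dots> = (\<Sum>w \<in> ?W. \<Sum>j \<in> ?S \<times> ?T.
      if fst j \<otimes>\<^bsub>M\<^esub> snd j \<otimes>\<^bsub>M\<^esub> w = m then f (fst j) * g (snd j) * h w else 0)"
    by (rule sum_pairs_delta) (use fin in force)+
  also have "\<dots> = (\<Sum>w \<in> ?W. \<Sum>u \<in> ?S. \<Sum>v \<in> ?T. if u \<otimes>\<^bsub>M\<^esub> v \<otimes>\<^bsub>M\<^esub> w = m then f u * g v * h w else 0)"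
    by (simp add: sum.cartesian_product split_def)
  also have "\<dots> = (\<Sum>u \<in> ?S. \<Sum>w \<in> ?W. \<Sum>v \<in> ?T. if u \<otimes>\<^bsub>M\<^esub> v \<otimes>\<^bsub>M\<^esub> w = m then f u * g v * h w else 0)"
    by (rule sum.swap)
  also have "\<dots> = (\<Sum>u \<in> ?S. \<Sum>v \<in> ?T. \<Sum>w \<in> ?W. if u \<otimes>\<^bsub>M\<^esub> v \<otimes>\<^bsub>M\<^esub> w = m then f u * g v * h w else 0)"
    by (intro sum.cong refl sum.swap)
  also have "\<dots> = (\<Sum>u \<in> ?S. \<Sum>v \<in> ?T. \<Sum>w \<in> ?W. if u \<otimes>\<^bsub>M\<^esub> (v \<otimes>\<^bsub>M\<^esub> w) = m then f u * (g v * h w) else 0)"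
    by (intro sum.cong refl) (use sub in \<open>auto simp: M.m_assoc subset_iff mult.assoc\<close>)
  also have "\<dots> = (\<Sum>u \<in> ?S. \<Sum>j \<in> ?T \<times> ?W.
      if u \<otimes>\<^bsub>M\<^esub> (fst j \<otimes>\<^bsub>M\<^esub> snd j) = m then f u * (g (fst j) * h (snd j)) else 0)"
    by (simp add: sum.cartesian_product split_def)
  also have "\<dots> = (\<Sum>(q, u) \<in> ?Q \<times> ?S. \<Sum>j \<in> ?T \<times> ?W. if q = fst j \<otimes>\<^bsub>M\<^esub> snd j
      then (if u \<otimes>\<^bsub>M\<^esub> q = m then f u * (g (fst j) * h (snd j)) else 0) else 0)"
    by (rule sum_pairs_delta [symmetric]) (use fin in force)+
  also have "\<dots> = (\<Sum>(q, u) \<in> ?Q \<times> ?S. if u \<otimes>\<^bsub>M\<^esub> q = m then f u * (g \<otimes>\<^bsub>monoid_algebra M\<^esub> h) q else 0)"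
    by (intro sum.cong refl)
      (auto simp: monoid_algebra_mult_superset [OF fin(2) subset_refl fin(3) subset_refl]
        sum_distrib_left split_def if_distrib intro!: sum.cong)
  also have "\<dots> = (\<Sum>(u, q) \<in> ?S \<times> ?Q. if u \<otimes>\<^bsub>M\<^esub> q = m then f u * (g \<otimes>\<^bsub>monoid_algebra M\<^esub> h) q else 0)"
    by (rule sum.reindex_bij_witness [of _ prod.swap prod.swap]) auto
  also have "\<dots> = (f \<otimes>\<^bsub>monoid_algebra M\<^esub> (g \<otimes>\<^bsub>monoid_algebra M\<^esub> h)) m"
    by (rule monoid_algebra_mult_superset [symmetric])
      (use fin monoid_algebra_mult_closed(2) [OF M g h] in auto)
  finally show "((f \<otimes>\<^bsub>monoid_algebra M\<^esub> g) \<otimes>\<^bsub>monoid_algebra M\<^esub> h) m =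
    (f \<otimes>\<^bsub>monoid_algebra M\<^esub> (g \<otimes>\<^bsub>monoid_algebra M\<^esub> h)) m" .
qed

theorem k_algebra_monoid_algebra:
  assumes M: "Group.monoid M"
  shows "k_algebra (monoid_algebra M :: ('k::field, 'm \<Rightarrow> 'k) module)"
proof -
  interpret M: Group.monoid M by fact
  let ?F = "monoid_algebra M :: ('k::field, 'm \<Rightarrow> 'k) module"
  note [simp] = carrier_monoid_algebra
  have ag: "abelian_group ?F"
  proof (rule abelian_groupI)
    fix f g assume *: "f \<in> carrier ?F" "g \<in> carrier ?F"
    have "finite {m. f m + g m \<noteq> 0}"
      by (rule finite_subset [of _ "{m. f m \<noteq> 0} \<union> {m. g m \<noteq> 0}"]) (use * in auto)
    then show "f \<oplus>\<^bsub>?F\<^esub> g \<in> carrier ?F" using * by auto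
  next
    fix f assume *: "f \<in> carrier ?F"
    then show "\<exists>g\<in>carrier ?F. g \<oplus>\<^bsub>?F\<^esub> f = \<zero>\<^bsub>?F\<^esub>"
      by (intro bexI [of _ "\<lambda>m. - f m"]) auto
  qed (auto simp: algebra_simps)
  have lin_l: "(\<lambda>m. f m + g m) \<otimes>\<^bsub>?F\<^esub> h = (\<lambda>m. (f \<otimes>\<^bsub>?F\<^esub> h) m + (g \<otimes>\<^bsub>?F\<^esub> h) m)"
    and lin_r: "h \<otimes>\<^bsub>?F\<^esub> (\<lambda>m. f m + g m) = (\<lambda>m. (h \<otimes>\<^bsub>?F\<^esub> f) m + (h \<otimes>\<^bsub>?F\<^esub> g) m)"
    if *: "f \<in> carrier ?F" "g \<in> carrier ?F" "h \<in> carrier ?F" for f g h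
  proof -
    let ?S = "{m. f m \<noteq> 0} \<union> {m. g m \<noteq> 0}" and ?T = "{m. h m \<noteq> 0}"
    note ss = monoid_algebra_mult_superset [of ?S _ ?T] monoid_algebra_mult_superset [of ?T _ ?S]
    have fin: "finite ?S" "finite ?T" using * by auto
    have le: "{m. f m + g m \<noteq> 0} \<subseteq> ?S" by auto
    show "(\<lambda>m. f m + g m) \<otimes>\<^bsub>?F\<^esub> h = (\<lambda>m. (f \<otimes>\<^bsub>?F\<^esub> h) m + (g \<otimes>\<^bsub>?F\<^esub> h) m)"
      by (intro ext, subst (1 2 3) ss(1))
        (use fin le in \<open>auto simp: sum.distrib [symmetric] algebra_simps split_def intro!: sum.cong\<close>)
    show "h \<otimes>\<^bsub>?F\<^esub> (\<lambda>m. f m + g m) = (\<lambda>m. (h \<otimes>\<^bsub>?F\<^esub> f) m + (h \<otimes>\<^bsub>?F\<^esub> g) m)"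
      by (intro ext, subst (1 2 3) ss(2))
        (use fin le in \<open>auto simp: sum.distrib [symmetric] algebra_simps split_def intro!: sum.cong\<close>)
  qed
  have one: "basis_elem \<one>\<^bsub>M\<^esub> \<otimes>\<^bsub>?F\<^esub> f = f" "f \<otimes>\<^bsub>?F\<^esub> basis_elem \<one>\<^bsub>M\<^esub> = f"
    if f: "f \<in> carrier ?F" for f
  proof -
    have fin: "finite {u. f u \<noteq> 0}" using f by simp
    have z: "u \<in> carrier M" if "f u \<noteq> 0" for u using f that by auto
    have "(basis_elem \<one>\<^bsub>M\<^esub> \<otimes>\<^bsub>?F\<^esub> f) m = f m" for m
    proof -
      have "(basis_elem \<one>\<^bsub>M\<^esub> \<otimes>\<^bsub>?F\<^esub> f) m =
          (\<Sum>(u, v) \<in> {\<one>\<^bsub>M\<^esub>} \<times> {u. f u \<noteq> 0}. if u \<otimes>\<^bsub>M\<^esub> v = m then basis_elem \<one>\<^bsub>M\<^esub> u * f v else 0)"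
        by (rule monoid_algebra_mult_superset) (use fin in auto)
      also have "\<dots> = (\<Sum>v \<in> {u. f u \<noteq> 0}. if v = m then f v else 0)"
        unfolding sum.cartesian_product [symmetric]
        by (simp, intro sum.cong refl) (simp add: basis_elem_def z)
      finally show ?thesis using fin by (auto simp: sum.delta)
    qed
    then show "basis_elem \<one>\<^bsub>M\<^esub> \<otimes>\<^bsub>?F\<^esub> f = f" by (rule ext)
    have "(f \<otimes>\<^bsub>?F\<^esub> basis_elem \<one>\<^bsub>M\<^esub>) m = f m" for m
    proof -
      have "(f \<otimes>\<^bsub>?F\<^esub> basis_elem \<one>\<^bsub>M\<^esub>) m =
          (\<Sum>(v, u) \<in> {u. f u \<noteq> 0} \<times> {\<one>\<^bsub>M\<^esub>}. if v \<otimes>\<^bsub>M\<^esub> u = m then f v * basis_elem \<one>\<^bsub>M\<^esub> u else 0)"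
        by (rule monoid_algebra_mult_superset) (use fin in auto)
      also have "\<dots> = (\<Sum>v \<in> {u. f u \<noteq> 0}. if v = m then f v else 0)"
        unfolding sum.cartesian_product [symmetric]
        by (simp, intro sum.cong refl) (simp add: basis_elem_def z)
      finally show ?thesis using fin by (auto simp: sum.delta)
    qed
    then show "f \<otimes>\<^bsub>?F\<^esub> basis_elem \<one>\<^bsub>M\<^esub> = f" by (rule ext)
  qed
  have "Group.monoid ?F"
  proof (rule monoidI)
    show "\<one>\<^bsub>?F\<^esub> \<in> carrier ?F" by (simp del: carrier_monoid_algebra add: basis_elem_closed)
  qed (use monoid_algebra_mult_closed(1) [OF M] monoid_algebra_mult_assoc [OF M] one in
      \<open>simp_all del: carrier_monoid_algebra\<close>)
  then have ring: "ring ?F"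
    by (rule ringI [OF ag]) (simp_all del: carrier_monoid_algebra add: lin_l lin_r)
  have scale: "(\<lambda>m. c * f m) \<otimes>\<^bsub>?F\<^esub> g = (\<lambda>m. c * (f \<otimes>\<^bsub>?F\<^esub> g) m)"
      "f \<otimes>\<^bsub>?F\<^esub> (\<lambda>m. c * g m) = (\<lambda>m. c * (f \<otimes>\<^bsub>?F\<^esub> g) m)"
    if *: "f \<in> carrier ?F" "g \<in> carrier ?F" for c f g
    by (intro ext, subst (1 2) monoid_algebra_mult_superset [of "{m. f m \<noteq> 0}" _ "{m. g m \<noteq> 0}"];
        use * in \<open>auto simp: sum_distrib_left split_def intro!: sum.cong\<close>)+
  have "finite {m. c * f m \<noteq> 0}" if "finite {m. f m \<noteq> 0}" for c and f :: "'m \<Rightarrow> 'k"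
    by (rule finite_subset [OF _ that]) auto
  with ring show ?thesis
    by (intro k_algebra.intro k_algebra_axioms.intro)
      (auto simp: algebra_simps scale simp del: carrier_monoid_algebra,
       auto simp: carrier_monoid_algebra)
qed

lemma uminus_monoid_algebra:
  assumes "Group.monoid M" "f \<in> carrier (monoid_algebra M)"
  shows "\<ominus>\<^bsub>monoid_algebra M\<^esub> f = (\<lambda>m. - f m)"
proof -
  interpret k_algebra "monoid_algebra M" by (rule k_algebra_monoid_algebra [OF assms(1)])
  show ?thesis using assms(2)
    by (intro minus_equality) (auto simp: carrier_monoid_algebra)
qed

lemma minus_monoid_algebra:
  assumes "Group.monoid M" "g \<in> carrier (monoid_algebra M)"
  shows "f \<ominus>\<^bsub>monoid_algebra M\<^esub> g = (\<lambda>m. f m - g m)"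
  using assms by (simp add: a_minus_def uminus_monoid_algebra)

lemma monoid_algebra_induct [consumes 1, case_names zero step]:
  fixes f :: "'m \<Rightarrow> 'k::field"
  assumes "f \<in> carrier (monoid_algebra M)"
    and "P (\<lambda>m. 0)"
    and step: "\<And>c u g. u \<in> carrier M \<Longrightarrow> g \<in> carrier (monoid_algebra M) \<Longrightarrow> P g \<Longrightarrow>
      P (\<lambda>m. c * basis_elem u m + g m)"
  shows "P f"
proof -
  \<comment> \<open>The support bound S carries the induction, so the claim is stated for all
    functions supported in S.\<close>
  have "finite S \<Longrightarrow> \<forall>f. f \<in> carrier (monoid_algebra M) \<and> {m. f m \<noteq> 0} \<subseteq> S \<longrightarrow> P f" for S
  proof (induction S rule: finite_induct)
    case empty
    have "f = (\<lambda>m. 0)" if "{m. f m \<noteq> 0} \<subseteq> {}" for f :: "'m \<Rightarrow> 'k" using that by auto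
    then show ?case using assms(2) by blast
  next
    case (insert u S)
    show ?case
    proof (intro allI impI)
      fix f :: "'m \<Rightarrow> 'k"
      assume f: "f \<in> carrier (monoid_algebra M) \<and> {m. f m \<noteq> 0} \<subseteq> insert u S"
      show "P f"
      proof (cases "u \<in> carrier M")
        case True
        let ?g = "f(u := 0)"
        have "finite {m. ?g m \<noteq> 0}"
          by (rule finite_subset [of _ "{m. f m \<noteq> 0}"]) (use f in \<open>auto simp: carrier_monoid_algebra\<close>)
        then have g: "?g \<in> carrier (monoid_algebra M)"
          using f by (auto simp: carrier_monoid_algebra)
        have "{m. ?g m \<noteq> 0} \<subseteq> S" using f by auto
        then have "P ?g" using insert.IH [rule_format, of ?g] g by simp
        from step [OF True g this, of "f u"] have "P (\<lambda>m. f u * basis_elem u m + ?g m)" .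
        moreover have "(\<lambda>m. f u * basis_elem u m + ?g m) = f" by (auto simp: basis_elem_def)
        ultimately show ?thesis by simp
      next
        case False
        then have "{m. f m \<noteq> 0} \<subseteq> S" using f by (auto simp: carrier_monoid_algebra)
        then show ?thesis using insert.IH [rule_format, of f] f by simp
      qed
    qed
  qed
  then show ?thesis using assms(1) by (auto simp: carrier_monoid_algebra)
qed

lemma lin_comb_monoid_algebra_closed:
  fixes G :: "('k::field, 'g) module"
  assumes "left_module field_ring G" "g \<in> carrier M \<rightarrow> carrier G" "f \<in> carrier (monoid_algebra M)"
  shows "lin_comb field_ring G g f \<in> carrier G"
  using left_module.lin_comb_closed [OF assms(1) _ assms(2)] assms(3)
  by (simp add: carrier_monoid_algebra_free)

lemma lin_comb_basis_elem:
  fixes G :: "('a::field, 'g) module" and u :: 'b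
  assumes "left_module field_ring G" "g u \<in> carrier G"
  shows "lin_comb field_ring G g (basis_elem u) = g u"
proof -
  have "(\<lambda>j. if j = u then 1 else \<zero>\<^bsub>field_ring\<^esub>) = (basis_elem u :: 'b \<Rightarrow> 'a)"
    by (rule ext) (simp add: basis_elem_def)
  with left_module.lin_comb_single [where g=g, OF assms(1) _ assms(2), of 1]
    left_module.smult_one [OF assms]
  show ?thesis by simp
qed

lemma lin_comb_monoid_algebra_add:
  fixes G :: "('k::field, 'g) module"
  assumes "left_module field_ring G" "g \<in> carrier M \<rightarrow> carrier G"
    "f \<in> carrier (monoid_algebra M)" "f' \<in> carrier (monoid_algebra M)"
  shows "lin_comb field_ring G g (\<lambda>m. f m + f' m) = lin_comb field_ring G g f \<oplus>\<^bsub>G\<^esub> lin_comb field_ring G g f'"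
  using left_module.lin_comb_add [OF assms(1) _ _ assms(2)] assms(3,4)
  by (simp add: carrier_monoid_algebra_free)

lemma lin_comb_monoid_algebra_smult:
  fixes G :: "('k::field, 'g) module"
  assumes "left_module field_ring G" "g \<in> carrier M \<rightarrow> carrier G" "f \<in> carrier (monoid_algebra M)"
  shows "lin_comb field_ring G g (\<lambda>m. c * f m) = c \<odot>\<^bsub>G\<^esub> lin_comb field_ring G g f"
  using left_module.lin_comb_smult [OF assms(1) _ _ assms(2)] assms(3)
  by (simp add: carrier_monoid_algebra_free)

section \<open>Quotient algebras\<close>

lemma quotient_algebra_simps:
  "carrier (quotient_algebra A I) = a_rcosets\<^bsub>A\<^esub> I"
  "U \<otimes>\<^bsub>quotient_algebra A I\<^esub> V = rcoset_mult A I U V"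
  "\<one>\<^bsub>quotient_algebra A I\<^esub> = I +>\<^bsub>A\<^esub> \<one>\<^bsub>A\<^esub>"
  "\<zero>\<^bsub>quotient_algebra A I\<^esub> = I"
  "U \<oplus>\<^bsub>quotient_algebra A I\<^esub> V = U <+>\<^bsub>A\<^esub> V"
  "c \<odot>\<^bsub>quotient_algebra A I\<^esub> U = (\<Union>u\<in>U. I +>\<^bsub>A\<^esub> (c \<odot>\<^bsub>A\<^esub> u))"
  by (simp_all add: quotient_algebra_def ring.defs module.defs FactRing_def)

context k_algebra
begin

context
  fixes I assumes I: "ideal I A"
begin

interpretation ideal I A by (rule I)

lemma carrier_quotient_algebra: "carrier (quotient_algebra A I) = (\<lambda>a. I +> a) ` carrier A"
  by (auto simp: quotient_algebra_simps A_RCOSETS_def')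

lemma coset_closed [intro]: "a \<in> carrier A \<Longrightarrow> I +> a \<in> carrier (quotient_algebra A I)"
  by (auto simp: carrier_quotient_algebra)

lemma coset_mult: "a \<in> carrier A \<Longrightarrow> b \<in> carrier A \<Longrightarrow>
    (I +> a) \<otimes>\<^bsub>quotient_algebra A I\<^esub> (I +> b) = I +> (a \<otimes> b)"
  by (simp add: quotient_algebra_simps rcoset_mult_add)

lemma coset_add: "a \<in> carrier A \<Longrightarrow> b \<in> carrier A \<Longrightarrow>
    (I +> a) \<oplus>\<^bsub>quotient_algebra A I\<^esub> (I +> b) = I +> (a \<oplus> b)"
  by (simp add: quotient_algebra_simps a_rcos_sum)

lemma coset_eq_iff: "a \<in> carrier A \<Longrightarrow> b \<in> carrier A \<Longrightarrow> I +> a = I +> b \<longleftrightarrow> a \<ominus> b \<in> I"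
  by (rule quotient_eq_iff_same_a_r_cos [OF I, symmetric])

text \<open>The scalar action on the quotient is a union over all representatives. They all give the
  same coset, because two of them differ by an element of I and I is a subspace.\<close>

lemma coset_smult:
  assumes a: "a \<in> carrier A"
  shows "c \<odot>\<^bsub>quotient_algebra A I\<^esub> (I +> a) = I +> (c \<odot> a)"
proof -
  have "I +> (c \<odot> u) = I +> (c \<odot> a)" if u: "u \<in> I +> a" for u
  proof -
    obtain i where i: "i \<in> I" "u = i \<oplus> a"
      using u unfolding a_r_coset_def' by fast
    have "c \<odot> u \<ominus> c \<odot> a = c \<odot> i"
      using i a Icarr by (simp add: smult_r_distr minus_eq add.m_assoc r_neg)
    then show ?thesis using i a Icarr ideal_smult [OF I] by (subst coset_eq_iff) auto
  qed
  then have "(\<Union>u\<in>I +> a. I +> (c \<odot> u)) = (\<Union>u\<in>I +> a. I +> (c \<odot> a))"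
    by (intro SUP_cong refl)
  also have "\<dots> = I +> (c \<odot> a)" using a_rcos_self [OF a] by blast
  finally show ?thesis by (simp only: quotient_algebra_simps)
qed

theorem k_algebra_quotient: "k_algebra (quotient_algebra A I)"
proof -
  have ring: "ring (quotient_algebra A I)"
    unfolding quotient_algebra_def by (rule ring_extend, rule quotient_is_ring)
  have rep: "\<exists>a\<in>carrier A. U = I +> a" if "U \<in> carrier (quotient_algebra A I)" for U
    using that by (auto simp: carrier_quotient_algebra)
  show ?thesis
    by (intro k_algebra.intro k_algebra_axioms.intro ring; (drule rep, elim bexE)+)
      (simp_all add: coset_closed coset_mult coset_add coset_smult smult_l_distr
        smult_r_distr smult_assoc smult_mult_left smult_mult_right)
qed

end

end

section \<open>Tensor products\<close>

text \<open>Multiplication by a basis element translates the monoid, so under the linear extension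
  of g it becomes the passage from g to a translate of g. Ideals can therefore be tested by families
  of functions that are stable under translation.\<close>

lemma lin_comb_basis_elem_mult:
  fixes f :: "'m \<Rightarrow> 'k::field"
  assumes M: "Group.monoid M" and G: "left_module field_ring G" and g: "g \<in> carrier M \<rightarrow> carrier G"
    and u: "u \<in> carrier M" and f: "f \<in> carrier (monoid_algebra M)"
  shows "lin_comb field_ring G g (basis_elem u \<otimes>\<^bsub>monoid_algebra M\<^esub> f) =
      lin_comb field_ring G (\<lambda>v. g (u \<otimes>\<^bsub>M\<^esub> v)) f"
    and "lin_comb field_ring G g (f \<otimes>\<^bsub>monoid_algebra M\<^esub> basis_elem u) =
      lin_comb field_ring G (\<lambda>v. g (v \<otimes>\<^bsub>M\<^esub> u)) f"
proof -
  interpret M: Group.monoid M by fact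
  interpret F: k_algebra "monoid_algebra M :: ('k, 'm \<Rightarrow> 'k) module"
    by (rule k_algebra_monoid_algebra [OF M])
  interpret G: left_module field_ring G by fact
  have gl: "(\<lambda>v. g (u \<otimes>\<^bsub>M\<^esub> v)) \<in> carrier M \<rightarrow> carrier G"
    and gr: "(\<lambda>v. g (v \<otimes>\<^bsub>M\<^esub> u)) \<in> carrier M \<rightarrow> carrier G"
    using g u by (auto simp: Pi_iff)
  note add = lin_comb_monoid_algebra_add [OF G] and sm = lin_comb_monoid_algebra_smult [OF G]
    and be = lin_comb_basis_elem [OF G]
  have cl: "(\<lambda>m. c * h m) \<in> carrier (monoid_algebra M)"
    if "h \<in> carrier (monoid_algebra M)" for c and h :: "'m \<Rightarrow> 'k"
    using F.smult_closed [OF that, of c] by simp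
  have expand: "lin_comb field_ring G k (\<lambda>m. c * basis_elem v m + h m) = c \<odot>\<^bsub>G\<^esub> k v \<oplus>\<^bsub>G\<^esub> lin_comb field_ring G k h"
    if k: "k \<in> carrier M \<rightarrow> carrier G" and v: "v \<in> carrier M"
      and h: "h \<in> carrier (monoid_algebra M)" for k c v and h :: "'m \<Rightarrow> 'k"
    using add [OF k cl [OF basis_elem_closed [OF v]] h] sm [OF k basis_elem_closed [OF v]]
      be [where g=k, OF funcset_mem [OF k v]] by simp
  show "lin_comb field_ring G g (basis_elem u \<otimes>\<^bsub>monoid_algebra M\<^esub> f) =
      lin_comb field_ring G (\<lambda>v. g (u \<otimes>\<^bsub>M\<^esub> v)) f"
    using f
  proof (induction f rule: monoid_algebra_induct)
    case zero
    show ?case using F.r_null [of "basis_elem u"] u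
      by (simp add: G.lin_comb_zero [simplified])
  next
    case (step c v h)
    have "basis_elem u \<otimes>\<^bsub>monoid_algebra M\<^esub> (\<lambda>m. c * basis_elem v m + h m) =
        (\<lambda>m. c * basis_elem (u \<otimes>\<^bsub>M\<^esub> v) m + (basis_elem u \<otimes>\<^bsub>monoid_algebra M\<^esub> h) m)"
      using F.r_distr [of "\<lambda>m. c * basis_elem v m" h "basis_elem u"]
        F.smult_mult_right [of "basis_elem u" "basis_elem v" c] step(1,2) u cl [of "basis_elem v" c]
      by (simp add: basis_elem_mult)
    then show ?case
      using expand [OF g, of "u \<otimes>\<^bsub>M\<^esub> v" "basis_elem u \<otimes>\<^bsub>monoid_algebra M\<^esub> h" c]
        expand [OF gl, of v h c] step u by simp
  qed
  show "lin_comb field_ring G g (f \<otimes>\<^bsub>monoid_algebra M\<^esub> basis_elem u) =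
      lin_comb field_ring G (\<lambda>v. g (v \<otimes>\<^bsub>M\<^esub> u)) f"
    using f
  proof (induction f rule: monoid_algebra_induct)
    case zero
    show ?case using F.l_null [of "basis_elem u"] u
      by (simp add: G.lin_comb_zero [simplified])
  next
    case (step c v h)
    have "(\<lambda>m. c * basis_elem v m + h m) \<otimes>\<^bsub>monoid_algebra M\<^esub> basis_elem u =
        (\<lambda>m. c * basis_elem (v \<otimes>\<^bsub>M\<^esub> u) m + (h \<otimes>\<^bsub>monoid_algebra M\<^esub> basis_elem u) m)"
      using F.l_distr [of "\<lambda>m. c * basis_elem v m" h "basis_elem u"]
        F.smult_mult_left [of "basis_elem v" "basis_elem u" c] step(1,2) u cl [of "basis_elem v" c]
      by (simp add: basis_elem_mult)
    then show ?case
      using expand [OF g, of "v \<otimes>\<^bsub>M\<^esub> u" "h \<otimes>\<^bsub>monoid_algebra M\<^esub> basis_elem u" c]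
        expand [OF gr, of v h c] step u by simp
  qed
qed

lemma lin_comb_diff_eq_zero:
  fixes f :: "'m \<Rightarrow> 'k::field"
  assumes M: "Group.monoid M" and G: "left_module field_ring G" and g: "g \<in> carrier M \<rightarrow> carrier G"
    and f: "f \<in> carrier (monoid_algebra M)" and h: "h \<in> carrier (monoid_algebra M)"
    and eq: "lin_comb field_ring G g f = lin_comb field_ring G g h"
  shows "lin_comb field_ring G g (\<lambda>m. f m - h m) = \<zero>\<^bsub>G\<^esub>"
proof -
  interpret F: k_algebra "monoid_algebra M :: ('k, 'm \<Rightarrow> 'k) module"
    by (rule k_algebra_monoid_algebra [OF M])
  interpret G: left_module field_ring G by fact
  have d: "(\<lambda>m. f m - h m) \<in> carrier (monoid_algebra M)"
    using F.minus_closed [OF f h] unfolding minus_monoid_algebra [OF M h] .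
  have "lin_comb field_ring G g (\<lambda>m. f m - h m) \<oplus>\<^bsub>G\<^esub> lin_comb field_ring G g h = lin_comb field_ring G g h"
    using lin_comb_monoid_algebra_add [OF G g d h] eq by simp
  then show ?thesis
    using lin_comb_monoid_algebra_closed [OF G g d] lin_comb_monoid_algebra_closed [OF G g h]
    by (simp only: G.M.add.r_cancel_one)
qed

text \<open>Products with basis elements replace g by a translate, which stays in
  \<open>\<Gamma>\<close>. Hence the common kernel absorbs basis elements on both sides, and by
  linearity all factors.\<close>

lemma ideal_translation_kernel:
  fixes G :: "('k::field, 'g) module"
  assumes M: "Group.monoid M" and G: "left_module field_ring G"
    and \<Gamma>: "\<And>g. g \<in> \<Gamma> \<Longrightarrow> g \<in> carrier M \<rightarrow> carrier G"
    and left: "\<And>g u. g \<in> \<Gamma> \<Longrightarrow> u \<in> carrier M \<Longrightarrow> (\<lambda>v. g (u \<otimes>\<^bsub>M\<^esub> v)) \<in> \<Gamma>"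
    and right: "\<And>g u. g \<in> \<Gamma> \<Longrightarrow> u \<in> carrier M \<Longrightarrow> (\<lambda>v. g (v \<otimes>\<^bsub>M\<^esub> u)) \<in> \<Gamma>"
  shows "ideal {f \<in> carrier (monoid_algebra M). \<forall>g\<in>\<Gamma>. lin_comb field_ring G g f = \<zero>\<^bsub>G\<^esub>} (monoid_algebra M)"
    (is "ideal ?J ?F")
proof -
  interpret F: k_algebra ?F by (rule k_algebra_monoid_algebra [OF M])
  interpret G: left_module field_ring G by (rule G)
  let ?lc = "lin_comb field_ring G"
  have scale_closed: "(\<lambda>m. c * f m) \<in> carrier ?F" if "f \<in> carrier ?F" for c f
    using F.smult_closed [OF that, of c] by simp
  have zero: "?lc g (\<lambda>m. 0) = \<zero>\<^bsub>G\<^esub>" for g :: "'a \<Rightarrow> 'g"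
    using G.lin_comb_zero [of g] by simp
  have lin: "?lc g (\<lambda>m. c * f m + h m) = \<zero>\<^bsub>G\<^esub>"
    if "g \<in> \<Gamma>" "f \<in> carrier ?F" "h \<in> carrier ?F" "?lc g f = \<zero>\<^bsub>G\<^esub>" "?lc g h = \<zero>\<^bsub>G\<^esub>" for g c f h
    using lin_comb_monoid_algebra_add [OF G \<Gamma> [OF that(1)] scale_closed [OF that(2), of c] that(3)]
      lin_comb_monoid_algebra_smult [OF G \<Gamma> [OF that(1)] that(2), of c] that(4,5)
      G.smult_zero_right [of c] by simp
  have mem: "f \<in> ?J \<longleftrightarrow> f \<in> carrier ?F \<and> (\<forall>g\<in>\<Gamma>. ?lc g f = \<zero>\<^bsub>G\<^esub>)" for f by blast
  have z: "(\<lambda>m. 0) \<in> ?J" using F.zero_closed zero by simp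
  have comb: "(\<lambda>m. c * f m + h m) \<in> ?J" if "f \<in> ?J" "h \<in> ?J" for c f h
  proof -
    have "(\<lambda>m. c * f m + h m) \<in> carrier ?F"
      using F.a_closed [OF scale_closed [of f c], of h] that by simp
    then show ?thesis using that lin by blast
  qed
  show ?thesis
  proof (rule idealI [OF F.ring_axioms])
    show "subgroup ?J (add_monoid ?F)"
    proof (rule F.add.subgroupI)
      show "?J \<subseteq> carrier ?F" by blast
      show "?J \<noteq> {}" using z by blast
    next
      fix f assume f: "f \<in> ?J"
      then have "\<ominus>\<^bsub>?F\<^esub> f = (\<lambda>m. (-1) * f m + 0)"
        by (simp add: uminus_monoid_algebra [OF M])
      with comb [OF f z, of "-1"] show "\<ominus>\<^bsub>?F\<^esub> f \<in> ?J" by simp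
    next
      fix f g assume "f \<in> ?J" "g \<in> ?J"
      from comb [OF this, of 1] show "f \<oplus>\<^bsub>?F\<^esub> g \<in> ?J" by simp
    qed
    fix f h assume f: "f \<in> ?J" and h: "h \<in> carrier ?F"
    have fF: "f \<in> carrier ?F" using f by blast
    have basis: "basis_elem u \<otimes>\<^bsub>?F\<^esub> f \<in> ?J" "f \<otimes>\<^bsub>?F\<^esub> basis_elem u \<in> ?J" if u: "u \<in> carrier M" for u
    proof -
      have "?lc g (basis_elem u \<otimes>\<^bsub>?F\<^esub> f) = \<zero>\<^bsub>G\<^esub>" "?lc g (f \<otimes>\<^bsub>?F\<^esub> basis_elem u) = \<zero>\<^bsub>G\<^esub>" if g: "g \<in> \<Gamma>" for g
        unfolding lin_comb_basis_elem_mult [OF M G \<Gamma> [OF g] u fF]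
        using f left [OF g u] right [OF g u] by blast+
      then show "basis_elem u \<otimes>\<^bsub>?F\<^esub> f \<in> ?J" "f \<otimes>\<^bsub>?F\<^esub> basis_elem u \<in> ?J"
        using F.m_closed [OF basis_elem_closed [OF u] fF] F.m_closed [OF fF basis_elem_closed [OF u]] by blast+
    qed
    show "h \<otimes>\<^bsub>?F\<^esub> f \<in> ?J"
      using h
    proof (induction h rule: monoid_algebra_induct)
      case zero
      then show ?case using F.l_null [OF fF] z by simp
    next
      case (step c u g)
      have "(\<lambda>m. c * basis_elem u m + g m) \<otimes>\<^bsub>?F\<^esub> f = (\<lambda>m. c * (basis_elem u \<otimes>\<^bsub>?F\<^esub> f) m + (g \<otimes>\<^bsub>?F\<^esub> f) m)"
        using F.l_distr [of "\<lambda>m. c * basis_elem u m" g f] scale_closed [OF basis_elem_closed [OF step(1)], of c]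
          F.smult_mult_left [of "basis_elem u" f c] step(1,2) fF by simp
      then show ?case using comb [OF basis(1) [OF step(1)] step(3), of c] by simp
    qed
    show "f \<otimes>\<^bsub>?F\<^esub> h \<in> ?J"
      using h
    proof (induction h rule: monoid_algebra_induct)
      case zero
      then show ?case using F.r_null [OF fF] z by simp
    next
      case (step c u g)
      have "f \<otimes>\<^bsub>?F\<^esub> (\<lambda>m. c * basis_elem u m + g m) = (\<lambda>m. c * (f \<otimes>\<^bsub>?F\<^esub> basis_elem u) m + (f \<otimes>\<^bsub>?F\<^esub> g) m)"
        using F.r_distr [of "\<lambda>m. c * basis_elem u m" g f] scale_closed [OF basis_elem_closed [OF step(1)], of c]
          F.smult_mult_right [of f "basis_elem u" c] step(1,2) fF by simp
      then show ?case using comb [OF basis(2) [OF step(1)] step(3), of c] by simp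
    qed
  qed
qed

text \<open>The device by which maps out of quotients are shown to be well defined: the map is
  enlarged to a translation stable family that kills the generators, and the elements of the ideal
  never have to be described explicitly.\<close>

lemma genideal_translation_kernel:
  fixes G :: "('k::field, 'g) module"
  assumes M: "Group.monoid M" and G: "left_module field_ring G"
    and \<Gamma>: "\<And>g. g \<in> \<Gamma> \<Longrightarrow> g \<in> carrier M \<rightarrow> carrier G"
    and left: "\<And>g u. g \<in> \<Gamma> \<Longrightarrow> u \<in> carrier M \<Longrightarrow> (\<lambda>v. g (u \<otimes>\<^bsub>M\<^esub> v)) \<in> \<Gamma>"
    and right: "\<And>g u. g \<in> \<Gamma> \<Longrightarrow> u \<in> carrier M \<Longrightarrow> (\<lambda>v. g (v \<otimes>\<^bsub>M\<^esub> u)) \<in> \<Gamma>"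
    and S: "S \<subseteq> carrier (monoid_algebra M)"
    and zero: "\<And>f g. f \<in> S \<Longrightarrow> g \<in> \<Gamma> \<Longrightarrow> lin_comb field_ring G g f = \<zero>\<^bsub>G\<^esub>"
    and f: "f \<in> Idl\<^bsub>monoid_algebra M\<^esub> S" and g: "g \<in> \<Gamma>"
  shows "lin_comb field_ring G g f = \<zero>\<^bsub>G\<^esub>"
proof -
  have "ring (monoid_algebra M :: ('k, _) module)"
    using k_algebra_monoid_algebra [OF M] by (rule k_algebra.axioms)
  from ring.genideal_minimal [OF this ideal_translation_kernel [OF M G \<Gamma> left right], of S]
  have "Idl\<^bsub>monoid_algebra M\<^esub> S \<subseteq> {f \<in> carrier (monoid_algebra M). \<forall>g\<in>\<Gamma>. lin_comb field_ring G g f = \<zero>\<^bsub>G\<^esub>}"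
    using S zero by blast
  then show ?thesis using f g by blast
qed

text \<open>The map induced on cosets, with its value computed from any representative. It is
  meaningful only if the linear extension of g is constant on the coset, that is, if it kills the
  ideal.\<close>

definition linear_lift ::
    "('k::field, 'g) module \<Rightarrow> ('m \<Rightarrow> 'g) \<Rightarrow> ('m \<Rightarrow> 'k) set \<Rightarrow> 'g" where
  "linear_lift G g U = the_elem (lin_comb field_ring G g ` U)"

context
  fixes M :: "('m, 'x) monoid_scheme" and G :: "('k::field, 'g) module"
    and I :: "('m \<Rightarrow> 'k) set" and g :: "'m \<Rightarrow> 'g"
  assumes M: "Group.monoid M" and G: "left_module field_ring G"
    and I: "ideal I (monoid_algebra M)" and g: "g \<in> carrier M \<rightarrow> carrier G"
    and zero: "\<And>f. f \<in> I \<Longrightarrow> lin_comb field_ring G g f = \<zero>\<^bsub>G\<^esub>"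
begin

lemma linear_lift_coset:
  assumes f: "f \<in> carrier (monoid_algebra M)"
  shows "linear_lift G g (I +>\<^bsub>monoid_algebra M\<^esub> f) = lin_comb field_ring G g f"
proof -
  interpret I: ideal I "monoid_algebra M" by (rule I)
  interpret G: left_module field_ring G by (rule G)
  let ?lc = "lin_comb field_ring G g"
  have *: "?lc h = ?lc f" if h: "h \<in> I +>\<^bsub>monoid_algebra M\<^esub> f" for h
  proof -
    obtain i where i: "i \<in> I" "h = i \<oplus>\<^bsub>monoid_algebra M\<^esub> f"
      using h unfolding a_r_coset_def' by fast
    have "?lc h = ?lc i \<oplus>\<^bsub>G\<^esub> ?lc f"
      using lin_comb_monoid_algebra_add [OF G g I.Icarr [OF i(1)] f] i(2) by simp
    then show ?thesis
      using zero [OF i(1)] lin_comb_monoid_algebra_closed [OF G g f] by simp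
  qed
  have "?lc ` (I +>\<^bsub>monoid_algebra M\<^esub> f) = {?lc f}"
  proof
    show "?lc ` (I +>\<^bsub>monoid_algebra M\<^esub> f) \<subseteq> {?lc f}"
      by (rule image_subsetI) (simp add: *)
    show "{?lc f} \<subseteq> ?lc ` (I +>\<^bsub>monoid_algebra M\<^esub> f)"
      using imageI [OF I.a_rcos_self [OF f], of ?lc] by simp
  qed
  then show ?thesis by (simp add: linear_lift_def)
qed

lemma quotient_representative:
  assumes "U \<in> carrier (quotient_algebra (monoid_algebra M) I)"
  obtains f where "f \<in> carrier (monoid_algebra M)" "U = I +>\<^bsub>monoid_algebra M\<^esub> f"
  using assms k_algebra.carrier_quotient_algebra [OF k_algebra_monoid_algebra [OF M] I] by blast

lemma linear_lift_closed:
  assumes "U \<in> carrier (quotient_algebra (monoid_algebra M) I)"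
  shows "linear_lift G g U \<in> carrier G"
  using assms
proof (rule quotient_representative)
  fix f assume "f \<in> carrier (monoid_algebra M)" "U = I +>\<^bsub>monoid_algebra M\<^esub> f"
  then show ?thesis using lin_comb_monoid_algebra_closed [OF G g] by (simp add: linear_lift_coset)
qed

lemma linear_lift_add:
  assumes U: "U \<in> carrier (quotient_algebra (monoid_algebra M) I)"
    and V: "V \<in> carrier (quotient_algebra (monoid_algebra M) I)"
  shows "linear_lift G g (U \<oplus>\<^bsub>quotient_algebra (monoid_algebra M) I\<^esub> V) =
    linear_lift G g U \<oplus>\<^bsub>G\<^esub> linear_lift G g V"
proof -
  interpret F: k_algebra "monoid_algebra M :: ('k, 'm \<Rightarrow> 'k) module"
    by (rule k_algebra_monoid_algebra [OF M])
  obtain e f where *: "e \<in> carrier (monoid_algebra M)" "f \<in> carrier (monoid_algebra M)"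
    "U = I +>\<^bsub>monoid_algebra M\<^esub> e" "V = I +>\<^bsub>monoid_algebra M\<^esub> f"
    using quotient_representative [OF U] quotient_representative [OF V] by metis
  then have "U \<oplus>\<^bsub>quotient_algebra (monoid_algebra M) I\<^esub> V = I +>\<^bsub>monoid_algebra M\<^esub> (\<lambda>m. e m + f m)"
    using F.coset_add [OF I, of e f] by simp
  moreover have "(\<lambda>m. e m + f m) \<in> carrier (monoid_algebra M)" using F.a_closed [OF *(1,2)] by simp
  ultimately show ?thesis
    using * lin_comb_monoid_algebra_add [OF G g *(1,2)] by (simp add: linear_lift_coset)
qed

lemma linear_lift_smult:
  assumes U: "U \<in> carrier (quotient_algebra (monoid_algebra M) I)"
  shows "linear_lift G g (c \<odot>\<^bsub>quotient_algebra (monoid_algebra M) I\<^esub> U) = c \<odot>\<^bsub>G\<^esub> linear_lift G g U"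
  using U
proof (rule quotient_representative)
  interpret F: k_algebra "monoid_algebra M :: ('k, 'm \<Rightarrow> 'k) module"
    by (rule k_algebra_monoid_algebra [OF M])
  fix f assume *: "f \<in> carrier (monoid_algebra M)" "U = I +>\<^bsub>monoid_algebra M\<^esub> f"
  then have "c \<odot>\<^bsub>quotient_algebra (monoid_algebra M) I\<^esub> U = I +>\<^bsub>monoid_algebra M\<^esub> (\<lambda>m. c * f m)"
    using F.coset_smult [OF I, of f c] by simp
  moreover have "(\<lambda>m. c * f m) \<in> carrier (monoid_algebra M)" using F.smult_closed [OF *(1), of c] by simp
  ultimately show ?thesis
    using * lin_comb_monoid_algebra_smult [OF G g *(1)] by (simp add: linear_lift_coset)
qed

end

definition bilinear_map ::
    "('k::field, 'a) module \<Rightarrow> ('k, 'b) module \<Rightarrow> ('k, 'g) module \<Rightarrow> ('a \<Rightarrow> 'b \<Rightarrow> 'g) \<Rightarrow> bool" where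
  "bilinear_map A B G \<beta> \<longleftrightarrow>
     (\<forall>a\<in>carrier A. \<forall>b\<in>carrier B. \<beta> a b \<in> carrier G) \<and>
     (\<forall>a\<in>carrier A. \<forall>a'\<in>carrier A. \<forall>b\<in>carrier B. \<beta> (a \<oplus>\<^bsub>A\<^esub> a') b = \<beta> a b \<oplus>\<^bsub>G\<^esub> \<beta> a' b) \<and>
     (\<forall>a\<in>carrier A. \<forall>b\<in>carrier B. \<forall>b'\<in>carrier B. \<beta> a (b \<oplus>\<^bsub>B\<^esub> b') = \<beta> a b \<oplus>\<^bsub>G\<^esub> \<beta> a b') \<and>
     (\<forall>c. \<forall>a\<in>carrier A. \<forall>b\<in>carrier B. \<beta> (c \<odot>\<^bsub>A\<^esub> a) b = c \<odot>\<^bsub>G\<^esub> \<beta> a b) \<and>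
     (\<forall>c. \<forall>a\<in>carrier A. \<forall>b\<in>carrier B. \<beta> a (c \<odot>\<^bsub>B\<^esub> b) = c \<odot>\<^bsub>G\<^esub> \<beta> a b)"

locale algebra_pair = A: k_algebra A + B: k_algebra B
  for A :: "('k::field, 'a) module" and B :: "('k, 'b) module"
begin

abbreviation "FF \<equiv> monoid_algebra (A \<times>\<times> B) :: ('k, 'a \<times> 'b \<Rightarrow> 'k) module"
abbreviation "T \<equiv> tensor_algebra A B"
abbreviation "pt \<equiv> pure_tensor A B"

lemma monoid_pair: "Group.monoid (A \<times>\<times> B)"
  by (rule DirProd_monoid) (rule A.monoid_axioms B.monoid_axioms)+

lemma carrier_pair [simp]: "p \<in> carrier (A \<times>\<times> B) \<longleftrightarrow> fst p \<in> carrier A \<and> snd p \<in> carrier B"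
  by (cases p) (auto simp: DirProd_def)

lemma mult_pair [simp]: "p \<otimes>\<^bsub>A \<times>\<times> B\<^esub> q = (fst p \<otimes>\<^bsub>A\<^esub> fst q, snd p \<otimes>\<^bsub>B\<^esub> snd q)"
  by (simp add: DirProd_def case_prod_beta)

lemma one_pair [simp]: "\<one>\<^bsub>A \<times>\<times> B\<^esub> = (\<one>\<^bsub>A\<^esub>, \<one>\<^bsub>B\<^esub>)"
  by (simp add: DirProd_def)

sublocale F: k_algebra FF
  by (rule k_algebra_monoid_algebra [OF monoid_pair])

lemma scale_closed [simp]: "f \<in> carrier FF \<Longrightarrow> (\<lambda>m. c * f m) \<in> carrier FF"
  using F.smult_closed [of f c] by simp

lemma add_closed' [simp]: "f \<in> carrier FF \<Longrightarrow> g \<in> carrier FF \<Longrightarrow> (\<lambda>m. f m + g m) \<in> carrier FF"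
  using F.add.m_closed [of f g] by simp

lemma tensor_relations_closed: "tensor_relations A B \<subseteq> carrier FF"
  unfolding tensor_relations_def Let_def by (auto intro!: F.minus_closed)

lemma ideal_tensor: "ideal (tensor_ideal A B) FF"
  unfolding tensor_ideal_def by (rule F.genideal_ideal [OF tensor_relations_closed])

lemma relation_in_ideal: "r \<in> tensor_relations A B \<Longrightarrow> r \<in> tensor_ideal A B"
  unfolding tensor_ideal_def using F.genideal_self [OF tensor_relations_closed] by blast

sublocale T: k_algebra T
  unfolding tensor_algebra_def by (rule F.k_algebra_quotient [OF ideal_tensor])

lemma pt_closed [simp, intro]: "a \<in> carrier A \<Longrightarrow> b \<in> carrier B \<Longrightarrow> pt a b \<in> carrier T"
  unfolding pure_tensor_def tensor_algebra_def by (rule F.coset_closed [OF ideal_tensor]) simp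

lemma pt_mult:
  assumes "a \<in> carrier A" "b \<in> carrier B" "a' \<in> carrier A" "b' \<in> carrier B"
  shows "pt a b \<otimes>\<^bsub>T\<^esub> pt a' b' = pt (a \<otimes>\<^bsub>A\<^esub> a') (b \<otimes>\<^bsub>B\<^esub> b')"
  unfolding pure_tensor_def tensor_algebra_def
  using assms by (subst F.coset_mult [OF ideal_tensor]) (auto simp: basis_elem_mult)

lemma pt_one: "pt \<one>\<^bsub>A\<^esub> \<one>\<^bsub>B\<^esub> = \<one>\<^bsub>T\<^esub>"
  by (simp add: pure_tensor_def tensor_algebra_def quotient_algebra_simps)

lemma pt_add_left:
  assumes "a \<in> carrier A" "a' \<in> carrier A" "b \<in> carrier B"
  shows "pt (a \<oplus>\<^bsub>A\<^esub> a') b = pt a b \<oplus>\<^bsub>T\<^esub> pt a' b"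
  unfolding pure_tensor_def tensor_algebra_def
  apply (subst F.coset_add [OF ideal_tensor])
  using assms apply (auto)[2]
  apply (subst F.coset_eq_iff [OF ideal_tensor])
  using assms apply (auto simp del: monoid_algebra_simps)[2]
  apply (rule relation_in_ideal)
  using assms by (auto simp: tensor_relations_def Let_def simp del: monoid_algebra_simps)

lemma pt_add_right:
  assumes "a \<in> carrier A" "b \<in> carrier B" "b' \<in> carrier B"
  shows "pt a (b \<oplus>\<^bsub>B\<^esub> b') = pt a b \<oplus>\<^bsub>T\<^esub> pt a b'"
  unfolding pure_tensor_def tensor_algebra_def
  apply (subst F.coset_add [OF ideal_tensor])
  using assms apply (auto)[2]
  apply (subst F.coset_eq_iff [OF ideal_tensor])
  using assms apply (auto simp del: monoid_algebra_simps)[2]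
  apply (rule relation_in_ideal)
  using assms by (auto simp: tensor_relations_def Let_def simp del: monoid_algebra_simps)

lemma pt_smult_left:
  assumes "a \<in> carrier A" "b \<in> carrier B"
  shows "pt (c \<odot>\<^bsub>A\<^esub> a) b = c \<odot>\<^bsub>T\<^esub> pt a b"
  unfolding pure_tensor_def tensor_algebra_def
  apply (subst F.coset_smult [OF ideal_tensor])
  using assms apply (auto)[1]
  apply (subst F.coset_eq_iff [OF ideal_tensor])
  using assms apply (auto simp del: monoid_algebra_simps)[2]
  apply (rule relation_in_ideal)
  using assms by (auto simp: tensor_relations_def Let_def simp del: monoid_algebra_simps)

lemma pt_smult_right:
  assumes "a \<in> carrier A" "b \<in> carrier B"
  shows "pt a (c \<odot>\<^bsub>B\<^esub> b) = c \<odot>\<^bsub>T\<^esub> pt a b"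
  unfolding pure_tensor_def tensor_algebra_def
  apply (subst F.coset_smult [OF ideal_tensor])
  using assms apply (auto)[1]
  apply (subst F.coset_eq_iff [OF ideal_tensor])
  using assms apply (auto simp del: monoid_algebra_simps)[2]
  apply (rule relation_in_ideal)
  using assms by (auto simp: tensor_relations_def Let_def simp del: monoid_algebra_simps)

lemma pt_zero_left [simp]: "b \<in> carrier B \<Longrightarrow> pt \<zero>\<^bsub>A\<^esub> b = \<zero>\<^bsub>T\<^esub>"
  using pt_smult_left [of "\<zero>\<^bsub>A\<^esub>" b 0] by simp

lemma pt_zero_right [simp]: "a \<in> carrier A \<Longrightarrow> pt a \<zero>\<^bsub>B\<^esub> = \<zero>\<^bsub>T\<^esub>"
  using pt_smult_right [of a "\<zero>\<^bsub>B\<^esub>" 0] by simp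

text \<open>The scalar of a basis element is absorbed into the left factor, so adding one pure
  tensor at a time reaches every element.\<close>

lemma tensor_induct [consumes 1, case_names zero add]:
  assumes t: "t \<in> carrier T" and zero: "P \<zero>\<^bsub>T\<^esub>"
    and add: "\<And>a b t. a \<in> carrier A \<Longrightarrow> b \<in> carrier B \<Longrightarrow> t \<in> carrier T \<Longrightarrow> P t \<Longrightarrow> P (pt a b \<oplus>\<^bsub>T\<^esub> t)"
  shows "P t"
proof -
  interpret I: ideal "tensor_ideal A B" FF by (rule ideal_tensor)
  obtain f where f: "f \<in> carrier FF" "t = tensor_ideal A B +>\<^bsub>FF\<^esub> f"
    using t by (auto simp: tensor_algebra_def F.carrier_quotient_algebra [OF ideal_tensor])
  have "P (tensor_ideal A B +>\<^bsub>FF\<^esub> f)"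
    using f(1)
  proof (induction f rule: monoid_algebra_induct)
    case zero
    have "tensor_ideal A B +>\<^bsub>FF\<^esub> (\<lambda>m. 0) = \<zero>\<^bsub>T\<^esub>"
      using F.a_coset_add_zero [OF I.a_subset]
      by (simp add: tensor_algebra_def quotient_algebra_simps)
    with assms(2) show ?case by simp
  next
    case (step c u g)
    obtain a b where u: "u = (a, b)" "a \<in> carrier A" "b \<in> carrier B" using step by (cases u) auto
    have "tensor_ideal A B +>\<^bsub>FF\<^esub> (\<lambda>m. c * basis_elem u m + g m) =
        pt (c \<odot>\<^bsub>A\<^esub> a) b \<oplus>\<^bsub>T\<^esub> (tensor_ideal A B +>\<^bsub>FF\<^esub> g)"
      using step u F.coset_add [OF ideal_tensor, of "\<lambda>m. c * basis_elem u m" g]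
        F.coset_smult [OF ideal_tensor, of "basis_elem u" c]
      by (simp add: pt_smult_left) (simp add: pure_tensor_def tensor_algebra_def)
    moreover have "tensor_ideal A B +>\<^bsub>FF\<^esub> g \<in> carrier T"
      using step F.coset_closed [OF ideal_tensor] by (simp add: tensor_algebra_def)
    ultimately show ?case using add u step by simp
  qed
  then show ?thesis using f by simp
qed

end

definition tensor_lift ::
    "('k::field, 'g) module \<Rightarrow> ('a \<Rightarrow> 'b \<Rightarrow> 'g) \<Rightarrow> ('a \<times> 'b \<Rightarrow> 'k) set \<Rightarrow> 'g" where
  "tensor_lift G \<beta> = linear_lift G (\<lambda>u. \<beta> (fst u) (snd u))"

context algebra_pair
begin

lemma bilinear_Pi:
  "bilinear_map A B G \<beta> \<Longrightarrow> (\<lambda>u. \<beta> (fst u) (snd u)) \<in> carrier (A \<times>\<times> B) \<rightarrow> carrier G"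
  by (auto simp: bilinear_map_def)

text \<open>The four kinds of generators express exactly additivity and homogeneity in each of the
  two arguments.\<close>

lemma tensor_relation_bilinear:
  assumes G: "left_module field_ring G" and r: "r \<in> tensor_relations A B"
    and \<gamma>: "bilinear_map A B G \<gamma>"
  shows "lin_comb field_ring G (\<lambda>u. \<gamma> (fst u) (snd u)) r = \<zero>\<^bsub>G\<^esub>"
proof -
  let ?lc = "lin_comb field_ring G (\<lambda>u. \<gamma> (fst u) (snd u))"
  note be = lin_comb_basis_elem [OF G] and add = lin_comb_monoid_algebra_add [OF G bilinear_Pi [OF \<gamma>]]
    and sm = lin_comb_monoid_algebra_smult [OF G bilinear_Pi [OF \<gamma>]]
  note diff = lin_comb_diff_eq_zero [OF monoid_pair G bilinear_Pi [OF \<gamma>]]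
  have bs: "?lc (basis_elem (a, b)) = \<gamma> a b" if "a \<in> carrier A" "b \<in> carrier B" for a b
    using \<gamma> that by (subst be) (auto simp: bilinear_map_def)
  have sum: "?lc (\<lambda>m. basis_elem (a, b) m + basis_elem (a', b') m) = \<gamma> a b \<oplus>\<^bsub>G\<^esub> \<gamma> a' b'"
    if "a \<in> carrier A" "b \<in> carrier B" "a' \<in> carrier A" "b' \<in> carrier B" for a b a' b'
    using add [of "basis_elem (a, b)" "basis_elem (a', b')"] bs that by simp
  have scal: "?lc (\<lambda>m. c * basis_elem (a, b) m) = c \<odot>\<^bsub>G\<^esub> \<gamma> a b"
    if "a \<in> carrier A" "b \<in> carrier B" for c a b
    using sm [of "basis_elem (a, b)"] bs that by simp
  have basis: "(basis_elem (a, b) :: 'a \<times> 'b \<Rightarrow> 'k) \<in> carrier FF"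
    if "a \<in> carrier A" "b \<in> carrier B" for a b
    using that by simp
  from r show ?thesis
    unfolding tensor_relations_def Let_def
  proof (elim UnE CollectE exE conjE)
    fix a a' b assume l: "a \<in> carrier A" "a' \<in> carrier A" "b \<in> carrier B"
      "r = basis_elem (a \<oplus>\<^bsub>A\<^esub> a', b) \<ominus>\<^bsub>FF\<^esub> (basis_elem (a, b) \<oplus>\<^bsub>FF\<^esub> basis_elem (a', b))"
    have "r = (\<lambda>m. basis_elem (a \<oplus>\<^bsub>A\<^esub> a', b) m - (basis_elem (a, b) m + basis_elem (a', b) m))"
      using l by (simp add: minus_monoid_algebra [OF monoid_pair])
    moreover have "\<gamma> (a \<oplus>\<^bsub>A\<^esub> a') b = \<gamma> a b \<oplus>\<^bsub>G\<^esub> \<gamma> a' b" using \<gamma> l by (simp add: bilinear_map_def)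
    ultimately show ?thesis
      using diff [of "basis_elem (a \<oplus>\<^bsub>A\<^esub> a', b)" "\<lambda>m. basis_elem (a, b) m + basis_elem (a', b) m"]
        bs sum basis l by simp
  next
    fix a b b' assume r: "a \<in> carrier A" "b \<in> carrier B" "b' \<in> carrier B"
      "r = basis_elem (a, b \<oplus>\<^bsub>B\<^esub> b') \<ominus>\<^bsub>FF\<^esub> (basis_elem (a, b) \<oplus>\<^bsub>FF\<^esub> basis_elem (a, b'))"
    have "r = (\<lambda>m. basis_elem (a, b \<oplus>\<^bsub>B\<^esub> b') m - (basis_elem (a, b) m + basis_elem (a, b') m))"
      using r by (simp add: minus_monoid_algebra [OF monoid_pair])
    moreover have "\<gamma> a (b \<oplus>\<^bsub>B\<^esub> b') = \<gamma> a b \<oplus>\<^bsub>G\<^esub> \<gamma> a b'" using \<gamma> r by (simp add: bilinear_map_def)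
    ultimately show ?thesis
      using diff [of "basis_elem (a, b \<oplus>\<^bsub>B\<^esub> b')" "\<lambda>m. basis_elem (a, b) m + basis_elem (a, b') m"]
        bs sum basis r by simp
  next
    fix c a b assume sl: "a \<in> carrier A" "b \<in> carrier B"
      "r = basis_elem (c \<odot>\<^bsub>A\<^esub> a, b) \<ominus>\<^bsub>FF\<^esub> c \<odot>\<^bsub>FF\<^esub> basis_elem (a, b)"
    have "r = (\<lambda>m. basis_elem (c \<odot>\<^bsub>A\<^esub> a, b) m - c * basis_elem (a, b) m)"
      using sl by (simp add: minus_monoid_algebra [OF monoid_pair])
    moreover have "\<gamma> (c \<odot>\<^bsub>A\<^esub> a) b = c \<odot>\<^bsub>G\<^esub> \<gamma> a b" using \<gamma> sl by (simp add: bilinear_map_def)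
    ultimately show ?thesis
      using diff [of "basis_elem (c \<odot>\<^bsub>A\<^esub> a, b)" "\<lambda>m. c * basis_elem (a, b) m"]
        bs scal basis sl by simp
  next
    fix c a b assume sr: "a \<in> carrier A" "b \<in> carrier B"
      "r = basis_elem (a, c \<odot>\<^bsub>B\<^esub> b) \<ominus>\<^bsub>FF\<^esub> c \<odot>\<^bsub>FF\<^esub> basis_elem (a, b)"
    have "r = (\<lambda>m. basis_elem (a, c \<odot>\<^bsub>B\<^esub> b) m - c * basis_elem (a, b) m)"
      using sr by (simp add: minus_monoid_algebra [OF monoid_pair])
    moreover have "\<gamma> a (c \<odot>\<^bsub>B\<^esub> b) = c \<odot>\<^bsub>G\<^esub> \<gamma> a b" using \<gamma> sr by (simp add: bilinear_map_def)
    ultimately show ?thesis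
      using diff [of "basis_elem (a, c \<odot>\<^bsub>B\<^esub> b)" "\<lambda>m. c * basis_elem (a, b) m"]
        bs scal basis sr by simp
  qed
qed

text \<open>Bilinearity by itself only controls the generators of the two-sided ideal. Since
  multiplication in both algebras is bilinear, translates of bilinear maps are bilinear, so the
  family of all bilinear maps into G is translation stable.\<close>

lemma tensor_ideal_bilinear:
  assumes G: "left_module field_ring G" and f: "f \<in> tensor_ideal A B" and \<beta>: "bilinear_map A B G \<beta>"
  shows "lin_comb field_ring G (\<lambda>u. \<beta> (fst u) (snd u)) f = \<zero>\<^bsub>G\<^esub>"
proof -
  let ?\<Gamma> = "{\<lambda>u. \<gamma> (fst u) (snd u) | \<gamma>. bilinear_map A B G \<gamma>}"
  have shift_l: "bilinear_map A B G (\<lambda>a' b'. \<gamma> (a \<otimes>\<^bsub>A\<^esub> a') (b \<otimes>\<^bsub>B\<^esub> b'))"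
    and shift_r: "bilinear_map A B G (\<lambda>a' b'. \<gamma> (a' \<otimes>\<^bsub>A\<^esub> a) (b' \<otimes>\<^bsub>B\<^esub> b))"
    if "bilinear_map A B G \<gamma>" "a \<in> carrier A" "b \<in> carrier B" for \<gamma> a b
    using that unfolding bilinear_map_def
    by (simp_all add: A.r_distr A.l_distr B.r_distr B.l_distr A.smult_mult_left A.smult_mult_right
      B.smult_mult_left B.smult_mult_right)
  show ?thesis
  proof (rule genideal_translation_kernel [OF monoid_pair G, where \<Gamma> = ?\<Gamma>])
    show "f \<in> Idl\<^bsub>FF\<^esub> (tensor_relations A B)" using f by (simp add: tensor_ideal_def)
    show "(\<lambda>u. \<beta> (fst u) (snd u)) \<in> ?\<Gamma>" using \<beta> by blast
    fix g assume "g \<in> ?\<Gamma>"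
    then obtain \<gamma> where g: "g = (\<lambda>u. \<gamma> (fst u) (snd u))" and \<gamma>: "bilinear_map A B G \<gamma>" by blast
    show "g \<in> carrier (A \<times>\<times> B) \<rightarrow> carrier G" unfolding g by (rule bilinear_Pi [OF \<gamma>])
    show "lin_comb field_ring G g f = \<zero>\<^bsub>G\<^esub>" if "f \<in> tensor_relations A B" for f
      unfolding g by (rule tensor_relation_bilinear [OF G that \<gamma>])
    fix u assume u: "u \<in> carrier (A \<times>\<times> B)"
    then have u': "fst u \<in> carrier A" "snd u \<in> carrier B" by auto
    show "(\<lambda>v. g (u \<otimes>\<^bsub>A \<times>\<times> B\<^esub> v)) \<in> ?\<Gamma>"
      unfolding g mult_pair fst_conv snd_conv
      by (rule CollectI, rule exI, rule conjI [OF _ shift_l [OF \<gamma> u']]) simp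
    show "(\<lambda>v. g (v \<otimes>\<^bsub>A \<times>\<times> B\<^esub> u)) \<in> ?\<Gamma>"
      unfolding g mult_pair fst_conv snd_conv
      by (rule CollectI, rule exI, rule conjI [OF _ shift_r [OF \<gamma> u']]) simp
  qed (rule tensor_relations_closed)
qed

context
  fixes G :: "('k, 'g) module" and \<beta>
  assumes G: "left_module field_ring G" and \<beta>: "bilinear_map A B G \<beta>"
begin

lemma tensor_lift_closed: "t \<in> carrier T \<Longrightarrow> tensor_lift G \<beta> t \<in> carrier G"
  unfolding tensor_lift_def tensor_algebra_def
  by (rule linear_lift_closed [OF monoid_pair G ideal_tensor bilinear_Pi [OF \<beta>] tensor_ideal_bilinear [OF G _ \<beta>]])

lemma tensor_lift_add:
  "s \<in> carrier T \<Longrightarrow> t \<in> carrier T \<Longrightarrow>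
    tensor_lift G \<beta> (s \<oplus>\<^bsub>T\<^esub> t) = tensor_lift G \<beta> s \<oplus>\<^bsub>G\<^esub> tensor_lift G \<beta> t"
  unfolding tensor_lift_def tensor_algebra_def
  by (rule linear_lift_add [OF monoid_pair G ideal_tensor bilinear_Pi [OF \<beta>] tensor_ideal_bilinear [OF G _ \<beta>]])

lemma tensor_lift_pt:
  assumes "a \<in> carrier A" "b \<in> carrier B"
  shows "tensor_lift G \<beta> (pt a b) = \<beta> a b"
proof -
  have ab: "(a, b) \<in> carrier (A \<times>\<times> B)" using assms by simp
  have "\<beta> a b \<in> carrier G" using \<beta> assms by (simp add: bilinear_map_def)
  then have "lin_comb field_ring G (\<lambda>u. \<beta> (fst u) (snd u)) (basis_elem (a, b)) = \<beta> a b"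
    using lin_comb_basis_elem [OF G, of "\<lambda>u. \<beta> (fst u) (snd u)" "(a, b)"] by simp
  moreover have "linear_lift G (\<lambda>u. \<beta> (fst u) (snd u)) (tensor_ideal A B +>\<^bsub>FF\<^esub> basis_elem (a, b)) =
      lin_comb field_ring G (\<lambda>u. \<beta> (fst u) (snd u)) (basis_elem (a, b))"
    by (rule linear_lift_coset [OF monoid_pair G ideal_tensor bilinear_Pi [OF \<beta>]
          tensor_ideal_bilinear [OF G _ \<beta>] basis_elem_closed [OF ab]])
  ultimately show ?thesis by (simp add: tensor_lift_def pure_tensor_def)
qed

end

end

section \<open>Enveloping algebras\<close>

lemma opposite_algebra_simps [simp]:
  "carrier (opposite_algebra A) = carrier A"
  "a \<otimes>\<^bsub>opposite_algebra A\<^esub> b = b \<otimes>\<^bsub>A\<^esub> a"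
  "\<one>\<^bsub>opposite_algebra A\<^esub> = \<one>\<^bsub>A\<^esub>"
  "\<zero>\<^bsub>opposite_algebra A\<^esub> = \<zero>\<^bsub>A\<^esub>"
  "a \<oplus>\<^bsub>opposite_algebra A\<^esub> b = a \<oplus>\<^bsub>A\<^esub> b"
  "c \<odot>\<^bsub>opposite_algebra A\<^esub> a = c \<odot>\<^bsub>A\<^esub> a"
  by (simp_all add: opposite_algebra_def)

lemma k_algebra_opposite:
  assumes "k_algebra A" shows "k_algebra (opposite_algebra A)"
proof -
  interpret A: k_algebra A by fact
  have "abelian_group (opposite_algebra A)"
  proof (rule abelian_groupI)
    fix x assume "x \<in> carrier (opposite_algebra A)"
    then show "\<exists>y\<in>carrier (opposite_algebra A).
        y \<oplus>\<^bsub>opposite_algebra A\<^esub> x = \<zero>\<^bsub>opposite_algebra A\<^esub>"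
      by (intro bexI [of _ "\<ominus>\<^bsub>A\<^esub> x"]) (simp_all add: A.l_neg)
  qed (simp_all add: A.a_ac)
  moreover have "Group.monoid (opposite_algebra A)"
    by (rule monoidI) (simp_all add: A.m_assoc)
  ultimately have "ring (opposite_algebra A)"
    by (rule ringI) (simp_all add: A.l_distr A.r_distr)
  then show ?thesis
    by (intro k_algebra.intro k_algebra_axioms.intro)
      (simp_all add: A.smult_l_distr A.smult_r_distr A.smult_assoc A.smult_mult_left A.smult_mult_right)
qed

section \<open>Comparison of free resolutions\<close>

lemma left_module_homI:
  assumes "\<And>u. u \<in> carrier M \<Longrightarrow> f u \<in> carrier N"
    and "\<And>u v. u \<in> carrier M \<Longrightarrow> v \<in> carrier M \<Longrightarrow> f (u \<oplus>\<^bsub>M\<^esub> v) = f u \<oplus>\<^bsub>N\<^esub> f v"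
    and "\<And>r u. r \<in> carrier R \<Longrightarrow> u \<in> carrier M \<Longrightarrow> f (r \<odot>\<^bsub>M\<^esub> u) = r \<odot>\<^bsub>N\<^esub> f u"
    and M: "left_module R M"
  shows "restrict f (carrier M) \<in> left_module_hom R M N"
proof -
  interpret M: left_module R M by fact
  show ?thesis using assms(1-3) by (simp add: left_module_hom_def)
qed

lemma
  assumes "f \<in> left_module_hom R M N"
  shows hom_closed: "u \<in> carrier M \<Longrightarrow> f u \<in> carrier N"
    and hom_add: "u \<in> carrier M \<Longrightarrow> v \<in> carrier M \<Longrightarrow> f (u \<oplus>\<^bsub>M\<^esub> v) = f u \<oplus>\<^bsub>N\<^esub> f v"
    and hom_smult: "r \<in> carrier R \<Longrightarrow> u \<in> carrier M \<Longrightarrow> f (r \<odot>\<^bsub>M\<^esub> u) = r \<odot>\<^bsub>N\<^esub> f u"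
  using assms unfolding left_module_hom_def by (auto dest: PiE_mem)

lemma hom_zero:
  assumes "left_module R M" "left_module R N" "f \<in> left_module_hom R M N"
  shows "f \<zero>\<^bsub>M\<^esub> = \<zero>\<^bsub>N\<^esub>"
proof -
  interpret M: left_module R M by fact
  interpret N: left_module R N by fact
  have "\<zero>\<^bsub>R\<^esub> \<in> carrier R" by (rule ring.ring_simprules(2) [OF M.ring_scalars])
  from hom_smult [OF assms(3) this M.M.zero_closed] show ?thesis
    using hom_closed [OF assms(3) M.M.zero_closed] by simp
qed

lemma hom_compose:
  assumes "left_module R L" "f \<in> left_module_hom R L M" "g \<in> left_module_hom R M N"
  shows "restrict (\<lambda>u. g (f u)) (carrier L) \<in> left_module_hom R L N"
  by (rule left_module_homI [OF _ _ _ assms(1)])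
    (simp_all add: hom_closed [OF assms(2)] hom_closed [OF assms(3)] hom_add [OF assms(2)]
      hom_add [OF assms(3)] hom_smult [OF assms(2)] hom_smult [OF assms(3)])

lemma hom_minus:
  assumes M: "left_module R M" and N: "left_module R N"
    and f: "f \<in> left_module_hom R M N" and g: "g \<in> left_module_hom R M N"
  shows "restrict (\<lambda>u. f u \<ominus>\<^bsub>N\<^esub> g u) (carrier M) \<in> left_module_hom R M N"
proof (rule left_module_homI [OF _ _ _ M])
  interpret N: left_module R N by fact
  show "f u \<ominus>\<^bsub>N\<^esub> g u \<in> carrier N" if "u \<in> carrier M" for u
    using that hom_closed [OF f] hom_closed [OF g] by simp
  show "f (u \<oplus>\<^bsub>M\<^esub> v) \<ominus>\<^bsub>N\<^esub> g (u \<oplus>\<^bsub>M\<^esub> v) = (f u \<ominus>\<^bsub>N\<^esub> g u) \<oplus>\<^bsub>N\<^esub> (f v \<ominus>\<^bsub>N\<^esub> g v)"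
    if "u \<in> carrier M" "v \<in> carrier M" for u v
    using that hom_closed [OF f] hom_closed [OF g]
    by (simp add: hom_add [OF f] hom_add [OF g] a_minus_def N.M.minus_add N.M.a_ac)
  show "f (r \<odot>\<^bsub>M\<^esub> u) \<ominus>\<^bsub>N\<^esub> g (r \<odot>\<^bsub>M\<^esub> u) = r \<odot>\<^bsub>N\<^esub> (f u \<ominus>\<^bsub>N\<^esub> g u)"
    if "r \<in> carrier R" "u \<in> carrier M" for r u
    using that hom_closed [OF f] hom_closed [OF g]
    by (simp add: hom_smult [OF f] hom_smult [OF g] a_minus_def N.smult_r_distr N.smult_minus_right)
qed

definition unit_vector :: "('r, 'x) ring_scheme \<Rightarrow> 'i \<Rightarrow> 'i \<Rightarrow> 'r" where
  "unit_vector R i = (\<lambda>j. if j = i then \<one>\<^bsub>R\<^esub> else \<zero>\<^bsub>R\<^esub>)"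

lemma unit_vector_closed:
  assumes "ring R" "i \<in> B"
  shows "unit_vector R i \<in> carrier (free_left_module R B)"
proof -
  have "finite {j. unit_vector R i j \<noteq> \<zero>\<^bsub>R\<^esub>}"
    by (rule finite_subset [of _ "{i}"]) (auto simp: unit_vector_def)
  then show ?thesis
    using ring.ring_simprules(2,6) [OF assms(1)] assms(2)
    by (auto simp: carrier_free_left_module unit_vector_def)
qed

lemma free_left_module_induct [consumes 2, case_names zero step]:
  assumes R: "ring R" and "p \<in> carrier (free_left_module R B)"
    and zero: "P (\<lambda>i. \<zero>\<^bsub>R\<^esub>)"
    and step: "\<And>r i q. r \<in> carrier R \<Longrightarrow> i \<in> B \<Longrightarrow> q \<in> carrier (free_left_module R B) \<Longrightarrow> P q \<Longrightarrow>
      P (\<lambda>j. r \<otimes>\<^bsub>R\<^esub> unit_vector R i j \<oplus>\<^bsub>R\<^esub> q j)"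
  shows "P p"
proof -
  interpret R: ring R by fact
  have "finite S \<Longrightarrow> \<forall>p. p \<in> carrier (free_left_module R B) \<and> {i. p i \<noteq> \<zero>\<^bsub>R\<^esub>} \<subseteq> S \<longrightarrow> P p" for S
  proof (induction S rule: finite_induct)
    case empty
    have "p = (\<lambda>i. \<zero>\<^bsub>R\<^esub>)" if "{i. p i \<noteq> \<zero>\<^bsub>R\<^esub>} \<subseteq> {}" for p :: "'c \<Rightarrow> 'a" using that by auto
    then show ?case using zero by blast
  next
    case (insert i S)
    show ?case
    proof (intro allI impI)
      fix p assume p: "p \<in> carrier (free_left_module R B) \<and> {i. p i \<noteq> \<zero>\<^bsub>R\<^esub>} \<subseteq> insert i S"
      show "P p"
      proof (cases "i \<in> B")
        case True
        let ?q = "p(i := \<zero>\<^bsub>R\<^esub>)"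
        have "finite {j. ?q j \<noteq> \<zero>\<^bsub>R\<^esub>}"
          by (rule finite_subset [of _ "{j. p j \<noteq> \<zero>\<^bsub>R\<^esub>}"]) (use p in \<open>auto simp: carrier_free_left_module\<close>)
        then have q: "?q \<in> carrier (free_left_module R B)"
          using p by (simp add: carrier_free_left_module)
        have "{j. ?q j \<noteq> \<zero>\<^bsub>R\<^esub>} \<subseteq> S" using p by auto
        then have "P ?q" using insert.IH [rule_format, of ?q] q by simp
        have pc: "p j \<in> carrier R" for j using p by (simp add: carrier_free_left_module)
        from step [OF pc True q \<open>P ?q\<close>]
        have "P (\<lambda>j. p i \<otimes>\<^bsub>R\<^esub> unit_vector R i j \<oplus>\<^bsub>R\<^esub> ?q j)" .
        moreover have "(\<lambda>j. p i \<otimes>\<^bsub>R\<^esub> unit_vector R i j \<oplus>\<^bsub>R\<^esub> ?q j) = p"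
          by (rule ext) (simp add: unit_vector_def pc)
        ultimately show ?thesis by simp
      next
        case False
        then have "{j. p j \<noteq> \<zero>\<^bsub>R\<^esub>} \<subseteq> S" using p by (auto simp: carrier_free_left_module)
        then show ?thesis using insert.IH [rule_format, of p] p by simp
      qed
    qed
  qed
  then show ?thesis using assms(2) by (auto simp: carrier_free_left_module)
qed

lemma free_hom_eqI:
  assumes N: "left_module R N"
    and f: "f \<in> left_module_hom R (free_left_module R B) N"
    and g: "g \<in> left_module_hom R (free_left_module R B) N"
    and eq: "\<And>i. i \<in> B \<Longrightarrow> f (unit_vector R i) = g (unit_vector R i)"
    and p: "p \<in> carrier (free_left_module R B)"
  shows "f p = g p"
proof -
  have R: "ring R" by (rule left_module.ring_scalars [OF N])
  note F = left_module_free [OF R, of B]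
  from R p show ?thesis
  proof (induction p rule: free_left_module_induct)
    case zero
    show ?case using hom_zero [OF F N f] hom_zero [OF F N g] by simp
  next
    case (step r i q)
    have e: "unit_vector R i \<in> carrier (free_left_module R B)"
      by (rule unit_vector_closed [OF R step(2)])
    have re: "r \<odot>\<^bsub>free_left_module R B\<^esub> unit_vector R i \<in> carrier (free_left_module R B)"
      by (rule left_module.smult_closed [OF F step(1) e])
    have "h (\<lambda>j. r \<otimes>\<^bsub>R\<^esub> unit_vector R i j \<oplus>\<^bsub>R\<^esub> q j) = r \<odot>\<^bsub>N\<^esub> h (unit_vector R i) \<oplus>\<^bsub>N\<^esub> h q"
      if h: "h \<in> left_module_hom R (free_left_module R B) N" for h
      using hom_add [OF h re step(3)] hom_smult [OF h step(1) e] by simp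
    from this [OF f] this [OF g] show ?case using eq step by simp
  qed
qed

text \<open>Projectivity of free modules: preimages under \<open>\<pi>\<close> are chosen for the
  basis vectors and extended linearly.\<close>

lemma free_hom_lift:
  assumes M: "left_module R M" and N: "left_module R N"
    and f: "f \<in> left_module_hom R (free_left_module R B) N" and \<pi>: "\<pi> \<in> left_module_hom R M N"
    and im: "\<And>p. p \<in> carrier (free_left_module R B) \<Longrightarrow> f p \<in> \<pi> ` carrier M"
  shows "\<exists>g \<in> left_module_hom R (free_left_module R B) M.
    \<forall>p \<in> carrier (free_left_module R B). \<pi> (g p) = f p"
proof -
  interpret M: left_module R M by fact
  have R: "ring R" by (rule M.ring_scalars)
  have "\<forall>i. \<exists>m. i \<in> B \<longrightarrow> m \<in> carrier M \<and> \<pi> m = f (unit_vector R i)"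
    using im [OF unit_vector_closed [OF R]] by (metis imageE)
  then obtain m where m: "\<And>i. i \<in> B \<Longrightarrow> m i \<in> carrier M"
      "\<And>i. i \<in> B \<Longrightarrow> \<pi> (m i) = f (unit_vector R i)"
    by metis
  let ?g = "restrict (lin_comb R M m) (carrier (free_left_module R B))"
  have g: "?g \<in> left_module_hom R (free_left_module R B) M"
    by (rule M.lin_comb_hom) (use m in blast)
  note F = left_module_free [OF R, of B]
  have ge: "?g (unit_vector R i) = m i" if "i \<in> B" for i
    using M.lin_comb_single [where g = m and i = i, OF ring.ring_simprules(6) [OF R]] m that
      unit_vector_closed [OF R that] by (simp add: unit_vector_def)
  have "\<pi> (?g p) = f p" if p: "p \<in> carrier (free_left_module R B)" for p
  proof -
    have "restrict (\<lambda>u. \<pi> (?g u)) (carrier (free_left_module R B)) p = f p"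
    proof (rule free_hom_eqI [OF N hom_compose [OF F g \<pi>] f _ p])
      fix i assume i: "i \<in> B"
      show "restrict (\<lambda>u. \<pi> (?g u)) (carrier (free_left_module R B)) (unit_vector R i) = f (unit_vector R i)"
        using unit_vector_closed [OF R i] ge [OF i] m(2) [OF i] by (simp only: restrict_apply if_True)
    qed
    then show ?thesis using p by (simp only: restrict_apply if_True)
  qed
  with g show ?thesis by blast
qed

lemma free_resolutionD:
  assumes "free_resolution R M B d \<epsilon>"
  shows "\<epsilon> \<in> left_module_hom R (free_left_module R (B 0)) M"
    and "d n \<in> left_module_hom R (free_left_module R (B (Suc n))) (free_left_module R (B n))"
    and "\<epsilon> ` carrier (free_left_module R (B 0)) = carrier M"
    and "{p \<in> carrier (free_left_module R (B 0)). \<epsilon> p = \<zero>\<^bsub>M\<^esub>} =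
       d 0 ` carrier (free_left_module R (B (Suc 0)))"
    and "{p \<in> carrier (free_left_module R (B (Suc n))). d n p = \<zero>\<^bsub>free_left_module R (B n)\<^esub>} =
       d (Suc n) ` carrier (free_left_module R (B (Suc (Suc n))))"
  using assms unfolding free_resolution_def by blast+

lemma free_resolution_augmentation_d:
  assumes "free_resolution R M B d \<epsilon>" "p \<in> carrier (free_left_module R (B (Suc 0)))"
  shows "\<epsilon> (d 0 p) = \<zero>\<^bsub>M\<^esub>"
  using free_resolutionD(4) [OF assms(1)] assms(2) by blast

lemma free_resolution_d_d:
  assumes "free_resolution R M B d \<epsilon>" "p \<in> carrier (free_left_module R (B (Suc (Suc n))))"
  shows "d n (d (Suc n) p) = \<zero>\<^bsub>free_left_module R (B n)\<^esub>"
  using free_resolutionD(5) [OF assms(1), of n] assms(2) by blast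

lemma free_resolution_exact:
  assumes "free_resolution R M B d \<epsilon>" "p \<in> carrier (free_left_module R (B (Suc n)))"
    "d n p = \<zero>\<^bsub>free_left_module R (B n)\<^esub>"
  shows "p \<in> d (Suc n) ` carrier (free_left_module R (B (Suc (Suc n))))"
  using free_resolutionD(5) [OF assms(1), of n] assms(2,3) by blast

lemma chain_map_exists:
  assumes M: "left_module R M"
    and res: "free_resolution R M B d \<epsilon>" and res': "free_resolution R M B' d' \<epsilon>'"
  shows "\<exists>F. (\<forall>n. F n \<in> left_module_hom R (free_left_module R (B n)) (free_left_module R (B' n))) \<and>
    (\<forall>p \<in> carrier (free_left_module R (B 0)). \<epsilon>' (F 0 p) = \<epsilon> p) \<and>
    (\<forall>n. \<forall>p \<in> carrier (free_left_module R (B (Suc n))). d' n (F (Suc n) p) = F n (d n p))"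
proof -
  have R: "ring R" by (rule left_module.ring_scalars [OF M])
  let ?P = "\<lambda>n. free_left_module R (B n)" and ?P' = "\<lambda>n. free_left_module R (B' n)"
  note D = free_resolutionD [OF res] and D' = free_resolutionD [OF res']
  note lm = left_module_free [OF R]
  \<comment> \<open>The invariant asks that F d lands in the image of d', which is exactly what the
    lifting in the next degree needs. Compatibility with the augmentations concerns degree 0 only
    and is carried along as an implication.\<close>
  let ?I = "\<lambda>n F. F \<in> left_module_hom R (?P n) (?P' n) \<and>
    (\<forall>p \<in> carrier (?P (Suc n)). F (d n p) \<in> d' n ` carrier (?P' (Suc n))) \<and>
    (n = 0 \<longrightarrow> (\<forall>p \<in> carrier (?P 0). \<epsilon>' (F p) = \<epsilon> p))"
  let ?Q = "\<lambda>n F G. \<forall>p \<in> carrier (?P (Suc n)). d' n (G p) = F (d n p)"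
  have base: "\<exists>F. ?I 0 F"
  proof -
    have "\<epsilon> p \<in> \<epsilon>' ` carrier (?P' 0)" if "p \<in> carrier (?P 0)" for p
      using hom_closed [OF D(1) that] D'(3) by simp
    then obtain F where F: "F \<in> left_module_hom R (?P 0) (?P' 0)"
      "\<forall>p \<in> carrier (?P 0). \<epsilon>' (F p) = \<epsilon> p"
      using free_hom_lift [OF lm M D(1) D'(1)] by blast
    have "F (d 0 p) \<in> d' 0 ` carrier (?P' (Suc 0))" if p: "p \<in> carrier (?P (Suc 0))" for p
    proof -
      have dp: "d 0 p \<in> carrier (?P 0)" by (rule hom_closed [OF D(2) p])
      have "\<epsilon>' (F (d 0 p)) = \<zero>\<^bsub>M\<^esub>" using F(2) dp free_resolution_augmentation_d [OF res p] by simp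
      then show ?thesis using D'(4) hom_closed [OF F(1) dp] by blast
    qed
    with F show ?thesis by blast
  qed
  have step: "\<exists>G. ?I (Suc n) G \<and> ?Q n F G" if F: "?I n F" for F n
  proof -
    have Fh: "F \<in> left_module_hom R (?P n) (?P' n)" using F by blast
    have "\<exists>G \<in> left_module_hom R (?P (Suc n)) (?P' (Suc n)).
        \<forall>p \<in> carrier (?P (Suc n)). d' n (G p) = restrict (\<lambda>p. F (d n p)) (carrier (?P (Suc n))) p"
      by (rule free_hom_lift [OF lm lm hom_compose [OF lm D(2) Fh] D'(2)]) (use F in simp)
    then obtain G where G: "G \<in> left_module_hom R (?P (Suc n)) (?P' (Suc n))"
      "\<And>p. p \<in> carrier (?P (Suc n)) \<Longrightarrow> d' n (G p) = F (d n p)"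
      by auto
    have "G (d (Suc n) p) \<in> d' (Suc n) ` carrier (?P' (Suc (Suc n)))"
      if p: "p \<in> carrier (?P (Suc (Suc n)))" for p
    proof (rule free_resolution_exact [OF res'])
      have dp: "d (Suc n) p \<in> carrier (?P (Suc n))" by (rule hom_closed [OF D(2) p])
      show "G (d (Suc n) p) \<in> carrier (?P' (Suc n))" by (rule hom_closed [OF G(1) dp])
      show "d' n (G (d (Suc n) p)) = \<zero>\<^bsub>?P' n\<^esub>"
        unfolding G(2) [OF dp] free_resolution_d_d [OF res p] by (rule hom_zero [OF lm lm Fh])
    qed
    with G show ?thesis by blast
  qed
  from dependent_nat_choice [of ?I ?Q, OF base step] show ?thesis by blast
qed

text \<open>K is meant to be the difference of two chain maps with the same augmentation. The
  homotopy identity is recorded in positive degrees, where cohomology is compared later.\<close>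

lemma null_homotopy_exists:
  assumes M: "left_module R M" and res: "free_resolution R M B d \<epsilon>"
    and K: "\<And>n. K n \<in> left_module_hom R (free_left_module R (B n)) (free_left_module R (B n))"
    and K0: "\<And>p. p \<in> carrier (free_left_module R (B 0)) \<Longrightarrow> \<epsilon> (K 0 p) = \<zero>\<^bsub>M\<^esub>"
    and Kd: "\<And>n p. p \<in> carrier (free_left_module R (B (Suc n))) \<Longrightarrow> d n (K (Suc n) p) = K n (d n p)"
  shows "\<exists>h. (\<forall>n. h n \<in> left_module_hom R (free_left_module R (B n)) (free_left_module R (B (Suc n)))) \<and>
    (\<forall>n. \<forall>p \<in> carrier (free_left_module R (B (Suc n))). d (Suc n) (h (Suc n) p) =
        K (Suc n) p \<ominus>\<^bsub>free_left_module R (B (Suc n))\<^esub> h n (d n p))"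
proof -
  have R: "ring R" by (rule left_module.ring_scalars [OF M])
  let ?P = "\<lambda>n. free_left_module R (B n)"
  note D = free_resolutionD [OF res]
  note lm = left_module_free [OF R]
  have minus: "f (u \<ominus>\<^bsub>?P m\<^esub> v) = f u \<ominus>\<^bsub>?P n\<^esub> f v"
    if "f \<in> left_module_hom R (?P m) (?P n)" "u \<in> carrier (?P m)" "v \<in> carrier (?P m)" for f m n u v
  proof -
    interpret L: left_module R "?P m" by (rule lm)
    interpret N: left_module R "?P n" by (rule lm)
    have "f u = f (u \<ominus>\<^bsub>?P m\<^esub> v) \<oplus>\<^bsub>?P n\<^esub> f v"
      using hom_add [OF that(1), of "u \<ominus>\<^bsub>?P m\<^esub> v" v] that(2,3)
      by (simp add: L.M.minus_eq L.M.a_assoc L.M.l_neg del: free_left_module_simps)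
    then show ?thesis
      using hom_closed [OF that(1)] that(2,3)
      by (simp add: N.M.minus_eq N.M.a_assoc N.M.r_neg del: free_left_module_simps)
  qed
  have cancel: "u \<ominus>\<^bsub>?P m\<^esub> u = \<zero>\<^bsub>?P m\<^esub>" "u \<ominus>\<^bsub>?P m\<^esub> \<zero>\<^bsub>?P m\<^esub> = u"
    if "u \<in> carrier (?P m)" for u m
  proof -
    interpret L: left_module R "?P m" by (rule lm)
    show "u \<ominus>\<^bsub>?P m\<^esub> u = \<zero>\<^bsub>?P m\<^esub>" "u \<ominus>\<^bsub>?P m\<^esub> \<zero>\<^bsub>?P m\<^esub> = u"
      using that by (simp_all add: L.M.minus_eq L.M.r_neg del: free_left_module_simps)
  qed
  \<comment> \<open>The part of K that the homotopy built so far does not account for. It takes its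
    values in the cycles, hence lifts along the next differential.\<close>
  let ?E = "\<lambda>n h. restrict (\<lambda>p. K (Suc n) p \<ominus>\<^bsub>?P (Suc n)\<^esub> h (d n p)) (carrier (?P (Suc n)))"
  let ?I = "\<lambda>n h. h \<in> left_module_hom R (?P n) (?P (Suc n)) \<and>
    (\<forall>p \<in> carrier (?P (Suc n)). ?E n h p \<in> d (Suc n) ` carrier (?P (Suc (Suc n))))"
  let ?Q = "\<lambda>n h h'. \<forall>p \<in> carrier (?P (Suc n)). d (Suc n) (h' p) = ?E n h p"
  have E_hom: "?E n h \<in> left_module_hom R (?P (Suc n)) (?P (Suc n))"
    if h: "h \<in> left_module_hom R (?P n) (?P (Suc n))" for n h
  proof -
    have "restrict (\<lambda>p. K (Suc n) p \<ominus>\<^bsub>?P (Suc n)\<^esub> restrict (\<lambda>p. h (d n p)) (carrier (?P (Suc n))) p)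
        (carrier (?P (Suc n))) \<in> left_module_hom R (?P (Suc n)) (?P (Suc n))"
      by (rule hom_minus [OF lm lm K hom_compose [OF lm D(2) h]])
    then show ?thesis by (simp cong: restrict_cong)
  qed
  have E_im: "?I n h" if h: "h \<in> left_module_hom R (?P n) (?P (Suc n))"
    and *: "\<And>q. q \<in> carrier (?P (Suc n)) \<Longrightarrow> d n (h (d n q)) = K n (d n q)" for n h
  proof (intro conjI ballI h)
    fix p assume p: "p \<in> carrier (?P (Suc n))"
    have hd: "h (d n p) \<in> carrier (?P (Suc n))" by (rule hom_closed [OF h hom_closed [OF D(2) p]])
    have "d n (?E n h p) = d n (K (Suc n) p) \<ominus>\<^bsub>?P n\<^esub> d n (h (d n p))"
      using minus [OF D(2) hom_closed [OF K p] hd] p by simp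
    also have "\<dots> = \<zero>\<^bsub>?P n\<^esub>"
      unfolding * [OF p] Kd [OF p] by (rule cancel(1) [OF hom_closed [OF K hom_closed [OF D(2) p]]])
    finally show "?E n h p \<in> d (Suc n) ` carrier (?P (Suc (Suc n)))"
      by (rule free_resolution_exact [OF res hom_closed [OF E_hom [OF h] p]])
  qed
  have base: "\<exists>h. ?I 0 h"
  proof -
    have "K 0 p \<in> d 0 ` carrier (?P (Suc 0))" if "p \<in> carrier (?P 0)" for p
      using D(4) K0 [OF that] hom_closed [OF K that] by blast
    then obtain h where h: "h \<in> left_module_hom R (?P 0) (?P (Suc 0))"
      "\<forall>p \<in> carrier (?P 0). d 0 (h p) = K 0 p"
      using free_hom_lift [OF lm lm K D(2)] by blast
    have "?I 0 h" by (rule E_im [OF h(1)]) (use h(2) hom_closed [OF D(2)] in simp)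
    then show ?thesis by blast
  qed
  have step: "\<exists>h'. ?I (Suc n) h' \<and> ?Q n h h'" if h: "?I n h" for h n
  proof -
    have hh: "h \<in> left_module_hom R (?P n) (?P (Suc n))" using h by blast
    obtain h' where h': "h' \<in> left_module_hom R (?P (Suc n)) (?P (Suc (Suc n)))"
      "\<forall>p \<in> carrier (?P (Suc n)). d (Suc n) (h' p) = ?E n h p"
      using free_hom_lift [OF lm lm E_hom [OF hh] D(2)] h by blast
    have "?I (Suc n) h'"
    proof (rule E_im [OF h'(1)])
      fix q assume q: "q \<in> carrier (?P (Suc (Suc n)))"
      have dq: "d (Suc n) q \<in> carrier (?P (Suc n))" by (rule hom_closed [OF D(2) q])
      have "d (Suc n) (h' (d (Suc n) q)) = K (Suc n) (d (Suc n) q) \<ominus>\<^bsub>?P (Suc n)\<^esub> h (d n (d (Suc n) q))"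
        using h'(2) dq by simp
      then show "d (Suc n) (h' (d (Suc n) q)) = K (Suc n) (d (Suc n) q)"
        unfolding free_resolution_d_d [OF res q] hom_zero [OF lm lm hh]
        using cancel(2) [OF hom_closed [OF K dq]] by simp
    qed
    with h'(2) show ?thesis by blast
  qed
  obtain h where h: "\<And>n. ?I n (h n) \<and> ?Q n (h n) (h (Suc n))"
    using dependent_nat_choice [of ?I ?Q, OF base step] by blast
  have "d (Suc n) (h (Suc n) p) = K (Suc n) p \<ominus>\<^bsub>?P (Suc n)\<^esub> h n (d n p)"
    if "p \<in> carrier (?P (Suc n))" for n p
    using h [of n] that by simp
  with h show ?thesis by blast
qed

section \<open>A faithful representation\<close>

lemma poly_map_poly_add:
  fixes h :: "'a::comm_semiring_0 \<Rightarrow> 'b::comm_semiring_1"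
  assumes "h 0 = 0" "\<And>a b. h (a + b) = h a + h b"
  shows "poly (map_poly h (p + q)) c = poly (map_poly h p) c + poly (map_poly h q) c"
  by (induction p q rule: poly_induct2) (simp_all add: map_poly_pCons assms algebra_simps)

lemma poly_map_poly_mult:
  fixes h :: "'a::comm_semiring_0 \<Rightarrow> 'b::comm_semiring_1"
  assumes "h 0 = 0" "\<And>a b. h (a + b) = h a + h b" "\<And>a b. h (a * b) = h a * h b"
  shows "poly (map_poly h (p * q)) c = poly (map_poly h p) c * poly (map_poly h q) c"
  by (induction p)
    (simp_all add: map_poly_pCons map_poly_smult assms poly_map_poly_add algebra_simps)

text \<open>k[u, v] is modelled as polynomials in v with coefficients in k[u]: \<open>const2\<close>
  embeds k, \<open>U2\<close> is the variable u of the coefficients and \<open>V2\<close> is the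
  outer variable v.\<close>

definition const2 :: "'k::field \<Rightarrow> 'k poly poly" where
  "const2 c = [:[:c:]:]"

definition U2 :: "'k::field poly poly" where
  "U2 = [:[:0, 1:]:]"

definition V2 :: "'k::field poly poly" where
  "V2 = [:0, 1:]"

lemma const2_simps [simp]:
  "const2 0 = 0" "const2 1 = 1" "const2 (c + d) = const2 c + const2 d"
  "const2 (c * d) = const2 c * const2 d"
  by (simp_all add: const2_def one_pCons)

lemma U2_mult: "U2 * r = smult [:0, 1:] r"
  by (simp add: U2_def)

lemma V2_mult: "V2 * r = pCons 0 r"
  by (simp add: V2_def)

lemma pCons_eq_V2: "pCons s r = [:s:] + V2 * r"
  by (simp add: V2_mult)

lemma const_pCons_eq_U2: "[:pCons c s:] = const2 c + U2 * [:s:]"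
  by (simp add: U2_def const2_def)

text \<open>Products with \<open>U2\<close> and \<open>V2\<close> are to stay symbolic, so that
  identities follow from the ring laws instead of from comparing coefficients.\<close>

lemmas [simp del] = mult_pCons_left mult_pCons_right

text \<open>Horner's scheme for v, with Horner's scheme for u in the coefficients.\<close>

lemma bivariate_induct [case_names zero U V]:
  assumes "P 0"
    and U: "\<And>c s. P [:s:] \<Longrightarrow> P (const2 c + U2 * [:s:])"
    and V: "\<And>s r. P [:s:] \<Longrightarrow> P r \<Longrightarrow> P ([:s:] + V2 * r)"
  shows "P r"
proof -
  have const: "P [:s:]" for s
  proof (induction s)
    case (pCons c s)
    show ?case unfolding const_pCons_eq_U2 by (rule U [OF pCons.IH])
  qed (simp add: assms(1))
  show ?thesis
  proof (induction r)
    case (pCons s r)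
    show ?case unfolding pCons_eq_V2 [of s r] by (rule V [OF const pCons.IH])
  qed (rule assms(1))
qed

definition bivariate_subst :: "'k::field poly poly \<Rightarrow> 'k poly poly \<Rightarrow> 'k poly poly \<Rightarrow> 'k poly poly" where
  "bivariate_subst a b r = poly (map_poly (\<lambda>s. poly (map_poly const2 s) a) r) b"

lemma bivariate_subst_simps [simp]:
  "bivariate_subst a b (r + s) = bivariate_subst a b r + bivariate_subst a b s"
  "bivariate_subst a b (r * s) = bivariate_subst a b r * bivariate_subst a b s"
  "bivariate_subst a b (const2 c) = const2 c"
  "bivariate_subst a b U2 = a"
  "bivariate_subst a b V2 = b"
  "bivariate_subst a b 0 = 0"
  "bivariate_subst a b 1 = 1"
proof -
  note inner = poly_map_poly_add [of const2] poly_map_poly_mult [of const2]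
  show "bivariate_subst a b (r + s) = bivariate_subst a b r + bivariate_subst a b s"
    "bivariate_subst a b (r * s) = bivariate_subst a b r * bivariate_subst a b s"
    unfolding bivariate_subst_def
    by (rule poly_map_poly_add poly_map_poly_mult; simp add: inner)+
  show c: "bivariate_subst a b (const2 c) = const2 c" for c
    by (simp add: bivariate_subst_def const2_def map_poly_pCons)
  show "bivariate_subst a b U2 = a" "bivariate_subst a b V2 = b" "bivariate_subst a b 0 = 0"
    by (simp_all add: bivariate_subst_def U2_def V2_def map_poly_pCons)
  show "bivariate_subst a b 1 = 1" using c [of 1] by simp
qed

lemma bivariate_subst_subst:
  assumes "bivariate_subst a b c = U2" "bivariate_subst a b d = V2"
  shows "bivariate_subst a b (bivariate_subst c d r) = r"
  by (induction r rule: bivariate_induct) (simp_all add: assms)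

text \<open>A bound on the total degree in u and v. The recursive form makes its stability under
  linear substitutions and under division by a variable provable by induction, without formulas for
  coefficients.\<close>

primrec deg_le :: "nat \<Rightarrow> 'k::field poly poly \<Rightarrow> bool" where
  "deg_le 0 r \<longleftrightarrow> (\<exists>c. r = const2 c)"
| "deg_le (Suc d) r \<longleftrightarrow> (\<exists>c r1 r2. r = const2 c + U2 * r1 + V2 * r2 \<and> deg_le d r1 \<and> deg_le d r2)"

lemma deg_le_const2 [simp]: "deg_le d (const2 c)"
proof (induction d arbitrary: c)
  case (Suc d)
  have "const2 c = const2 c + U2 * const2 0 + V2 * const2 0" by simp
  then show ?case using Suc deg_le.simps(2) by blast
qed auto

lemma deg_le_zero [simp]: "deg_le d 0"
  using deg_le_const2 [of d 0] by simp

lemma deg_le_add: "deg_le d r \<Longrightarrow> deg_le d s \<Longrightarrow> deg_le d (r + s)"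
proof (induction d arbitrary: r s)
  case 0
  then obtain c c' where "r = const2 c" "s = const2 c'" by auto
  then have "r + s = const2 (c + c')" by simp
  then show ?case by (simp only: deg_le_const2)
next
  case (Suc d)
  obtain c r1 r2 c' s1 s2 where *: "r = const2 c + U2 * r1 + V2 * r2" "deg_le d r1" "deg_le d r2"
    "s = const2 c' + U2 * s1 + V2 * s2" "deg_le d s1" "deg_le d s2"
    using Suc.prems by auto
  have "r + s = const2 (c + c') + U2 * (r1 + s1) + V2 * (r2 + s2)"
    using * by (simp add: algebra_simps)
  moreover have "deg_le d (r1 + s1)" "deg_le d (r2 + s2)" using Suc.IH * by blast+
  ultimately show ?case unfolding deg_le.simps by blast
qed

lemma deg_le_const2_mult: "deg_le d r \<Longrightarrow> deg_le d (const2 c * r)"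
proof (induction d arbitrary: r)
  case 0
  then obtain e where "r = const2 e" by auto
  then have "const2 c * r = const2 (c * e)" by simp
  then show ?case by (simp only: deg_le_const2)
next
  case (Suc d)
  obtain e r1 r2 where *: "r = const2 e + U2 * r1 + V2 * r2" "deg_le d r1" "deg_le d r2"
    using Suc.prems by auto
  have "const2 c * r = const2 (c * e) + U2 * (const2 c * r1) + V2 * (const2 c * r2)"
    using * by (simp add: algebra_simps)
  moreover have "deg_le d (const2 c * r1)" "deg_le d (const2 c * r2)" using Suc.IH * by blast+
  ultimately show ?case unfolding deg_le.simps by blast
qed

lemma deg_le_U2: "deg_le d r \<Longrightarrow> deg_le (Suc d) (U2 * r)"
  unfolding deg_le.simps by (rule exI [of _ 0], rule exI [of _ r], rule exI [of _ 0]) simp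

lemma deg_le_V2: "deg_le d r \<Longrightarrow> deg_le (Suc d) (V2 * r)"
  unfolding deg_le.simps by (rule exI [of _ 0], rule exI [of _ 0], rule exI [of _ r]) simp

lemma deg_le_Suc: "deg_le d r \<Longrightarrow> deg_le (Suc d) r"
proof (induction d arbitrary: r)
  case 0
  then obtain c where "r = const2 c" by auto
  then show ?case by (simp only: deg_le_const2)
next
  case (Suc d)
  obtain c r1 r2 where *: "r = const2 c + U2 * r1 + V2 * r2" "deg_le d r1" "deg_le d r2"
    using Suc.prems by auto
  then show ?case using Suc.IH unfolding deg_le.simps(2) [of "Suc d"] by blast
qed

lemma deg_le_mono: "d \<le> e \<Longrightarrow> deg_le d r \<Longrightarrow> deg_le e r"
  by (induction e rule: dec_induct) (auto intro: deg_le_Suc simp del: deg_le.simps)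

lemma deg_le_exists: "\<exists>d. deg_le d r"
proof (induction r rule: bivariate_induct)
  case (U c s)
  then obtain d where "deg_le d [:s:]" by blast
  then show ?case using deg_le_add [OF deg_le_const2 deg_le_U2] by blast
next
  case (V s r)
  then obtain d e where "deg_le d [:s:]" "deg_le e r" by blast
  from \<open>deg_le d [:s:]\<close> have "deg_le (Suc (max d e)) [:s:]" by (rule deg_le_mono [rotated]) simp
  moreover from \<open>deg_le e r\<close> have "deg_le (Suc (max d e)) (V2 * r)"
    by (rule deg_le_V2 [OF deg_le_mono [OF max.cobounded2]])
  ultimately show ?case using deg_le_add by blast
qed (auto intro: deg_le_zero)

lemma deg_le_subst:
  assumes a: "\<exists>c d. a = const2 c * U2 + const2 d * V2" and b: "\<exists>c d. b = const2 c * U2 + const2 d * V2"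
  shows "deg_le n r \<Longrightarrow> deg_le n (bivariate_subst a b r)"
proof (induction n arbitrary: r)
  case (Suc n)
  obtain c r1 r2 where *: "r = const2 c + U2 * r1 + V2 * r2" "deg_le n r1" "deg_le n r2"
    using Suc.prems by auto
  \<comment> \<open>A product with a linear form is regrouped as u times one factor plus v times
    another, each still bounded by n.\<close>
  have lin: "deg_le (Suc n) (l * s)" if "\<exists>c d. l = const2 c * U2 + const2 d * V2" "deg_le n s" for l s
  proof -
    from that(1) obtain c d where l: "l = const2 c * U2 + const2 d * V2" by blast
    have "l * s = U2 * (const2 c * s) + V2 * (const2 d * s)" by (simp add: l algebra_simps)
    then show ?thesis
      using deg_le_add [OF deg_le_U2 deg_le_V2] deg_le_const2_mult that(2) by metis
  qed
  show ?case
    unfolding *(1) bivariate_subst_simps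
    by (intro deg_le_add deg_le_const2 lin a b Suc.IH *)
qed auto

text \<open>The quotient of r - r(u, 0) by v. The operation after it takes the part r(u, 0) without
  v and divides it by u, dropping its constant term.\<close>

definition V_quotient :: "'k::field poly poly \<Rightarrow> 'k poly poly" where
  "V_quotient r = poly_shift 1 r"

definition U_quotient_const :: "'k::field poly poly \<Rightarrow> 'k poly poly" where
  "U_quotient_const r = [:poly_shift 1 (coeff r 0):]"

lemma poly_shift_1_pCons [simp]: "poly_shift (Suc 0) (pCons c p) = p"
  by (rule poly_eqI) (simp add: coeff_poly_shift)

lemma quotient_simps [simp]:
  "V_quotient (r + s) = V_quotient r + V_quotient s" "V_quotient (const2 c) = 0"
  "V_quotient (V2 * r) = r" "V_quotient (U2 * r) = U2 * V_quotient r" "V_quotient 0 = 0"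
  "V_quotient (const2 c * r) = const2 c * V_quotient r" "V_quotient [:t:] = 0"
  "U_quotient_const (r + s) = U_quotient_const r + U_quotient_const s" "U_quotient_const (const2 c) = 0"
  "U_quotient_const (V2 * r) = 0" "U_quotient_const (U2 * r) = [:coeff r 0:]" "U_quotient_const 0 = 0"
  "U_quotient_const (const2 c * r) = const2 c * U_quotient_const r"
  by (auto simp: V_quotient_def U_quotient_const_def const2_def V2_mult U2_mult poly_eq_iff coeff_poly_shift
      coeff_pCons mult_pCons_left split: nat.splits)

lemma V_decompose: "r = [:coeff r 0:] + V2 * V_quotient r"
  by (auto simp: V2_mult V_quotient_def poly_eq_iff coeff_poly_shift coeff_pCons split: nat.splits)

lemma deg_le_V_quotient: "deg_le (Suc d) r \<Longrightarrow> deg_le d (V_quotient r)"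
proof (induction d arbitrary: r)
  case 0
  then show ?case by auto
next
  case (Suc d)
  obtain c r1 r2 where *: "r = const2 c + U2 * r1 + V2 * r2" "deg_le (Suc d) r1" "deg_le (Suc d) r2"
    using Suc.prems unfolding deg_le.simps(2) [of "Suc d"] by blast
  have "V_quotient r = U2 * V_quotient r1 + r2" by (simp add: *(1))
  then show ?case using deg_le_add [OF deg_le_U2 [OF Suc.IH [OF *(2)]] *(3)] by simp
qed

lemma deg_le_coeff_0: "deg_le d r \<Longrightarrow> deg_le d [:coeff r 0:]"
proof (induction d arbitrary: r)
  case 0
  then obtain c where r: "r = const2 c" by auto
  have "[:coeff r 0:] = const2 c" by (simp add: r const2_def)
  then show ?case by (simp only: deg_le_const2)
next
  case (Suc d)
  obtain c r1 r2 where *: "r = const2 c + U2 * r1 + V2 * r2" "deg_le d r1" "deg_le d r2"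
    using Suc.prems by auto
  have "[:coeff r 0:] = const2 c + U2 * [:coeff r1 0:]"
    by (simp add: *(1) const2_def U2_mult V2_mult)
  then show ?case using deg_le_add [OF deg_le_const2 deg_le_U2 [OF Suc.IH [OF *(2)]]] by simp
qed

lemma deg_le_U_quotient_const: "deg_le (Suc d) r \<Longrightarrow> deg_le d (U_quotient_const r)"
proof -
  assume "deg_le (Suc d) r"
  then obtain c r1 r2 where *: "r = const2 c + U2 * r1 + V2 * r2" "deg_le d r1" "deg_le d r2"
    by auto
  have "U_quotient_const r = [:coeff r1 0:]" by (simp add: *(1))
  then show ?thesis using deg_le_coeff_0 [OF *(2)] by simp
qed

section \<open>The twist of k[u, v] and the right multiplications by x and y\<close>

locale down_up_params =
  fixes \<alpha> \<beta> :: "'k::field"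
  assumes \<beta>: "\<beta> \<noteq> 0"
begin

text \<open>The twist in f y = y \<open>phi\<close> f for polynomials f in u = xy and v = yx: the
  second relation gives uy = y(\<alpha> u + \<beta> v), and vy = yu is associativity. The inverse
  \<open>psi\<close> describes f x = x \<open>psi\<close> f and exists because \<beta> is
  invertible.\<close>

definition phi :: "'k poly poly \<Rightarrow> 'k poly poly" where
  "phi = bivariate_subst (const2 \<alpha> * U2 + const2 \<beta> * V2) U2"

definition psi :: "'k poly poly \<Rightarrow> 'k poly poly" where
  "psi = bivariate_subst V2 (const2 (1 / \<beta>) * U2 + const2 (- \<alpha> / \<beta>) * V2)"

lemma phi_simps [simp]:
  "phi (r + s) = phi r + phi s" "phi (r * s) = phi r * phi s" "phi (const2 c) = const2 c"
  "phi U2 = const2 \<alpha> * U2 + const2 \<beta> * V2" "phi V2 = U2" "phi 0 = 0" "phi 1 = 1"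
  by (simp_all add: phi_def)

lemma psi_simps [simp]:
  "psi (r + s) = psi r + psi s" "psi (r * s) = psi r * psi s" "psi (const2 c) = const2 c"
  "psi U2 = V2" "psi V2 = const2 (1 / \<beta>) * U2 + const2 (- \<alpha> / \<beta>) * V2" "psi 0 = 0" "psi 1 = 1"
  by (simp_all add: psi_def)

lemma const2_inverse: "const2 \<beta> * const2 (1 / \<beta>) = 1" "const2 \<beta> * const2 (- \<alpha> / \<beta>) = const2 (- \<alpha>)"
  using \<beta> by (simp_all flip: const2_simps(2,4))

lemma const2_uminus: "const2 (- c) = - const2 c"
  by (simp add: const2_def)

text \<open>This is \<open>psi (phi U2) = U2\<close> written out, the form in which the first
  defining relation appears in the representation.\<close>

lemma U2_recurrence: "U2 = const2 \<alpha> * V2 + const2 \<beta> * psi V2"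
proof -
  have "const2 \<beta> * psi V2 = (const2 \<beta> * const2 (1 / \<beta>)) * U2 + (const2 \<beta> * const2 (- \<alpha> / \<beta>)) * V2"
    by (simp add: algebra_simps)
  then show ?thesis by (simp only: const2_inverse const2_uminus) simp
qed

lemma phi_psi [simp]: "phi (psi r) = r"
proof -
  have "phi (psi V2) = (const2 \<beta> * const2 (1 / \<beta>)) * V2 + const2 (1 / \<beta>) * const2 \<alpha> * U2 + const2 (- \<alpha> / \<beta>) * U2"
    by (simp add: algebra_simps)
  also have "const2 (1 / \<beta>) * const2 \<alpha> = - const2 (- \<alpha> / \<beta>)"
    by (simp flip: const2_simps(4) const2_uminus)
  finally have "phi (psi V2) = V2" by (simp only: const2_inverse) simp
  then show ?thesis
    unfolding phi_def psi_def by (intro bivariate_subst_subst) (simp_all add: phi_def psi_def)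
qed

lemma psi_phi [simp]: "psi (phi r) = r"
proof -
  have "psi (phi U2) = U2"
    using U2_recurrence by (simp add: algebra_simps)
  then show ?thesis
    unfolding phi_def psi_def by (intro bivariate_subst_subst) (simp_all add: phi_def psi_def)
qed

lemma deg_le_phi: "deg_le n r \<Longrightarrow> deg_le n (phi r)"
  unfolding phi_def
proof (rule deg_le_subst)
  show "\<exists>c d. (U2 :: 'k poly poly) = const2 c * U2 + const2 d * V2"
    by (rule exI [of _ 1], rule exI [of _ 0]) simp
qed blast+

text \<open>
  The algebra embeds into the skew Laurent ring \<open>k[u, v][z, z\<^sup>-\<^sup>1; \<phi>]\<close> via \<open>x = z\<close>, \<open>y = z\<^sup>-\<^sup>1u\<close>, so that
  \<open>xy = u\<close> and \<open>yx = v\<close>. A function \<open>f\<close> stands for the sum of the \<open>z\<^sub>m f(m)\<close> with \<open>z\<^sub>m = x\<^sup>m\<close> for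
  \<open>m \<ge> 0\<close> and \<open>z\<^sub>m = y\<^sup>-\<^sup>m\<close> for \<open>m \<le> 0\<close>; the operators are the right multiplications by \<open>x\<close> and \<open>y\<close>.
\<close>

definition opX :: "(int \<Rightarrow> 'k poly poly) \<Rightarrow> int \<Rightarrow> 'k poly poly" where
  "opX f = (\<lambda>m. (if m \<le> 0 then V2 else 1) * psi (f (m - 1)))"

definition opY :: "(int \<Rightarrow> 'k poly poly) \<Rightarrow> int \<Rightarrow> 'k poly poly" where
  "opY f = (\<lambda>m. (if m \<ge> 0 then U2 else 1) * phi (f (m + 1)))"

text \<open>The factors \<open>U2\<close> and \<open>V2\<close> in the operators come from x^(m+1) y
  = x^m u and y^(m+1) x = y^m v. In the composites the twists cancel, and xy and yx act as
  multiplication by u and v.\<close>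

lemma opY_opX: "opY (opX f) = (\<lambda>m. U2 * f m)"
  by (auto simp: opX_def opY_def fun_eq_iff)

lemma opX_opY: "opX (opY f) = (\<lambda>m. V2 * f m)"
  by (auto simp: opX_def opY_def fun_eq_iff)

lemma opX_scale: "opX (\<lambda>m. r * f m) = (\<lambda>m. psi r * opX f m)"
  by (auto simp: opX_def fun_eq_iff)

lemma opY_scale: "opY (\<lambda>m. r * f m) = (\<lambda>m. phi r * opY f m)"
  by (auto simp: opY_def fun_eq_iff)

lemma op_add:
  "opX (\<lambda>m. f m + g m) = (\<lambda>m. opX f m + opX g m)" "opY (\<lambda>m. f m + g m) = (\<lambda>m. opY f m + opY g m)"
  by (auto simp: opX_def opY_def fun_eq_iff algebra_simps)

text \<open>In a right action the letters of a word are applied from left to right, so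
  \<open>opY (opX (opX f))\<close> stands for f times x^2 y.\<close>

lemma op_relation_1:
  "opY (opX (opX f)) = (\<lambda>m. const2 \<alpha> * opX (opY (opX f)) m + const2 \<beta> * opX (opX (opY f)) m)"
proof
  fix m
  have "opX (opX (opY f)) m = psi V2 * opX f m" by (simp only: opX_opY opX_scale)
  moreover have "opX (opY (opX f)) m = V2 * opX f m" by (rule fun_cong [OF opX_opY])
  moreover have "opY (opX (opX f)) m = (const2 \<alpha> * V2 + const2 \<beta> * psi V2) * opX f m"
    by (simp only: opY_opX flip: U2_recurrence)
  ultimately show "opY (opX (opX f)) m = const2 \<alpha> * opX (opY (opX f)) m + const2 \<beta> * opX (opX (opY f)) m"
    by (simp only:) (simp only: distrib_right mult.assoc)
qed

lemma op_relation_2: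
  "opY (opY (opX f)) = (\<lambda>m. const2 \<alpha> * opY (opX (opY f)) m + const2 \<beta> * opX (opY (opY f)) m)"
proof
  fix m
  have "opY (opY (opX f)) m = phi U2 * opY f m" by (simp only: opY_opX opY_scale)
  moreover have "opY (opX (opY f)) m = U2 * opY f m" by (rule fun_cong [OF opY_opX])
  moreover have "opX (opY (opY f)) m = V2 * opY f m" by (rule fun_cong [OF opX_opY])
  ultimately show "opY (opY (opX f)) m = const2 \<alpha> * opY (opX (opY f)) m + const2 \<beta> * opX (opY (opY f)) m"
    by (simp add: algebra_simps)
qed

text \<open>Right division by x in coordinates: \<open>opR\<close> is the quotient, and
  \<open>opE\<close> below is the remainder, made of the terms y^k p(u) without v. Positive powers
  of x are always divisible, the other terms only if they contain v.\<close>

definition opR :: "(int \<Rightarrow> 'k poly poly) \<Rightarrow> int \<Rightarrow> 'k poly poly" where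
  "opR f = (\<lambda>m. phi (if m \<ge> 0 then f (m + 1) else V_quotient (f (m + 1))))"

text \<open>On the terms y^k p(u) this divides p by u, and it kills all multiples of x. So it
  recovers a remainder from its product with xy.\<close>

definition opS :: "(int \<Rightarrow> 'k poly poly) \<Rightarrow> int \<Rightarrow> 'k poly poly" where
  "opS f = (\<lambda>m. if m > 0 then 0 else U_quotient_const (f m))"

definition opE :: "(int \<Rightarrow> 'k poly poly) \<Rightarrow> int \<Rightarrow> 'k poly poly" where
  "opE f = (\<lambda>m. if m > 0 then 0 else [:coeff (f m) 0:])"

lemma opR_opX: "opR (opX f) = f"
  by (auto simp: opR_def opX_def fun_eq_iff)

lemma opS_opX: "opS (opX f) = (\<lambda>m. 0)"
  by (auto simp: opS_def opX_def fun_eq_iff)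

lemma opE_opR: "f m = opE f m + opX (opR f) m"
proof (cases "m > 0")
  case False
  then show ?thesis using V_decompose [of "f m"] by (simp add: opE_def opX_def opR_def)
qed (simp add: opE_def opX_def opR_def)

lemma opS_U2_opE: "opS (\<lambda>m. U2 * opE f m) = opE f"
  by (auto simp: opS_def opE_def fun_eq_iff)

lemma opR_U2_opE: "opR (\<lambda>m. U2 * opE f m) = (\<lambda>m. 0)"
  by (auto simp: opR_def opE_def fun_eq_iff)

lemma opRS_linear:
  "opR (\<lambda>m. f m + g m) = (\<lambda>m. opR f m + opR g m)" "opS (\<lambda>m. f m + g m) = (\<lambda>m. opS f m + opS g m)"
  "opR (\<lambda>m. const2 c * f m) = (\<lambda>m. const2 c * opR f m)"
  "opS (\<lambda>m. const2 c * f m) = (\<lambda>m. const2 c * opS f m)"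
  by (auto simp: opR_def opS_def fun_eq_iff)

section \<open>Finite support and the filtration by word length\<close>

definition finsupp :: "(int \<Rightarrow> 'k poly poly) \<Rightarrow> bool" where
  "finsupp f \<longleftrightarrow> finite {m. f m \<noteq> 0}"

text \<open>The operators are local: the value at m depends on the value at one shifted place and
  vanishes with it.\<close>

lemma finsupp_shift: "finsupp f \<Longrightarrow> (\<And>m. f (m + d) = 0 \<Longrightarrow> g m = 0) \<Longrightarrow> finsupp g"
proof -
  assume f: "finsupp f" and g: "\<And>m. f (m + d) = 0 \<Longrightarrow> g m = 0"
  have "{m. g m \<noteq> 0} \<subseteq> (\<lambda>m. m - d) ` {m. f m \<noteq> 0}"
  proof
    fix m assume "m \<in> {m. g m \<noteq> 0}"
    then have "m + d \<in> {m. f m \<noteq> 0}" using g by auto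
    then show "m \<in> (\<lambda>m. m - d) ` {m. f m \<noteq> 0}" by (rule rev_image_eqI) simp
  qed
  then show "finsupp g" using f unfolding finsupp_def by (rule finite_surj [rotated])
qed

lemma finsupp_ops:
  assumes "finsupp f"
  shows "finsupp (opX f)" "finsupp (opY f)" "finsupp (opR f)" "finsupp (opS f)"
proof -
  show "finsupp (opX f)" by (rule finsupp_shift [OF assms, of "-1"]) (simp add: opX_def)
  show "finsupp (opY f)" by (rule finsupp_shift [OF assms, of 1]) (simp add: opY_def)
  show "finsupp (opR f)" by (rule finsupp_shift [OF assms, of 1]) (simp add: opR_def)
  show "finsupp (opS f)" by (rule finsupp_shift [OF assms, of 0]) (simp add: opS_def)
qed

lemma finsupp_add: "finsupp f \<Longrightarrow> finsupp g \<Longrightarrow> finsupp (\<lambda>m. f m + g m)"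
  unfolding finsupp_def by (rule finite_subset [of _ "{m. f m \<noteq> 0} \<union> {m. g m \<noteq> 0}"]) auto

lemma finsupp_scale: "finsupp f \<Longrightarrow> finsupp (\<lambda>m. r * f m)"
  by (rule finsupp_shift [of f 0]) auto

text \<open>The term z_m r with r of total degree d corresponds to words of length |m| + 2 d, as u
  and v are quadratic in the generators. The bound is strict so that level 0 contains only the zero
  function.\<close>

definition filtered :: "nat \<Rightarrow> (int \<Rightarrow> 'k poly poly) \<Rightarrow> bool" where
  "filtered n f \<longleftrightarrow> (\<forall>m. f m = 0 \<or> (\<exists>d. nat \<bar>m\<bar> + 2 * d < n \<and> deg_le d (f m)))"

lemma filtered_0: "filtered 0 f \<Longrightarrow> f = (\<lambda>m. 0)"
  by (auto simp: filtered_def)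

lemma filteredI: "(\<And>m. f m \<noteq> 0 \<Longrightarrow> \<exists>d. nat \<bar>m\<bar> + 2 * d < n \<and> deg_le d (f m)) \<Longrightarrow> filtered n f"
  unfolding filtered_def by blast

lemma filteredE:
  assumes "filtered n f" "f m \<noteq> 0"
  obtains d where "nat \<bar>m\<bar> + 2 * d < n" "deg_le d (f m)"
  using assms unfolding filtered_def by blast

lemma filtered_mono: "filtered n f \<Longrightarrow> n \<le> n' \<Longrightarrow> filtered n' f"
  unfolding filtered_def by (meson less_le_trans)

lemma filtered_exists:
  assumes "finsupp f" shows "\<exists>n. filtered n f"
proof -
  have "\<forall>m. \<exists>d. deg_le d (f m)" by (intro allI deg_le_exists)
  then obtain d where d: "\<And>m. deg_le (d m) (f m)" by metis
  have "finite ((\<lambda>m. nat \<bar>m\<bar> + 2 * d m) ` {m. f m \<noteq> 0})"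
    using assms by (simp add: finsupp_def)
  then obtain N where N: "\<And>k. k \<in> (\<lambda>m. nat \<bar>m\<bar> + 2 * d m) ` {m. f m \<noteq> 0} \<Longrightarrow> k \<le> N"
    using finite_nat_set_iff_bounded_le by auto
  have "filtered (Suc N) f"
  proof (rule filteredI)
    fix m assume "f m \<noteq> 0"
    then have "nat \<bar>m\<bar> + 2 * d m \<le> N" by (intro N) blast
    then show "\<exists>d. nat \<bar>m\<bar> + 2 * d < Suc N \<and> deg_le d (f m)" using d by (intro exI [of _ "d m"]) simp
  qed
  then show ?thesis by blast
qed

text \<open>One letter is added. For m at least 0 the power of x drops by one while the factor u
  adds length two.\<close>

lemma filtered_opY: "filtered n f \<Longrightarrow> filtered (Suc n) (opY f)"
proof (rule filteredI)
  fix m assume f: "filtered n f" and m: "opY f m \<noteq> 0"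
  have "f (m + 1) \<noteq> 0" using m by (auto simp: opY_def)
  then obtain d where d: "nat \<bar>m + 1\<bar> + 2 * d < n" "deg_le d (f (m + 1))" by (rule filteredE [OF f])
  show "\<exists>d. nat \<bar>m\<bar> + 2 * d < Suc n \<and> deg_le d (opY f m)"
  proof (cases "m \<ge> 0")
    case True
    then show ?thesis using d deg_le_U2 [OF deg_le_phi [OF d(2)]]
      by (intro exI [of _ "Suc d"]) (auto simp: opY_def simp del: deg_le.simps)
  next
    case False
    then show ?thesis using d deg_le_phi [OF d(2)]
      by (intro exI [of _ d]) (auto simp: opY_def)
  qed
qed

text \<open>Division by x removes one letter. For m < 0 the exponent of y grows by one, but the
  division by v lowers the length by two.\<close>

lemma filtered_opR: "filtered n f \<Longrightarrow> filtered (n - 1) (opR f)"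
proof (rule filteredI)
  fix m assume f: "filtered n f" and m: "opR f m \<noteq> 0"
  have "f (m + 1) \<noteq> 0" using m by (auto simp: opR_def split: if_splits)
  then obtain d where d: "nat \<bar>m + 1\<bar> + 2 * d < n" "deg_le d (f (m + 1))" by (rule filteredE [OF f])
  show "\<exists>d. nat \<bar>m\<bar> + 2 * d < n - 1 \<and> deg_le d (opR f m)"
  proof (cases "m \<ge> 0")
    case True
    then show ?thesis using d deg_le_phi [OF d(2)]
      by (intro exI [of _ d]) (auto simp: opR_def)
  next
    case False
    show ?thesis
    proof (cases d)
      case 0
      then have "V_quotient (f (m + 1)) = 0" using d(2) by auto
      then show ?thesis using m False by (simp add: opR_def)
    next
      case (Suc e)
      then show ?thesis
        using d False deg_le_phi [OF deg_le_V_quotient [of e "f (m + 1)"]]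
        by (intro exI [of _ e]) (auto simp: opR_def simp del: deg_le.simps)
    qed
  qed
qed

text \<open>Division by u = xy removes two letters, and it sends constants to zero.\<close>

lemma filtered_opS: "filtered n f \<Longrightarrow> filtered (n - 2) (opS f)"
proof (rule filteredI)
  fix m assume f: "filtered n f" and m: "opS f m \<noteq> 0"
  have nz: "f m \<noteq> 0" and m0: "\<not> m > 0" using m by (auto simp: opS_def split: if_splits)
  obtain d where d: "nat \<bar>m\<bar> + 2 * d < n" "deg_le d (f m)" by (rule filteredE [OF f nz])
  show "\<exists>d. nat \<bar>m\<bar> + 2 * d < n - 2 \<and> deg_le d (opS f m)"
  proof (cases d)
    case 0
    then have "U_quotient_const (f m) = 0" using d(2) by auto
    then show ?thesis using m m0 by (simp add: opS_def)
  next
    case (Suc e)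
    then show ?thesis
      using d m0 deg_le_U_quotient_const [of e "f m"]
      by (intro exI [of _ e]) (auto simp: opS_def simp del: deg_le.simps)
  qed
qed

end

section \<open>Down-up algebras\<close>

lemma word_monoid_simps [simp]:
  "carrier word_monoid = UNIV" "u \<otimes>\<^bsub>word_monoid\<^esub> v = u @ v" "\<one>\<^bsub>word_monoid\<^esub> = []"
  by (simp_all add: word_monoid_def)

lemma monoid_word_monoid: "Group.monoid (word_monoid :: 'v list monoid)"
  by (rule monoidI) simp_all

lemma k_algebra_free: "k_algebra (free_algebra :: ('k::field, 'v list \<Rightarrow> 'k) module)"
  by (rule k_algebra_monoid_algebra [OF monoid_word_monoid])

lemma free_algebra_basis_elem [simp]: "basis_elem w \<in> carrier free_algebra"
  by (rule basis_elem_closed) simp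

lemma free_algebra_scale: "f \<in> carrier free_algebra \<Longrightarrow> (\<lambda>w. c * f w) \<in> carrier free_algebra"
  using k_algebra.smult_closed [OF k_algebra_free, of f c] by simp

lemma free_algebra_add:
  "f \<in> carrier free_algebra \<Longrightarrow> g \<in> carrier free_algebra \<Longrightarrow> (\<lambda>w. f w + g w) \<in> carrier free_algebra"
  using ring.ring_simprules(1) [OF k_algebra.axioms(1) [OF k_algebra_free], of f g] by simp

lemma down_up_relations_eq:
  "down_up_relations \<alpha> \<beta> =
    {(\<lambda>w. basis_elem [GenX, GenX, GenY] w -
        (\<alpha> * basis_elem [GenX, GenY, GenX] w + \<beta> * basis_elem [GenY, GenX, GenX] w)),
     (\<lambda>w. basis_elem [GenX, GenY, GenY] w -
        (\<alpha> * basis_elem [GenY, GenX, GenY] w + \<beta> * basis_elem [GenY, GenY, GenX] w))}"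
  unfolding down_up_relations_def
  by (simp add: minus_monoid_algebra [OF monoid_word_monoid] free_algebra_scale algebra_simps)

lemma down_up_relations_closed: "down_up_relations \<alpha> \<beta> \<subseteq> carrier free_algebra"
proof -
  interpret F: k_algebra "free_algebra :: ('a, generator list \<Rightarrow> 'a) module" by (rule k_algebra_free)
  show ?thesis
    unfolding down_up_relations_def
    by (intro subsetI; elim insertE emptyE; hypsubst;
        intro F.minus_closed F.smult_closed free_algebra_basis_elem)
qed

lemma ideal_down_up: "ideal (down_up_ideal \<alpha> \<beta>) free_algebra"
  unfolding down_up_ideal_def
  by (rule ring.genideal_ideal [OF k_algebra.axioms(1) [OF k_algebra_free] down_up_relations_closed])

lemma k_algebra_down_up: "k_algebra (down_up_algebra \<alpha> \<beta>)"
  unfolding down_up_algebra_def by (rule k_algebra.k_algebra_quotient [OF k_algebra_free ideal_down_up])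

text \<open>A function on words induces a linear map on the down-up algebra when both relations hold
  for it in every context. Contexts are encoded by the family \<open>\<Gamma>\<close>, which is
  stable under adding prefixes and suffixes.\<close>

lemma down_up_ideal_lin_comb_eq_zero:
  fixes G :: "('k::field, 'g) module"
  assumes G: "left_module field_ring G"
    and \<Gamma>: "\<And>g w. g \<in> \<Gamma> \<Longrightarrow> g w \<in> carrier G"
    and left: "\<And>g u. g \<in> \<Gamma> \<Longrightarrow> (\<lambda>v. g (u @ v)) \<in> \<Gamma>"
    and right: "\<And>g u. g \<in> \<Gamma> \<Longrightarrow> (\<lambda>v. g (v @ u)) \<in> \<Gamma>"
    and rel1: "\<And>g. g \<in> \<Gamma> \<Longrightarrow>
      g [GenX, GenX, GenY] = \<alpha> \<odot>\<^bsub>G\<^esub> g [GenX, GenY, GenX] \<oplus>\<^bsub>G\<^esub> \<beta> \<odot>\<^bsub>G\<^esub> g [GenY, GenX, GenX]"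
    and rel2: "\<And>g. g \<in> \<Gamma> \<Longrightarrow>
      g [GenX, GenY, GenY] = \<alpha> \<odot>\<^bsub>G\<^esub> g [GenY, GenX, GenY] \<oplus>\<^bsub>G\<^esub> \<beta> \<odot>\<^bsub>G\<^esub> g [GenY, GenY, GenX]"
    and f: "f \<in> down_up_ideal \<alpha> \<beta>" and g: "g \<in> \<Gamma>"
  shows "lin_comb field_ring G g f = \<zero>\<^bsub>G\<^esub>"
proof (rule genideal_translation_kernel [OF monoid_word_monoid G])
  show "f \<in> Idl\<^bsub>free_algebra\<^esub> (down_up_relations \<alpha> \<beta>)" using f by (simp add: down_up_ideal_def)
  show "lin_comb field_ring G g r = \<zero>\<^bsub>G\<^esub>" if r: "r \<in> down_up_relations \<alpha> \<beta>" and g: "g \<in> \<Gamma>" for g r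
  proof -
    have g': "g \<in> carrier word_monoid \<rightarrow> carrier G" using \<Gamma> [OF g] by simp
    have rel: "lin_comb field_ring G g (\<lambda>w. basis_elem p w - (\<alpha> * basis_elem q w + \<beta> * basis_elem s w)) = \<zero>\<^bsub>G\<^esub>"
      if "g p = \<alpha> \<odot>\<^bsub>G\<^esub> g q \<oplus>\<^bsub>G\<^esub> \<beta> \<odot>\<^bsub>G\<^esub> g s" for p q s
    proof (rule lin_comb_diff_eq_zero [OF monoid_word_monoid G g' free_algebra_basis_elem
          free_algebra_add [OF free_algebra_scale free_algebra_scale]])
      have be: "lin_comb field_ring G g (basis_elem w) = g w" for w
        by (rule lin_comb_basis_elem [where g = g, OF G \<Gamma> [OF g, of w]])
      have sm: "lin_comb field_ring G g (\<lambda>v. c * basis_elem w v) = c \<odot>\<^bsub>G\<^esub> g w" for c w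
        using lin_comb_monoid_algebra_smult [OF G g' free_algebra_basis_elem] be by simp
      show "lin_comb field_ring G g (basis_elem p) =
          lin_comb field_ring G g (\<lambda>w. \<alpha> * basis_elem q w + \<beta> * basis_elem s w)"
        unfolding lin_comb_monoid_algebra_add [OF G g' free_algebra_scale [OF free_algebra_basis_elem]
            free_algebra_scale [OF free_algebra_basis_elem]] be sm by (rule that)
    qed simp_all
    from r show ?thesis
      unfolding down_up_relations_eq by (elim insertE emptyE; hypsubst; intro rel rel1 rel2 g)
  qed
qed (use \<Gamma> left right g down_up_relations_closed in simp_all)

definition laurent_module :: "('k::field, int \<Rightarrow> 'k poly poly) module" where
  "laurent_module = \<lparr>carrier = UNIV, monoid.mult = undefined, monoid.one = undefined,
     ring.zero = (\<lambda>m. 0), ring.add = (\<lambda>f g m. f m + g m), module.smult = (\<lambda>c f m. const2 c * f m)\<rparr>"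

lemma laurent_module_simps [simp]:
  "carrier laurent_module = UNIV" "\<zero>\<^bsub>laurent_module\<^esub> = (\<lambda>m. 0)"
  "f \<oplus>\<^bsub>laurent_module\<^esub> g = (\<lambda>m. f m + g m)" "c \<odot>\<^bsub>laurent_module\<^esub> f = (\<lambda>m. const2 c * f m)"
  by (simp_all add: laurent_module_def)

lemma left_module_laurent: "left_module field_ring (laurent_module :: ('k::field, int \<Rightarrow> 'k poly poly) module)"
proof -
  have "abelian_group (laurent_module :: ('k::field, int \<Rightarrow> 'k poly poly) module)"
  proof (rule abelian_groupI)
    fix f :: "int \<Rightarrow> 'k poly poly"
    show "\<exists>g\<in>carrier laurent_module. g \<oplus>\<^bsub>laurent_module\<^esub> f = \<zero>\<^bsub>laurent_module\<^esub>"
      by (rule bexI [of _ "\<lambda>m. - f m"]) simp_all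
  qed (simp_all add: algebra_simps)
  then show ?thesis
    by (intro left_module.intro left_module_axioms.intro ring_field_ring) (simp_all add: algebra_simps)
qed

section \<open>Words in the down-up algebra and their action on Laurent functions\<close>

context down_up_params
begin

abbreviation "A \<equiv> down_up_algebra \<alpha> \<beta>"
abbreviation "gx \<equiv> down_up_generator \<alpha> \<beta> GenX"
abbreviation "gy \<equiv> down_up_generator \<alpha> \<beta> GenY"

sublocale A: k_algebra A by (rule k_algebra_down_up)

abbreviation cs :: "(generator list \<Rightarrow> 'k) \<Rightarrow> (generator list \<Rightarrow> 'k) set" where
  "cs f \<equiv> down_up_ideal \<alpha> \<beta> +>\<^bsub>free_algebra\<^esub> f"

lemma cs_closed: "f \<in> carrier free_algebra \<Longrightarrow> cs f \<in> carrier A"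
  unfolding down_up_algebra_def by (rule k_algebra.coset_closed [OF k_algebra_free ideal_down_up])

lemma cs_mult: "f \<in> carrier free_algebra \<Longrightarrow> g \<in> carrier free_algebra \<Longrightarrow>
    cs f \<otimes>\<^bsub>A\<^esub> cs g = cs (f \<otimes>\<^bsub>free_algebra\<^esub> g)"
  unfolding down_up_algebra_def by (rule k_algebra.coset_mult [OF k_algebra_free ideal_down_up])

lemma cs_add: "f \<in> carrier free_algebra \<Longrightarrow> g \<in> carrier free_algebra \<Longrightarrow>
    cs f \<oplus>\<^bsub>A\<^esub> cs g = cs (\<lambda>w. f w + g w)"
  unfolding down_up_algebra_def
  by (rule k_algebra.coset_add [OF k_algebra_free ideal_down_up, unfolded monoid_algebra_simps])

lemma cs_smult: "f \<in> carrier free_algebra \<Longrightarrow> c \<odot>\<^bsub>A\<^esub> cs f = cs (\<lambda>w. c * f w)"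
  unfolding down_up_algebra_def
  by (rule k_algebra.coset_smult [OF k_algebra_free ideal_down_up, unfolded monoid_algebra_simps])

lemma cs_eq_iff: "f \<in> carrier free_algebra \<Longrightarrow> g \<in> carrier free_algebra \<Longrightarrow>
    cs f = cs g \<longleftrightarrow> (\<lambda>w. f w - g w) \<in> down_up_ideal \<alpha> \<beta>"
  using k_algebra.coset_eq_iff [OF k_algebra_free ideal_down_up, of f g]
  by (simp add: minus_monoid_algebra [OF monoid_word_monoid])

lemma cs_representative:
  assumes "a \<in> carrier A"
  obtains f where "f \<in> carrier free_algebra" "a = cs f"
  using assms k_algebra.carrier_quotient_algebra [OF k_algebra_free ideal_down_up, of \<alpha> \<beta>]
  unfolding down_up_algebra_def by blast

definition monomial :: "generator list \<Rightarrow> (generator list \<Rightarrow> 'k) set" where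
  "monomial w = down_up_ideal \<alpha> \<beta> +>\<^bsub>free_algebra\<^esub> basis_elem w"

lemma monomial_closed [simp, intro]: "monomial w \<in> carrier A"
  unfolding monomial_def by (rule cs_closed [OF free_algebra_basis_elem])

lemma monomial_append: "monomial (v @ w) = monomial v \<otimes>\<^bsub>A\<^esub> monomial w"
  unfolding monomial_def cs_mult [OF free_algebra_basis_elem free_algebra_basis_elem]
  by (simp add: basis_elem_mult)

lemma monomial_Nil: "monomial [] = \<one>\<^bsub>A\<^esub>"
  by (simp add: monomial_def down_up_algebra_def quotient_algebra_simps)

lemma monomial_single: "monomial [g] = down_up_generator \<alpha> \<beta> g"
  by (simp add: monomial_def down_up_generator_def)

lemma generator_closed [simp, intro]: "down_up_generator \<alpha> \<beta> g \<in> carrier A"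
  using monomial_closed [of "[g]"] by (simp add: monomial_single)

lemma monomial_snoc: "monomial (w @ [g]) = monomial w \<otimes>\<^bsub>A\<^esub> down_up_generator \<alpha> \<beta> g"
  by (simp add: monomial_append monomial_single)

lemma monomial_Cons: "monomial (g # w) = down_up_generator \<alpha> \<beta> g \<otimes>\<^bsub>A\<^esub> monomial w"
  using monomial_append [of "[g]" w] by (simp add: monomial_single)

lemma coset_step:
  assumes "f \<in> carrier free_algebra"
  shows "down_up_ideal \<alpha> \<beta> +>\<^bsub>free_algebra\<^esub> (\<lambda>w. c * basis_elem u w + f w) =
    c \<odot>\<^bsub>A\<^esub> monomial u \<oplus>\<^bsub>A\<^esub> (down_up_ideal \<alpha> \<beta> +>\<^bsub>free_algebra\<^esub> f)"
  unfolding monomial_def cs_smult [OF free_algebra_basis_elem]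
    cs_add [OF free_algebra_scale [OF free_algebra_basis_elem] assms] ..

lemma coset_zero: "down_up_ideal \<alpha> \<beta> +>\<^bsub>free_algebra\<^esub> (\<lambda>w. 0) = \<zero>\<^bsub>A\<^esub>"
proof -
  interpret F: k_algebra "free_algebra :: ('k, generator list \<Rightarrow> 'k) module" by (rule k_algebra_free)
  interpret I: ideal "down_up_ideal \<alpha> \<beta>" free_algebra by (rule ideal_down_up)
  show ?thesis
    using F.a_coset_add_zero [OF I.a_subset] by (simp add: down_up_algebra_def quotient_algebra_simps)
qed

lemma down_up_induct [consumes 1, case_names zero step]:
  assumes a: "a \<in> carrier A" and "P \<zero>\<^bsub>A\<^esub>"
    and step: "\<And>c w a. a \<in> carrier A \<Longrightarrow> P a \<Longrightarrow> P (c \<odot>\<^bsub>A\<^esub> monomial w \<oplus>\<^bsub>A\<^esub> a)"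
  shows "P a"
proof -
  obtain f where f: "f \<in> carrier free_algebra" "a = cs f"
    by (rule cs_representative [OF a])
  have "P (down_up_ideal \<alpha> \<beta> +>\<^bsub>free_algebra\<^esub> f)"
    using f(1)
  proof (induction f rule: monoid_algebra_induct)
    case zero
    show ?case unfolding coset_zero by (rule assms(2))
  next
    case (step c u g)
    have "cs g \<in> carrier A" by (rule cs_closed [OF step(2)])
    then show ?case unfolding coset_step [OF step(2)] by (rule assms(3)) (rule step(3))
  qed
  then show ?thesis using f by simp
qed

lemma down_up_relation:
  "gx \<otimes>\<^bsub>A\<^esub> (gx \<otimes>\<^bsub>A\<^esub> gy) = \<alpha> \<odot>\<^bsub>A\<^esub> (gx \<otimes>\<^bsub>A\<^esub> (gy \<otimes>\<^bsub>A\<^esub> gx)) \<oplus>\<^bsub>A\<^esub> \<beta> \<odot>\<^bsub>A\<^esub> (gy \<otimes>\<^bsub>A\<^esub> (gx \<otimes>\<^bsub>A\<^esub> gx))"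
  "gx \<otimes>\<^bsub>A\<^esub> (gy \<otimes>\<^bsub>A\<^esub> gy) = \<alpha> \<odot>\<^bsub>A\<^esub> (gy \<otimes>\<^bsub>A\<^esub> (gx \<otimes>\<^bsub>A\<^esub> gy)) \<oplus>\<^bsub>A\<^esub> \<beta> \<odot>\<^bsub>A\<^esub> (gy \<otimes>\<^bsub>A\<^esub> (gy \<otimes>\<^bsub>A\<^esub> gx))"
proof -
  have rel: "monomial p = \<alpha> \<odot>\<^bsub>A\<^esub> monomial q \<oplus>\<^bsub>A\<^esub> \<beta> \<odot>\<^bsub>A\<^esub> monomial s"
    if r: "(\<lambda>w. basis_elem p w - (\<alpha> * basis_elem q w + \<beta> * basis_elem s w)) \<in> down_up_relations \<alpha> \<beta>" for p q s
  proof -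
    let ?g = "\<lambda>w. \<alpha> * basis_elem q w + \<beta> * basis_elem s w"
    have g: "?g \<in> carrier free_algebra"
      by (intro free_algebra_add free_algebra_scale free_algebra_basis_elem)
    have "(\<lambda>w. basis_elem p w - ?g w) \<in> down_up_ideal \<alpha> \<beta>"
      using ring.genideal_self [OF k_algebra.axioms(1) [OF k_algebra_free] down_up_relations_closed] r
      unfolding down_up_ideal_def by blast
    then have "monomial p = cs ?g"
      unfolding monomial_def cs_eq_iff [OF free_algebra_basis_elem g] .
    also have "\<dots> = \<alpha> \<odot>\<^bsub>A\<^esub> monomial q \<oplus>\<^bsub>A\<^esub> (cs (\<lambda>w. \<beta> * basis_elem s w))"
      by (rule coset_step [OF free_algebra_scale [OF free_algebra_basis_elem]])
    also have "cs (\<lambda>w. \<beta> * basis_elem s w) = \<beta> \<odot>\<^bsub>A\<^esub> monomial s"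
      unfolding monomial_def cs_smult [OF free_algebra_basis_elem] ..
    finally show ?thesis .
  qed
  show "gx \<otimes>\<^bsub>A\<^esub> (gx \<otimes>\<^bsub>A\<^esub> gy) = \<alpha> \<odot>\<^bsub>A\<^esub> (gx \<otimes>\<^bsub>A\<^esub> (gy \<otimes>\<^bsub>A\<^esub> gx)) \<oplus>\<^bsub>A\<^esub> \<beta> \<odot>\<^bsub>A\<^esub> (gy \<otimes>\<^bsub>A\<^esub> (gx \<otimes>\<^bsub>A\<^esub> gx))"
    using rel [of "[GenX, GenX, GenY]" "[GenX, GenY, GenX]" "[GenY, GenX, GenX]"]
    unfolding down_up_relations_eq by (simp add: monomial_Cons monomial_Nil)
  show "gx \<otimes>\<^bsub>A\<^esub> (gy \<otimes>\<^bsub>A\<^esub> gy) = \<alpha> \<odot>\<^bsub>A\<^esub> (gy \<otimes>\<^bsub>A\<^esub> (gx \<otimes>\<^bsub>A\<^esub> gy)) \<oplus>\<^bsub>A\<^esub> \<beta> \<odot>\<^bsub>A\<^esub> (gy \<otimes>\<^bsub>A\<^esub> (gy \<otimes>\<^bsub>A\<^esub> gx))"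
    using rel [of "[GenX, GenY, GenY]" "[GenY, GenX, GenY]" "[GenY, GenY, GenX]"]
    unfolding down_up_relations_eq by (simp add: monomial_Cons monomial_Nil)
qed

fun op_gen :: "generator \<Rightarrow> (int \<Rightarrow> 'k poly poly) \<Rightarrow> int \<Rightarrow> 'k poly poly" where
  "op_gen GenX = opX"
| "op_gen GenY = opY"

text \<open>A left fold: the letters act in reading order, so words give a right action.\<close>

definition act :: "generator list \<Rightarrow> (int \<Rightarrow> 'k poly poly) \<Rightarrow> int \<Rightarrow> 'k poly poly" where
  "act w f = fold op_gen w f"

lemma act_simps [simp]: "act [] f = f" "act (g # w) f = act w (op_gen g f)"
  "act (v @ w) f = act w (act v f)"
  by (simp_all add: act_def)

definition laurent_linear :: "((int \<Rightarrow> 'k poly poly) \<Rightarrow> int \<Rightarrow> 'k poly poly) \<Rightarrow> bool" where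
  "laurent_linear L \<longleftrightarrow> (\<forall>f g. L (\<lambda>m. f m + g m) = (\<lambda>m. L f m + L g m)) \<and>
    (\<forall>c f. L (\<lambda>m. const2 c * f m) = (\<lambda>m. const2 c * L f m))"

lemma laurent_linear_compose: "laurent_linear L \<Longrightarrow> laurent_linear K \<Longrightarrow> laurent_linear (\<lambda>f. L (K f))"
  by (simp add: laurent_linear_def)

lemma laurent_linear_op_gen: "laurent_linear (op_gen g)"
  by (cases g) (simp_all add: laurent_linear_def op_add opX_scale opY_scale)

lemma laurent_linear_act: "laurent_linear (act w)"
proof (induction w)
  case (Cons g w)
  show ?case using laurent_linear_compose [OF Cons laurent_linear_op_gen [of g]] by simp
qed (simp add: laurent_linear_def)

text \<open>A prefix changes the starting vector e, and a suffix composes a further linear operator.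
  Hence the family of all \<open>L (act w e)\<close> with L linear is translation stable, and
  \<open>op_relation_1\<close> and \<open>op_relation_2\<close> give the two relations.\<close>

lemma act_ideal:
  assumes "f \<in> down_up_ideal \<alpha> \<beta>"
  shows "lin_comb field_ring laurent_module (\<lambda>w. act w e) f = \<zero>\<^bsub>laurent_module\<^esub>"
proof (rule down_up_ideal_lin_comb_eq_zero [OF left_module_laurent _ _ _ _ _ assms,
      where \<Gamma> = "{\<lambda>w. L (act w e) | L e. laurent_linear L}"])
  show "(\<lambda>w. act w e) \<in> {\<lambda>w. L (act w e) | L e. laurent_linear L}"
    by (rule CollectI, rule exI [of _ "\<lambda>f. f"], rule exI [of _ e]) (simp add: laurent_linear_def)
  fix g assume "g \<in> {\<lambda>w. L (act w e) | L e. laurent_linear L}"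
  then obtain L e where g: "g = (\<lambda>w. L (act w e))" and L: "laurent_linear L" by blast
  show "(\<lambda>v. g (u @ v)) \<in> {\<lambda>w. L (act w e) | L e. laurent_linear L}" for u
    unfolding g by (rule CollectI, rule exI [of _ L], rule exI [of _ "act u e"]) (simp add: L)
  show "(\<lambda>v. g (v @ u)) \<in> {\<lambda>w. L (act w e) | L e. laurent_linear L}" for u
    unfolding g
    by (rule CollectI, rule exI [of _ "\<lambda>f. L (act u f)"], rule exI [of _ e])
      (simp add: laurent_linear_compose [OF L laurent_linear_act])
  have lin: "L (\<lambda>m. const2 c * f m + const2 d * f' m) = (\<lambda>m. const2 c * L f m + const2 d * L f' m)" for c d f f'
    using L by (simp add: laurent_linear_def)
  show "g [GenX, GenX, GenY] = \<alpha> \<odot>\<^bsub>laurent_module\<^esub> g [GenX, GenY, GenX] \<oplus>\<^bsub>laurent_module\<^esub> \<beta> \<odot>\<^bsub>laurent_module\<^esub> g [GenY, GenX, GenX]"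
    using arg_cong [OF op_relation_1 [of e], of L] by (simp add: g lin)
  show "g [GenX, GenY, GenY] = \<alpha> \<odot>\<^bsub>laurent_module\<^esub> g [GenY, GenX, GenY] \<oplus>\<^bsub>laurent_module\<^esub> \<beta> \<odot>\<^bsub>laurent_module\<^esub> g [GenY, GenY, GenX]"
    using arg_cong [OF op_relation_2 [of e], of L] by (simp add: g lin)
qed simp

lemma act_Pi: "(\<lambda>w. act w e) \<in> carrier word_monoid \<rightarrow> carrier laurent_module"
  by simp

lemmas act_lift = monoid_word_monoid left_module_laurent ideal_down_up act_Pi act_ideal

definition unit_laurent :: "int \<Rightarrow> 'k poly poly" where
  "unit_laurent = (\<lambda>m. if m = 0 then 1 else 0)"

text \<open>The image of the unit under the right action of an element, that is, its coordinate
  function with respect to the z_m over k[u, v].\<close>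

definition theta :: "(generator list \<Rightarrow> 'k) set \<Rightarrow> int \<Rightarrow> 'k poly poly" where
  "theta = linear_lift laurent_module (\<lambda>w. act w unit_laurent)"

lemma theta_coset:
  assumes "f \<in> carrier free_algebra"
  shows "theta (down_up_ideal \<alpha> \<beta> +>\<^bsub>free_algebra\<^esub> f) = lin_comb field_ring laurent_module (\<lambda>w. act w unit_laurent) f"
  unfolding theta_def
  by (rule linear_lift_coset [OF act_lift assms])

lemma theta_monomial: "theta (monomial w) = act w unit_laurent"
  unfolding monomial_def theta_coset [OF free_algebra_basis_elem]
  by (rule lin_comb_basis_elem [OF left_module_laurent]) simp

lemma theta_add:
  assumes "a \<in> carrier A" "b \<in> carrier A"
  shows "theta (a \<oplus>\<^bsub>A\<^esub> b) = (\<lambda>m. theta a m + theta b m)"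
proof -
  have "theta (a \<oplus>\<^bsub>A\<^esub> b) = theta a \<oplus>\<^bsub>laurent_module\<^esub> theta b"
    unfolding theta_def down_up_algebra_def
    by (rule linear_lift_add [OF act_lift]; insert assms, unfold down_up_algebra_def, assumption)
  then show ?thesis by simp
qed

lemma theta_smult:
  assumes "a \<in> carrier A"
  shows "theta (c \<odot>\<^bsub>A\<^esub> a) = (\<lambda>m. const2 c * theta a m)"
proof -
  have "theta (c \<odot>\<^bsub>A\<^esub> a) = c \<odot>\<^bsub>laurent_module\<^esub> theta a"
    unfolding theta_def down_up_algebra_def
    by (rule linear_lift_smult [OF act_lift]; insert assms, unfold down_up_algebra_def, assumption)
  then show ?thesis by simp
qed

lemma theta_zero: "theta \<zero>\<^bsub>A\<^esub> = (\<lambda>m. 0)"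
  using theta_smult [of "\<zero>\<^bsub>A\<^esub>" 0] by simp

lemma theta_gen: "a \<in> carrier A \<Longrightarrow> theta (a \<otimes>\<^bsub>A\<^esub> down_up_generator \<alpha> \<beta> g) = op_gen g (theta a)"
proof (induction a rule: down_up_induct)
  case zero
  have "op_gen g (\<lambda>m. 0) = (\<lambda>m. 0)" by (cases g) (auto simp: opX_def opY_def)
  then show ?case by (simp add: theta_zero)
next
  case (step c w a)
  have lin: "op_gen g (\<lambda>m. const2 c * f m + f' m) = (\<lambda>m. const2 c * op_gen g f m + op_gen g f' m)" for f f'
    using laurent_linear_op_gen [of g] by (simp add: laurent_linear_def)
  have "(c \<odot>\<^bsub>A\<^esub> monomial w \<oplus>\<^bsub>A\<^esub> a) \<otimes>\<^bsub>A\<^esub> down_up_generator \<alpha> \<beta> g =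
      c \<odot>\<^bsub>A\<^esub> monomial (w @ [g]) \<oplus>\<^bsub>A\<^esub> a \<otimes>\<^bsub>A\<^esub> down_up_generator \<alpha> \<beta> g"
    using step(1) by (simp add: A.l_distr A.smult_mult_left monomial_snoc)
  then show ?case
    using step by (simp add: theta_add theta_smult theta_monomial lin)
qed

lemma theta_gx: "a \<in> carrier A \<Longrightarrow> theta (a \<otimes>\<^bsub>A\<^esub> gx) = opX (theta a)"
  and theta_gy: "a \<in> carrier A \<Longrightarrow> theta (a \<otimes>\<^bsub>A\<^esub> gy) = opY (theta a)"
  by (simp_all add: theta_gen)

lemma finsupp_theta: "a \<in> carrier A \<Longrightarrow> finsupp (theta a)"
proof (induction a rule: down_up_induct)
  case zero
  then show ?case by (simp add: theta_zero finsupp_def)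
next
  case (step c w a)
  have "finsupp unit_laurent"
    unfolding finsupp_def unit_laurent_def by (rule finite_subset [of _ "{0}"]) auto
  moreover have "finsupp f \<Longrightarrow> finsupp (act w f)" for f
  proof (induction w arbitrary: f)
    case (Cons g w)
    have "finsupp (op_gen g f)" using finsupp_ops [OF Cons.prems] by (cases g) simp_all
    from Cons.IH [OF this] show ?case by simp
  qed simp
  ultimately have "finsupp (act w unit_laurent)" by blast
  from finsupp_add [OF finsupp_scale [OF this, of "const2 c"] step(2)]
  show ?case using step(1) by (simp add: theta_add theta_smult theta_monomial)
qed

section \<open>A basis of the down-up algebra\<close>

abbreviation mult (infixl "\<star>" 70) where "a \<star> b \<equiv> a \<otimes>\<^bsub>A\<^esub> b"
abbreviation plus (infixl "\<boxplus>" 65) where "a \<boxplus> b \<equiv> a \<oplus>\<^bsub>A\<^esub> b"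
abbreviation scal (infixr "\<cdot>" 75) where "c \<cdot> a \<equiv> c \<odot>\<^bsub>A\<^esub> a"

abbreviation "UA \<equiv> gx \<star> gy"
abbreviation "VA \<equiv> gy \<star> gx"

lemma gx_VA: "UA \<star> gx = gx \<star> VA"
  by (simp add: A.m_assoc)

lemma UA_gy: "UA \<star> gy = gy \<star> (\<alpha> \<cdot> UA \<boxplus> \<beta> \<cdot> VA)"
  by (simp add: A.m_assoc down_up_relation(2) A.r_distr A.smult_mult_right)

lemma VA_gy: "VA \<star> gy = gy \<star> UA"
  by (simp add: A.m_assoc)

lemma gx_UA: "gx \<star> UA = (\<alpha> \<cdot> UA \<boxplus> \<beta> \<cdot> VA) \<star> gx"
  by (simp add: A.m_assoc down_up_relation(1) A.l_distr A.smult_mult_left)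

text \<open>The first relation expresses x(xy) through x(yx) and (yx)x; division by \<beta> solves
  it for (yx)x.\<close>

lemma VA_gx: "VA \<star> gx = gx \<star> ((1 / \<beta>) \<cdot> UA \<boxplus> (- \<alpha> / \<beta>) \<cdot> VA)"
proof -
  have "gx \<star> ((1 / \<beta>) \<cdot> UA \<boxplus> (- \<alpha> / \<beta>) \<cdot> VA) =
      (1 / \<beta>) \<cdot> (gx \<star> UA) \<boxplus> (- \<alpha> / \<beta>) \<cdot> (gx \<star> VA)"
    by (simp add: A.r_distr A.smult_mult_right)
  also have "gx \<star> UA = \<alpha> \<cdot> (gx \<star> VA) \<boxplus> \<beta> \<cdot> (VA \<star> gx)"
    by (simp add: A.m_assoc down_up_relation(1))
  also have "(1 / \<beta>) \<cdot> (\<alpha> \<cdot> (gx \<star> VA) \<boxplus> \<beta> \<cdot> (VA \<star> gx)) \<boxplus> (- \<alpha> / \<beta>) \<cdot> (gx \<star> VA) =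
      ((\<alpha> / \<beta>) \<cdot> (gx \<star> VA) \<boxplus> VA \<star> gx) \<boxplus> (- \<alpha> / \<beta>) \<cdot> (gx \<star> VA)"
    using \<beta> by (simp add: A.smult_r_distr flip: A.smult_assoc)
  also have "\<dots> = VA \<star> gx \<boxplus> ((\<alpha> / \<beta>) \<cdot> (gx \<star> VA) \<boxplus> (- \<alpha> / \<beta>) \<cdot> (gx \<star> VA))"
    by (simp add: A.a_ac)
  also have "\<dots> = VA \<star> gx"
    by (simp flip: A.smult_l_distr)
  finally show ?thesis ..
qed

text \<open>Both products equal y(\<alpha> u + \<beta> v)x: the second relation moves y to the left
  in one of them, the first relation moves x to the right in the other.\<close>

lemma UA_VA: "UA \<star> VA = VA \<star> UA"
proof -
  have "UA \<star> VA = (UA \<star> gy) \<star> gx" by (simp add: A.m_assoc)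
  also have "\<dots> = gy \<star> ((\<alpha> \<cdot> UA \<boxplus> \<beta> \<cdot> VA) \<star> gx)" unfolding UA_gy by (simp add: A.m_assoc)
  also have "\<dots> = VA \<star> UA" unfolding gx_UA [symmetric] by (simp add: A.m_assoc)
  finally show ?thesis .
qed

definition ev1 :: "'k poly \<Rightarrow> (generator list \<Rightarrow> 'k) set" where
  "ev1 s = fold_coeffs (\<lambda>c a. c \<cdot> \<one>\<^bsub>A\<^esub> \<boxplus> UA \<star> a) s \<zero>\<^bsub>A\<^esub>"

text \<open>Evaluation at u = xy and v = yx in Horner form, with the powers of v to the left of the
  coefficients in u.\<close>

definition ev :: "'k poly poly \<Rightarrow> (generator list \<Rightarrow> 'k) set" where
  "ev r = fold_coeffs (\<lambda>s a. ev1 s \<boxplus> VA \<star> a) r \<zero>\<^bsub>A\<^esub>"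

lemma ev1_0 [simp]: "ev1 0 = \<zero>\<^bsub>A\<^esub>"
  by (simp add: ev1_def)

lemma ev1_pCons: "ev1 (pCons c s) = c \<cdot> \<one>\<^bsub>A\<^esub> \<boxplus> UA \<star> ev1 s"
  by (cases "s = 0"; cases "c = 0") (simp_all add: ev1_def)

lemma ev1_closed [simp]: "ev1 s \<in> carrier A"
  by (induction s) (simp_all add: ev1_pCons)

lemma ev_0 [simp]: "ev 0 = \<zero>\<^bsub>A\<^esub>"
  by (simp add: ev_def)

lemma ev_pCons: "ev (pCons s r) = ev1 s \<boxplus> VA \<star> ev r"
  by (cases "r = 0"; cases "s = 0") (simp_all add: ev_def)

lemma ev_closed [simp]: "ev r \<in> carrier A"
  by (induction r) (simp_all add: ev_pCons)

lemma ev1_add: "ev1 (s + t) = ev1 s \<boxplus> ev1 t"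
  by (induction s t rule: poly_induct2)
    (simp_all add: ev1_pCons A.smult_l_distr A.r_distr A.a_ac)

lemma ev_add: "ev (r + s) = ev r \<boxplus> ev s"
  by (induction r s rule: poly_induct2)
    (simp_all add: ev_pCons ev1_add A.r_distr A.a_ac)

lemma ev_const: "ev [:s:] = ev1 s"
  by (simp add: ev_pCons)

lemma ev_const2: "ev (const2 c) = c \<cdot> \<one>\<^bsub>A\<^esub>"
  by (simp add: const2_def ev_const ev1_pCons)

lemma ev_1: "ev 1 = \<one>\<^bsub>A\<^esub>"
  using ev_const2 [of 1] by simp

lemma ev_V2: "ev (V2 * r) = VA \<star> ev r"
  by (simp add: V2_mult ev_pCons)

text \<open>In the Horner form v stands to the left, so u has to be moved past it; this is where the
  commutation of xy and yx enters.\<close>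

lemma ev_U2: "ev (U2 * r) = UA \<star> ev r"
proof (induction r)
  case (pCons s r)
  have "ev1 ([:0, 1:] * s) = UA \<star> ev1 s"
    by (simp add: mult_pCons_left ev1_pCons)
  moreover have "UA \<star> (VA \<star> ev r) = VA \<star> (UA \<star> ev r)"
    using UA_VA by (simp flip: A.m_assoc del: A.m_assoc)
  ultimately show ?case
    using pCons.IH by (simp add: U2_mult ev_pCons A.r_distr)
qed simp

lemma ev_const2_mult: "ev (const2 c * r) = c \<cdot> ev r"
proof (induction r rule: bivariate_induct)
  case (U d s)
  have "const2 c * (const2 d + U2 * [:s:]) = const2 (c * d) + U2 * (const2 c * [:s:])"
    by (simp add: algebra_simps)
  then show ?case using U
    by (simp only: ev_add ev_const2 ev_U2)
      (simp add: A.smult_r_distr A.smult_assoc A.smult_mult_right)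
next
  case (V s r)
  have "const2 c * ([:s:] + V2 * r) = const2 c * [:s:] + V2 * (const2 c * r)"
    by (simp add: algebra_simps)
  then show ?case using V
    by (simp only: ev_add ev_V2) (simp add: A.smult_r_distr A.smult_mult_right)
qed simp

lemma ev_gx: "ev r \<star> gx = gx \<star> ev (psi r)"
proof (induction r rule: bivariate_induct)
  case (U c s)
  have "(UA \<star> ev [:s:]) \<star> gx = UA \<star> (gx \<star> ev (psi [:s:]))"
    using U by (simp add: A.m_assoc)
  also have "\<dots> = (UA \<star> gx) \<star> ev (psi [:s:])" by (simp add: A.m_assoc)
  also have "\<dots> = gx \<star> ev (V2 * psi [:s:])" unfolding gx_VA ev_V2 by (simp add: A.m_assoc)
  finally have "(UA \<star> ev [:s:]) \<star> gx = gx \<star> ev (V2 * psi [:s:])" .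
  then show ?case
    by (simp add: ev_add ev_const2 ev_U2 A.l_distr A.r_distr A.smult_mult_left A.smult_mult_right)
next
  case (V s r)
  have "(VA \<star> ev r) \<star> gx = VA \<star> (gx \<star> ev (psi r))"
    using V by (simp add: A.m_assoc)
  also have "\<dots> = (VA \<star> gx) \<star> ev (psi r)" by (simp add: A.m_assoc)
  also have "\<dots> = gx \<star> (((1 / \<beta>) \<cdot> UA \<boxplus> (- \<alpha> / \<beta>) \<cdot> VA) \<star> ev (psi r))"
    unfolding VA_gx by (simp add: A.m_assoc)
  also have "((1 / \<beta>) \<cdot> UA \<boxplus> (- \<alpha> / \<beta>) \<cdot> VA) \<star> ev (psi r) = ev (psi V2 * psi r)"
    by (simp add: distrib_right mult.assoc ev_add ev_const2_mult ev_U2 ev_V2 A.l_distr A.smult_mult_left)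
  finally have "(VA \<star> ev r) \<star> gx = gx \<star> ev (psi V2 * psi r)" .
  then show ?case using V
    by (simp only: ev_add ev_V2 psi_simps(1,2)) (simp add: A.l_distr A.r_distr del: psi_simps)
qed simp

lemma ev_gy: "ev r \<star> gy = gy \<star> ev (phi r)"
proof (induction r rule: bivariate_induct)
  case (U c s)
  have "(UA \<star> ev [:s:]) \<star> gy = UA \<star> (gy \<star> ev (phi [:s:]))"
    using U by (simp add: A.m_assoc)
  also have "\<dots> = (UA \<star> gy) \<star> ev (phi [:s:])" by (simp add: A.m_assoc)
  also have "\<dots> = gy \<star> ((\<alpha> \<cdot> UA \<boxplus> \<beta> \<cdot> VA) \<star> ev (phi [:s:]))"
    unfolding UA_gy by (simp add: A.m_assoc)
  also have "(\<alpha> \<cdot> UA \<boxplus> \<beta> \<cdot> VA) \<star> ev (phi [:s:]) = ev (phi U2 * phi [:s:])"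
    by (simp add: distrib_right mult.assoc ev_add ev_const2_mult ev_U2 ev_V2 A.l_distr A.smult_mult_left)
  finally have "(UA \<star> ev [:s:]) \<star> gy = gy \<star> ev (phi U2 * phi [:s:])" .
  then show ?case
    by (simp only: ev_add ev_U2 phi_simps(1-3) ev_const2)
      (simp add: A.l_distr A.r_distr A.smult_mult_left A.smult_mult_right del: phi_simps)
next
  case (V s r)
  have "(VA \<star> ev r) \<star> gy = VA \<star> (gy \<star> ev (phi r))"
    using V by (simp add: A.m_assoc)
  also have "\<dots> = (VA \<star> gy) \<star> ev (phi r)" by (simp add: A.m_assoc)
  also have "\<dots> = gy \<star> ev (U2 * phi r)" unfolding VA_gy ev_U2 by (simp add: A.m_assoc)
  finally have "(VA \<star> ev r) \<star> gy = gy \<star> ev (U2 * phi r)" .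
  then show ?case using V
    by (simp add: ev_add ev_V2 A.l_distr A.r_distr)
qed simp

definition zmon :: "int \<Rightarrow> (generator list \<Rightarrow> 'k) set" where
  "zmon m = monomial (if m \<ge> 0 then replicate (nat m) GenX else replicate (nat (- m)) GenY)"

lemma zmon_closed [simp]: "zmon m \<in> carrier A"
  by (simp add: zmon_def)

text \<open>For m < 0 the last y of the power meets x and leaves the factor yx.\<close>

lemma zmon_gx: "zmon m \<star> gx = (if m \<ge> 0 then zmon (m + 1) else zmon (m + 1) \<star> VA)"
proof (cases "m \<ge> 0")
  case True
  then have "nat (m + 1) = Suc (nat m)" by simp
  then show ?thesis using True
    by (simp add: zmon_def flip: monomial_snoc replicate_append_same)
next
  case False
  then have n: "nat (- m) = Suc (nat (- (m + 1)))" by simp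
  have "zmon m = zmon (m + 1) \<star> gy"
    using False n
    by (cases "m = -1") (auto simp: zmon_def monomial_snoc [symmetric] replicate_append_same)
  then show ?thesis using False by (simp add: A.m_assoc)
qed

lemma zmon_gy: "zmon m \<star> gy = (if m \<le> 0 then zmon (m - 1) else zmon (m - 1) \<star> UA)"
proof (cases "m \<le> 0")
  case True
  then have "nat (- (m - 1)) = Suc (nat (- m))" by simp
  then show ?thesis using True
    by (cases "m = 0") (simp_all add: zmon_def flip: monomial_snoc replicate_append_same)
next
  case False
  then have "nat m = Suc (nat (m - 1))" by simp
  then have "zmon m = zmon (m - 1) \<star> gx"
    using False by (simp add: zmon_def flip: monomial_snoc replicate_append_same)
  then show ?thesis using False by (simp add: A.m_assoc)
qed

definition of_laurent :: "(int \<Rightarrow> 'k poly poly) \<Rightarrow> (generator list \<Rightarrow> 'k) set" where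
  "of_laurent f = (\<Oplus>\<^bsub>A\<^esub> m \<in> {m. f m \<noteq> 0}. zmon m \<star> ev (f m))"

lemma of_laurent_superset:
  assumes "finite S" "{m. f m \<noteq> 0} \<subseteq> S"
  shows "of_laurent f = (\<Oplus>\<^bsub>A\<^esub> m \<in> S. zmon m \<star> ev (f m))"
  unfolding of_laurent_def
  by (rule A.add.finprod_mono_neutral_cong_left) (use assms in auto)

lemma of_laurent_closed [simp]: "of_laurent f \<in> carrier A"
  unfolding of_laurent_def by (rule A.finsum_closed) simp

lemma of_laurent_add:
  assumes "finsupp f" "finsupp g"
  shows "of_laurent (\<lambda>m. f m + g m) = of_laurent f \<boxplus> of_laurent g"
proof -
  let ?S = "{m. f m \<noteq> 0} \<union> {m. g m \<noteq> 0}"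
  have S: "finite ?S" using assms by (simp add: finsupp_def)
  have "of_laurent (\<lambda>m. f m + g m) = (\<Oplus>\<^bsub>A\<^esub> m \<in> ?S. zmon m \<star> ev (f m + g m))"
    by (rule of_laurent_superset [OF S]) auto
  also have "\<dots> = (\<Oplus>\<^bsub>A\<^esub> m \<in> ?S. zmon m \<star> ev (f m) \<boxplus> zmon m \<star> ev (g m))"
    by (rule A.finsum_cong') (simp_all add: ev_add A.r_distr)
  also have "\<dots> = (\<Oplus>\<^bsub>A\<^esub> m \<in> ?S. zmon m \<star> ev (f m)) \<boxplus> (\<Oplus>\<^bsub>A\<^esub> m \<in> ?S. zmon m \<star> ev (g m))"
    by (rule A.finsum_addf) simp_all
  also have "(\<Oplus>\<^bsub>A\<^esub> m \<in> ?S. zmon m \<star> ev (f m)) = of_laurent f"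
    by (rule of_laurent_superset [OF S, symmetric]) auto
  also have "(\<Oplus>\<^bsub>A\<^esub> m \<in> ?S. zmon m \<star> ev (g m)) = of_laurent g"
    by (rule of_laurent_superset [OF S, symmetric]) auto
  finally show ?thesis .
qed

lemma of_laurent_scale:
  assumes "finsupp f"
  shows "of_laurent (\<lambda>m. const2 c * f m) = c \<cdot> of_laurent f"
proof -
  have S: "finite {m. f m \<noteq> 0}" using assms by (simp add: finsupp_def)
  have "of_laurent (\<lambda>m. const2 c * f m) = (\<Oplus>\<^bsub>A\<^esub> m \<in> {m. f m \<noteq> 0}. zmon m \<star> ev (const2 c * f m))"
    by (rule of_laurent_superset [OF S]) auto
  also have "\<dots> = (\<Oplus>\<^bsub>A\<^esub> m \<in> {m. f m \<noteq> 0}. c \<cdot> (zmon m \<star> ev (f m)))"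
    by (rule A.finsum_cong') (simp_all add: ev_const2_mult A.smult_mult_right)
  also have "\<dots> = c \<cdot> of_laurent f"
    unfolding of_laurent_def
    using left_module.smult_finsum [OF A.left_module_field _ S, of c "\<lambda>m. zmon m \<star> ev (f m)"] by simp
  finally show ?thesis .
qed

text \<open>z_m f x = z_m x \<open>psi\<close> f, and z_m x is z_(m+1), followed by yx if m < 0.
  These are the shift, the twist and the extra factor in \<open>opX\<close>.\<close>

lemma of_laurent_opX:
  assumes "finsupp f"
  shows "of_laurent (opX f) = of_laurent f \<star> gx"
proof -
  let ?S = "{m. f m \<noteq> 0}"
  have S: "finite ?S" using assms by (simp add: finsupp_def)
  have sub: "{m. opX f m \<noteq> 0} \<subseteq> (\<lambda>m. m + 1) ` ?S"
  proof
    fix m assume "m \<in> {m. opX f m \<noteq> 0}"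
    then have "m - 1 \<in> ?S" by (auto simp: opX_def)
    then show "m \<in> (\<lambda>m. m + 1) ` ?S" by (rule rev_image_eqI) simp
  qed
  have "of_laurent (opX f) = (\<Oplus>\<^bsub>A\<^esub> m \<in> (\<lambda>m. m + 1) ` ?S. zmon m \<star> ev (opX f m))"
    by (rule of_laurent_superset [OF finite_imageI [OF S] sub])
  also have "\<dots> = (\<Oplus>\<^bsub>A\<^esub> m \<in> ?S. zmon (m + 1) \<star> ev (opX f (m + 1)))"
    by (rule A.finsum_reindex) (simp_all add: inj_on_def)
  also have "\<dots> = (\<Oplus>\<^bsub>A\<^esub> m \<in> ?S. (zmon m \<star> ev (f m)) \<star> gx)"
  proof (rule A.finsum_cong' [OF refl])
    fix m
    have "(zmon m \<star> ev (f m)) \<star> gx = (zmon m \<star> gx) \<star> ev (psi (f m))"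
      by (simp add: A.m_assoc ev_gx)
    also have "\<dots> = zmon (m + 1) \<star> ev (opX f (m + 1))"
      unfolding zmon_gx by (simp add: opX_def ev_V2 A.m_assoc)
    finally show "zmon (m + 1) \<star> ev (opX f (m + 1)) = (zmon m \<star> ev (f m)) \<star> gx" ..
  qed simp
  also have "\<dots> = of_laurent f \<star> gx"
    unfolding of_laurent_def by (rule A.finsum_ldistr [symmetric]) (use S in simp_all)
  finally show ?thesis .
qed

lemma of_laurent_opY:
  assumes "finsupp f"
  shows "of_laurent (opY f) = of_laurent f \<star> gy"
proof -
  let ?S = "{m. f m \<noteq> 0}"
  have S: "finite ?S" using assms by (simp add: finsupp_def)
  have sub: "{m. opY f m \<noteq> 0} \<subseteq> (\<lambda>m. m - 1) ` ?S"
  proof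
    fix m assume "m \<in> {m. opY f m \<noteq> 0}"
    then have "m + 1 \<in> ?S" by (auto simp: opY_def)
    then show "m \<in> (\<lambda>m. m - 1) ` ?S" by (rule rev_image_eqI) simp
  qed
  have "of_laurent (opY f) = (\<Oplus>\<^bsub>A\<^esub> m \<in> (\<lambda>m. m - 1) ` ?S. zmon m \<star> ev (opY f m))"
    by (rule of_laurent_superset [OF finite_imageI [OF S] sub])
  also have "\<dots> = (\<Oplus>\<^bsub>A\<^esub> m \<in> ?S. zmon (m - 1) \<star> ev (opY f (m - 1)))"
    by (rule A.finsum_reindex) (simp_all add: inj_on_def)
  also have "\<dots> = (\<Oplus>\<^bsub>A\<^esub> m \<in> ?S. (zmon m \<star> ev (f m)) \<star> gy)"
  proof (rule A.finsum_cong' [OF refl])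
    fix m
    have "(zmon m \<star> ev (f m)) \<star> gy = (zmon m \<star> gy) \<star> ev (phi (f m))"
      by (simp add: A.m_assoc ev_gy)
    also have "\<dots> = zmon (m - 1) \<star> ev (opY f (m - 1))"
      unfolding zmon_gy by (simp add: opY_def ev_U2 A.m_assoc)
    finally show "zmon (m - 1) \<star> ev (opY f (m - 1)) = (zmon m \<star> ev (f m)) \<star> gy" ..
  qed simp
  also have "\<dots> = of_laurent f \<star> gy"
    unfolding of_laurent_def by (rule A.finsum_ldistr [symmetric]) (use S in simp_all)
  finally show ?thesis .
qed

lemma finsupp_op_gen: "finsupp f \<Longrightarrow> finsupp (op_gen g f)"
  using finsupp_ops by (cases g) simp_all

lemma of_laurent_op_gen:
  "finsupp f \<Longrightarrow> of_laurent (op_gen g f) = of_laurent f \<star> down_up_generator \<alpha> \<beta> g"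
  by (cases g) (simp_all add: of_laurent_opX of_laurent_opY)

lemma finsupp_unit_laurent: "finsupp unit_laurent"
  unfolding finsupp_def unit_laurent_def by (rule finite_subset [of _ "{0}"]) auto

lemma of_laurent_unit: "of_laurent unit_laurent = \<one>\<^bsub>A\<^esub>"
proof -
  have "of_laurent unit_laurent = (\<Oplus>\<^bsub>A\<^esub> m \<in> {0}. zmon m \<star> ev (unit_laurent m))"
    by (rule of_laurent_superset) (auto simp: unit_laurent_def)
  also have "\<dots> = zmon 0 \<star> ev (unit_laurent 0)" by simp
  also have "\<dots> = \<one>\<^bsub>A\<^esub>" by (simp add: unit_laurent_def zmon_def monomial_Nil ev_1)
  finally show ?thesis .
qed

lemma of_laurent_monomial: "of_laurent (act w unit_laurent) = monomial w \<and> finsupp (act w unit_laurent)"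
proof (induction w rule: rev_induct)
  case Nil
  show ?case by (simp add: of_laurent_unit monomial_Nil finsupp_unit_laurent)
next
  case (snoc g w)
  then show ?case by (simp add: of_laurent_op_gen finsupp_op_gen monomial_snoc)
qed

text \<open>Every word arises from the unit by right multiplications, and \<open>of_laurent\<close>
  intertwines these with the operators, so an element is recovered from its coordinates. This is the
  faithfulness of the representation.\<close>

lemma of_laurent_theta: "a \<in> carrier A \<Longrightarrow> of_laurent (theta a) = a"
proof (induction a rule: down_up_induct)
  case zero
  show ?case by (simp add: theta_zero of_laurent_def)
next
  case (step c w a)
  have w: "of_laurent (act w unit_laurent) = monomial w" "finsupp (act w unit_laurent)"
    using of_laurent_monomial by blast+
  have "theta (c \<cdot> monomial w \<boxplus> a) = (\<lambda>m. const2 c * act w unit_laurent m + theta a m)"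
    using step(1) by (simp add: theta_add theta_smult theta_monomial)
  then show ?case
    using of_laurent_add [OF finsupp_scale [OF w(2)] finsupp_theta [OF step(1)], of "const2 c"]
      of_laurent_scale [OF w(2)] step(2) w(1) by simp
qed

lemma theta_inj: "a \<in> carrier A \<Longrightarrow> b \<in> carrier A \<Longrightarrow> theta a = theta b \<Longrightarrow> a = b"
  using of_laurent_theta by metis

lemma theta_ev1: "a \<in> carrier A \<Longrightarrow> theta (a \<star> ev1 s) = (\<lambda>m. [:s:] * theta a m)"
proof (induction s arbitrary: a)
  case 0
  then show ?case by (simp add: theta_zero)
next
  case (pCons c s)
  have "a \<star> ev1 (pCons c s) = c \<cdot> a \<boxplus> ((a \<star> gx) \<star> gy) \<star> ev1 s"
    using pCons.prems by (simp add: ev1_pCons A.r_distr A.smult_mult_right A.m_assoc)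
  then have "theta (a \<star> ev1 (pCons c s)) = (\<lambda>m. const2 c * theta a m + [:s:] * (U2 * theta a m))"
    using pCons.prems pCons.IH [of "(a \<star> gx) \<star> gy"]
    by (simp add: theta_add theta_smult theta_gx theta_gy opY_opX)
  also have "\<dots> = (\<lambda>m. [:pCons c s:] * theta a m)"
    unfolding const_pCons_eq_U2 by (simp add: algebra_simps)
  finally show ?case .
qed

text \<open>Right multiplication by xy or yx multiplies every coordinate by u or v; Horner's scheme
  extends this to all polynomials.\<close>

lemma theta_ev: "a \<in> carrier A \<Longrightarrow> theta (a \<star> ev r) = (\<lambda>m. r * theta a m)"
proof (induction r arbitrary: a)
  case 0
  then show ?case by (simp add: theta_zero)
next
  case (pCons s r)
  have "a \<star> ev (pCons s r) = a \<star> ev1 s \<boxplus> ((a \<star> gy) \<star> gx) \<star> ev r"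
    using pCons.prems by (simp add: ev_pCons A.r_distr A.m_assoc)
  then have "theta (a \<star> ev (pCons s r)) = (\<lambda>m. [:s:] * theta a m + r * (V2 * theta a m))"
    using pCons.prems pCons.IH [of "(a \<star> gy) \<star> gx"]
    by (simp add: theta_add theta_ev1 theta_gx theta_gy opX_opY)
  also have "\<dots> = (\<lambda>m. pCons s r * theta a m)"
    unfolding pCons_eq_V2 [of s r] by (simp add: algebra_simps)
  finally show ?case .
qed

lemma theta_zmon: "theta (zmon m) = (\<lambda>n. if n = m then 1 else 0)"
proof -
  have X: "theta (monomial (replicate n GenX)) = (\<lambda>k. if k = int n then 1 else 0)" for n
  proof (induction n)
    case 0
    show ?case by (simp add: theta_monomial unit_laurent_def)
  next
    case (Suc n)
    have "monomial (replicate (Suc n) GenX) = monomial (replicate n GenX) \<star> gx"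
      by (simp flip: monomial_snoc replicate_append_same)
    then have "theta (monomial (replicate (Suc n) GenX)) = opX (\<lambda>k. if k = int n then 1 else 0)"
      using Suc.IH by (simp only: theta_gx [OF monomial_closed])
    also have "\<dots> = (\<lambda>k. if k = int (Suc n) then 1 else 0)"
      by (auto simp: opX_def fun_eq_iff)
    finally show ?case .
  qed
  have Y: "theta (monomial (replicate n GenY)) = (\<lambda>k. if k = - int n then 1 else 0)" for n
  proof (induction n)
    case 0
    show ?case by (simp add: theta_monomial unit_laurent_def)
  next
    case (Suc n)
    have "monomial (replicate (Suc n) GenY) = monomial (replicate n GenY) \<star> gy"
      by (simp flip: monomial_snoc replicate_append_same)
    then have "theta (monomial (replicate (Suc n) GenY)) = opY (\<lambda>k. if k = - int n then 1 else 0)"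
      using Suc.IH by (simp only: theta_gy [OF monomial_closed])
    also have "\<dots> = (\<lambda>k. if k = - int (Suc n) then 1 else 0)"
      by (auto simp: opY_def fun_eq_iff)
    finally show ?case .
  qed
  show ?thesis
    using X [of "nat m"] Y [of "nat (- m)"] by (simp add: zmon_def)
qed

text \<open>Together with the injectivity of \<open>theta\<close> this identifies A with the
  finitely supported functions, so operators on coordinates can be transported to A.\<close>

lemma theta_of_laurent:
  assumes "finsupp f"
  shows "theta (of_laurent f) = f"
proof -
  have "finite S \<Longrightarrow> theta (\<Oplus>\<^bsub>A\<^esub> m \<in> S. zmon m \<star> ev (f m)) = (\<lambda>m. if m \<in> S then f m else 0)" for S
  proof (induction S rule: finite_induct)
    case empty
    show ?case by (simp add: theta_zero)
  next
    case (insert m S)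
    have "(\<Oplus>\<^bsub>A\<^esub> m \<in> insert m S. zmon m \<star> ev (f m)) =
        zmon m \<star> ev (f m) \<boxplus> (\<Oplus>\<^bsub>A\<^esub> m \<in> S. zmon m \<star> ev (f m))"
      by (rule A.finsum_insert) (use insert in simp_all)
    then have "theta (\<Oplus>\<^bsub>A\<^esub> m \<in> insert m S. zmon m \<star> ev (f m)) =
        (\<lambda>k. f m * (if k = m then 1 else 0) + (if k \<in> S then f k else 0))"
      using insert.IH by (simp add: theta_add theta_ev theta_zmon A.finsum_closed)
    also have "\<dots> = (\<lambda>k. if k \<in> insert m S then f k else 0)"
      using insert.hyps by (auto simp: fun_eq_iff)
    finally show ?case .
  qed
  from this [of "{m. f m \<noteq> 0}"] assms show ?thesis
    by (auto simp: of_laurent_def finsupp_def fun_eq_iff)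
qed

lemma finsupp_opE: "finsupp f \<Longrightarrow> finsupp (opE f)"
  by (rule finsupp_shift [of f 0]) (simp_all add: opE_def)

text \<open>Right division by x on A: \<open>rho\<close> is the quotient, \<open>eta\<close> the
  remainder, and \<open>sigma\<close> recovers a remainder from its product with xy. They serve as
  k-linear coefficient extractions.\<close>

definition rho where "rho a = of_laurent (opR (theta a))"
definition sigma where "sigma a = of_laurent (opS (theta a))"
definition eta where "eta a = of_laurent (opE (theta a))"

lemma rho_closed [simp]: "rho a \<in> carrier A"
  and sigma_closed [simp]: "sigma a \<in> carrier A"
  and eta_closed [simp]: "eta a \<in> carrier A"
  by (simp_all add: rho_def sigma_def eta_def)

lemma theta_rho: "a \<in> carrier A \<Longrightarrow> theta (rho a) = opR (theta a)"
  and theta_sigma: "a \<in> carrier A \<Longrightarrow> theta (sigma a) = opS (theta a)"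
  and theta_eta: "a \<in> carrier A \<Longrightarrow> theta (eta a) = opE (theta a)"
  by (simp_all add: rho_def sigma_def eta_def theta_of_laurent finsupp_ops finsupp_opE finsupp_theta)

lemma opE_linear:
  "opE (\<lambda>m. f m + g m) = (\<lambda>m. opE f m + opE g m)" "opE (\<lambda>m. const2 c * f m) = (\<lambda>m. const2 c * opE f m)"
  by (auto simp: opE_def fun_eq_iff const2_def mult_pCons_left)

lemma rho_linear:
  "a \<in> carrier A \<Longrightarrow> b \<in> carrier A \<Longrightarrow> rho (a \<boxplus> b) = rho a \<boxplus> rho b" "a \<in> carrier A \<Longrightarrow> rho (c \<cdot> a) = c \<cdot> rho a"
  by (rule theta_inj; simp add: theta_rho theta_add theta_smult opRS_linear)+

lemma sigma_linear:
  "a \<in> carrier A \<Longrightarrow> b \<in> carrier A \<Longrightarrow> sigma (a \<boxplus> b) = sigma a \<boxplus> sigma b" "a \<in> carrier A \<Longrightarrow> sigma (c \<cdot> a) = c \<cdot> sigma a"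
  by (rule theta_inj; simp add: theta_sigma theta_add theta_smult opRS_linear)+

lemma eta_linear:
  "a \<in> carrier A \<Longrightarrow> b \<in> carrier A \<Longrightarrow> eta (a \<boxplus> b) = eta a \<boxplus> eta b" "a \<in> carrier A \<Longrightarrow> eta (c \<cdot> a) = c \<cdot> eta a"
  by (rule theta_inj; simp add: theta_eta theta_add theta_smult opE_linear)+

lemma rho_gx: "a \<in> carrier A \<Longrightarrow> rho (a \<star> gx) = a"
  by (rule theta_inj) (simp_all add: theta_rho theta_gx opR_opX)

lemma sigma_gx: "a \<in> carrier A \<Longrightarrow> sigma (a \<star> gx) = \<zero>\<^bsub>A\<^esub>"
  by (rule theta_inj) (simp_all add: theta_sigma theta_gx opS_opX theta_zero)

lemma eta_rho: "a \<in> carrier A \<Longrightarrow> eta a \<boxplus> rho a \<star> gx = a"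
  by (rule theta_inj) (simp_all add: theta_add theta_eta theta_rho theta_gx flip: opE_opR)

lemma sigma_eta: "a \<in> carrier A \<Longrightarrow> sigma (eta a \<star> UA) = eta a"
  using opS_U2_opE [of "theta a"]
  by (intro theta_inj) (simp_all add: theta_sigma theta_eta theta_gx theta_gy opY_opX flip: A.m_assoc del: A.m_assoc)

lemma rho_eta: "a \<in> carrier A \<Longrightarrow> rho (eta a \<star> UA) = \<zero>\<^bsub>A\<^esub>"
  using opR_U2_opE [of "theta a"]
  by (intro theta_inj) (simp_all add: theta_rho theta_eta theta_gx theta_gy opY_opX theta_zero flip: A.m_assoc del: A.m_assoc)

section \<open>Normal words and a linear section of the free algebra\<close>

lemma act_replicate_XY: "act (concat (replicate i [GenX, GenY])) f = (\<lambda>m. U2 ^ i * f m)"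
  by (induction i arbitrary: f) (simp_all add: opY_opX mult.assoc power_commutes mult.left_commute)

lemma act_replicate_YX: "act (concat (replicate i [GenY, GenX])) f = (\<lambda>m. V2 ^ i * f m)"
  by (induction i arbitrary: f) (simp_all add: opX_opY mult.assoc power_commutes mult.left_commute)

text \<open>The words z_m (xy)^i (yx)^j, whose classes form a basis of A.\<close>

definition normal_word :: "int \<times> nat \<times> nat \<Rightarrow> generator list" where
  "normal_word = (\<lambda>(m, i, j). (if m \<ge> 0 then replicate (nat m) GenX else replicate (nat (- m)) GenY) @
     concat (replicate i [GenX, GenY]) @ concat (replicate j [GenY, GenX]))"

definition coords :: "(int \<Rightarrow> 'k poly poly) \<Rightarrow> int \<times> nat \<times> nat \<Rightarrow> 'k" where
  "coords f = (\<lambda>(m, i, j). coeff (coeff (f m) j) i)"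

lemma coords_linear: "coords (\<lambda>m. f m + g m) = (\<lambda>k. coords f k + coords g k)"
  "coords (\<lambda>m. const2 c * f m) = (\<lambda>k. c * coords f k)"
  by (auto simp: coords_def const2_def mult_pCons_left)

lemma coords_eqI: "coords f = coords g \<Longrightarrow> f = g"
  by (auto simp: coords_def fun_eq_iff poly_eq_iff)

lemma UV_power: "(V2 :: 'k poly poly) ^ j * U2 ^ i = monom (monom 1 i) j"
proof -
  have "U2 ^ i = [:monom 1 i :: 'k poly:]"
    by (induction i) (simp_all add: U2_mult monom_Suc mult_pCons_left one_pCons monom_0)
  moreover have "V2 ^ j = (monom 1 j :: 'k poly poly)"
    by (induction j) (simp_all add: V2_mult monom_Suc)
  ultimately show ?thesis by (simp only: monom_0 [symmetric] mult_monom add_0_right mult_1_left)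
qed

lemma coords_normal_word: "coords (theta (monomial (normal_word k))) = (\<lambda>l. if l = k then 1 else 0)"
proof -
  obtain m i j where k: "k = (m, i, j)" by (cases k)
  have "theta (monomial (normal_word k)) = (\<lambda>n. V2 ^ j * (U2 ^ i * (if n = m then 1 else 0)))"
    using theta_zmon [of m]
    by (simp add: k normal_word_def theta_monomial act_replicate_XY act_replicate_YX zmon_def fun_eq_iff split: if_splits)
  also have "\<dots> = (\<lambda>n. if n = m then monom (monom 1 i) j else 0)"
    by (simp add: fun_eq_iff UV_power)
  finally show ?thesis
    by (auto simp: k coords_def fun_eq_iff)
qed

lemma coords_closed:
  assumes "finsupp f" shows "coords f \<in> carrier (free_left_module field_ring UNIV)"
proof -
  have "{k. coords f k \<noteq> 0} \<subseteq>
      (\<Union>m\<in>{m. f m \<noteq> 0}. \<Union>j\<le>degree (f m). (\<lambda>i. (m, i, j)) ` {..degree (coeff (f m) j)})"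
  proof
    fix k assume k: "k \<in> {k. coords f k \<noteq> 0}"
    obtain m i j where mij: "k = (m, i, j)" by (cases k)
    have c: "coeff (coeff (f m) j) i \<noteq> 0" using k by (simp add: mij coords_def)
    then have "coeff (f m) j \<noteq> 0" "f m \<noteq> 0" by auto
    with c show "k \<in> (\<Union>m\<in>{m. f m \<noteq> 0}. \<Union>j\<le>degree (f m). (\<lambda>i. (m, i, j)) ` {..degree (coeff (f m) j)})"
      by (auto simp: mij le_degree image_iff)
  qed
  then have "finite {k. coords f k \<noteq> 0}"
    by (rule finite_subset) (use assms in \<open>auto simp: finsupp_def\<close>)
  then show ?thesis by (simp add: carrier_free_left_module)
qed

text \<open>A linear choice of representatives. Fox derivatives live on the free algebra, and they
  reach A only through such a section.\<close>

definition section_map :: "(generator list \<Rightarrow> 'k) set \<Rightarrow> generator list \<Rightarrow> 'k" where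
  "section_map a = lin_comb field_ring free_algebra (\<lambda>k. basis_elem (normal_word k)) (coords (theta a))"

lemma left_module_free_algebra:
  "left_module field_ring (free_algebra :: ('k, generator list \<Rightarrow> 'k) module)"
  by (rule k_algebra.left_module_field [OF k_algebra_free])

lemma normal_word_Pi: "(\<lambda>k. basis_elem (normal_word k)) \<in> UNIV \<rightarrow> carrier (free_algebra :: ('k, _) module)"
  by (intro Pi_I free_algebra_basis_elem)

lemma section_map_closed: "a \<in> carrier A \<Longrightarrow> section_map a \<in> carrier free_algebra"
  unfolding section_map_def
  by (rule left_module.lin_comb_closed [OF left_module_free_algebra coords_closed normal_word_Pi]) (rule finsupp_theta)

lemma section_map_add:
  assumes "a \<in> carrier A" "b \<in> carrier A"
  shows "section_map (a \<boxplus> b) = (\<lambda>w. section_map a w + section_map b w)"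
  using left_module.lin_comb_add [OF left_module_free_algebra coords_closed [OF finsupp_theta [OF assms(1)]]
      coords_closed [OF finsupp_theta [OF assms(2)]] normal_word_Pi]
  by (simp add: section_map_def theta_add assms coords_linear)

lemma section_map_smult:
  assumes "a \<in> carrier A"
  shows "section_map (c \<cdot> a) = (\<lambda>w. c * section_map a w)"
  using left_module.lin_comb_smult [OF left_module_free_algebra _ coords_closed [OF finsupp_theta [OF assms(1)]] normal_word_Pi, of c]
  by (simp add: section_map_def theta_smult assms coords_linear)

text \<open>The coordinates determine an element, and in coordinates the normal words are the
  standard basis, so the linear combination with coefficients \<open>coords (theta a)\<close> has
  the coordinates of a.\<close>

lemma cs_section_map:
  assumes a: "a \<in> carrier A" shows "cs (section_map a) = a"
proof -
  let ?L = "lin_comb field_ring (free_algebra :: ('k, _) module) (\<lambda>k. basis_elem (normal_word k))"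
  have cl: "?L c \<in> carrier free_algebra" if "c \<in> carrier (free_left_module field_ring UNIV)" for c
    by (rule left_module.lin_comb_closed [OF left_module_free_algebra that normal_word_Pi])
  have "coords (theta (cs (?L c))) = c" if "c \<in> carrier (free_left_module field_ring UNIV)" for c
    using ring_field_ring that
  proof (induction c rule: free_left_module_induct)
    case zero
    have "?L (\<lambda>i. \<zero>\<^bsub>field_ring\<^esub>) = (\<lambda>w. 0)"
      using left_module.lin_comb_zero [OF left_module_free_algebra, of "\<lambda>k. basis_elem (normal_word k)"] by simp
    then show ?case using coset_zero theta_zero by (simp add: coords_def)
  next
    case (step r k q)
    let ?e = "unit_vector field_ring k :: _ \<Rightarrow> 'k"
    have e: "?e \<in> carrier (free_left_module field_ring UNIV)"
      by (rule unit_vector_closed [OF ring_field_ring]) simp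
    have re: "(\<lambda>j. r * ?e j) \<in> carrier (free_left_module field_ring UNIV)"
      using left_module.smult_closed [OF left_module_free [OF ring_field_ring] _ e, of r] by simp
    have Le: "?L ?e = basis_elem (normal_word k)"
      using left_module.lin_comb_single [OF left_module_free_algebra,
          where r = 1 and i = k and g = "\<lambda>k. basis_elem (normal_word k)"]
      by (simp add: unit_vector_def cong: if_cong)
    have "?L (\<lambda>j. r * ?e j + q j) = (\<lambda>w. r * basis_elem (normal_word k) w + ?L q w)"
      using left_module.lin_comb_add [OF left_module_free_algebra re step(3) normal_word_Pi]
        left_module.lin_comb_smult [OF left_module_free_algebra _ e normal_word_Pi, of r] Le by simp
    then have "cs (?L (\<lambda>j. r * ?e j + q j)) = r \<cdot> monomial (normal_word k) \<boxplus> cs (?L q)"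
      using coset_step [OF cl [OF step(3)]] by simp
    then have "coords (theta (cs (?L (\<lambda>j. r * ?e j + q j)))) =
        (\<lambda>l. r * (if l = k then 1 else 0) + q l)"
      using cs_closed [OF cl [OF step(3)]] step(4)
      by (simp add: theta_add theta_smult coords_linear coords_normal_word)
    then show ?case by (simp add: unit_vector_def fun_eq_iff)
  qed
  from coords_eqI [OF this [OF coords_closed [OF finsupp_theta [OF a]]]]
  have "theta (cs (section_map a)) = theta a" by (simp add: section_map_def)
  then show ?thesis by (rule theta_inj [OF cs_closed [OF section_map_closed [OF a]] a])
qed

section \<open>The enveloping algebra\<close>

lemma env_pair: "algebra_pair A (opposite_algebra A)"
  by (rule algebra_pair.intro [OF k_algebra_down_up k_algebra_opposite [OF k_algebra_down_up]])

abbreviation "E \<equiv> enveloping_algebra A"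
abbreviation tens (infix "\<bowtie>" 72) where "a \<bowtie> b \<equiv> pure_tensor A (opposite_algebra A) a b"
abbreviation multE (infixl "\<odot>\<odot>" 70) where "s \<odot>\<odot> t \<equiv> s \<otimes>\<^bsub>E\<^esub> t"
abbreviation plusE (infixl "\<oplus>\<oplus>" 65) where "s \<oplus>\<oplus> t \<equiv> s \<oplus>\<^bsub>E\<^esub> t"
abbreviation scalE (infixr "\<diamondop>" 75) where "c \<diamondop> t \<equiv> c \<odot>\<^bsub>E\<^esub> t"
abbreviation "oneA \<equiv> \<one>\<^bsub>A\<^esub>"

sublocale E: k_algebra E
  using env_pair k_algebra_down_up
  by (simp add: tensor_algebra_def algebra_pair.ideal_tensor
      k_algebra.k_algebra_quotient [OF k_algebra_monoid_algebra [OF algebra_pair.monoid_pair [OF env_pair]]])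

lemma tens_closed [simp, intro]: "a \<in> carrier A \<Longrightarrow> b \<in> carrier A \<Longrightarrow> a \<bowtie> b \<in> carrier E"
  by (rule algebra_pair.pt_closed [OF env_pair]) simp_all

lemma tens_mult [simp]:
  assumes "a \<in> carrier A" "b \<in> carrier A" "c \<in> carrier A" "d \<in> carrier A"
  shows "(a \<bowtie> b) \<odot>\<odot> (c \<bowtie> d) = (a \<star> c) \<bowtie> (d \<star> b)"
  using algebra_pair.pt_mult [OF env_pair, of a b c d] assms by simp

lemma tens_one: "oneA \<bowtie> oneA = \<one>\<^bsub>E\<^esub>"
  using algebra_pair.pt_one [OF env_pair] by simp

lemma tens_add_left:
  "a \<in> carrier A \<Longrightarrow> a' \<in> carrier A \<Longrightarrow> b \<in> carrier A \<Longrightarrow> (a \<boxplus> a') \<bowtie> b = (a \<bowtie> b) \<oplus>\<oplus> (a' \<bowtie> b)"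
  using algebra_pair.pt_add_left [OF env_pair, of a a' b] by simp

lemma tens_add_right:
  "a \<in> carrier A \<Longrightarrow> b \<in> carrier A \<Longrightarrow> b' \<in> carrier A \<Longrightarrow> a \<bowtie> (b \<boxplus> b') = (a \<bowtie> b) \<oplus>\<oplus> (a \<bowtie> b')"
  using algebra_pair.pt_add_right [OF env_pair, of a b b'] by simp

lemma tens_smult_left: "a \<in> carrier A \<Longrightarrow> b \<in> carrier A \<Longrightarrow> (c \<cdot> a) \<bowtie> b = c \<diamondop> (a \<bowtie> b)"
  using algebra_pair.pt_smult_left [OF env_pair, of a b c] by simp

lemma tens_smult_right: "a \<in> carrier A \<Longrightarrow> b \<in> carrier A \<Longrightarrow> a \<bowtie> (c \<cdot> b) = c \<diamondop> (a \<bowtie> b)"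
  using algebra_pair.pt_smult_right [OF env_pair, of a b c] by simp

lemma tens_zero_left [simp]: "b \<in> carrier A \<Longrightarrow> \<zero>\<^bsub>A\<^esub> \<bowtie> b = \<zero>\<^bsub>E\<^esub>"
  using algebra_pair.pt_zero_left [OF env_pair, of b] by simp

lemma env_induct [consumes 1, case_names zero add]:
  assumes "t \<in> carrier E" "P \<zero>\<^bsub>E\<^esub>"
    and "\<And>a b t. a \<in> carrier A \<Longrightarrow> b \<in> carrier A \<Longrightarrow> t \<in> carrier E \<Longrightarrow> P t \<Longrightarrow> P ((a \<bowtie> b) \<oplus>\<oplus> t)"
  shows "P t"
  using algebra_pair.tensor_induct [OF env_pair assms(1), of P] assms(2,3) by simp

definition linear_A :: "((generator list \<Rightarrow> 'k) set \<Rightarrow> (generator list \<Rightarrow> 'k) set) \<Rightarrow> bool" where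
  "linear_A L \<longleftrightarrow> (\<forall>a\<in>carrier A. L a \<in> carrier A) \<and>
     (\<forall>a\<in>carrier A. \<forall>b\<in>carrier A. L (a \<boxplus> b) = L a \<boxplus> L b) \<and> (\<forall>c. \<forall>a\<in>carrier A. L (c \<cdot> a) = c \<cdot> L a)"

lemma linear_A_simps: "linear_A rho" "linear_A sigma" "linear_A eta"
  by (simp_all add: linear_A_def rho_linear sigma_linear eta_linear)

text \<open>The operator L tensor id on the enveloping algebra.\<close>

definition left_op where "left_op L = tensor_lift E (\<lambda>a b. L a \<bowtie> b)"

context
  fixes L assumes L: "linear_A L"
begin

lemma left_op_bilinear: "bilinear_map A (opposite_algebra A) E (\<lambda>a b. L a \<bowtie> b)"
  using L by (simp add: bilinear_map_def linear_A_def tens_add_left tens_add_right tens_smult_left tens_smult_right)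

lemma left_op_closed [simp]: "t \<in> carrier E \<Longrightarrow> left_op L t \<in> carrier E"
  unfolding left_op_def by (rule algebra_pair.tensor_lift_closed [OF env_pair E.left_module_field left_op_bilinear])

lemma left_op_add: "s \<in> carrier E \<Longrightarrow> t \<in> carrier E \<Longrightarrow> left_op L (s \<oplus>\<oplus> t) = left_op L s \<oplus>\<oplus> left_op L t"
  unfolding left_op_def by (rule algebra_pair.tensor_lift_add [OF env_pair E.left_module_field left_op_bilinear])

lemma left_op_tens: "a \<in> carrier A \<Longrightarrow> b \<in> carrier A \<Longrightarrow> left_op L (a \<bowtie> b) = L a \<bowtie> b"
  unfolding left_op_def
  using algebra_pair.tensor_lift_pt [OF env_pair E.left_module_field left_op_bilinear, of a b] by simp

lemma left_op_zero [simp]: "left_op L \<zero>\<^bsub>E\<^esub> = \<zero>\<^bsub>E\<^esub>"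
  using left_op_add [of "\<zero>\<^bsub>E\<^esub>" "\<zero>\<^bsub>E\<^esub>"] by simp

lemma left_op_smult: "t \<in> carrier E \<Longrightarrow> left_op L (c \<diamondop> t) = c \<diamondop> left_op L t"
proof (induction t rule: env_induct)
  case (add a b t)
  have "c \<diamondop> ((a \<bowtie> b) \<oplus>\<oplus> t) = ((c \<cdot> a) \<bowtie> b) \<oplus>\<oplus> c \<diamondop> t"
    using add by (simp add: E.smult_r_distr tens_smult_left)
  moreover have "left_op L ((c \<cdot> a) \<bowtie> b) = c \<diamondop> left_op L (a \<bowtie> b)"
  proof -
    have "left_op L ((c \<cdot> a) \<bowtie> b) = (c \<cdot> L a) \<bowtie> b"
      using left_op_tens [of "c \<cdot> a" b] add(1,2) L by (simp add: linear_A_def)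
    moreover have "L a \<in> carrier A" using add(1) L by (simp add: linear_A_def)
    ultimately show ?thesis using add(1,2) by (simp add: left_op_tens tens_smult_left)
  qed
  ultimately show ?case using add by (simp add: left_op_add E.smult_r_distr)
qed simp

lemma left_op_mult_right:
  "t \<in> carrier E \<Longrightarrow> c \<in> carrier A \<Longrightarrow> left_op L (t \<odot>\<odot> (oneA \<bowtie> c)) = left_op L t \<odot>\<odot> (oneA \<bowtie> c)"
proof (induction t rule: env_induct)
  case (add a b t)
  have "L a \<in> carrier A" using add(1) L by (simp add: linear_A_def)
  then show ?case using add by (simp add: E.l_distr left_op_add left_op_tens)
qed simp

lemma left_op_mult:
  assumes t: "t \<in> carrier E" and c: "c \<in> carrier A" and K: "linear_A K"
    and eq: "\<And>a. a \<in> carrier A \<Longrightarrow> L (a \<star> c) = K a"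
  shows "left_op L (t \<odot>\<odot> (c \<bowtie> oneA)) = tensor_lift E (\<lambda>a b. K a \<bowtie> b) t"
  using t
proof (induction t rule: env_induct)
  have bil: "bilinear_map A (opposite_algebra A) E (\<lambda>a b. K a \<bowtie> b)"
    using K by (simp add: bilinear_map_def linear_A_def tens_add_left tens_add_right tens_smult_left tens_smult_right)
  note lift = algebra_pair.tensor_lift_add [OF env_pair E.left_module_field bil]
    algebra_pair.tensor_lift_pt [OF env_pair E.left_module_field bil, simplified]
    algebra_pair.tensor_lift_closed [OF env_pair E.left_module_field bil]
  case zero
  have "tensor_lift E (\<lambda>a b. K a \<bowtie> b) \<zero>\<^bsub>E\<^esub> = \<zero>\<^bsub>E\<^esub>"
    using lift(1) [of "\<zero>\<^bsub>E\<^esub>" "\<zero>\<^bsub>E\<^esub>"] lift(3) [of "\<zero>\<^bsub>E\<^esub>"] by simp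
  then show ?case using c by simp
next
  have bil: "bilinear_map A (opposite_algebra A) E (\<lambda>a b. K a \<bowtie> b)"
    using K by (simp add: bilinear_map_def linear_A_def tens_add_left tens_add_right tens_smult_left tens_smult_right)
  note lift = algebra_pair.tensor_lift_add [OF env_pair E.left_module_field bil]
    algebra_pair.tensor_lift_pt [OF env_pair E.left_module_field bil, simplified]
  case (add a b t)
  have "K a \<in> carrier A" using add(1) K by (simp add: linear_A_def)
  then show ?case using add c eq [OF add(1)] by (simp add: E.l_distr left_op_add left_op_tens lift)
qed

end

lemma left_op_mult_left:
  assumes "linear_A L" "linear_A K" "t \<in> carrier E" "c \<in> carrier A"
    and "\<And>a. a \<in> carrier A \<Longrightarrow> L (a \<star> c) = K a"
  shows "left_op L (t \<odot>\<odot> (c \<bowtie> oneA)) = left_op K t"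
  using left_op_mult [OF assms(1,3,4,2,5)] by (simp add: left_op_def)

lemma left_op_id: "t \<in> carrier E \<Longrightarrow> left_op (\<lambda>a. a) t = t"
proof (induction t rule: env_induct)
  have L: "linear_A (\<lambda>a. a)" by (simp add: linear_A_def)
  case zero
  show ?case by (rule left_op_zero [OF L])
next
  have L: "linear_A (\<lambda>a. a)" by (simp add: linear_A_def)
  case (add a b t)
  then show ?case by (simp add: left_op_add [OF L] left_op_tens [OF L])
qed

lemma left_op_const_zero: "t \<in> carrier E \<Longrightarrow> left_op (\<lambda>a. \<zero>\<^bsub>A\<^esub>) t = \<zero>\<^bsub>E\<^esub>"
proof (induction t rule: env_induct)
  have L: "linear_A (\<lambda>a. \<zero>\<^bsub>A\<^esub>)" by (simp add: linear_A_def)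
  case zero
  show ?case by (rule left_op_zero [OF L])
next
  have L: "linear_A (\<lambda>a. \<zero>\<^bsub>A\<^esub>)" by (simp add: linear_A_def)
  case (add a b t)
  then show ?case by (simp add: left_op_add [OF L] left_op_tens [OF L])
qed

abbreviation "rhoE \<equiv> left_op rho"
abbreviation "sigmaE \<equiv> left_op sigma"
abbreviation "etaE \<equiv> left_op eta"

lemmas rhoE_simps = left_op_closed [OF linear_A_simps(1)] left_op_add [OF linear_A_simps(1)]
  left_op_smult [OF linear_A_simps(1)] left_op_mult_right [OF linear_A_simps(1)] left_op_zero [OF linear_A_simps(1)]
lemmas sigmaE_simps = left_op_closed [OF linear_A_simps(2)] left_op_add [OF linear_A_simps(2)]
  left_op_smult [OF linear_A_simps(2)] left_op_mult_right [OF linear_A_simps(2)] left_op_zero [OF linear_A_simps(2)]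

abbreviation "X1 \<equiv> gx \<bowtie> oneA"
abbreviation "Y1 \<equiv> gy \<bowtie> oneA"
abbreviation "X2 \<equiv> oneA \<bowtie> gx"
abbreviation "Y2 \<equiv> oneA \<bowtie> gy"

lemma rhoE_X1: "t \<in> carrier E \<Longrightarrow> rhoE (t \<odot>\<odot> X1) = t"
  using left_op_mult_left [OF linear_A_simps(1), of "\<lambda>a. a" t gx]
  by (simp add: left_op_id rho_gx) (simp add: linear_A_def)

lemma sigmaE_X1: "t \<in> carrier E \<Longrightarrow> sigmaE (t \<odot>\<odot> X1) = \<zero>\<^bsub>E\<^esub>"
  using left_op_mult_left [OF linear_A_simps(2), of "\<lambda>a. \<zero>\<^bsub>A\<^esub>" t gx]
  by (simp add: left_op_const_zero sigma_gx) (simp add: linear_A_def)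

lemma etaE_decompose: "t \<in> carrier E \<Longrightarrow> etaE t \<oplus>\<oplus> rhoE t \<odot>\<odot> X1 = t"
proof (induction t rule: env_induct)
  case zero
  show ?case by (simp add: left_op_zero [OF linear_A_simps(1)] left_op_zero [OF linear_A_simps(3)])
next
  case (add a b t)
  have "(eta a \<bowtie> b) \<oplus>\<oplus> (rho a \<bowtie> b) \<odot>\<odot> X1 = a \<bowtie> b"
    using add(1,2) by (simp add: eta_rho flip: tens_add_left)
  moreover have "etaE ((a \<bowtie> b) \<oplus>\<oplus> t) \<oplus>\<oplus> rhoE ((a \<bowtie> b) \<oplus>\<oplus> t) \<odot>\<odot> X1 =
      ((eta a \<bowtie> b) \<oplus>\<oplus> (rho a \<bowtie> b) \<odot>\<odot> X1) \<oplus>\<oplus> (etaE t \<oplus>\<oplus> rhoE t \<odot>\<odot> X1)"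
    using add(1-3) by (simp add: left_op_add [OF linear_A_simps(1)] left_op_add [OF linear_A_simps(3)]
        left_op_tens [OF linear_A_simps(1)] left_op_tens [OF linear_A_simps(3)]
        left_op_closed [OF linear_A_simps(1)] left_op_closed [OF linear_A_simps(3)]
        E.l_distr E.a_ac del: tens_mult)
  ultimately show ?case using add(4) by simp
qed

lemma rho_sigma_etaE:
  "t \<in> carrier E \<Longrightarrow> sigmaE (etaE t \<odot>\<odot> (UA \<bowtie> oneA)) = etaE t \<and> rhoE (etaE t \<odot>\<odot> (UA \<bowtie> oneA)) = \<zero>\<^bsub>E\<^esub>"
proof (induction t rule: env_induct)
  case zero
  show ?case
    by (simp add: left_op_zero [OF linear_A_simps(1)] left_op_zero [OF linear_A_simps(2)] left_op_zero [OF linear_A_simps(3)])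
next
  case (add a b t)
  then show ?case
    by (simp add: left_op_add [OF linear_A_simps(1)] left_op_add [OF linear_A_simps(2)] left_op_add [OF linear_A_simps(3)]
        left_op_tens [OF linear_A_simps(1)] left_op_tens [OF linear_A_simps(2)] left_op_tens [OF linear_A_simps(3)]
        left_op_closed [OF linear_A_simps(3)] E.l_distr sigma_eta rho_eta)
qed

text \<open>Only the left tensor factors are filtered. Multiplications in the second factor leave
  the level unchanged, so they do not disturb the descent arguments.\<close>

inductive filt :: "nat \<Rightarrow> ((generator list \<Rightarrow> 'k) set \<times> (generator list \<Rightarrow> 'k) set \<Rightarrow> 'k) set \<Rightarrow> bool"
  for n where
  zero: "filt n \<zero>\<^bsub>E\<^esub>"
| step: "a \<in> carrier A \<Longrightarrow> filtered n (theta a) \<Longrightarrow> b \<in> carrier A \<Longrightarrow> filt n t \<Longrightarrow> filt n ((a \<bowtie> b) \<oplus>\<oplus> t)"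

lemma filt_closed: "filt n t \<Longrightarrow> t \<in> carrier E"
  by (induction rule: filt.induct) auto

lemma filt_add: "filt n s \<Longrightarrow> filt n t \<Longrightarrow> filt n (s \<oplus>\<oplus> t)"
proof (induction rule: filt.induct)
  case zero
  then show ?case using filt_closed by simp
next
  case (step a b s)
  then show ?case
    using filt.step [of a n b "s \<oplus>\<oplus> t"] filt_closed [of n s] filt_closed [of n t] by (simp add: E.a_assoc)
qed

lemma filt_mono: "filt n t \<Longrightarrow> n \<le> n' \<Longrightarrow> filt n' t"
  by (induction rule: filt.induct) (auto intro: filt.intros filtered_mono)

lemma filt_0: "filt 0 t \<Longrightarrow> t = \<zero>\<^bsub>E\<^esub>"
proof (induction rule: filt.induct)
  case (step a b t)
  have "theta a = theta \<zero>\<^bsub>A\<^esub>" using filtered_0 [OF step(2)] by (simp add: theta_zero)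
  then have "a = \<zero>\<^bsub>A\<^esub>" using step(1) by (intro theta_inj) simp_all
  then show ?case using step by simp
qed simp

lemma filt_exists: "t \<in> carrier E \<Longrightarrow> \<exists>n. filt n t"
proof (induction t rule: env_induct)
  case zero
  show ?case by (blast intro: filt.zero)
next
  case (add a b t)
  obtain n where n: "filt n t" using add by blast
  obtain n' where n': "filtered n' (theta a)" using filtered_exists [OF finsupp_theta [OF add(1)]] by blast
  have "filt (max n n') ((a \<bowtie> b) \<oplus>\<oplus> t)"
    by (rule filt.step [OF add(1) filtered_mono [OF n'] add(2) filt_mono [OF n]]) simp_all
  then show ?case by blast
qed

lemma filt_left_op:
  assumes L: "linear_A L" and n: "\<And>a. a \<in> carrier A \<Longrightarrow> filtered n (theta a) \<Longrightarrow> filtered n' (theta (L a))"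
  shows "filt n t \<Longrightarrow> filt n' (left_op L t)"
proof (induction rule: filt.induct)
  case zero
  show ?case using left_op_zero [OF L] filt.zero by simp
next
  case (step a b t)
  have "L a \<in> carrier A" using L step(1) by (simp add: linear_A_def)
  then show ?case
    using filt.step [of "L a" n' b "left_op L t"] n step filt_closed [of n t]
    by (simp add: left_op_add [OF L] left_op_tens [OF L])
qed

lemma filt_rhoE: "filt n t \<Longrightarrow> filt (n - 1) (rhoE t)"
  by (rule filt_left_op [OF linear_A_simps(1)]) (simp_all only: theta_rho filtered_opR)

lemma filt_sigmaE: "filt n t \<Longrightarrow> filt (n - 2) (sigmaE t)"
  by (rule filt_left_op [OF linear_A_simps(2)]) (simp_all add: theta_sigma filtered_opS)

lemma filt_Y1: "filt n t \<Longrightarrow> filt (Suc n) (t \<odot>\<odot> Y1)"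
proof (induction rule: filt.induct)
  case zero
  show ?case using filt.zero by simp
next
  case (step a b t)
  then show ?case
    using filt.step [of "a \<star> gy" "Suc n" b "t \<odot>\<odot> Y1"] filt_closed [of n t]
    by (simp add: E.l_distr theta_gy filtered_opY)
qed

lemma filt_mult_right: "filt n t \<Longrightarrow> c \<in> carrier A \<Longrightarrow> filt n (t \<odot>\<odot> (oneA \<bowtie> c))"
proof (induction rule: filt.induct)
  case zero
  then show ?case using filt.zero by simp
next
  case (step a b t)
  then show ?case
    using filt.step [of a n "c \<star> b" "t \<odot>\<odot> (oneA \<bowtie> c)"] filt_closed [of n t] by (simp add: E.l_distr)
qed

lemma filtered_scale: "filtered n f \<Longrightarrow> filtered n (\<lambda>m. const2 c * f m)"
proof (rule filteredI)
  fix m assume f: "filtered n f" and "const2 c * f m \<noteq> 0"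
  then have "f m \<noteq> 0" by auto
  then obtain d where "nat \<bar>m\<bar> + 2 * d < n" "deg_le d (f m)" by (rule filteredE [OF f])
  then show "\<exists>d. nat \<bar>m\<bar> + 2 * d < n \<and> deg_le d (const2 c * f m)" using deg_le_const2_mult by blast
qed

lemma filt_smult: "filt n t \<Longrightarrow> filt n (c \<diamondop> t)"
proof (induction rule: filt.induct)
  case zero
  then show ?case using filt.zero by simp
next
  case (step a b t)
  then show ?case
    using filt.step [of "c \<cdot> a" n b "c \<diamondop> t"] filt_closed [of n t]
    by (simp add: E.smult_r_distr tens_smult_left theta_smult filtered_scale)
qed

section \<open>The bimodule resolution\<close>

text \<open>The Fox derivative with values in the enveloping algebra: the sum of p tensor s over all
  factorisations p g s of the word.\<close>

primrec fox_word where
  "fox_word g [] = \<zero>\<^bsub>E\<^esub>"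
| "fox_word g (h # w) = (if h = g then oneA \<bowtie> monomial w else \<zero>\<^bsub>E\<^esub>) \<oplus>\<oplus>
     (down_up_generator \<alpha> \<beta> h \<bowtie> oneA) \<odot>\<odot> fox_word g w"

lemma fox_word_closed [simp]: "fox_word g w \<in> carrier E"
  by (induction w) simp_all

text \<open>The letter g is met either in v or in w. As the second tensor factor carries the
  opposite product, left multiplication by 1 tensor w appends w on the right.\<close>

lemma fox_word_append:
  "fox_word g (v @ w) = (oneA \<bowtie> monomial w) \<odot>\<odot> fox_word g v \<oplus>\<oplus> (monomial v \<bowtie> oneA) \<odot>\<odot> fox_word g w"
proof (induction v)
  case Nil
  show ?case by (simp add: monomial_Nil tens_one)
next
  case (Cons h v)
  let ?h = "down_up_generator \<alpha> \<beta> h"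
  have 1: "(?h \<bowtie> oneA) \<odot>\<odot> ((oneA \<bowtie> monomial w) \<odot>\<odot> fox_word g v) = (oneA \<bowtie> monomial w) \<odot>\<odot> ((?h \<bowtie> oneA) \<odot>\<odot> fox_word g v)"
    by (simp flip: E.m_assoc)
  have 2: "(?h \<bowtie> oneA) \<odot>\<odot> ((monomial v \<bowtie> oneA) \<odot>\<odot> fox_word g w) = (monomial (h # v) \<bowtie> oneA) \<odot>\<odot> fox_word g w"
    by (simp add: monomial_Cons flip: E.m_assoc)
  have 3: "oneA \<bowtie> monomial (v @ w) = (oneA \<bowtie> monomial w) \<odot>\<odot> (oneA \<bowtie> monomial v)"
    by (simp add: monomial_append)
  show ?case
    by (simp add: Cons.IH E.r_distr 1 2 3 E.a_assoc del: tens_mult)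
qed

definition fox where "fox g f = lin_comb field_ring E (fox_word g) f"

lemma fox_word_Pi: "fox_word g \<in> carrier word_monoid \<rightarrow> carrier E"
  by simp

lemma fox_closed [simp]: "f \<in> carrier free_algebra \<Longrightarrow> fox g f \<in> carrier E"
  unfolding fox_def by (rule lin_comb_monoid_algebra_closed [OF E.left_module_field fox_word_Pi])

lemma fox_add: "f \<in> carrier free_algebra \<Longrightarrow> h \<in> carrier free_algebra \<Longrightarrow>
    fox g (\<lambda>w. f w + h w) = fox g f \<oplus>\<oplus> fox g h"
  unfolding fox_def by (rule lin_comb_monoid_algebra_add [OF E.left_module_field fox_word_Pi])

lemma fox_smult: "f \<in> carrier free_algebra \<Longrightarrow> fox g (\<lambda>w. c * f w) = c \<diamondop> fox g f"
  unfolding fox_def by (rule lin_comb_monoid_algebra_smult [OF E.left_module_field fox_word_Pi])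

lemma fox_basis_elem: "fox g (basis_elem w) = fox_word g w"
  unfolding fox_def by (rule lin_comb_basis_elem [OF E.left_module_field]) simp

lemma fox_zero: "fox g (\<lambda>w. 0) = \<zero>\<^bsub>E\<^esub>"
  using left_module.lin_comb_zero [OF E.left_module_field, of "fox_word g"] by (simp add: fox_def)

lemma fox_step: "f \<in> carrier free_algebra \<Longrightarrow>
    fox g (\<lambda>w. c * basis_elem u w + f w) = c \<diamondop> fox_word g u \<oplus>\<oplus> fox g f"
  by (simp add: fox_add free_algebra_scale fox_smult fox_basis_elem)

lemma free_mult_closed: "f \<in> carrier free_algebra \<Longrightarrow> h \<in> carrier free_algebra \<Longrightarrow>
    f \<otimes>\<^bsub>free_algebra\<^esub> h \<in> carrier (free_algebra :: ('k, generator list \<Rightarrow> 'k) module)"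
  by (rule monoid_algebra_mult_closed [OF monoid_word_monoid])

lemma free_step_left:
  fixes f h :: "generator list \<Rightarrow> 'k"
  assumes "f \<in> carrier free_algebra" "h \<in> carrier free_algebra"
  shows "(\<lambda>w. c * basis_elem u w + f w) \<otimes>\<^bsub>free_algebra\<^esub> h =
      (\<lambda>w. c * (basis_elem u \<otimes>\<^bsub>free_algebra\<^esub> h) w + (f \<otimes>\<^bsub>free_algebra\<^esub> h) w)"
proof -
  interpret F: k_algebra "free_algebra :: ('k, generator list \<Rightarrow> 'k) module" by (rule k_algebra_free)
  show ?thesis
    using F.l_distr [OF free_algebra_scale [OF free_algebra_basis_elem] assms, of c u]
      F.smult_mult_left [OF free_algebra_basis_elem assms(2), of c u] by simp
qed

lemma free_step_right:
  fixes f h :: "generator list \<Rightarrow> 'k"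
  assumes "f \<in> carrier free_algebra" "h \<in> carrier free_algebra"
  shows "h \<otimes>\<^bsub>free_algebra\<^esub> (\<lambda>w. c * basis_elem u w + f w) =
      (\<lambda>w. c * (h \<otimes>\<^bsub>free_algebra\<^esub> basis_elem u) w + (h \<otimes>\<^bsub>free_algebra\<^esub> f) w)"
proof -
  interpret F: k_algebra "free_algebra :: ('k, generator list \<Rightarrow> 'k) module" by (rule k_algebra_free)
  show ?thesis
    using F.r_distr [OF free_algebra_scale [OF free_algebra_basis_elem] assms, of c u]
      F.smult_mult_right [OF assms(2) free_algebra_basis_elem, of c u] by simp
qed

lemma free_basis_mult:
  "basis_elem u \<otimes>\<^bsub>free_algebra\<^esub> basis_elem v = (basis_elem (u @ v) :: generator list \<Rightarrow> 'k)"
  by (simp add: basis_elem_mult)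

lemma free_mult_zero:
  fixes f :: "generator list \<Rightarrow> 'k"
  assumes "f \<in> carrier free_algebra"
  shows "f \<otimes>\<^bsub>free_algebra\<^esub> (\<lambda>w. 0) = (\<lambda>w. 0)" "(\<lambda>w. 0) \<otimes>\<^bsub>free_algebra\<^esub> f = (\<lambda>w. 0)"
proof -
  interpret F: k_algebra "free_algebra :: ('k, generator list \<Rightarrow> 'k) module" by (rule k_algebra_free)
  show "f \<otimes>\<^bsub>free_algebra\<^esub> (\<lambda>w. 0) = (\<lambda>w. 0)" "(\<lambda>w. 0) \<otimes>\<^bsub>free_algebra\<^esub> f = (\<lambda>w. 0)"
    using F.r_null [OF assms] F.l_null [OF assms] by simp_all
qed

lemma fox_basis_mult:
  "h \<in> carrier free_algebra \<Longrightarrow> fox g (basis_elem u \<otimes>\<^bsub>free_algebra\<^esub> h) =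
    (oneA \<bowtie> cs h) \<odot>\<odot> fox_word g u \<oplus>\<oplus> (monomial u \<bowtie> oneA) \<odot>\<odot> fox g h"
proof (induction h rule: monoid_algebra_induct)
  case zero
  show ?case
    by (simp add: free_mult_zero [OF free_algebra_basis_elem] fox_zero coset_zero tens_smult_right [of oneA "\<zero>\<^bsub>A\<^esub>" 0, simplified])
next
  case (step c v h)
  have [simp]: "cs h \<in> carrier A" by (rule cs_closed [OF step(2)])
  have "fox g (basis_elem u \<otimes>\<^bsub>free_algebra\<^esub> (\<lambda>w. c * basis_elem v w + h w)) =
      c \<diamondop> fox_word g (u @ v) \<oplus>\<oplus> fox g (basis_elem u \<otimes>\<^bsub>free_algebra\<^esub> h)"
    unfolding free_step_right [OF step(2) free_algebra_basis_elem] free_basis_mult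
    by (rule fox_step [OF free_mult_closed [OF free_algebra_basis_elem step(2)]])
  then show ?case
    using step(2)
    by (simp add: step(3) fox_word_append coset_step fox_step tens_add_right tens_smult_right
        E.smult_r_distr E.l_distr E.r_distr E.smult_mult_left E.smult_mult_right E.a_ac)
qed

text \<open>Leibniz rule on the free algebra. Outside the derivatives only the classes in A of the
  factors occur, so for a product with an element of the ideal one of the two terms
  disappears.\<close>

lemma fox_mult:
  assumes h: "h \<in> carrier free_algebra"
  shows "f \<in> carrier free_algebra \<Longrightarrow> fox g (f \<otimes>\<^bsub>free_algebra\<^esub> h) =
    (oneA \<bowtie> cs h) \<odot>\<odot> fox g f \<oplus>\<oplus> (cs f \<bowtie> oneA) \<odot>\<odot> fox g h"
proof (induction f rule: monoid_algebra_induct)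
  case zero
  show ?case using h cs_closed [OF h]
    by (simp add: free_mult_zero [OF h] fox_zero coset_zero)
next
  case (step c u f)
  have [simp]: "cs f \<in> carrier A" "cs h \<in> carrier A"
    by (rule cs_closed [OF step(2)], rule cs_closed [OF h])
  have "fox g ((\<lambda>w. c * basis_elem u w + f w) \<otimes>\<^bsub>free_algebra\<^esub> h) =
      c \<diamondop> fox g (basis_elem u \<otimes>\<^bsub>free_algebra\<^esub> h) \<oplus>\<oplus> fox g (f \<otimes>\<^bsub>free_algebra\<^esub> h)"
    unfolding free_step_left [OF step(2) h]
    by (simp add: fox_add fox_smult free_algebra_scale free_mult_closed h step(2))
  then show ?case
    using step(2) h
    by (simp add: step(3) fox_basis_mult coset_step fox_step tens_add_left tens_smult_left
        E.smult_r_distr E.l_distr E.r_distr E.smult_mult_left E.smult_mult_right E.a_ac)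
qed

definition "dX = X1 \<ominus>\<^bsub>E\<^esub> X2"
definition "dY = Y1 \<ominus>\<^bsub>E\<^esub> Y2"

lemma dXY_closed [simp]: "dX \<in> carrier E" "dY \<in> carrier E"
  by (simp_all add: dX_def dY_def)

text \<open>The fundamental formula of Fox calculus: the letters of w are moved across the tensor
  sign one at a time, and the differences telescope.\<close>

lemma fox_word_boundary:
  "fox_word GenX w \<odot>\<odot> dX \<oplus>\<oplus> fox_word GenY w \<odot>\<odot> dY = (monomial w \<bowtie> oneA) \<ominus>\<^bsub>E\<^esub> (oneA \<bowtie> monomial w)"
proof (induction w)
  case Nil
  show ?case by (simp add: monomial_Nil E.minus_eq E.r_neg)
next
  case (Cons h w)
  let ?h = "down_up_generator \<alpha> \<beta> h" and ?fX = "fox_word GenX w" and ?fY = "fox_word GenY w"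
  define dh where "dh = (?h \<bowtie> oneA) \<ominus>\<^bsub>E\<^esub> (oneA \<bowtie> ?h)"
  have dh: "dh \<in> carrier E" by (simp add: dh_def)
  have "fox_word GenX (h # w) \<odot>\<odot> dX \<oplus>\<oplus> fox_word GenY (h # w) \<odot>\<odot> dY =
      (oneA \<bowtie> monomial w) \<odot>\<odot> dh \<oplus>\<oplus> (?h \<bowtie> oneA) \<odot>\<odot> (?fX \<odot>\<odot> dX \<oplus>\<oplus> ?fY \<odot>\<odot> dY)"
    by (cases h) (simp_all add: dh_def dX_def [symmetric] dY_def [symmetric] E.l_distr E.r_distr E.m_assoc E.a_ac)
  also have "(oneA \<bowtie> monomial w) \<odot>\<odot> dh = (?h \<bowtie> monomial w) \<ominus>\<^bsub>E\<^esub> (oneA \<bowtie> monomial (h # w))"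
    by (simp add: dh_def E.minus_eq E.r_distr E.r_minus monomial_Cons)
  also have "(?h \<bowtie> oneA) \<odot>\<odot> (?fX \<odot>\<odot> dX \<oplus>\<oplus> ?fY \<odot>\<odot> dY) = (monomial (h # w) \<bowtie> oneA) \<ominus>\<^bsub>E\<^esub> (?h \<bowtie> monomial w)"
    unfolding Cons.IH by (simp add: E.minus_eq E.r_distr E.r_minus monomial_Cons)
  also have "((?h \<bowtie> monomial w) \<ominus>\<^bsub>E\<^esub> (oneA \<bowtie> monomial (h # w))) \<oplus>\<oplus>
      ((monomial (h # w) \<bowtie> oneA) \<ominus>\<^bsub>E\<^esub> (?h \<bowtie> monomial w)) =
      (monomial (h # w) \<bowtie> oneA) \<ominus>\<^bsub>E\<^esub> (oneA \<bowtie> monomial (h # w))"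
  proof -
    have "(p \<ominus>\<^bsub>E\<^esub> q) \<oplus>\<oplus> (r \<ominus>\<^bsub>E\<^esub> p) = r \<ominus>\<^bsub>E\<^esub> q"
      if "p \<in> carrier E" "q \<in> carrier E" "r \<in> carrier E" for p q r
      using that by algebra
    then show ?thesis by simp
  qed
  finally show ?case .
qed

lemma fox_boundary:
  "f \<in> carrier free_algebra \<Longrightarrow>
    fox GenX f \<odot>\<odot> dX \<oplus>\<oplus> fox GenY f \<odot>\<odot> dY = (cs f \<bowtie> oneA) \<ominus>\<^bsub>E\<^esub> (oneA \<bowtie> cs f)"
proof (induction f rule: monoid_algebra_induct)
  case zero
  show ?case
    by (simp add: fox_zero coset_zero tens_smult_right [of oneA "\<zero>\<^bsub>A\<^esub>" 0, simplified] E.minus_eq)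
next
  case (step c u f)
  have [simp]: "cs f \<in> carrier A" by (rule cs_closed [OF step(2)])
  let ?a = "fox GenX f" and ?b = "fox GenY f" and ?a' = "fox_word GenX u" and ?b' = "fox_word GenY u"
  have "fox GenX (\<lambda>w. c * basis_elem u w + f w) \<odot>\<odot> dX \<oplus>\<oplus> fox GenY (\<lambda>w. c * basis_elem u w + f w) \<odot>\<odot> dY =
      c \<diamondop> (?a' \<odot>\<odot> dX \<oplus>\<oplus> ?b' \<odot>\<odot> dY) \<oplus>\<oplus> (?a \<odot>\<odot> dX \<oplus>\<oplus> ?b \<odot>\<odot> dY)"
    using step(2)
    by (simp add: fox_step E.l_distr E.smult_r_distr E.smult_mult_left E.a_ac)
  also have "\<dots> = c \<diamondop> ((monomial u \<bowtie> oneA) \<ominus>\<^bsub>E\<^esub> (oneA \<bowtie> monomial u)) \<oplus>\<oplus> ((cs f \<bowtie> oneA) \<ominus>\<^bsub>E\<^esub> (oneA \<bowtie> cs f))"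
    unfolding fox_word_boundary step(3) ..
  also have "\<dots> = (cs (\<lambda>w. c * basis_elem u w + f w) \<bowtie> oneA) \<ominus>\<^bsub>E\<^esub> (oneA \<bowtie> cs (\<lambda>w. c * basis_elem u w + f w))"
    using step(2)
    by (simp add: coset_step tens_add_left tens_add_right tens_smult_left tens_smult_right E.minus_eq
        E.smult_r_distr E.smult_minus E.minus_add E.a_ac)
  finally show ?case .
qed

section \<open>The relations, their overlap and the last differential\<close>

definition rel1 :: "generator list \<Rightarrow> 'k" where
  "rel1 = (\<lambda>w. basis_elem [GenX, GenX, GenY] w -
      (\<alpha> * basis_elem [GenX, GenY, GenX] w + \<beta> * basis_elem [GenY, GenX, GenX] w))"

definition rel2 :: "generator list \<Rightarrow> 'k" where
  "rel2 = (\<lambda>w. basis_elem [GenX, GenY, GenY] w -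
      (\<alpha> * basis_elem [GenY, GenX, GenY] w + \<beta> * basis_elem [GenY, GenY, GenX] w))"

lemma rel_ideal: "rel1 \<in> down_up_ideal \<alpha> \<beta>" "rel2 \<in> down_up_ideal \<alpha> \<beta>"
  using ring.genideal_self [OF k_algebra.axioms(1) [OF k_algebra_free] down_up_relations_closed, of \<alpha> \<beta>]
  unfolding down_up_ideal_def down_up_relations_eq rel1_def rel2_def by blast+

lemma ideal_closed: "f \<in> down_up_ideal \<alpha> \<beta> \<Longrightarrow> f \<in> carrier free_algebra"
  by (rule ideal.Icarr [OF ideal_down_up])

lemma cs_ideal: "f \<in> down_up_ideal \<alpha> \<beta> \<Longrightarrow> cs f = \<zero>\<^bsub>A\<^esub>"
proof -
  assume f: "f \<in> down_up_ideal \<alpha> \<beta>"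
  have z: "(\<lambda>w. 0 :: 'k) \<in> carrier free_algebra" by (simp add: carrier_monoid_algebra)
  have "cs f = cs (\<lambda>w. 0)" using f by (simp add: cs_eq_iff [OF ideal_closed [OF f] z])
  then show ?thesis by (simp add: coset_zero)
qed

lemma rel_closed [simp]: "rel1 \<in> carrier free_algebra" "rel2 \<in> carrier free_algebra"
  by (simp_all add: ideal_closed rel_ideal)

text \<open>The coefficient 1 in front and the trailing 0 give the relations the shape of the
  induction step for the free algebra, so that linear maps are evaluated on them by
  rewriting.\<close>

lemma rel_form:
  "rel1 = (\<lambda>w. 1 * basis_elem [GenX, GenX, GenY] w + ((- \<alpha>) * basis_elem [GenX, GenY, GenX] w +
      ((- \<beta>) * basis_elem [GenY, GenX, GenX] w + 0)))"
  "rel2 = (\<lambda>w. 1 * basis_elem [GenX, GenY, GenY] w + ((- \<alpha>) * basis_elem [GenY, GenX, GenY] w +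
      ((- \<beta>) * basis_elem [GenY, GenY, GenX] w + 0)))"
  by (simp_all add: rel1_def rel2_def fun_eq_iff)

lemma free_zero_closed: "(\<lambda>w. 0 :: 'k) \<in> carrier free_algebra"
  by (simp add: carrier_monoid_algebra)

lemma free_step_closed: "f \<in> carrier free_algebra \<Longrightarrow>
    (\<lambda>w. c * basis_elem u w + f w :: 'k) \<in> carrier free_algebra"
  by (intro free_algebra_add free_algebra_scale free_algebra_basis_elem)

lemma fox_rel:
  "fox g rel1 = fox_word g [GenX, GenX, GenY] \<oplus>\<oplus> ((- \<alpha>) \<diamondop> fox_word g [GenX, GenY, GenX] \<oplus>\<oplus>
     (- \<beta>) \<diamondop> fox_word g [GenY, GenX, GenX])"
  "fox g rel2 = fox_word g [GenX, GenY, GenY] \<oplus>\<oplus> ((- \<alpha>) \<diamondop> fox_word g [GenY, GenX, GenY] \<oplus>\<oplus>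
     (- \<beta>) \<diamondop> fox_word g [GenY, GenY, GenX])"
  unfolding rel_form
  by (simp_all only: fox_step free_step_closed free_zero_closed fox_zero E.smult_one fox_word_closed
      E.r_zero E.smult_closed)

text \<open>In the overlap identity below the first relation r occurs as r y + \<beta> y r and the
  second as x r + \<beta> r x. Read as bimodule coefficients these are 1 tensor y + \<beta> (y
  tensor 1) and x tensor 1 + \<beta> (1 tensor x).\<close>

definition "kappa1 = Y2 \<oplus>\<oplus> \<beta> \<diamondop> Y1"
definition "kappa2 = X1 \<oplus>\<oplus> \<beta> \<diamondop> X2"

lemma kappa_closed [simp]: "kappa1 \<in> carrier E" "kappa2 \<in> carrier E"
  by (simp_all add: kappa1_def kappa2_def)

text \<open>The overlap \<open>x\<^sup>2y\<^sup>2\<close> of the two relations.\<close>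

lemma overlap:
  "(\<lambda>w. (rel1 \<otimes>\<^bsub>free_algebra\<^esub> basis_elem [GenY]) w + \<beta> * (basis_elem [GenY] \<otimes>\<^bsub>free_algebra\<^esub> rel1) w) =
   (\<lambda>w. (basis_elem [GenX] \<otimes>\<^bsub>free_algebra\<^esub> rel2) w + \<beta> * (rel2 \<otimes>\<^bsub>free_algebra\<^esub> basis_elem [GenX]) w)"
  unfolding rel_form
  by (simp only: free_step_left free_step_right free_step_closed free_zero_closed free_algebra_basis_elem
      free_basis_mult free_mult_zero append_Cons append_Nil) (simp add: fun_eq_iff algebra_simps)

text \<open>The Fox derivatives of both sides of the overlap. Terms in which the additional letter
  is differentiated carry the class of a relation, which is zero in A.\<close>

lemma kappa_fox: "kappa1 \<odot>\<odot> fox g rel1 = kappa2 \<odot>\<odot> fox g rel2"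
proof -
  have z: "oneA \<bowtie> \<zero>\<^bsub>A\<^esub> = \<zero>\<^bsub>E\<^esub>" using tens_smult_right [of oneA "\<zero>\<^bsub>A\<^esub>" 0] by simp
  have c: "cs rel1 = \<zero>\<^bsub>A\<^esub>" "cs rel2 = \<zero>\<^bsub>A\<^esub>" by (simp_all add: cs_ideal rel_ideal)
  have m: "cs (basis_elem [h]) = down_up_generator \<alpha> \<beta> h" for h
    by (simp add: down_up_generator_def)
  note fm = fox_mult [OF free_algebra_basis_elem rel_closed(1)] fox_mult [OF rel_closed(1) free_algebra_basis_elem]
    fox_mult [OF free_algebra_basis_elem rel_closed(2)] fox_mult [OF rel_closed(2) free_algebra_basis_elem]
  note cl = free_mult_closed [OF free_algebra_basis_elem rel_closed(1)] free_mult_closed [OF rel_closed(1) free_algebra_basis_elem]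
    free_mult_closed [OF free_algebra_basis_elem rel_closed(2)] free_mult_closed [OF rel_closed(2) free_algebra_basis_elem]
  have "Y2 \<odot>\<odot> fox g rel1 \<oplus>\<oplus> \<beta> \<diamondop> (Y1 \<odot>\<odot> fox g rel1) = X1 \<odot>\<odot> fox g rel2 \<oplus>\<oplus> \<beta> \<diamondop> (X2 \<odot>\<odot> fox g rel2)"
    using arg_cong [OF overlap, of "fox g"]
    by (simp add: fox_add fox_smult cl free_algebra_scale fm c m z fox_basis_elem)
  then show ?thesis
    by (simp add: kappa1_def kappa2_def E.l_distr E.smult_mult_left)
qed

section \<open>The augmentation and exactness in degrees zero and one\<close>

definition mulE where "mulE = tensor_lift A (\<lambda>a b. a \<star> b)"

lemma mulE_bilinear: "bilinear_map A (opposite_algebra A) A (\<lambda>a b. a \<star> b)"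
  by (simp add: bilinear_map_def A.l_distr A.r_distr A.smult_mult_left A.smult_mult_right)

lemma mulE_closed [simp]: "t \<in> carrier E \<Longrightarrow> mulE t \<in> carrier A"
  unfolding mulE_def by (rule algebra_pair.tensor_lift_closed [OF env_pair A.left_module_field mulE_bilinear])

lemma mulE_add: "s \<in> carrier E \<Longrightarrow> t \<in> carrier E \<Longrightarrow> mulE (s \<oplus>\<oplus> t) = mulE s \<boxplus> mulE t"
  unfolding mulE_def by (rule algebra_pair.tensor_lift_add [OF env_pair A.left_module_field mulE_bilinear])

lemma mulE_tens: "a \<in> carrier A \<Longrightarrow> b \<in> carrier A \<Longrightarrow> mulE (a \<bowtie> b) = a \<star> b"
  unfolding mulE_def
  using algebra_pair.tensor_lift_pt [OF env_pair A.left_module_field mulE_bilinear, of a b] by simp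

lemma mulE_zero [simp]: "mulE \<zero>\<^bsub>E\<^esub> = \<zero>\<^bsub>A\<^esub>"
  using mulE_add [of "\<zero>\<^bsub>E\<^esub>" "\<zero>\<^bsub>E\<^esub>"] by simp

lemma mulE_minus: "s \<in> carrier E \<Longrightarrow> mulE (\<ominus>\<^bsub>E\<^esub> s) = \<ominus>\<^bsub>A\<^esub> mulE s"
  using mulE_add [of "\<ominus>\<^bsub>E\<^esub> s" s] A.minus_equality [of "mulE (\<ominus>\<^bsub>E\<^esub> s)" "mulE s"] by (simp add: E.l_neg)

lemma mulE_boundary: "t \<in> carrier E \<Longrightarrow> mulE (t \<odot>\<odot> dX) = \<zero>\<^bsub>A\<^esub> \<and> mulE (t \<odot>\<odot> dY) = \<zero>\<^bsub>A\<^esub>"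
proof (induction t rule: env_induct)
  case (add a b t)
  have "mulE ((a \<bowtie> b) \<odot>\<odot> dX) = \<zero>\<^bsub>A\<^esub>" "mulE ((a \<bowtie> b) \<odot>\<odot> dY) = \<zero>\<^bsub>A\<^esub>"
    using add(1,2)
    by (simp_all add: dX_def dY_def E.minus_eq E.r_distr E.r_minus mulE_add mulE_minus mulE_tens A.m_assoc A.r_neg)
  then show ?case using add by (simp add: E.l_distr mulE_add)
qed simp

text \<open>a tensor b differs from 1 tensor ab by (1 tensor b)(a tensor 1 - 1 tensor a), and the
  last factor is a combination of \<open>dX\<close> and \<open>dY\<close> by the boundary formula
  for a representative of a.\<close>

lemma mulE_kernel:
  "t \<in> carrier E \<Longrightarrow> \<exists>p\<in>carrier E. \<exists>q\<in>carrier E. t = (oneA \<bowtie> mulE t) \<oplus>\<oplus> (p \<odot>\<odot> dX \<oplus>\<oplus> q \<odot>\<odot> dY)"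
proof (induction t rule: env_induct)
  case zero
  show ?case
    by (rule bexI [of _ "\<zero>\<^bsub>E\<^esub>"], rule bexI [of _ "\<zero>\<^bsub>E\<^esub>"])
      (simp_all add: tens_smult_right [of oneA "\<zero>\<^bsub>A\<^esub>" 0, simplified])
next
  case (add a b t)
  obtain p q where pq: "p \<in> carrier E" "q \<in> carrier E" "t = (oneA \<bowtie> mulE t) \<oplus>\<oplus> (p \<odot>\<odot> dX \<oplus>\<oplus> q \<odot>\<odot> dY)"
    using add(4) by blast
  obtain f where f: "f \<in> carrier free_algebra" "a = cs f" by (rule cs_representative [OF add(1)])
  define p' q' where "p' = (oneA \<bowtie> b) \<odot>\<odot> fox GenX f" and "q' = (oneA \<bowtie> b) \<odot>\<odot> fox GenY f"
  have cl: "p' \<in> carrier E" "q' \<in> carrier E" using f add(2) by (simp_all add: p'_def q'_def)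
  have "p' \<odot>\<odot> dX \<oplus>\<oplus> q' \<odot>\<odot> dY = (oneA \<bowtie> b) \<odot>\<odot> (fox GenX f \<odot>\<odot> dX \<oplus>\<oplus> fox GenY f \<odot>\<odot> dY)"
    using f add(2) by (simp add: p'_def q'_def E.r_distr E.m_assoc)
  also have "\<dots> = (a \<bowtie> b) \<ominus>\<^bsub>E\<^esub> (oneA \<bowtie> (a \<star> b))"
    unfolding fox_boundary [OF f(1)] f(2) [symmetric]
    using add(1,2) by (simp add: E.minus_eq E.r_distr E.r_minus)
  finally have e: "p' \<odot>\<odot> dX \<oplus>\<oplus> q' \<odot>\<odot> dY = (a \<bowtie> b) \<ominus>\<^bsub>E\<^esub> (oneA \<bowtie> (a \<star> b))" .
  have alg: "u \<oplus>\<oplus> (v \<oplus>\<oplus> (r \<oplus>\<oplus> s)) = (z \<oplus>\<oplus> v) \<oplus>\<oplus> ((r \<oplus>\<oplus> r') \<oplus>\<oplus> (s \<oplus>\<oplus> s'))"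
    if "r' \<oplus>\<oplus> s' = u \<ominus>\<^bsub>E\<^esub> z" "u \<in> carrier E" "v \<in> carrier E" "r \<in> carrier E" "s \<in> carrier E"
      "r' \<in> carrier E" "s' \<in> carrier E" "z \<in> carrier E" for u v r s r' s' z
  proof -
    have "(z \<oplus>\<oplus> v) \<oplus>\<oplus> ((r \<oplus>\<oplus> r') \<oplus>\<oplus> (s \<oplus>\<oplus> s')) = z \<oplus>\<oplus> (v \<oplus>\<oplus> (r \<oplus>\<oplus> (s \<oplus>\<oplus> (r' \<oplus>\<oplus> s'))))"
      using that(2-) by (simp add: E.a_ac)
    also have "\<dots> = u \<oplus>\<oplus> (v \<oplus>\<oplus> (r \<oplus>\<oplus> s))" unfolding that(1) using that(2-) by algebra
    finally show ?thesis ..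
  qed
  have "(a \<bowtie> b) \<oplus>\<oplus> t = (a \<bowtie> b) \<oplus>\<oplus> ((oneA \<bowtie> mulE t) \<oplus>\<oplus> (p \<odot>\<odot> dX \<oplus>\<oplus> q \<odot>\<odot> dY))"
    using pq(3) by simp
  also have "\<dots> = ((oneA \<bowtie> (a \<star> b)) \<oplus>\<oplus> (oneA \<bowtie> mulE t)) \<oplus>\<oplus>
      ((p \<odot>\<odot> dX \<oplus>\<oplus> p' \<odot>\<odot> dX) \<oplus>\<oplus> (q \<odot>\<odot> dY \<oplus>\<oplus> q' \<odot>\<odot> dY))"
    by (rule alg [OF e]) (use add(1-3) pq(1,2) cl in simp_all)
  also have "\<dots> = (oneA \<bowtie> mulE ((a \<bowtie> b) \<oplus>\<oplus> t)) \<oplus>\<oplus> ((p \<oplus>\<oplus> p') \<odot>\<odot> dX \<oplus>\<oplus> (q \<oplus>\<oplus> q') \<odot>\<odot> dY)"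
    using add(1-3) pq(1,2) cl by (simp add: mulE_add mulE_tens tens_add_right E.l_distr)
  finally show ?case using pq(1,2) cl by (meson E.a_closed)
qed

text \<open>The image of the differential from degree 2 to degree 1, whose matrix consists of the
  Fox derivatives of the relations.\<close>

definition d1_image where
  "d1_image p q \<longleftrightarrow> (\<exists>s\<in>carrier E. \<exists>t\<in>carrier E.
     p = s \<odot>\<odot> fox GenX rel1 \<oplus>\<oplus> t \<odot>\<odot> fox GenX rel2 \<and> q = s \<odot>\<odot> fox GenY rel1 \<oplus>\<oplus> t \<odot>\<odot> fox GenY rel2)"

lemma d1_image_add:
  assumes "d1_image p q" "d1_image p' q'"
  shows "d1_image (p \<oplus>\<oplus> p') (q \<oplus>\<oplus> q')"
proof -
  obtain s t where st: "s \<in> carrier E" "t \<in> carrier E"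
    "p = s \<odot>\<odot> fox GenX rel1 \<oplus>\<oplus> t \<odot>\<odot> fox GenX rel2" "q = s \<odot>\<odot> fox GenY rel1 \<oplus>\<oplus> t \<odot>\<odot> fox GenY rel2"
    using assms(1) unfolding d1_image_def by blast
  obtain s' t' where st': "s' \<in> carrier E" "t' \<in> carrier E"
    "p' = s' \<odot>\<odot> fox GenX rel1 \<oplus>\<oplus> t' \<odot>\<odot> fox GenX rel2" "q' = s' \<odot>\<odot> fox GenY rel1 \<oplus>\<oplus> t' \<odot>\<odot> fox GenY rel2"
    using assms(2) unfolding d1_image_def by blast
  show ?thesis
    unfolding d1_image_def
    by (rule bexI [of _ "s \<oplus>\<oplus> s'"], rule bexI [of _ "t \<oplus>\<oplus> t'"]) (use st st' in \<open>simp_all add: E.l_distr E.a_ac\<close>)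
qed

lemma d1_image_mult:
  assumes "d1_image p q" "u \<in> carrier E"
  shows "d1_image (u \<odot>\<odot> p) (u \<odot>\<odot> q)"
proof -
  obtain s t where st: "s \<in> carrier E" "t \<in> carrier E"
    "p = s \<odot>\<odot> fox GenX rel1 \<oplus>\<oplus> t \<odot>\<odot> fox GenX rel2" "q = s \<odot>\<odot> fox GenY rel1 \<oplus>\<oplus> t \<odot>\<odot> fox GenY rel2"
    using assms(1) unfolding d1_image_def by blast
  show ?thesis
    unfolding d1_image_def
    by (rule bexI [of _ "u \<odot>\<odot> s"], rule bexI [of _ "u \<odot>\<odot> t"]) (use st assms(2) in \<open>simp_all add: E.r_distr E.m_assoc\<close>)
qed

lemma d1_image_zero: "d1_image \<zero>\<^bsub>E\<^esub> \<zero>\<^bsub>E\<^esub>"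
  unfolding d1_image_def by (rule bexI [of _ "\<zero>\<^bsub>E\<^esub>"], rule bexI [of _ "\<zero>\<^bsub>E\<^esub>"]) simp_all

lemma d1_image_rel: "d1_image (fox GenX rel1) (fox GenY rel1)" "d1_image (fox GenX rel2) (fox GenY rel2)"
  unfolding d1_image_def
  by (rule bexI [of _ "\<one>\<^bsub>E\<^esub>"], rule bexI [of _ "\<zero>\<^bsub>E\<^esub>"], simp_all)
    (rule bexI [of _ "\<zero>\<^bsub>E\<^esub>"], rule bexI [of _ "\<one>\<^bsub>E\<^esub>"], simp_all)

lemma tens_zero_right [simp]: "a \<in> carrier A \<Longrightarrow> a \<bowtie> \<zero>\<^bsub>A\<^esub> = \<zero>\<^bsub>E\<^esub>"
  using tens_smult_right [of a "\<zero>\<^bsub>A\<^esub>" 0] by simp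

lemma fox_uminus: "f \<in> carrier free_algebra \<Longrightarrow> fox g (\<lambda>w. - f w) = \<ominus>\<^bsub>E\<^esub> fox g f"
  using fox_smult [of f g "-1"] by (simp add: E.smult_uminus)

text \<open>Elements of the ideal vanish in A, so by the Leibniz rule multiplying f on either side
  just multiplies its derivatives by an element of the enveloping algebra. Hence the f with
  derivatives in \<open>d1_image\<close> form an ideal, and it contains the relations.\<close>

lemma fox_ideal: "f \<in> down_up_ideal \<alpha> \<beta> \<Longrightarrow> d1_image (fox GenX f) (fox GenY f)"
proof -
  interpret F: k_algebra "free_algebra :: ('k, generator list \<Rightarrow> 'k) module" by (rule k_algebra_free)
  interpret I: ideal "down_up_ideal \<alpha> \<beta>" free_algebra by (rule ideal_down_up)
  let ?J = "{f \<in> down_up_ideal \<alpha> \<beta>. d1_image (fox GenX f) (fox GenY f)}"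
  have "ideal ?J free_algebra"
  proof (rule idealI [OF F.ring_axioms])
    show "subgroup ?J (add_monoid free_algebra)"
    proof (rule F.add.subgroupI)
      show "?J \<subseteq> carrier free_algebra" using ideal_closed by blast
      have "(\<lambda>w. 0) \<in> ?J" using I.zero_closed d1_image_zero by (simp add: fox_zero)
      then show "?J \<noteq> {}" by blast
    next
      fix f assume f: "f \<in> ?J"
      then have fc: "f \<in> carrier free_algebra" using ideal_closed by blast
      have m: "\<ominus>\<^bsub>free_algebra\<^esub> f = (\<lambda>w. - f w)" by (rule uminus_monoid_algebra [OF monoid_word_monoid fc])
      have "d1_image (\<ominus>\<^bsub>E\<^esub> \<one>\<^bsub>E\<^esub> \<odot>\<odot> fox GenX f) (\<ominus>\<^bsub>E\<^esub> \<one>\<^bsub>E\<^esub> \<odot>\<odot> fox GenY f)"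
        by (rule d1_image_mult) (use f in simp_all)
      then have "d1_image (fox GenX (\<lambda>w. - f w)) (fox GenY (\<lambda>w. - f w))"
        using fc by (simp add: fox_uminus E.l_minus)
      then show "\<ominus>\<^bsub>free_algebra\<^esub> f \<in> ?J" using I.a_inv_closed [of f] f unfolding m by simp
    next
      fix f h assume *: "f \<in> ?J" "h \<in> ?J"
      then have c: "f \<in> carrier free_algebra" "h \<in> carrier free_algebra" using ideal_closed by blast+
      have "(\<lambda>w. f w + h w) \<in> down_up_ideal \<alpha> \<beta>" using I.a_closed [of f h] * by simp
      moreover have "d1_image (fox GenX (\<lambda>w. f w + h w)) (fox GenY (\<lambda>w. f w + h w))"
        unfolding fox_add [OF c] by (rule d1_image_add) (use * in simp_all)
      ultimately show "f \<oplus>\<^bsub>free_algebra\<^esub> h \<in> ?J" by simp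
    qed
    fix f h :: "generator list \<Rightarrow> 'k" assume f: "f \<in> ?J" and h: "h \<in> carrier free_algebra"
    then have fc: "f \<in> carrier free_algebra" and fI: "f \<in> down_up_ideal \<alpha> \<beta>" and fd: "d1_image (fox GenX f) (fox GenY f)"
      using ideal_closed by blast+
    have ch: "cs h \<in> carrier A" by (rule cs_closed [OF h])
    have "fox g (h \<otimes>\<^bsub>free_algebra\<^esub> f) = (cs h \<bowtie> oneA) \<odot>\<odot> fox g f" for g
      using fox_mult [OF fc h, of g] h fc ch by (simp add: cs_ideal [OF fI])
    then have "d1_image (fox GenX (h \<otimes>\<^bsub>free_algebra\<^esub> f)) (fox GenY (h \<otimes>\<^bsub>free_algebra\<^esub> f))"
      using d1_image_mult [OF fd, of "cs h \<bowtie> oneA"] ch by simp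
    then show "h \<otimes>\<^bsub>free_algebra\<^esub> f \<in> ?J" using I.I_l_closed [OF fI h] by blast
    have "fox g (f \<otimes>\<^bsub>free_algebra\<^esub> h) = (oneA \<bowtie> cs h) \<odot>\<odot> fox g f" for g
      using fox_mult [OF h fc, of g] h fc ch by (simp add: cs_ideal [OF fI])
    then have "d1_image (fox GenX (f \<otimes>\<^bsub>free_algebra\<^esub> h)) (fox GenY (f \<otimes>\<^bsub>free_algebra\<^esub> h))"
      using d1_image_mult [OF fd, of "oneA \<bowtie> cs h"] ch by simp
    then show "f \<otimes>\<^bsub>free_algebra\<^esub> h \<in> ?J" using I.I_r_closed [OF fI h] by blast
  qed
  moreover have "down_up_relations \<alpha> \<beta> \<subseteq> ?J"
    using rel_ideal d1_image_rel unfolding down_up_relations_eq rel1_def [symmetric] rel2_def [symmetric] by blast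
  ultimately have "down_up_ideal \<alpha> \<beta> \<subseteq> ?J"
    using F.genideal_minimal [of ?J "down_up_relations \<alpha> \<beta>"] by (simp add: down_up_ideal_def)
  then show "f \<in> down_up_ideal \<alpha> \<beta> \<Longrightarrow> d1_image (fox GenX f) (fox GenY f)" by blast
qed

text \<open>A k-linear left inverse of the first differential up to \<open>d1_image\<close>: it
  differentiates a chosen representative of a and appends b. It need not respect left
  multiplication, because the section need not be multiplicative.\<close>

definition fox_lift where
  "fox_lift g = tensor_lift E (\<lambda>a b. (oneA \<bowtie> b) \<odot>\<odot> fox g (section_map a))"

lemma fox_lift_bilinear:
  "bilinear_map A (opposite_algebra A) E (\<lambda>a b. (oneA \<bowtie> b) \<odot>\<odot> fox g (section_map a))"
  by (simp add: bilinear_map_def section_map_closed section_map_add section_map_smult fox_add fox_smult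
      tens_add_right tens_smult_right E.l_distr E.r_distr E.smult_mult_left E.smult_mult_right)

lemma fox_lift_closed [simp]: "t \<in> carrier E \<Longrightarrow> fox_lift g t \<in> carrier E"
  unfolding fox_lift_def by (rule algebra_pair.tensor_lift_closed [OF env_pair E.left_module_field fox_lift_bilinear])

lemma fox_lift_add: "s \<in> carrier E \<Longrightarrow> t \<in> carrier E \<Longrightarrow> fox_lift g (s \<oplus>\<oplus> t) = fox_lift g s \<oplus>\<oplus> fox_lift g t"
  unfolding fox_lift_def by (rule algebra_pair.tensor_lift_add [OF env_pair E.left_module_field fox_lift_bilinear])

lemma fox_lift_tens: "a \<in> carrier A \<Longrightarrow> b \<in> carrier A \<Longrightarrow> fox_lift g (a \<bowtie> b) = (oneA \<bowtie> b) \<odot>\<odot> fox g (section_map a)"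
  unfolding fox_lift_def
  using algebra_pair.tensor_lift_pt [OF env_pair E.left_module_field fox_lift_bilinear, of a b] by simp

lemma fox_lift_zero [simp]: "fox_lift g \<zero>\<^bsub>E\<^esub> = \<zero>\<^bsub>E\<^esub>"
  using fox_lift_add [of "\<zero>\<^bsub>E\<^esub>" "\<zero>\<^bsub>E\<^esub>" g] by simp

lemma fox_lift_minus: "s \<in> carrier E \<Longrightarrow> fox_lift g (\<ominus>\<^bsub>E\<^esub> s) = \<ominus>\<^bsub>E\<^esub> fox_lift g s"
  using fox_lift_add [of "\<ominus>\<^bsub>E\<^esub> s" s g] E.minus_equality [of "fox_lift g (\<ominus>\<^bsub>E\<^esub> s)" "fox_lift g s"]
  by (simp add: E.l_neg)

lemma fox_lift_boundary:
  assumes a: "a \<in> carrier A" and b: "b \<in> carrier A"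
  shows "\<exists>k l. d1_image k l \<and>
    fox_lift GenX ((a \<bowtie> b) \<odot>\<odot> ((down_up_generator \<alpha> \<beta> h \<bowtie> oneA) \<ominus>\<^bsub>E\<^esub> (oneA \<bowtie> down_up_generator \<alpha> \<beta> h))) =
      (if h = GenX then a \<bowtie> b else \<zero>\<^bsub>E\<^esub>) \<oplus>\<oplus> k \<and>
    fox_lift GenY ((a \<bowtie> b) \<odot>\<odot> ((down_up_generator \<alpha> \<beta> h \<bowtie> oneA) \<ominus>\<^bsub>E\<^esub> (oneA \<bowtie> down_up_generator \<alpha> \<beta> h))) =
      (if h = GenY then a \<bowtie> b else \<zero>\<^bsub>E\<^esub>) \<oplus>\<oplus> l"
proof -
  let ?h = "down_up_generator \<alpha> \<beta> h"
  let ?e = "basis_elem [h] :: generator list \<Rightarrow> 'k"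
  \<comment> \<open>Both terms represent the product of a with the generator, so f lies in the
    ideal. It measures how far the section is from being multiplicative, and its derivatives are the
    error terms.\<close>
  define f where "f = (\<lambda>w. section_map (a \<star> ?h) w + - ((section_map a \<otimes>\<^bsub>free_algebra\<^esub> ?e) w))"
  have s: "section_map a \<in> carrier free_algebra" "section_map (a \<star> ?h) \<in> carrier free_algebra"
    using a by (simp_all add: section_map_closed)
  have se: "section_map a \<otimes>\<^bsub>free_algebra\<^esub> ?e \<in> carrier free_algebra"
    by (rule free_mult_closed [OF s(1) free_algebra_basis_elem])
  have nse: "(\<lambda>w. - ((section_map a \<otimes>\<^bsub>free_algebra\<^esub> ?e) w)) \<in> carrier free_algebra"
    using free_algebra_scale [OF se, of "-1"] by simp
  have e: "cs ?e = ?h" by (simp add: down_up_generator_def)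
  have "cs (section_map (a \<star> ?h)) = cs (section_map a \<otimes>\<^bsub>free_algebra\<^esub> ?e)"
    using a by (simp add: cs_section_map e flip: cs_mult [OF s(1) free_algebra_basis_elem])
  then have f: "f \<in> down_up_ideal \<alpha> \<beta>"
    using cs_eq_iff [OF s(2) se] by (simp add: f_def)
  have fox_f: "fox g (section_map (a \<star> ?h)) \<ominus>\<^bsub>E\<^esub> (oneA \<bowtie> ?h) \<odot>\<odot> fox g (section_map a) =
      (if h = g then a \<bowtie> oneA else \<zero>\<^bsub>E\<^esub>) \<oplus>\<oplus> fox g f" for g
  proof -
    let ?q = "if h = g then a \<bowtie> oneA else \<zero>\<^bsub>E\<^esub>"
    have q: "?q \<in> carrier E" using a by simp
    have "fox g (section_map a \<otimes>\<^bsub>free_algebra\<^esub> ?e) = (oneA \<bowtie> ?h) \<odot>\<odot> fox g (section_map a) \<oplus>\<oplus> ?q"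
      using fox_mult [OF free_algebra_basis_elem s(1), of g "[h]"] a s
      by (simp add: e cs_section_map fox_basis_elem monomial_Nil tens_one)
    then have "fox g f = fox g (section_map (a \<star> ?h)) \<oplus>\<oplus> \<ominus>\<^bsub>E\<^esub> ((oneA \<bowtie> ?h) \<odot>\<odot> fox g (section_map a) \<oplus>\<oplus> ?q)"
      unfolding f_def fox_add [OF s(2) nse] fox_uminus [OF se] by simp
    then show ?thesis using q s a
      by (simp add: E.minus_eq E.minus_add E.a_ac E.r_neg1 E.r_neg2 del: if_split) algebra
  qed
  have lift: "fox_lift g ((a \<bowtie> b) \<odot>\<odot> ((?h \<bowtie> oneA) \<ominus>\<^bsub>E\<^esub> (oneA \<bowtie> ?h))) =
      (if h = g then a \<bowtie> b else \<zero>\<^bsub>E\<^esub>) \<oplus>\<oplus> (oneA \<bowtie> b) \<odot>\<odot> fox g f" for g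
  proof -
    have m: "oneA \<bowtie> (?h \<star> b) = (oneA \<bowtie> b) \<odot>\<odot> (oneA \<bowtie> ?h)" using b by simp
    have "fox_lift g ((a \<bowtie> b) \<odot>\<odot> ((?h \<bowtie> oneA) \<ominus>\<^bsub>E\<^esub> (oneA \<bowtie> ?h))) =
        (oneA \<bowtie> b) \<odot>\<odot> fox g (section_map (a \<star> ?h)) \<oplus>\<oplus> \<ominus>\<^bsub>E\<^esub> ((oneA \<bowtie> (?h \<star> b)) \<odot>\<odot> fox g (section_map a))"
      using a b by (simp add: E.minus_eq E.r_distr E.r_minus fox_lift_add fox_lift_minus fox_lift_tens)
    also have "\<dots> = (oneA \<bowtie> b) \<odot>\<odot> (fox g (section_map (a \<star> ?h)) \<ominus>\<^bsub>E\<^esub> (oneA \<bowtie> ?h) \<odot>\<odot> fox g (section_map a))"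
      unfolding m using a b s by (simp add: E.minus_eq E.r_distr E.r_minus E.m_assoc del: tens_mult)
    also have "\<dots> = (if h = g then a \<bowtie> b else \<zero>\<^bsub>E\<^esub>) \<oplus>\<oplus> (oneA \<bowtie> b) \<odot>\<odot> fox g f"
      unfolding fox_f using a b ideal_closed [OF f] by (simp add: E.r_distr)
    finally show ?thesis .
  qed
  have "d1_image ((oneA \<bowtie> b) \<odot>\<odot> fox GenX f) ((oneA \<bowtie> b) \<odot>\<odot> fox GenY f)"
    by (rule d1_image_mult [OF fox_ideal [OF f]]) (use b in simp)
  with lift show ?thesis by blast
qed

lemma fox_lift_d0:
  assumes p: "p \<in> carrier E" and q: "q \<in> carrier E"
  shows "\<exists>k l. d1_image k l \<and> fox_lift GenX (p \<odot>\<odot> dX \<oplus>\<oplus> q \<odot>\<odot> dY) = p \<oplus>\<oplus> k \<and>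
    fox_lift GenY (p \<odot>\<odot> dX \<oplus>\<oplus> q \<odot>\<odot> dY) = q \<oplus>\<oplus> l"
proof -
  have d1_closed: "k \<in> carrier E \<and> l \<in> carrier E" if "d1_image k l" for k l
    using that unfolding d1_image_def by auto
  have X: "\<exists>k l. d1_image k l \<and> fox_lift GenX (p \<odot>\<odot> dX) = p \<oplus>\<oplus> k \<and> fox_lift GenY (p \<odot>\<odot> dX) = l"
    using p
  proof (induction p rule: env_induct)
    case zero
    show ?case by (rule exI [of _ "\<zero>\<^bsub>E\<^esub>"], rule exI [of _ "\<zero>\<^bsub>E\<^esub>"]) (simp add: d1_image_zero)
  next
    case (add a b p)
    obtain k l where kl: "d1_image k l" "fox_lift GenX (p \<odot>\<odot> dX) = p \<oplus>\<oplus> k" "fox_lift GenY (p \<odot>\<odot> dX) = l"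
      using add(4) by blast
    obtain k' l' where kl': "d1_image k' l'" "fox_lift GenX ((a \<bowtie> b) \<odot>\<odot> dX) = (a \<bowtie> b) \<oplus>\<oplus> k'"
        "fox_lift GenY ((a \<bowtie> b) \<odot>\<odot> dX) = \<zero>\<^bsub>E\<^esub> \<oplus>\<oplus> l'"
      using fox_lift_boundary [OF add(1,2), of GenX] unfolding dX_def by auto
    show ?case
      by (rule exI [of _ "k' \<oplus>\<oplus> k"], rule exI [of _ "l' \<oplus>\<oplus> l"])
        (use add(1-3) kl kl' d1_closed [OF kl(1)] d1_closed [OF kl'(1)] d1_image_add [OF kl'(1) kl(1)] in
          \<open>simp add: E.l_distr fox_lift_add E.a_ac\<close>)
  qed
  have Y: "\<exists>k l. d1_image k l \<and> fox_lift GenX (q \<odot>\<odot> dY) = k \<and> fox_lift GenY (q \<odot>\<odot> dY) = q \<oplus>\<oplus> l"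
    using q
  proof (induction q rule: env_induct)
    case zero
    show ?case by (rule exI [of _ "\<zero>\<^bsub>E\<^esub>"], rule exI [of _ "\<zero>\<^bsub>E\<^esub>"]) (simp add: d1_image_zero)
  next
    case (add a b p)
    obtain k l where kl: "d1_image k l" "fox_lift GenX (p \<odot>\<odot> dY) = k" "fox_lift GenY (p \<odot>\<odot> dY) = p \<oplus>\<oplus> l"
      using add(4) by blast
    obtain k' l' where kl': "d1_image k' l'" "fox_lift GenX ((a \<bowtie> b) \<odot>\<odot> dY) = \<zero>\<^bsub>E\<^esub> \<oplus>\<oplus> k'"
        "fox_lift GenY ((a \<bowtie> b) \<odot>\<odot> dY) = (a \<bowtie> b) \<oplus>\<oplus> l'"
      using fox_lift_boundary [OF add(1,2), of GenY] unfolding dY_def by auto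
    show ?case
      by (rule exI [of _ "k' \<oplus>\<oplus> k"], rule exI [of _ "l' \<oplus>\<oplus> l"])
        (use add(1-3) kl kl' d1_closed [OF kl(1)] d1_closed [OF kl'(1)] d1_image_add [OF kl'(1) kl(1)] in
          \<open>simp add: E.l_distr fox_lift_add E.a_ac\<close>)
  qed
  obtain k l where kl: "d1_image k l" "fox_lift GenX (p \<odot>\<odot> dX) = p \<oplus>\<oplus> k" "fox_lift GenY (p \<odot>\<odot> dX) = l"
    using X by blast
  obtain k' l' where kl': "d1_image k' l'" "fox_lift GenX (q \<odot>\<odot> dY) = k'" "fox_lift GenY (q \<odot>\<odot> dY) = q \<oplus>\<oplus> l'"
    using Y by blast
  show ?thesis
    by (rule exI [of _ "k \<oplus>\<oplus> k'"], rule exI [of _ "l \<oplus>\<oplus> l'"])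
      (use p q kl kl' d1_closed [OF kl(1)] d1_closed [OF kl'(1)] d1_image_add [OF kl(1) kl'(1)] in
        \<open>simp add: fox_lift_add E.a_ac\<close>)
qed

text \<open>\<open>fox_lift\<close> sends the boundary, which is zero here, to (p, q) plus an
  element of \<open>d1_image\<close>.\<close>

theorem exact_1:
  assumes p: "p \<in> carrier E" and q: "q \<in> carrier E" and zero: "p \<odot>\<odot> dX \<oplus>\<oplus> q \<odot>\<odot> dY = \<zero>\<^bsub>E\<^esub>"
  shows "d1_image p q"
proof -
  obtain k l where kl: "d1_image k l" "\<zero>\<^bsub>E\<^esub> = p \<oplus>\<oplus> k" "\<zero>\<^bsub>E\<^esub> = q \<oplus>\<oplus> l"
    using fox_lift_d0 [OF p q] unfolding zero by auto
  have c: "k \<in> carrier E" "l \<in> carrier E" using kl(1) unfolding d1_image_def by auto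
  have "p = \<ominus>\<^bsub>E\<^esub> \<one>\<^bsub>E\<^esub> \<odot>\<odot> k" "q = \<ominus>\<^bsub>E\<^esub> \<one>\<^bsub>E\<^esub> \<odot>\<odot> l"
    using E.minus_equality [of p k] E.minus_equality [of q l] kl(2,3) c p q by (simp_all add: E.l_minus)
  with d1_image_mult [OF kl(1), of "\<ominus>\<^bsub>E\<^esub> \<one>\<^bsub>E\<^esub>"] show ?thesis by simp
qed

text \<open>Each use of the equation lowers the filtration level by one, so q lies in level
  0.\<close>

lemma rhoE_equation_zero:
  assumes q: "q \<in> carrier E" and eq: "q = c \<diamondop> (rhoE q \<odot>\<odot> X2)"
  shows "q = \<zero>\<^bsub>E\<^esub>"
proof -
  have "filt n q \<Longrightarrow> filt (n - 1) q" for n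
    using filt_smult [OF filt_mult_right [OF filt_rhoE [of n q], of gx], of c] eq by simp
  then have "filt n q \<Longrightarrow> filt 0 q" for n
    by (induction n) force+
  then show ?thesis using filt_exists [OF q] filt_0 by blast
qed

text \<open>Applying \<open>rhoE\<close> to q(x tensor 1) + \<beta> q(1 tensor x) = 0 returns q from
  the first term and so expresses q through \<open>rhoE q\<close>.\<close>

theorem exact_3:
  assumes q: "q \<in> carrier E" and zero: "q \<odot>\<odot> kappa2 = \<zero>\<^bsub>E\<^esub>"
  shows "q = \<zero>\<^bsub>E\<^esub>"
proof (rule rhoE_equation_zero [OF q])
  have "\<zero>\<^bsub>E\<^esub> = rhoE (q \<odot>\<odot> X1 \<oplus>\<oplus> \<beta> \<diamondop> (q \<odot>\<odot> X2))"
    using zero q by (simp add: kappa2_def E.r_distr E.smult_mult_right rhoE_simps)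
  also have "\<dots> = q \<oplus>\<oplus> \<beta> \<diamondop> (rhoE q \<odot>\<odot> X2)"
    using q by (simp add: rhoE_simps rhoE_X1)
  finally have "q \<oplus>\<oplus> \<beta> \<diamondop> (rhoE q \<odot>\<odot> X2) = \<zero>\<^bsub>E\<^esub>" ..
  then have "q = \<ominus>\<^bsub>E\<^esub> (\<beta> \<diamondop> (rhoE q \<odot>\<odot> X2))"
    using q by (intro E.minus_equality [symmetric]) (simp_all add: rhoE_simps)
  then show "q = (- \<beta>) \<diamondop> (rhoE q \<odot>\<odot> X2)"
    using q by (simp add: E.smult_uminus rhoE_simps)
qed

text \<open>Division by \<open>kappa2\<close>, whose leading term is x tensor 1. Subtracting
  \<open>rhoE p\<close> times \<open>kappa2\<close> cancels the quotient and leaves -\<beta>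
  \<open>rhoE (rhoE p)\<close> (1 tensor x) in its place, so the level of the quotient
  descends.\<close>

lemma reduce_kappa2:
  assumes "p \<in> carrier E"
  shows "\<exists>q\<in>carrier E. rhoE (p \<oplus>\<oplus> q \<odot>\<odot> kappa2) = \<zero>\<^bsub>E\<^esub>"
proof -
  have "filt n (rhoE p) \<Longrightarrow> p \<in> carrier E \<Longrightarrow> \<exists>q\<in>carrier E. rhoE (p \<oplus>\<oplus> q \<odot>\<odot> kappa2) = \<zero>\<^bsub>E\<^esub>" for n p
  proof (induction n arbitrary: p)
    case 0
    have "rhoE p = \<zero>\<^bsub>E\<^esub>" by (rule filt_0 [OF 0(1)])
    with 0(2) show ?case by (intro bexI [of _ "\<zero>\<^bsub>E\<^esub>"]) simp_all
  next
    case (Suc n)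
    let ?r = "rhoE p"
    have r: "?r \<in> carrier E" using Suc.prems by (simp add: rhoE_simps)
    let ?p = "p \<oplus>\<oplus> (\<ominus>\<^bsub>E\<^esub> ?r) \<odot>\<odot> kappa2"
    have p': "?p \<in> carrier E" using Suc.prems r by simp
    have "?p = p \<oplus>\<oplus> ((- 1) \<diamondop> (?r \<odot>\<odot> X1) \<oplus>\<oplus> (- \<beta>) \<diamondop> (?r \<odot>\<odot> X2))"
      using Suc.prems r by (simp add: kappa2_def E.l_minus E.r_distr E.smult_mult_right E.smult_uminus E.smult_minus E.minus_add)
    then have "rhoE ?p = ?r \<oplus>\<oplus> ((- 1) \<diamondop> ?r \<oplus>\<oplus> (- \<beta>) \<diamondop> (rhoE ?r \<odot>\<odot> X2))"
      using Suc.prems r by (simp add: rhoE_simps rhoE_X1)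
    also have "\<dots> = (- \<beta>) \<diamondop> (rhoE ?r \<odot>\<odot> X2)"
      using r by (simp add: rhoE_simps E.smult_uminus E.r_neg1 E.r_neg2)
    finally have "filt n (rhoE ?p)"
      using filt_smult [OF filt_mult_right [OF filt_rhoE [OF Suc.prems(1)], of gx], of "- \<beta>"] by simp
    from Suc.IH [OF this p'] obtain q where q: "q \<in> carrier E" "rhoE (?p \<oplus>\<oplus> q \<odot>\<odot> kappa2) = \<zero>\<^bsub>E\<^esub>" by blast
    have "?p \<oplus>\<oplus> q \<odot>\<odot> kappa2 = p \<oplus>\<oplus> (\<ominus>\<^bsub>E\<^esub> ?r \<oplus>\<oplus> q) \<odot>\<odot> kappa2"
      using Suc.prems r q by (simp add: E.l_distr E.a_assoc)
    then show ?case using q r by (intro bexI [of _ "\<ominus>\<^bsub>E\<^esub> ?r \<oplus>\<oplus> q"]) simp_all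
  qed
  then show ?thesis using filt_exists [of "rhoE p"] assms by (simp add: rhoE_simps) blast
qed

lemma fox_Y_rel:
  "fox GenY rel1 = ((gx \<star> gx) \<bowtie> oneA) \<oplus>\<oplus> ((- \<alpha>) \<diamondop> (gx \<bowtie> gx) \<oplus>\<oplus> (- \<beta>) \<diamondop> (oneA \<bowtie> (gx \<star> gx)))"
  "fox GenY rel2 = ((gx \<bowtie> gy) \<oplus>\<oplus> ((gx \<star> gy) \<bowtie> oneA)) \<oplus>\<oplus>
     ((- \<alpha>) \<diamondop> ((oneA \<bowtie> (gx \<star> gy)) \<oplus>\<oplus> ((gy \<star> gx) \<bowtie> oneA)) \<oplus>\<oplus>
      (- \<beta>) \<diamondop> ((oneA \<bowtie> (gy \<star> gx)) \<oplus>\<oplus> (gy \<bowtie> gx)))"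
  by (simp_all add: fox_rel monomial_Cons monomial_Nil E.r_distr)

lemma rhoE_tens_gx:
  assumes t: "t \<in> carrier E" and c: "c \<in> carrier A" and b: "b \<in> carrier A"
  shows "rhoE (t \<odot>\<odot> ((c \<star> gx) \<bowtie> b)) = t \<odot>\<odot> (c \<bowtie> b)" "sigmaE (t \<odot>\<odot> ((c \<star> gx) \<bowtie> b)) = \<zero>\<^bsub>E\<^esub>"
proof -
  have "t \<odot>\<odot> ((c \<star> gx) \<bowtie> b) = (t \<odot>\<odot> (c \<bowtie> b)) \<odot>\<odot> X1"
    using assms by (simp add: E.m_assoc)
  then show "rhoE (t \<odot>\<odot> ((c \<star> gx) \<bowtie> b)) = t \<odot>\<odot> (c \<bowtie> b)" "sigmaE (t \<odot>\<odot> ((c \<star> gx) \<bowtie> b)) = \<zero>\<^bsub>E\<^esub>"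
    using assms by (simp_all add: rhoE_X1 sigmaE_X1)
qed

text \<open>
  Comparing coefficients in the \<open>e\<^sub>y\<close> component of the differential: the leading terms of the two
  relations are \<open>x\<^sup>2\<close> and \<open>xy - \<alpha>yx\<close>, and on \<open>ker \<rho>\<close> these are separated by \<open>\<sigma>\<close> and \<open>\<rho>\<^sup>2\<close>.
\<close>

lemma d1_reduced_zero:
  assumes p: "p \<in> carrier E" and q: "q \<in> carrier E" and r: "rhoE q = \<zero>\<^bsub>E\<^esub>"
    and zero: "p \<odot>\<odot> fox GenY rel1 \<oplus>\<oplus> q \<odot>\<odot> fox GenY rel2 = \<zero>\<^bsub>E\<^esub>"
  shows "p = \<zero>\<^bsub>E\<^esub> \<and> q = \<zero>\<^bsub>E\<^esub>"
proof -
  \<comment> \<open>With zero quotient by x, q is its own remainder, so its product with xy can be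
    undone by \<open>sigmaE\<close>.\<close>
  have q_eta: "etaE q = q"
    using etaE_decompose [OF q] left_op_closed [OF linear_A_simps(3) q] by (simp add: r)
  have UA: "sigmaE (q \<odot>\<odot> (UA \<bowtie> oneA)) = q" "rhoE (q \<odot>\<odot> (UA \<bowtie> oneA)) = \<zero>\<^bsub>E\<^esub>"
    using rho_sigma_etaE [OF q] by (simp_all add: q_eta)
  define XX XY YX where "XX = oneA \<bowtie> (gx \<star> gx)" and "XY = oneA \<bowtie> (gx \<star> gy)" and "YX = oneA \<bowtie> (gy \<star> gx)"
  have cl: "XX \<in> carrier E" "XY \<in> carrier E" "YX \<in> carrier E" by (simp_all add: XX_def XY_def YX_def)
  define qY where "qY = q \<odot>\<odot> Y1"
  have qY: "qY \<in> carrier E" using q by (simp add: qY_def)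
  have expand: "p \<odot>\<odot> fox GenY rel1 \<oplus>\<oplus> q \<odot>\<odot> fox GenY rel2 =
      (p \<odot>\<odot> ((gx \<star> gx) \<bowtie> oneA) \<oplus>\<oplus> ((- \<alpha>) \<diamondop> (p \<odot>\<odot> (gx \<bowtie> gx)) \<oplus>\<oplus> (- \<beta>) \<diamondop> (p \<odot>\<odot> XX))) \<oplus>\<oplus>
      ((q \<odot>\<odot> (gx \<bowtie> gy) \<oplus>\<oplus> q \<odot>\<odot> (UA \<bowtie> oneA)) \<oplus>\<oplus>
       ((- \<alpha>) \<diamondop> (q \<odot>\<odot> XY \<oplus>\<oplus> q \<odot>\<odot> (VA \<bowtie> oneA)) \<oplus>\<oplus> (- \<beta>) \<diamondop> (q \<odot>\<odot> YX \<oplus>\<oplus> qY \<odot>\<odot> X2)))"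
    unfolding fox_Y_rel XX_def XY_def YX_def qY_def using p q
    by (simp add: E.r_distr E.smult_mult_right E.m_assoc)
  note gx1 = rhoE_tens_gx [OF _ A.one_closed, simplified] and gx' = rhoE_tens_gx
  have s1: "sigmaE (p \<odot>\<odot> (gx \<bowtie> gx)) = \<zero>\<^bsub>E\<^esub>" "sigmaE (q \<odot>\<odot> (gx \<bowtie> gy)) = \<zero>\<^bsub>E\<^esub>"
    "sigmaE (p \<odot>\<odot> ((gx \<star> gx) \<bowtie> oneA)) = \<zero>\<^bsub>E\<^esub>" "sigmaE (q \<odot>\<odot> (VA \<bowtie> oneA)) = \<zero>\<^bsub>E\<^esub>"
    using gx1(2) [OF p] gx1(2) [OF q] gx'(2) [OF p, of gx oneA] gx'(2) [OF q, of gy oneA] by simp_all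
  have s2: "sigmaE (p \<odot>\<odot> XX) = sigmaE p \<odot>\<odot> XX" "sigmaE (q \<odot>\<odot> XY) = sigmaE q \<odot>\<odot> XY"
    "sigmaE (q \<odot>\<odot> YX) = sigmaE q \<odot>\<odot> YX" "sigmaE (qY \<odot>\<odot> X2) = sigmaE qY \<odot>\<odot> X2"
    unfolding XX_def XY_def YX_def using p q qY by (simp_all add: sigmaE_simps(4))
  have "\<zero>\<^bsub>E\<^esub> = sigmaE (p \<odot>\<odot> fox GenY rel1 \<oplus>\<oplus> q \<odot>\<odot> fox GenY rel2)"
    unfolding zero by (simp add: sigmaE_simps)
  also have "\<dots> = (- \<beta>) \<diamondop> (sigmaE p \<odot>\<odot> XX) \<oplus>\<oplus> (q \<oplus>\<oplus> ((- \<alpha>) \<diamondop> (sigmaE q \<odot>\<odot> XY) \<oplus>\<oplus>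
      (- \<beta>) \<diamondop> (sigmaE q \<odot>\<odot> YX \<oplus>\<oplus> sigmaE qY \<odot>\<odot> X2)))"
    unfolding expand using p q qY cl by (simp add: sigmaE_simps(1-3) s1 s2 UA)
  finally have Q0: "(- \<beta>) \<diamondop> (sigmaE p \<odot>\<odot> XX) \<oplus>\<oplus> (q \<oplus>\<oplus> ((- \<alpha>) \<diamondop> (sigmaE q \<odot>\<odot> XY) \<oplus>\<oplus>
      (- \<beta>) \<diamondop> (sigmaE q \<odot>\<odot> YX \<oplus>\<oplus> sigmaE qY \<odot>\<odot> X2))) = \<zero>\<^bsub>E\<^esub>" ..
  \<comment> \<open>Under \<open>sigmaE\<close> the term q(xy tensor 1) returns q itself; L collects
    what the remaining terms contribute.\<close>
  define L where "L = (- \<beta>) \<diamondop> (sigmaE p \<odot>\<odot> XX) \<oplus>\<oplus> ((- \<alpha>) \<diamondop> (sigmaE q \<odot>\<odot> XY) \<oplus>\<oplus>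
      (- \<beta>) \<diamondop> (sigmaE q \<odot>\<odot> YX \<oplus>\<oplus> sigmaE qY \<odot>\<odot> X2))"
  have L: "L \<in> carrier E" using p q qY cl by (simp add: L_def sigmaE_simps)
  have "q \<oplus>\<oplus> L = \<zero>\<^bsub>E\<^esub>"
    using Q0 p q qY cl by (simp add: L_def sigmaE_simps E.a_ac)
  then have Q: "q = (- 1) \<diamondop> L" using q L E.minus_equality [of q L] by (simp add: E.smult_uminus)
  have r1: "rhoE (p \<odot>\<odot> ((gx \<star> gx) \<bowtie> oneA)) = p \<odot>\<odot> X1" "rhoE (p \<odot>\<odot> (gx \<bowtie> gx)) = p \<odot>\<odot> X2"
    "rhoE (q \<odot>\<odot> (gx \<bowtie> gy)) = q \<odot>\<odot> Y2" "rhoE (q \<odot>\<odot> (VA \<bowtie> oneA)) = qY"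
    using gx1(1) [OF p] gx1(1) [OF q] gx'(1) [OF p, of gx oneA] gx'(1) [OF q, of gy oneA] by (simp_all add: qY_def)
  have r2: "rhoE (p \<odot>\<odot> XX) = rhoE p \<odot>\<odot> XX" "rhoE (q \<odot>\<odot> XY) = \<zero>\<^bsub>E\<^esub>"
    "rhoE (q \<odot>\<odot> YX) = \<zero>\<^bsub>E\<^esub>" "rhoE (qY \<odot>\<odot> X2) = rhoE qY \<odot>\<odot> X2" "rhoE (q \<odot>\<odot> Y2) = \<zero>\<^bsub>E\<^esub>"
    "rhoE (rhoE p \<odot>\<odot> XX) = rhoE (rhoE p) \<odot>\<odot> XX" "rhoE (p \<odot>\<odot> X2) = rhoE p \<odot>\<odot> X2"
    "rhoE (rhoE qY \<odot>\<odot> X2) = rhoE (rhoE qY) \<odot>\<odot> X2"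
    unfolding XX_def XY_def YX_def using p q qY by (simp_all add: rhoE_simps(1,4) r)
  have "\<zero>\<^bsub>E\<^esub> = rhoE (rhoE (p \<odot>\<odot> fox GenY rel1 \<oplus>\<oplus> q \<odot>\<odot> fox GenY rel2))"
    unfolding zero by (simp add: rhoE_simps)
  also have "\<dots> = (p \<oplus>\<oplus> ((- \<alpha>) \<diamondop> (rhoE p \<odot>\<odot> X2) \<oplus>\<oplus> (- \<beta>) \<diamondop> (rhoE (rhoE p) \<odot>\<odot> XX))) \<oplus>\<oplus>
      ((- \<alpha>) \<diamondop> rhoE qY \<oplus>\<oplus> (- \<beta>) \<diamondop> (rhoE (rhoE qY) \<odot>\<odot> X2))"
    unfolding expand using p q qY cl by (simp add: rhoE_simps(1-3,5) r1 r2 UA rhoE_X1)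
  finally have P0: "(p \<oplus>\<oplus> ((- \<alpha>) \<diamondop> (rhoE p \<odot>\<odot> X2) \<oplus>\<oplus> (- \<beta>) \<diamondop> (rhoE (rhoE p) \<odot>\<odot> XX))) \<oplus>\<oplus>
      ((- \<alpha>) \<diamondop> rhoE qY \<oplus>\<oplus> (- \<beta>) \<diamondop> (rhoE (rhoE qY) \<odot>\<odot> X2)) = \<zero>\<^bsub>E\<^esub>" ..
  \<comment> \<open>Under \<open>rhoE\<close> applied twice the term p(x^2 tensor 1) returns p; K
    collects the rest. The second relation still contributes through its terms ending in yx tensor 1
    and y tensor x.\<close>
  define K where "K = ((- \<alpha>) \<diamondop> (rhoE p \<odot>\<odot> X2) \<oplus>\<oplus> (- \<beta>) \<diamondop> (rhoE (rhoE p) \<odot>\<odot> XX)) \<oplus>\<oplus>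
      ((- \<alpha>) \<diamondop> rhoE qY \<oplus>\<oplus> (- \<beta>) \<diamondop> (rhoE (rhoE qY) \<odot>\<odot> X2))"
  have K: "K \<in> carrier E" using p q qY cl by (simp add: K_def rhoE_simps)
  have "p \<oplus>\<oplus> K = \<zero>\<^bsub>E\<^esub>"
    using P0 p q qY cl by (simp add: K_def rhoE_simps E.a_assoc)
  then have P: "p = (- 1) \<diamondop> K" using p K E.minus_equality [of p K] by (simp add: E.smult_uminus)
  have "filt (n - 1) p \<and> filt (n - 1) q" if n: "filt n p" "filt n q" for n
  proof -
    have sp: "filt (n - 1) (sigmaE p)" "filt (n - 1) (sigmaE q)"
      using filt_mono [OF filt_sigmaE [OF n(1)]] filt_mono [OF filt_sigmaE [OF n(2)]] by simp_all
    have sY: "filt (n - 1) (sigmaE qY)"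
      using filt_mono [OF filt_sigmaE [OF filt_Y1 [OF n(2)]], of "n - 1"] by (simp add: qY_def)
    have "filt (n - 1) L"
      unfolding L_def XX_def XY_def YX_def
      by (intro filt_add filt_smult filt_mult_right sp sY) simp_all
    then have fq: "filt (n - 1) q" using filt_smult Q by metis
    have rp: "filt (n - 1) (rhoE p)" by (rule filt_rhoE [OF n(1)])
    have rrp: "filt (n - 1) (rhoE (rhoE p))" by (rule filt_mono [OF filt_rhoE [OF rp]]) simp
    \<comment> \<open>The level of q has to drop before that of p: multiplication by y costs one
      level, so \<open>rhoE qY\<close> reaches level n - 1 only because q already lies
      there.\<close>
    have rY: "filt (n - 1) (rhoE qY)"
      using filt_rhoE [OF filt_Y1 [OF fq]] by (simp add: qY_def)
    have rrY: "filt (n - 1) (rhoE (rhoE qY))" by (rule filt_mono [OF filt_rhoE [OF rY]]) simp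
    have "filt (n - 1) K"
      unfolding K_def XX_def
      by (intro filt_add filt_smult filt_mult_right rp rrp rY rrY) simp_all
    then have "filt (n - 1) p" using filt_smult P by metis
    with fq show ?thesis by blast
  qed
  then have "filt n p \<and> filt n q \<Longrightarrow> filt 0 p \<and> filt 0 q" for n
    by (induction n) force+
  moreover obtain n where "filt n p" using filt_exists [OF p] by blast
  moreover obtain m where "filt m q" using filt_exists [OF q] by blast
  ultimately have "filt 0 p \<and> filt 0 q"
    using filt_mono [of n p "max n m"] filt_mono [of m q "max n m"] by simp
  then show ?thesis using filt_0 by blast
qed

text \<open>A multiple of (\<open>kappa1\<close>, -\<open>kappa2\<close>) is subtracted so that the
  second coordinate has zero quotient by x; the remaining pair is still in the kernel by
  \<open>kappa_fox\<close> and vanishes by \<open>d1_reduced_zero\<close>.\<close>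

theorem exact_2:
  assumes p: "p \<in> carrier E" and q: "q \<in> carrier E"
    and zero: "p \<odot>\<odot> fox GenY rel1 \<oplus>\<oplus> q \<odot>\<odot> fox GenY rel2 = \<zero>\<^bsub>E\<^esub>"
  shows "\<exists>t\<in>carrier E. p = t \<odot>\<odot> kappa1 \<and> q = \<ominus>\<^bsub>E\<^esub> (t \<odot>\<odot> kappa2)"
proof -
  obtain t where t: "t \<in> carrier E" "rhoE (q \<oplus>\<oplus> t \<odot>\<odot> kappa2) = \<zero>\<^bsub>E\<^esub>"
    using reduce_kappa2 [OF q] by blast
  let ?f = "fox GenY rel1" and ?g = "fox GenY rel2"
  let ?p = "p \<oplus>\<oplus> \<ominus>\<^bsub>E\<^esub> (t \<odot>\<odot> kappa1)" and ?q = "q \<oplus>\<oplus> t \<odot>\<odot> kappa2"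
  have "?p \<odot>\<odot> ?f \<oplus>\<oplus> ?q \<odot>\<odot> ?g = (p \<odot>\<odot> ?f \<oplus>\<oplus> q \<odot>\<odot> ?g) \<oplus>\<oplus> (\<ominus>\<^bsub>E\<^esub> (t \<odot>\<odot> (kappa1 \<odot>\<odot> ?f)) \<oplus>\<oplus> t \<odot>\<odot> (kappa2 \<odot>\<odot> ?g))"
    using p q t by (simp add: E.l_distr E.l_minus E.m_assoc E.a_ac)
  also have "\<dots> = \<zero>\<^bsub>E\<^esub>"
    unfolding zero kappa_fox using t by (simp add: E.l_neg)
  finally have "?p = \<zero>\<^bsub>E\<^esub> \<and> ?q = \<zero>\<^bsub>E\<^esub>"
    by (intro d1_reduced_zero) (use p q t in simp_all)
  then have "p = t \<odot>\<odot> kappa1" "q = \<ominus>\<^bsub>E\<^esub> (t \<odot>\<odot> kappa2)"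
    using p q t E.minus_equality [of p "\<ominus>\<^bsub>E\<^esub> (t \<odot>\<odot> kappa1)"] E.minus_equality [of q "t \<odot>\<odot> kappa2"] by simp_all
  with t show ?thesis by blast
qed

end

section \<open>Cohomology does not depend on the resolution\<close>

lemma hom_eqI:
  assumes "f \<in> left_module_hom R M N" "g \<in> left_module_hom R M N"
    and "\<And>u. u \<in> carrier M \<Longrightarrow> f u = g u"
  shows "f = g"
  using assms unfolding left_module_hom_def by (blast intro: PiE_ext)

lemma hom_plus:
  assumes M: "left_module R M" and N: "left_module R N"
    and f: "f \<in> left_module_hom R M N" and g: "g \<in> left_module_hom R M N"
  shows "restrict (\<lambda>u. f u \<oplus>\<^bsub>N\<^esub> g u) (carrier M) \<in> left_module_hom R M N"
proof (rule left_module_homI [OF _ _ _ M])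
  interpret N: left_module R N by fact
  show "f u \<oplus>\<^bsub>N\<^esub> g u \<in> carrier N" if "u \<in> carrier M" for u
    using that hom_closed [OF f] hom_closed [OF g] by simp
  show "f (u \<oplus>\<^bsub>M\<^esub> v) \<oplus>\<^bsub>N\<^esub> g (u \<oplus>\<^bsub>M\<^esub> v) = (f u \<oplus>\<^bsub>N\<^esub> g u) \<oplus>\<^bsub>N\<^esub> (f v \<oplus>\<^bsub>N\<^esub> g v)"
    if "u \<in> carrier M" "v \<in> carrier M" for u v
    using that hom_closed [OF f] hom_closed [OF g]
    by (simp add: hom_add [OF f] hom_add [OF g] N.M.a_ac)
  show "f (r \<odot>\<^bsub>M\<^esub> u) \<oplus>\<^bsub>N\<^esub> g (r \<odot>\<^bsub>M\<^esub> u) = r \<odot>\<^bsub>N\<^esub> (f u \<oplus>\<^bsub>N\<^esub> g u)"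
    if "r \<in> carrier R" "u \<in> carrier M" for r u
    using that hom_closed [OF f] hom_closed [OF g]
    by (simp add: hom_smult [OF f] hom_smult [OF g] N.smult_r_distr)
qed

lemma zero_hom:
  assumes M: "left_module R M" and N: "left_module R N"
  shows "restrict (\<lambda>u. \<zero>\<^bsub>N\<^esub>) (carrier M) \<in> left_module_hom R M N"
proof (rule left_module_homI [OF _ _ _ M])
  interpret N: left_module R N by fact
  show "\<zero>\<^bsub>N\<^esub> \<in> carrier N" "\<zero>\<^bsub>N\<^esub> = \<zero>\<^bsub>N\<^esub> \<oplus>\<^bsub>N\<^esub> \<zero>\<^bsub>N\<^esub>" by simp_all
  show "\<zero>\<^bsub>N\<^esub> = r \<odot>\<^bsub>N\<^esub> \<zero>\<^bsub>N\<^esub>" if "r \<in> carrier R" for r using that by simp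
qed

text \<open>First isomorphism theorem with an additional action. On the quotient the action is a
  union over representatives, and it is unambiguous because the cosets are the fibres of
  \<open>\<chi>\<close>.\<close>

lemma equivariant_iso_quotient:
  fixes M :: "('s, 'm) module" and E :: "('s, 'e) module"
  assumes M: "abelian_group M" and N: "additive_subgroup N M"
    and closed: "\<And>u. u \<in> carrier M \<Longrightarrow> \<chi> u \<in> carrier E"
    and surj: "\<And>e. e \<in> carrier E \<Longrightarrow> \<exists>u\<in>carrier M. \<chi> u = e"
    and add: "\<And>u v. u \<in> carrier M \<Longrightarrow> v \<in> carrier M \<Longrightarrow> \<chi> (u \<oplus>\<^bsub>M\<^esub> v) = \<chi> u \<oplus>\<^bsub>E\<^esub> \<chi> v"
    and kernel: "\<And>u v. u \<in> carrier M \<Longrightarrow> v \<in> carrier M \<Longrightarrow> \<chi> u = \<chi> v \<longleftrightarrow> u \<ominus>\<^bsub>M\<^esub> v \<in> N"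
    and smult_closed: "\<And>s u. s \<in> S \<Longrightarrow> u \<in> carrier M \<Longrightarrow> s \<odot>\<^bsub>M\<^esub> u \<in> carrier M"
    and smult: "\<And>s u. s \<in> S \<Longrightarrow> u \<in> carrier M \<Longrightarrow> \<chi> (s \<odot>\<^bsub>M\<^esub> u) = s \<odot>\<^bsub>E\<^esub> \<chi> u"
  shows "\<exists>\<phi> \<in> equivariant_iso S (quotient_module M N) E. \<forall>u\<in>carrier M. \<phi> (N +>\<^bsub>M\<^esub> u) = \<chi> u"
    and "u \<in> carrier M \<Longrightarrow> v \<in> carrier M \<Longrightarrow> N +>\<^bsub>M\<^esub> u = N +>\<^bsub>M\<^esub> v \<longleftrightarrow> \<chi> u = \<chi> v"
    and "s \<in> S \<Longrightarrow> u \<in> carrier M \<Longrightarrow>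
      s \<odot>\<^bsub>quotient_module M N\<^esub> (N +>\<^bsub>M\<^esub> u) = N +>\<^bsub>M\<^esub> (s \<odot>\<^bsub>M\<^esub> u)"
proof -
  interpret abelian_subgroup N M by (rule abelian_subgroupI3 [OF N M])
  have mem: "h \<in> N +>\<^bsub>M\<^esub> u \<longleftrightarrow> h \<in> carrier M \<and> \<chi> h = \<chi> u" if "u \<in> carrier M" for h u
    using a_rcos_module [OF that, of h] a_elemrcos_carrier [OF that, of h] kernel [OF _ that, of h]
    by (auto simp: minus_eq)
  show coset_eq: "N +>\<^bsub>M\<^esub> u = N +>\<^bsub>M\<^esub> v \<longleftrightarrow> \<chi> u = \<chi> v" if "u \<in> carrier M" "v \<in> carrier M" for u v
    using mem [OF that(1)] mem [OF that(2)] that by (auto simp: set_eq_iff)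
  show coset_smult: "s \<odot>\<^bsub>quotient_module M N\<^esub> (N +>\<^bsub>M\<^esub> u) = N +>\<^bsub>M\<^esub> (s \<odot>\<^bsub>M\<^esub> u)"
    if s: "s \<in> S" and u: "u \<in> carrier M" for s u
  proof -
    have "N +>\<^bsub>M\<^esub> (s \<odot>\<^bsub>M\<^esub> h) = N +>\<^bsub>M\<^esub> (s \<odot>\<^bsub>M\<^esub> u)" if "h \<in> N +>\<^bsub>M\<^esub> u" for h
      using that mem [OF u] coset_eq smult_closed [OF s] smult [OF s] u by simp
    then have "(\<Union>h\<in>N +>\<^bsub>M\<^esub> u. N +>\<^bsub>M\<^esub> (s \<odot>\<^bsub>M\<^esub> h)) = (\<Union>h\<in>N +>\<^bsub>M\<^esub> u. N +>\<^bsub>M\<^esub> (s \<odot>\<^bsub>M\<^esub> u))"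
      by (intro SUP_cong refl)
    also have "\<dots> = N +>\<^bsub>M\<^esub> (s \<odot>\<^bsub>M\<^esub> u)" using a_rcos_self [OF u] by blast
    finally show ?thesis by (simp add: quotient_module_def)
  qed
  define \<phi> where "\<phi> U = the_elem (\<chi> ` U)" for U
  have \<phi>: "\<phi> (N +>\<^bsub>M\<^esub> u) = \<chi> u" if u: "u \<in> carrier M" for u
  proof -
    have "\<chi> ` (N +>\<^bsub>M\<^esub> u) = {\<chi> u}"
    proof
      show "\<chi> ` (N +>\<^bsub>M\<^esub> u) \<subseteq> {\<chi> u}" by (rule image_subsetI) (simp add: mem [OF u])
      show "{\<chi> u} \<subseteq> \<chi> ` (N +>\<^bsub>M\<^esub> u)" using imageI [OF a_rcos_self [OF u], of \<chi>] by simp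
    qed
    then show ?thesis by (simp add: \<phi>_def)
  qed
  have carr: "carrier (quotient_module M N) = (\<lambda>u. N +>\<^bsub>M\<^esub> u) ` carrier M"
    by (auto simp: quotient_module_def A_RCOSETS_def')
  have "\<phi> \<in> equivariant_iso S (quotient_module M N) E"
    unfolding equivariant_iso_def
  proof (intro CollectI conjI ballI)
    show "bij_betw \<phi> (carrier (quotient_module M N)) (carrier E)"
    proof (rule bij_betw_imageI)
      show "inj_on \<phi> (carrier (quotient_module M N))"
        unfolding carr by (rule inj_onI, elim imageE) (simp add: \<phi> coset_eq)
      show "\<phi> ` carrier (quotient_module M N) = carrier E"
      proof
        show "\<phi> ` carrier (quotient_module M N) \<subseteq> carrier E" unfolding carr by (auto simp: \<phi> closed)
        show "carrier E \<subseteq> \<phi> ` carrier (quotient_module M N)"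
        proof
          fix e assume "e \<in> carrier E"
          then obtain u where u: "u \<in> carrier M" "\<chi> u = e" using surj by blast
          show "e \<in> \<phi> ` carrier (quotient_module M N)"
            unfolding carr by (rule image_eqI [of _ _ "N +>\<^bsub>M\<^esub> u"]) (use u \<phi> in auto)
        qed
      qed
    qed
  next
    fix U V assume "U \<in> carrier (quotient_module M N)" "V \<in> carrier (quotient_module M N)"
    then obtain u v where uv: "u \<in> carrier M" "v \<in> carrier M" "U = N +>\<^bsub>M\<^esub> u" "V = N +>\<^bsub>M\<^esub> v"
      unfolding carr by blast
    then have "U \<oplus>\<^bsub>quotient_module M N\<^esub> V = N +>\<^bsub>M\<^esub> (u \<oplus>\<^bsub>M\<^esub> v)"
      by (simp add: quotient_module_def a_rcos_sum)
    then show "\<phi> (U \<oplus>\<^bsub>quotient_module M N\<^esub> V) = \<phi> U \<oplus>\<^bsub>E\<^esub> \<phi> V"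
      using uv by (simp add: \<phi> add)
  next
    fix s U assume s: "s \<in> S" and "U \<in> carrier (quotient_module M N)"
    then obtain u where "u \<in> carrier M" "U = N +>\<^bsub>M\<^esub> u" unfolding carr by blast
    then show "\<phi> (s \<odot>\<^bsub>quotient_module M N\<^esub> U) = s \<odot>\<^bsub>E\<^esub> \<phi> U"
      using coset_smult [OF s] smult_closed [OF s] smult [OF s] \<phi> by simp
  qed
  with \<phi> show "\<exists>\<phi> \<in> equivariant_iso S (quotient_module M N) E. \<forall>u\<in>carrier M. \<phi> (N +>\<^bsub>M\<^esub> u) = \<chi> u" by blast
qed

text \<open>The additional scalars act by R-endomorphisms of N, so composing with them preserves
  homomorphisms, cocycles and coboundaries.\<close>

definition linear_actions :: "('r, 'x) ring_scheme \<Rightarrow> ('r, 'n) module \<Rightarrow> 's set \<Rightarrow> ('s \<Rightarrow> 'n \<Rightarrow> 'n) \<Rightarrow> bool" where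
  "linear_actions R N S act \<longleftrightarrow> (\<forall>s\<in>S. restrict (act s) (carrier N) \<in> left_module_hom R N N)"

text \<open>The complex of homomorphisms into N. \<open>C n\<close> and \<open>Bd n\<close> belong
  to degree n + 1, so that coboundaries always come from a preceding term.\<close>

locale cochain_complex =
  fixes R :: "('r, 'x) ring_scheme" and N :: "('r, 'n) module" and S :: "'s set" and act
    and B :: "nat \<Rightarrow> 'i set" and d
  assumes N: "left_module R N" and act: "linear_actions R N S act"
    and d: "\<And>n. d n \<in> left_module_hom R (free_left_module R (B (Suc n))) (free_left_module R (B n))"
    and dd: "\<And>n p. p \<in> carrier (free_left_module R (B (Suc (Suc n)))) \<Longrightarrow>
      d n (d (Suc n) p) = \<zero>\<^bsub>free_left_module R (B n)\<^esub>"
begin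

abbreviation "FM n \<equiv> free_left_module R (B n)"
abbreviation "C n \<equiv> cocycle_module R N act B d (Suc n)"
abbreviation "Bd n \<equiv> coboundaries R N B d (Suc n)"

interpretation N: left_module R N by (rule N)

lemma lm: "left_module R (FM n)"
  by (rule left_module_free [OF N.ring_scalars])

lemma cocycle_carrier: "f \<in> carrier (C n) \<longleftrightarrow> f \<in> left_module_hom R (FM (Suc n)) N \<and>
    (\<forall>p\<in>carrier (FM (Suc (Suc n))). f (d (Suc n) p) = \<zero>\<^bsub>N\<^esub>)"
  by (simp add: cocycle_module_def)

lemma cocycle_simps:
  "f \<oplus>\<^bsub>C n\<^esub> g = (\<lambda>u\<in>carrier (FM (Suc n)). f u \<oplus>\<^bsub>N\<^esub> g u)"
  "\<zero>\<^bsub>C n\<^esub> = (\<lambda>u\<in>carrier (FM (Suc n)). \<zero>\<^bsub>N\<^esub>)"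
  "s \<odot>\<^bsub>C n\<^esub> f = (\<lambda>u\<in>carrier (FM (Suc n)). act s (f u))"
  by (simp_all add: cocycle_module_def hom_module_def)

lemma neg_hom:
  assumes f: "f \<in> left_module_hom R (FM n) N"
  shows "restrict (\<lambda>u. \<ominus>\<^bsub>N\<^esub> f u) (carrier (FM n)) \<in> left_module_hom R (FM n) N"
proof -
  have "restrict (\<lambda>u. restrict (\<lambda>u. \<zero>\<^bsub>N\<^esub>) (carrier (FM n)) u \<ominus>\<^bsub>N\<^esub> f u) (carrier (FM n)) \<in> left_module_hom R (FM n) N"
    by (rule hom_minus [OF lm N zero_hom [OF lm N] f])
  moreover have "restrict (\<lambda>u. restrict (\<lambda>u. \<zero>\<^bsub>N\<^esub>) (carrier (FM n)) u \<ominus>\<^bsub>N\<^esub> f u) (carrier (FM n)) =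
      restrict (\<lambda>u. \<ominus>\<^bsub>N\<^esub> f u) (carrier (FM n))"
    by (rule restrict_ext) (use hom_closed [OF f] in \<open>simp add: N.M.minus_eq\<close>)
  ultimately show ?thesis by simp
qed

lemma abelian_group_cocycle: "abelian_group (C n)"
proof (rule abelian_groupI)
  have dcl: "d (Suc n) p \<in> carrier (FM (Suc n))" if "p \<in> carrier (FM (Suc (Suc n)))" for p
    by (rule hom_closed [OF d that])
  fix f g h assume f: "f \<in> carrier (C n)" and g: "g \<in> carrier (C n)" and h: "h \<in> carrier (C n)"
  note fh = f [unfolded cocycle_carrier, THEN conjunct1] and gh = g [unfolded cocycle_carrier, THEN conjunct1]
    and hh = h [unfolded cocycle_carrier, THEN conjunct1]
  note cl = hom_closed [OF fh] hom_closed [OF gh] hom_closed [OF hh]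
  show "f \<oplus>\<^bsub>C n\<^esub> g \<in> carrier (C n)"
    using f g hom_plus [OF lm N fh gh] dcl unfolding cocycle_carrier cocycle_simps by simp
  show "(f \<oplus>\<^bsub>C n\<^esub> g) \<oplus>\<^bsub>C n\<^esub> h = f \<oplus>\<^bsub>C n\<^esub> (g \<oplus>\<^bsub>C n\<^esub> h)"
    unfolding cocycle_simps by (rule restrict_ext) (simp add: cl N.M.a_assoc)
  show "f \<oplus>\<^bsub>C n\<^esub> g = g \<oplus>\<^bsub>C n\<^esub> f"
    unfolding cocycle_simps by (rule restrict_ext) (simp add: cl N.M.a_comm)
  show "\<zero>\<^bsub>C n\<^esub> \<oplus>\<^bsub>C n\<^esub> f = f"
  proof (rule hom_eqI)
    show "\<zero>\<^bsub>C n\<^esub> \<oplus>\<^bsub>C n\<^esub> f \<in> left_module_hom R (FM (Suc n)) N"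
      unfolding cocycle_simps by (rule hom_plus [OF lm N zero_hom [OF lm N] fh])
  qed (use fh cl in \<open>simp_all add: cocycle_simps\<close>)
  show "\<exists>g\<in>carrier (C n). g \<oplus>\<^bsub>C n\<^esub> f = \<zero>\<^bsub>C n\<^esub>"
  proof (rule bexI)
    show "restrict (\<lambda>u. \<ominus>\<^bsub>N\<^esub> f u) (carrier (FM (Suc n))) \<in> carrier (C n)"
      using f neg_hom [OF fh] dcl unfolding cocycle_carrier by simp
    show "restrict (\<lambda>u. \<ominus>\<^bsub>N\<^esub> f u) (carrier (FM (Suc n))) \<oplus>\<^bsub>C n\<^esub> f = \<zero>\<^bsub>C n\<^esub>"
      unfolding cocycle_simps by (rule restrict_ext) (simp add: cl N.M.l_neg)
  qed
next
  show "\<zero>\<^bsub>C n\<^esub> \<in> carrier (C n)"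
    using zero_hom [OF lm N] hom_closed [OF d] unfolding cocycle_carrier cocycle_simps by simp
qed

text \<open>Subtraction is defined through the group inverse, so its pointwise form is obtained by
  adding g back.\<close>

lemma cocycle_minus:
  assumes f: "f \<in> carrier (C n)" and g: "g \<in> carrier (C n)"
  shows "f \<ominus>\<^bsub>C n\<^esub> g = (\<lambda>u\<in>carrier (FM (Suc n)). f u \<ominus>\<^bsub>N\<^esub> g u)"
proof -
  interpret C: abelian_group "C n" by (rule abelian_group_cocycle)
  note fh = f [unfolded cocycle_carrier, THEN conjunct1] and gh = g [unfolded cocycle_carrier, THEN conjunct1]
  let ?m = "\<lambda>u\<in>carrier (FM (Suc n)). f u \<ominus>\<^bsub>N\<^esub> g u"
  have m: "?m \<in> carrier (C n)"
    using f g hom_minus [OF lm N fh gh] hom_closed [OF d] unfolding cocycle_carrier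
    by (simp add: N.M.minus_eq)
  have "?m \<oplus>\<^bsub>C n\<^esub> g = f"
  proof (rule hom_eqI [OF _ fh])
    show "?m \<oplus>\<^bsub>C n\<^esub> g \<in> left_module_hom R (FM (Suc n)) N"
      using C.a_closed [OF m g] unfolding cocycle_carrier by blast
    show "(?m \<oplus>\<^bsub>C n\<^esub> g) u = f u" if "u \<in> carrier (FM (Suc n))" for u
      using that hom_closed [OF fh that] hom_closed [OF gh that]
      by (simp add: cocycle_simps N.M.minus_eq N.M.a_assoc N.M.l_neg)
  qed
  then have "f \<ominus>\<^bsub>C n\<^esub> g = (?m \<oplus>\<^bsub>C n\<^esub> g) \<ominus>\<^bsub>C n\<^esub> g" by simp
  also have "\<dots> = ?m" using m g by (simp add: C.minus_eq C.a_assoc C.r_neg del: restrict_apply)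
  finally show ?thesis .
qed

lemma coboundary_iff: "f \<in> Bd n \<longleftrightarrow>
    (\<exists>g\<in>left_module_hom R (FM n) N. f = (\<lambda>p\<in>carrier (FM (Suc n)). g (d n p)))"
  by (auto simp: coboundaries_def)

lemma coboundaryI: "g \<in> left_module_hom R (FM n) N \<Longrightarrow> (\<lambda>p\<in>carrier (FM (Suc n)). g (d n p)) \<in> Bd n"
  unfolding coboundary_iff by blast

lemma coboundary_cocycle: "f \<in> Bd n \<Longrightarrow> f \<in> carrier (C n)"
  unfolding coboundary_iff cocycle_carrier
  using hom_compose [OF lm d] hom_closed [OF d] dd hom_zero [OF lm N] by fastforce

lemma additive_subgroup_coboundary: "additive_subgroup (Bd n) (C n)"
proof (rule additive_subgroupI)
  interpret C: abelian_group "C n" by (rule abelian_group_cocycle)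
  show "subgroup (Bd n) (add_monoid (C n))"
  proof (rule C.add.subgroupI)
    show "Bd n \<subseteq> carrier (C n)" using coboundary_cocycle by blast
    show "Bd n \<noteq> {}" using coboundaryI [OF zero_hom [OF lm N]] by blast
  next
    fix f assume f: "f \<in> Bd n"
    then obtain g where g: "g \<in> left_module_hom R (FM n) N" "f = (\<lambda>p\<in>carrier (FM (Suc n)). g (d n p))"
      unfolding coboundary_iff by blast
    have "\<ominus>\<^bsub>C n\<^esub> f = \<zero>\<^bsub>C n\<^esub> \<ominus>\<^bsub>C n\<^esub> f"
      using coboundary_cocycle [OF f] by (simp add: C.minus_eq)
    also have "\<dots> = (\<lambda>u\<in>carrier (FM (Suc n)). \<zero>\<^bsub>C n\<^esub> u \<ominus>\<^bsub>N\<^esub> f u)"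
      by (rule cocycle_minus [OF C.zero_closed coboundary_cocycle [OF f]])
    also have "\<dots> = (\<lambda>p\<in>carrier (FM (Suc n)). restrict (\<lambda>u. \<ominus>\<^bsub>N\<^esub> g u) (carrier (FM n)) (d n p))"
      by (rule restrict_ext)
        (use hom_closed [OF d] hom_closed [OF g(1)] in \<open>simp add: cocycle_simps g(2) N.M.minus_eq\<close>)
    finally show "\<ominus>\<^bsub>C n\<^esub> f \<in> Bd n" using coboundaryI [OF neg_hom [OF g(1)]] by simp
  next
    fix f f' assume "f \<in> Bd n" "f' \<in> Bd n"
    then obtain g g' where g: "g \<in> left_module_hom R (FM n) N" "f = (\<lambda>p\<in>carrier (FM (Suc n)). g (d n p))"
      and g': "g' \<in> left_module_hom R (FM n) N" "f' = (\<lambda>p\<in>carrier (FM (Suc n)). g' (d n p))"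
      unfolding coboundary_iff by blast
    have "f \<oplus>\<^bsub>C n\<^esub> f' = (\<lambda>p\<in>carrier (FM (Suc n)). restrict (\<lambda>u. g u \<oplus>\<^bsub>N\<^esub> g' u) (carrier (FM n)) (d n p))"
      unfolding cocycle_simps by (rule restrict_ext) (use hom_closed [OF d] in \<open>simp add: g(2) g'(2)\<close>)
    then show "f \<oplus>\<^bsub>C n\<^esub> f' \<in> Bd n" using coboundaryI [OF hom_plus [OF lm N g(1) g'(1)]] by simp
  qed
qed

lemma cocycle_smult_closed:
  assumes s: "s \<in> S" and f: "f \<in> carrier (C n)"
  shows "s \<odot>\<^bsub>C n\<^esub> f \<in> carrier (C n)"
proof -
  note fh = f [unfolded cocycle_carrier, THEN conjunct1]
  have a: "restrict (act s) (carrier N) \<in> left_module_hom R N N"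
    using act s unfolding linear_actions_def by blast
  have "s \<odot>\<^bsub>C n\<^esub> f = restrict (\<lambda>u. restrict (act s) (carrier N) (f u)) (carrier (FM (Suc n)))"
    unfolding cocycle_simps by (rule restrict_ext) (simp add: hom_closed [OF fh])
  moreover have "act s \<zero>\<^bsub>N\<^esub> = \<zero>\<^bsub>N\<^esub>" using hom_zero [OF N N a] by simp
  ultimately show ?thesis
    using f hom_compose [OF lm fh a] hom_closed [OF d] unfolding cocycle_carrier by simp
qed

lemma coboundary_smult:
  assumes s: "s \<in> S" and f: "f \<in> Bd n"
  shows "s \<odot>\<^bsub>C n\<^esub> f \<in> Bd n"
proof -
  obtain g where g: "g \<in> left_module_hom R (FM n) N" "f = (\<lambda>p\<in>carrier (FM (Suc n)). g (d n p))"
    using f unfolding coboundary_iff by blast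
  have a: "restrict (act s) (carrier N) \<in> left_module_hom R N N"
    using act s unfolding linear_actions_def by blast
  have "s \<odot>\<^bsub>C n\<^esub> f = (\<lambda>p\<in>carrier (FM (Suc n)).
      restrict (\<lambda>u. restrict (act s) (carrier N) (g u)) (carrier (FM n)) (d n p))"
    unfolding cocycle_simps g(2)
    by (rule restrict_ext) (simp add: hom_closed [OF g(1)] hom_closed [OF d])
  then show ?thesis using coboundaryI [OF hom_compose [OF lm g(1) a]] by simp
qed

lemma coset_eq_iff:
  assumes u: "u \<in> carrier (C n)" and v: "v \<in> carrier (C n)"
  shows "Bd n +>\<^bsub>C n\<^esub> u = Bd n +>\<^bsub>C n\<^esub> v \<longleftrightarrow> u \<ominus>\<^bsub>C n\<^esub> v \<in> Bd n"
proof -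
  interpret abelian_subgroup "Bd n" "C n"
    by (rule abelian_subgroupI3 [OF additive_subgroup_coboundary abelian_group_cocycle])
  show ?thesis
    using a_rcos_module [OF v u] a_repr_independence' [of u v] a_repr_independenceD [OF u, of v] v
    unfolding minus_eq by blast
qed

lemma carrier_cohomology: "carrier (cohomology_module R N act B d (Suc n)) = (\<lambda>u. Bd n +>\<^bsub>C n\<^esub> u) ` carrier (C n)"
  unfolding cohomology_module_def quotient_module_def A_RCOSETS_def' by auto

lemma coset_add:
  assumes "u \<in> carrier (C n)" "v \<in> carrier (C n)"
  shows "(Bd n +>\<^bsub>C n\<^esub> u) \<oplus>\<^bsub>cohomology_module R N act B d (Suc n)\<^esub> (Bd n +>\<^bsub>C n\<^esub> v) = Bd n +>\<^bsub>C n\<^esub> (u \<oplus>\<^bsub>C n\<^esub> v)"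
proof -
  interpret abelian_subgroup "Bd n" "C n"
    by (rule abelian_subgroupI3 [OF additive_subgroup_coboundary abelian_group_cocycle])
  show ?thesis using a_rcos_sum [OF assms] by (simp add: cohomology_module_def quotient_module_def)
qed

lemma coset_smult:
  assumes s: "s \<in> S" and u: "u \<in> carrier (C n)"
  shows "s \<odot>\<^bsub>cohomology_module R N act B d (Suc n)\<^esub> (Bd n +>\<^bsub>C n\<^esub> u) = Bd n +>\<^bsub>C n\<^esub> (s \<odot>\<^bsub>C n\<^esub> u)"
proof -
  interpret abelian_subgroup "Bd n" "C n"
    by (rule abelian_subgroupI3 [OF additive_subgroup_coboundary abelian_group_cocycle])
  note uh = u [unfolded cocycle_carrier, THEN conjunct1]
  have a: "restrict (act s) (carrier N) \<in> left_module_hom R N N"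
    using act s unfolding linear_actions_def by blast
  have "Bd n +>\<^bsub>C n\<^esub> (s \<odot>\<^bsub>C n\<^esub> h) = Bd n +>\<^bsub>C n\<^esub> (s \<odot>\<^bsub>C n\<^esub> u)" if h: "h \<in> Bd n +>\<^bsub>C n\<^esub> u" for h
  proof -
    obtain i where i: "i \<in> Bd n" "h = i \<oplus>\<^bsub>C n\<^esub> u" using h unfolding a_r_coset_def' by fast
    note ih = coboundary_cocycle [OF i(1), unfolded cocycle_carrier, THEN conjunct1]
    have "act s (i p \<oplus>\<^bsub>N\<^esub> u p) = act s (i p) \<oplus>\<^bsub>N\<^esub> act s (u p)" if "p \<in> carrier (FM (Suc n))" for p
      using hom_add [OF a hom_closed [OF ih that] hom_closed [OF uh that]]
        hom_closed [OF ih that] hom_closed [OF uh that] by simp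
    then have "s \<odot>\<^bsub>C n\<^esub> h = (s \<odot>\<^bsub>C n\<^esub> i) \<oplus>\<^bsub>C n\<^esub> (s \<odot>\<^bsub>C n\<^esub> u)"
      unfolding i(2) cocycle_simps by (intro restrict_ext) simp
    then have "(s \<odot>\<^bsub>C n\<^esub> h) \<ominus>\<^bsub>C n\<^esub> (s \<odot>\<^bsub>C n\<^esub> u) = s \<odot>\<^bsub>C n\<^esub> i"
      using cocycle_smult_closed [OF s u] cocycle_smult_closed [OF s coboundary_cocycle [OF i(1)]]
      by (simp add: minus_eq a_assoc r_neg)
    then show ?thesis
      using coset_eq_iff [OF cocycle_smult_closed [OF s] cocycle_smult_closed [OF s u], of h]
        coboundary_smult [OF s i(1)] a_elemrcos_carrier [OF u h] by simp
  qed
  then have "(\<Union>h\<in>Bd n +>\<^bsub>C n\<^esub> u. Bd n +>\<^bsub>C n\<^esub> (s \<odot>\<^bsub>C n\<^esub> h)) = (\<Union>h\<in>Bd n +>\<^bsub>C n\<^esub> u. Bd n +>\<^bsub>C n\<^esub> (s \<odot>\<^bsub>C n\<^esub> u))"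
    by (intro SUP_cong refl)
  also have "\<dots> = Bd n +>\<^bsub>C n\<^esub> (s \<odot>\<^bsub>C n\<^esub> u)" using a_rcos_self [OF u] by blast
  finally show ?thesis by (simp add: cohomology_module_def quotient_module_def)
qed

end

lemma cochain_complex_resolution:
  assumes "left_module R N" "linear_actions R N S act" "free_resolution R M B d \<epsilon>"
  shows "cochain_complex R N S act B d"
  using assms(1,2) free_resolutionD(2) [OF assms(3)] free_resolution_d_d [OF assms(3)]
  by (intro cochain_complex.intro)

text \<open>K - id covers zero on M and is therefore null homotopic. For a cocycle f the homotopy
  identity gives f K - f = (f h) d, because f kills the image of the next differential.\<close>

lemma free_resolution_homotopy:
  assumes M: "left_module R M" and res: "free_resolution R M B d \<epsilon>"
    and K: "\<And>n. K n \<in> left_module_hom R (free_left_module R (B n)) (free_left_module R (B n))"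
    and K0: "\<And>p. p \<in> carrier (free_left_module R (B 0)) \<Longrightarrow> \<epsilon> (K 0 p) = \<epsilon> p"
    and Kd: "\<And>n p. p \<in> carrier (free_left_module R (B (Suc n))) \<Longrightarrow> d n (K (Suc n) p) = K n (d n p)"
    and N: "left_module R N" and act: "linear_actions R N S act"
    and f: "f \<in> carrier (cocycle_module R N act B d (Suc n))"
  shows "(\<lambda>p\<in>carrier (free_left_module R (B (Suc n))). f (K (Suc n) p)) \<ominus>\<^bsub>cocycle_module R N act B d (Suc n)\<^esub> f
    \<in> coboundaries R N B d (Suc n)"
    and "(\<lambda>p\<in>carrier (free_left_module R (B (Suc n))). f (K (Suc n) p)) \<in> carrier (cocycle_module R N act B d (Suc n))"
proof -
  interpret cochain_complex R N S act B d by (rule cochain_complex_resolution [OF N act res])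
  interpret N: left_module R N by (rule N)
  interpret L: left_module R "FM m" for m by (rule lm)
  note D = free_resolutionD [OF res]
  have fh: "f \<in> left_module_hom R (FM (Suc n)) N" using f unfolding cocycle_carrier by blast
  define K' where "K' n = restrict (\<lambda>p. K n p \<ominus>\<^bsub>FM n\<^esub> restrict (\<lambda>p. p) (carrier (FM n)) p) (carrier (FM n))" for n
  have idh: "restrict (\<lambda>p. p) (carrier (FM n)) \<in> left_module_hom R (FM n) (FM n)" for n
    by (rule left_module_homI [OF _ _ _ lm]) simp_all
  have K': "K' n \<in> left_module_hom R (FM n) (FM n)" for n
    unfolding K'_def by (rule hom_minus [OF lm lm K idh])
  have K'_eq: "K' n p = K n p \<ominus>\<^bsub>FM n\<^esub> p" if "p \<in> carrier (FM n)" for n p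
    using that by (simp add: K'_def del: free_left_module_simps)
  have split: "K n p = K' n p \<oplus>\<^bsub>FM n\<^esub> p" if "p \<in> carrier (FM n)" for n p
    using that hom_closed [OF K that]
    by (simp add: K'_eq L.M.minus_eq L.M.a_assoc L.M.l_neg del: free_left_module_simps)
  interpret M: left_module R M by (rule M)
  have e0: "\<epsilon> (K' 0 p) = \<zero>\<^bsub>M\<^esub>" if p: "p \<in> carrier (FM 0)" for p
  proof -
    have "\<epsilon> p = \<epsilon> (K' 0 p) \<oplus>\<^bsub>M\<^esub> \<epsilon> p"
      using hom_add [OF D(1) hom_closed [OF K' p] p] K0 [OF p] split [OF p] by simp
    then show ?thesis
      using hom_closed [OF D(1) p] hom_closed [OF D(1) hom_closed [OF K' p]] by (metis M.M.add.r_cancel_one')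
  qed
  have ed: "d n (K' (Suc n) p) = K' n (d n p)" if p: "p \<in> carrier (FM (Suc n))" for n p
  proof -
    have dp: "d n p \<in> carrier (FM n)" by (rule hom_closed [OF d p])
    have "K n (d n p) = d n (K' (Suc n) p) \<oplus>\<^bsub>FM n\<^esub> d n p"
      using hom_add [OF d hom_closed [OF K' p] p] Kd [OF p] split [OF p] by (simp del: free_left_module_simps)
    then have "K' n (d n p) \<oplus>\<^bsub>FM n\<^esub> d n p = d n (K' (Suc n) p) \<oplus>\<^bsub>FM n\<^esub> d n p"
      unfolding split [OF dp] .
    from L.M.add.r_cancel [OF this [symmetric]] show ?thesis
      using dp hom_closed [OF K' dp] hom_closed [OF d hom_closed [OF K' p]] by blast
  qed
  obtain h where h: "\<And>n. h n \<in> left_module_hom R (FM n) (FM (Suc n))"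
    "\<And>n p. p \<in> carrier (FM (Suc n)) \<Longrightarrow> d (Suc n) (h (Suc n) p) = K' (Suc n) p \<ominus>\<^bsub>FM (Suc n)\<^esub> h n (d n p)"
    using null_homotopy_exists [OF M res K', OF e0 ed] by blast
  define g where "g = restrict (\<lambda>p. f (h n p)) (carrier (FM n))"
  have g: "g \<in> left_module_hom R (FM n) N" unfolding g_def by (rule hom_compose [OF lm h(1) fh])
  have fK: "f (K (Suc n) p) = g (d n p) \<oplus>\<^bsub>N\<^esub> f p" if p: "p \<in> carrier (FM (Suc n))" for p
  proof -
    have dp: "d n p \<in> carrier (FM n)" by (rule hom_closed [OF d p])
    have hs: "h (Suc n) p \<in> carrier (FM (Suc (Suc n)))" by (rule hom_closed [OF h(1) p])
    have hd: "h n (d n p) \<in> carrier (FM (Suc n))" by (rule hom_closed [OF h(1) dp])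
    have kp: "K' (Suc n) p \<in> carrier (FM (Suc n))" by (rule hom_closed [OF K' p])
    have "K' (Suc n) p = d (Suc n) (h (Suc n) p) \<oplus>\<^bsub>FM (Suc n)\<^esub> h n (d n p)"
      unfolding h(2) [OF p] using kp hd
      by (simp add: L.M.minus_eq L.M.a_assoc L.M.l_neg del: free_left_module_simps)
    then have "f (K' (Suc n) p) = f (d (Suc n) (h (Suc n) p)) \<oplus>\<^bsub>N\<^esub> f (h n (d n p))"
      using hom_add [OF fh hom_closed [OF d hs] hd] by simp
    also have "f (d (Suc n) (h (Suc n) p)) = \<zero>\<^bsub>N\<^esub>" using f hs unfolding cocycle_carrier by blast
    finally have "f (K' (Suc n) p) = g (d n p)"
      using hom_closed [OF fh hd] dp by (simp add: g_def)
    then show ?thesis using hom_add [OF fh kp p] split [OF p] by simp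
  qed
  let ?fK = "\<lambda>p\<in>carrier (FM (Suc n)). f (K (Suc n) p)"
  have "f (K (Suc n) (d (Suc n) p)) = \<zero>\<^bsub>N\<^esub>" if p: "p \<in> carrier (FM (Suc (Suc n)))" for p
    using f hom_closed [OF K p] unfolding cocycle_carrier Kd [OF p, symmetric] by blast
  then show c: "?fK \<in> carrier (C n)"
    using hom_compose [OF lm K fh] hom_closed [OF d] unfolding cocycle_carrier by simp
  have "?fK \<ominus>\<^bsub>C n\<^esub> f = (\<lambda>p\<in>carrier (FM (Suc n)). g (d n p))"
    unfolding cocycle_minus [OF c f]
    by (rule restrict_ext)
      (use hom_closed [OF fh] hom_closed [OF g] hom_closed [OF d] in
        \<open>simp add: fK N.M.minus_eq N.M.a_assoc N.M.r_neg\<close>)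
  then show "?fK \<ominus>\<^bsub>C n\<^esub> f \<in> Bd n" using coboundaryI [OF g] by simp
qed

lemma cocycle_pullback:
  assumes C: "cochain_complex R N S act B d" and C': "cochain_complex R N S act B' d'"
    and G: "\<And>n. G n \<in> left_module_hom R (free_left_module R (B' n)) (free_left_module R (B n))"
    and Gd: "\<And>n p. p \<in> carrier (free_left_module R (B' (Suc n))) \<Longrightarrow> d n (G (Suc n) p) = G n (d' n p)"
  shows "f \<in> carrier (cocycle_module R N act B d (Suc n)) \<Longrightarrow>
      (\<lambda>p\<in>carrier (free_left_module R (B' (Suc n))). f (G (Suc n) p)) \<in> carrier (cocycle_module R N act B' d' (Suc n))"
    and "f \<in> coboundaries R N B d (Suc n) \<Longrightarrow>
      (\<lambda>p\<in>carrier (free_left_module R (B' (Suc n))). f (G (Suc n) p)) \<in> coboundaries R N B' d' (Suc n)"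
proof -
  interpret C: cochain_complex R N S act B d by (rule C)
  interpret C': cochain_complex R N S act B' d' by (rule C')
  show "(\<lambda>p\<in>carrier (C'.FM (Suc n)). f (G (Suc n) p)) \<in> carrier (C'.C n)" if f: "f \<in> carrier (C.C n)"
  proof -
    have fh: "f \<in> left_module_hom R (C.FM (Suc n)) N" using f unfolding C.cocycle_carrier by blast
    have "f (G (Suc n) (d' (Suc n) p)) = \<zero>\<^bsub>N\<^esub>" if p: "p \<in> carrier (C'.FM (Suc (Suc n)))" for p
      using f hom_closed [OF G p] unfolding C.cocycle_carrier Gd [OF p, symmetric] by blast
    then show ?thesis
      using hom_compose [OF C'.lm G fh] hom_closed [OF C'.d] unfolding C'.cocycle_carrier by simp
  qed
  show "(\<lambda>p\<in>carrier (C'.FM (Suc n)). f (G (Suc n) p)) \<in> C'.Bd n" if f: "f \<in> C.Bd n"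
  proof -
    obtain g where g: "g \<in> left_module_hom R (C.FM n) N" "f = (\<lambda>p\<in>carrier (C.FM (Suc n)). g (d n p))"
      using f unfolding C.coboundary_iff by blast
    have "(\<lambda>p\<in>carrier (C'.FM (Suc n)). f (G (Suc n) p)) =
        (\<lambda>p\<in>carrier (C'.FM (Suc n)). restrict (\<lambda>p. g (G n p)) (carrier (C'.FM n)) (d' n p))"
      by (rule restrict_ext) (simp add: g(2) hom_closed [OF G] hom_closed [OF C'.d] Gd)
    then show ?thesis using C'.coboundaryI [OF hom_compose [OF C'.lm G g(1)]] by simp
  qed
qed

text \<open>Chain maps F and G exist in both directions, and their composites act as the identity on
  cohomology. The pullback along G commutes with S because S acts on values only.\<close>

theorem cohomology_resolution_independent:
  fixes R :: "('r, 'x) ring_scheme" and N :: "('r, 'n) module"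
    and B :: "nat \<Rightarrow> 'i set" and B' :: "nat \<Rightarrow> 'j set"
  assumes M: "left_module R M" and N: "left_module R N" and act: "linear_actions R N S act"
    and res: "free_resolution R M B d \<epsilon>" and res': "free_resolution R M B' d' \<epsilon>'"
  shows "equivariant_iso S (cohomology_module R N act B d (Suc n)) (cohomology_module R N act B' d' (Suc n)) \<noteq> {}"
proof -
  interpret C: cochain_complex R N S act B d by (rule cochain_complex_resolution [OF N act res])
  interpret C': cochain_complex R N S act B' d' by (rule cochain_complex_resolution [OF N act res'])
  obtain F where F: "\<And>n. F n \<in> left_module_hom R (C.FM n) (C'.FM n)"
    "\<And>p. p \<in> carrier (C.FM 0) \<Longrightarrow> \<epsilon>' (F 0 p) = \<epsilon> p"
    "\<And>n p. p \<in> carrier (C.FM (Suc n)) \<Longrightarrow> d' n (F (Suc n) p) = F n (d n p)"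
    using chain_map_exists [OF M res res'] by blast
  obtain G where G: "\<And>n. G n \<in> left_module_hom R (C'.FM n) (C.FM n)"
    "\<And>p. p \<in> carrier (C'.FM 0) \<Longrightarrow> \<epsilon> (G 0 p) = \<epsilon>' p"
    "\<And>n p. p \<in> carrier (C'.FM (Suc n)) \<Longrightarrow> d n (G (Suc n) p) = G n (d' n p)"
    using chain_map_exists [OF M res' res] by blast
  define \<Phi> where "\<Phi> f = (\<lambda>p\<in>carrier (C'.FM (Suc n)). f (G (Suc n) p))" for f :: "('i \<Rightarrow> 'r) \<Rightarrow> 'n"
  define \<Psi> where "\<Psi> f = (\<lambda>p\<in>carrier (C.FM (Suc n)). f (F (Suc n) p))" for f :: "('j \<Rightarrow> 'r) \<Rightarrow> 'n"
  have \<Phi>: "\<Phi> f \<in> carrier (C'.C n)" if "f \<in> carrier (C.C n)" for f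
    unfolding \<Phi>_def by (rule cocycle_pullback(1) [OF C.cochain_complex_axioms C'.cochain_complex_axioms G(1,3) that])
  have \<Phi>B: "\<Phi> f \<in> C'.Bd n" if "f \<in> C.Bd n" for f
    unfolding \<Phi>_def by (rule cocycle_pullback(2) [OF C.cochain_complex_axioms C'.cochain_complex_axioms G(1,3) that])
  have \<Psi>: "\<Psi> f \<in> carrier (C.C n)" if "f \<in> carrier (C'.C n)" for f
    unfolding \<Psi>_def by (rule cocycle_pullback(1) [OF C'.cochain_complex_axioms C.cochain_complex_axioms F(1,3) that])
  have \<Psi>B: "\<Psi> f \<in> C.Bd n" if "f \<in> C'.Bd n" for f
    unfolding \<Psi>_def by (rule cocycle_pullback(2) [OF C'.cochain_complex_axioms C.cochain_complex_axioms F(1,3) that])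
  have GF: "\<Psi> (\<Phi> f) \<ominus>\<^bsub>C.C n\<^esub> f \<in> C.Bd n" if f: "f \<in> carrier (C.C n)" for f
  proof -
    let ?K = "\<lambda>n. restrict (\<lambda>p. G n (F n p)) (carrier (C.FM n))"
    have "(\<lambda>p\<in>carrier (C.FM (Suc n)). f (?K (Suc n) p)) \<ominus>\<^bsub>C.C n\<^esub> f \<in> C.Bd n"
    proof (rule free_resolution_homotopy(1) [OF M res _ _ _ N act f])
      show "?K n \<in> left_module_hom R (C.FM n) (C.FM n)" for n by (rule hom_compose [OF C.lm F(1) G(1)])
      show "\<epsilon> (?K 0 p) = \<epsilon> p" if "p \<in> carrier (C.FM 0)" for p
        using that F(2) G(2) hom_closed [OF F(1)] by simp
      show "d n (?K (Suc n) p) = ?K n (d n p)" if "p \<in> carrier (C.FM (Suc n))" for n p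
        using that F(3) G(3) hom_closed [OF F(1)] hom_closed [OF C.d] by simp
    qed
    moreover have "\<Psi> (\<Phi> f) = (\<lambda>p\<in>carrier (C.FM (Suc n)). f (?K (Suc n) p))"
      unfolding \<Phi>_def \<Psi>_def by (rule restrict_ext) (simp add: hom_closed [OF F(1)])
    ultimately show ?thesis by simp
  qed
  have FG: "\<Phi> (\<Psi> f) \<ominus>\<^bsub>C'.C n\<^esub> f \<in> C'.Bd n" if f: "f \<in> carrier (C'.C n)" for f
  proof -
    let ?K = "\<lambda>n. restrict (\<lambda>p. F n (G n p)) (carrier (C'.FM n))"
    have "(\<lambda>p\<in>carrier (C'.FM (Suc n)). f (?K (Suc n) p)) \<ominus>\<^bsub>C'.C n\<^esub> f \<in> C'.Bd n"
    proof (rule free_resolution_homotopy(1) [OF M res' _ _ _ N act f])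
      show "?K n \<in> left_module_hom R (C'.FM n) (C'.FM n)" for n by (rule hom_compose [OF C'.lm G(1) F(1)])
      show "\<epsilon>' (?K 0 p) = \<epsilon>' p" if "p \<in> carrier (C'.FM 0)" for p
        using that F(2) G(2) hom_closed [OF G(1)] by simp
      show "d' n (?K (Suc n) p) = ?K n (d' n p)" if "p \<in> carrier (C'.FM (Suc n))" for n p
        using that F(3) G(3) hom_closed [OF G(1)] hom_closed [OF C'.d] by simp
    qed
    moreover have "\<Phi> (\<Psi> f) = (\<lambda>p\<in>carrier (C'.FM (Suc n)). f (?K (Suc n) p))"
      unfolding \<Phi>_def \<Psi>_def by (rule restrict_ext) (simp add: hom_closed [OF G(1)])
    ultimately show ?thesis by simp
  qed
  have \<Phi>add: "\<Phi> (u \<oplus>\<^bsub>C.C n\<^esub> v) = \<Phi> u \<oplus>\<^bsub>C'.C n\<^esub> \<Phi> v" for u v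
    unfolding \<Phi>_def C.cocycle_simps C'.cocycle_simps by (rule restrict_ext) (simp add: hom_closed [OF G(1)])
  have \<Phi>sm: "\<Phi> (s \<odot>\<^bsub>C.C n\<^esub> u) = s \<odot>\<^bsub>C'.C n\<^esub> \<Phi> u" for s u
    unfolding \<Phi>_def C.cocycle_simps C'.cocycle_simps by (rule restrict_ext) (simp add: hom_closed [OF G(1)])
  have \<Phi>minus: "\<Phi> (u \<ominus>\<^bsub>C.C n\<^esub> v) = \<Phi> u \<ominus>\<^bsub>C'.C n\<^esub> \<Phi> v"
    if "u \<in> carrier (C.C n)" "v \<in> carrier (C.C n)" for u v
    unfolding C.cocycle_minus [OF that] C'.cocycle_minus [OF \<Phi> [OF that(1)] \<Phi> [OF that(2)]]
    unfolding \<Phi>_def by (rule restrict_ext) (simp add: hom_closed [OF G(1)])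
  interpret CG: abelian_group "C.C n" by (rule C.abelian_group_cocycle)
  interpret CB: additive_subgroup "C.Bd n" "C.C n" by (rule C.additive_subgroup_coboundary)
  let ?\<chi> = "\<lambda>f. C'.Bd n +>\<^bsub>C'.C n\<^esub> \<Phi> f"
  have "\<exists>\<phi> \<in> equivariant_iso S (quotient_module (C.C n) (C.Bd n)) (cohomology_module R N act B' d' (Suc n)).
      \<forall>u\<in>carrier (C.C n). \<phi> (C.Bd n +>\<^bsub>C.C n\<^esub> u) = ?\<chi> u"
  proof (rule equivariant_iso_quotient(1) [OF C.abelian_group_cocycle C.additive_subgroup_coboundary])
    fix u assume u: "u \<in> carrier (C.C n)"
    show "?\<chi> u \<in> carrier (cohomology_module R N act B' d' (Suc n))"
      unfolding C'.carrier_cohomology using \<Phi> [OF u] by blast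
    fix v assume v: "v \<in> carrier (C.C n)"
    show "?\<chi> (u \<oplus>\<^bsub>C.C n\<^esub> v) = ?\<chi> u \<oplus>\<^bsub>cohomology_module R N act B' d' (Suc n)\<^esub> ?\<chi> v"
      unfolding C'.coset_add [OF \<Phi> [OF u] \<Phi> [OF v]] \<Phi>add ..
    have w: "u \<ominus>\<^bsub>C.C n\<^esub> v \<in> carrier (C.C n)" by (rule CG.minus_closed [OF u v])
    have minus_eq_cancel: "a = b \<oplus>\<^bsub>C.C n\<^esub> \<ominus>\<^bsub>C.C n\<^esub> (b \<ominus>\<^bsub>C.C n\<^esub> a)"
      if "a \<in> carrier (C.C n)" "b \<in> carrier (C.C n)" for a b
      using that by (simp add: CG.minus_eq CG.minus_add CG.r_neg flip: CG.a_assoc)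
    \<comment> \<open>Injectivity on classes: if the image of w is a coboundary, then w is the
      coboundary \<open>\<Psi> (\<Phi> w)\<close> minus the coboundary
      \<open>\<Psi> (\<Phi> w) - w\<close>.\<close>
    have "u \<ominus>\<^bsub>C.C n\<^esub> v \<in> C.Bd n" if "\<Phi> (u \<ominus>\<^bsub>C.C n\<^esub> v) \<in> C'.Bd n"
    proof -
      let ?w = "u \<ominus>\<^bsub>C.C n\<^esub> v"
      have pw: "\<Psi> (\<Phi> ?w) \<in> carrier (C.C n)" by (rule \<Psi> [OF \<Phi> [OF w]])
      have "?w = \<Psi> (\<Phi> ?w) \<oplus>\<^bsub>C.C n\<^esub> \<ominus>\<^bsub>C.C n\<^esub> (\<Psi> (\<Phi> ?w) \<ominus>\<^bsub>C.C n\<^esub> ?w)"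
        using w pw minus_eq_cancel by blast
      also have "\<dots> \<in> C.Bd n" by (intro CB.a_closed CB.a_inv_closed \<Psi>B that GF w)
      finally show ?thesis .
    qed
    then show "?\<chi> u = ?\<chi> v \<longleftrightarrow> u \<ominus>\<^bsub>C.C n\<^esub> v \<in> C.Bd n"
      unfolding C'.coset_eq_iff [OF \<Phi> [OF u] \<Phi> [OF v]] \<Phi>minus [OF u v, symmetric] using \<Phi>B by blast
  next
    fix e assume "e \<in> carrier (cohomology_module R N act B' d' (Suc n))"
    then obtain v where v: "v \<in> carrier (C'.C n)" "e = C'.Bd n +>\<^bsub>C'.C n\<^esub> v"
      unfolding C'.carrier_cohomology by blast
    have "?\<chi> (\<Psi> v) = e"
      unfolding v(2) C'.coset_eq_iff [OF \<Phi> [OF \<Psi> [OF v(1)]] v(1)] by (rule FG [OF v(1)])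
    then show "\<exists>u\<in>carrier (C.C n). ?\<chi> u = e" using \<Psi> [OF v(1)] by blast
  next
    fix s u assume su: "s \<in> S" "u \<in> carrier (C.C n)"
    show "s \<odot>\<^bsub>C.C n\<^esub> u \<in> carrier (C.C n)" by (rule C.cocycle_smult_closed [OF su])
    show "?\<chi> (s \<odot>\<^bsub>C.C n\<^esub> u) = s \<odot>\<^bsub>cohomology_module R N act B' d' (Suc n)\<^esub> ?\<chi> u"
      unfolding C'.coset_smult [OF su(1) \<Phi> [OF su(2)]] \<Phi>sm ..
  qed
  then show ?thesis unfolding cohomology_module_def by blast
qed

text \<open>
  The index type prescribed by \<open>Ext_isomorphic\<close>; the lists \<open>[]\<close> and \<open>[undefined]\<close> serve as the two
  basis indices.
\<close>

type_synonym 'k down_up_element = "(generator list \<Rightarrow> 'k) set"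
type_synonym 'k resolution_index =
  "(('k down_up_element \<times> 'k down_up_element \<Rightarrow> 'k) set \<times> 'k down_up_element) list"

lemma regular_left_module_simps [simp]:
  "carrier (regular_left_module R) = carrier R"
  "u \<oplus>\<^bsub>regular_left_module R\<^esub> v = u \<oplus>\<^bsub>R\<^esub> v"
  "r \<odot>\<^bsub>regular_left_module R\<^esub> u = r \<otimes>\<^bsub>R\<^esub> u"
  "\<zero>\<^bsub>regular_left_module R\<^esub> = \<zero>\<^bsub>R\<^esub>"
  by (simp_all add: regular_left_module_def)

context down_up_params
begin

section \<open>A as a bimodule and the assembled resolution\<close>

lemma diagonal_module_simps [simp]:
  "carrier (diagonal_module A) = carrier A"
  "a \<oplus>\<^bsub>diagonal_module A\<^esub> b = a \<boxplus> b"
  "\<zero>\<^bsub>diagonal_module A\<^esub> = \<zero>\<^bsub>A\<^esub>"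
  by (simp_all add: diagonal_module_def)

text \<open>The action in \<open>diagonal_module\<close> unfolds literally to the lift of the
  bilinear map acb, so its independence of representatives comes from the universal property of the
  tensor product.\<close>

lemma diagonal_smult: "t \<odot>\<^bsub>diagonal_module A\<^esub> c = tensor_lift A (\<lambda>a b. a \<star> c \<star> b) t"
  by (simp add: diagonal_module_def tensor_lift_def linear_lift_def lin_comb_def)

lemma diagonal_bilinear: "c \<in> carrier A \<Longrightarrow> bilinear_map A (opposite_algebra A) A (\<lambda>a b. a \<star> c \<star> b)"
  by (simp add: bilinear_map_def A.l_distr A.r_distr A.smult_mult_left A.smult_mult_right)

lemma diagonal_smult_closed:
    "c \<in> carrier A \<Longrightarrow> t \<in> carrier E \<Longrightarrow> t \<odot>\<^bsub>diagonal_module A\<^esub> c \<in> carrier A"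
  unfolding diagonal_smult
  by (rule algebra_pair.tensor_lift_closed [OF env_pair A.left_module_field diagonal_bilinear])

lemma diagonal_smult_add:
    "c \<in> carrier A \<Longrightarrow> s \<in> carrier E \<Longrightarrow> t \<in> carrier E \<Longrightarrow>
      (s \<oplus>\<oplus> t) \<odot>\<^bsub>diagonal_module A\<^esub> c = s \<odot>\<^bsub>diagonal_module A\<^esub> c \<boxplus> t \<odot>\<^bsub>diagonal_module A\<^esub> c"
  unfolding diagonal_smult
  by (rule algebra_pair.tensor_lift_add [OF env_pair A.left_module_field diagonal_bilinear])

lemma diagonal_smult_tens:
    "a \<in> carrier A \<Longrightarrow> b \<in> carrier A \<Longrightarrow> c \<in> carrier A \<Longrightarrow> (a \<bowtie> b) \<odot>\<^bsub>diagonal_module A\<^esub> c = a \<star> c \<star> b"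
  unfolding diagonal_smult
  using algebra_pair.tensor_lift_pt [OF env_pair A.left_module_field diagonal_bilinear, of c a b] by simp

lemma diagonal_smult_zero: "c \<in> carrier A \<Longrightarrow> \<zero>\<^bsub>E\<^esub> \<odot>\<^bsub>diagonal_module A\<^esub> c = \<zero>\<^bsub>A\<^esub>"
  using diagonal_smult_add [of c "\<zero>\<^bsub>E\<^esub>" "\<zero>\<^bsub>E\<^esub>"] diagonal_smult_closed [of c "\<zero>\<^bsub>E\<^esub>"] by simp

lemma diagonal_smult_assoc:
  assumes c: "c \<in> carrier A" and s: "s \<in> carrier E" and t: "t \<in> carrier E"
  shows "(s \<odot>\<odot> t) \<odot>\<^bsub>diagonal_module A\<^esub> c = s \<odot>\<^bsub>diagonal_module A\<^esub> (t \<odot>\<^bsub>diagonal_module A\<^esub> c)"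
  using s
proof (induction s rule: env_induct)
  case zero
  then show ?case using c t by (simp add: diagonal_smult_zero diagonal_smult_closed)
next
  case (add a b s)
  have "((a \<bowtie> b) \<odot>\<odot> t) \<odot>\<^bsub>diagonal_module A\<^esub> c = a \<star> (t \<odot>\<^bsub>diagonal_module A\<^esub> c) \<star> b"
    using t
  proof (induction t rule: env_induct)
    case zero
    then show ?case using c add(1,2) by (simp add: diagonal_smult_zero)
  next
    case (add a' b' t)
    then show ?case
      using c \<open>a \<in> carrier A\<close> \<open>b \<in> carrier A\<close>
      by (simp add: E.r_distr diagonal_smult_add diagonal_smult_tens diagonal_smult_closed A.r_distr A.l_distr A.m_assoc)
  qed
  then show ?case using c t add
    by (simp add: E.l_distr diagonal_smult_add diagonal_smult_closed diagonal_smult_tens)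
qed

lemma left_module_diagonal: "left_module E (diagonal_module A)"
proof (intro left_module.intro left_module_axioms.intro)
  show "abelian_group (diagonal_module A)"
  proof (rule abelian_groupI)
    show "\<exists>b\<in>carrier (diagonal_module A). b \<oplus>\<^bsub>diagonal_module A\<^esub> a = \<zero>\<^bsub>diagonal_module A\<^esub>"
      if "a \<in> carrier (diagonal_module A)" for a
      by (rule bexI [of _ "\<ominus>\<^bsub>A\<^esub> a"]) (use that in \<open>simp_all add: A.l_neg\<close>)
  qed (simp_all add: A.a_ac)
  show "r \<odot>\<^bsub>diagonal_module A\<^esub> (u \<oplus>\<^bsub>diagonal_module A\<^esub> v) =
      r \<odot>\<^bsub>diagonal_module A\<^esub> u \<oplus>\<^bsub>diagonal_module A\<^esub> r \<odot>\<^bsub>diagonal_module A\<^esub> v"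
    if "r \<in> carrier E" "u \<in> carrier (diagonal_module A)" "v \<in> carrier (diagonal_module A)" for r u v
    using that
    by (induction r rule: env_induct)
      (simp_all add: diagonal_smult_zero diagonal_smult_add diagonal_smult_tens diagonal_smult_closed
        A.r_distr A.l_distr A.a_ac)
  show "\<one>\<^bsub>E\<^esub> \<odot>\<^bsub>diagonal_module A\<^esub> u = u" if "u \<in> carrier (diagonal_module A)" for u
    using that by (simp add: tens_one [symmetric] diagonal_smult_tens)
qed (simp_all add: E.ring_axioms diagonal_smult_closed diagonal_smult_add diagonal_smult_assoc)

text \<open>The augmentation is the action on 1; its linearity over the enveloping algebra follows
  from this.\<close>

lemma mulE_eq_smult: "t \<in> carrier E \<Longrightarrow> mulE t = t \<odot>\<^bsub>diagonal_module A\<^esub> oneA"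
  by (induction t rule: env_induct)
    (simp_all add: mulE_add mulE_tens diagonal_smult_zero diagonal_smult_add diagonal_smult_tens)

lemma mulE_mult: "s \<in> carrier E \<Longrightarrow> t \<in> carrier E \<Longrightarrow> mulE (s \<odot>\<odot> t) = s \<odot>\<^bsub>diagonal_module A\<^esub> mulE t"
  by (simp add: mulE_eq_smult diagonal_smult_assoc)

definition pair_vec where
  "pair_vec s t = (\<lambda>i :: 'k resolution_index. if i = [] then s else if i = [undefined] then t else \<zero>\<^bsub>E\<^esub>)"

definition basis :: "nat \<Rightarrow> 'k resolution_index set" where
  "basis n = (if n = 0 \<or> n = 3 then {[]} else if n = 1 \<or> n = 2 then {[], [undefined]} else {})"

text \<open>Matrix entries of the differentials; False and True stand for the basis indices
  \<open>[]\<close> and \<open>[undefined]\<close>. The first index belongs to the source, since row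
  vectors are multiplied by the matrix from the right.\<close>

definition entry where
  "entry n i j =
    (if n = 0 then if j then \<zero>\<^bsub>E\<^esub> else if i then dY else dX
     else if n = (1::nat) then fox (if j then GenY else GenX) (if i then rel2 else rel1)
     else if n = 2 \<and> \<not> i then if j then \<ominus>\<^bsub>E\<^esub> kappa2 else kappa1
     else \<zero>\<^bsub>E\<^esub>)"

abbreviation "FE n \<equiv> free_left_module E (basis n)"

definition differential where
  "differential n = (\<lambda>p\<in>carrier (FE (Suc n)).
     pair_vec (p [] \<odot>\<odot> entry n False False \<oplus>\<oplus> p [undefined] \<odot>\<odot> entry n True False)
       (p [] \<odot>\<odot> entry n False True \<oplus>\<oplus> p [undefined] \<odot>\<odot> entry n True True) :: 'k resolution_index \<Rightarrow> _)"

definition augmentation where "augmentation = (\<lambda>p\<in>carrier (FE 0). mulE (p []))"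

lemma entry_closed [simp]: "entry n i j \<in> carrier E" by (simp add: entry_def)

lemma pair_vec_simps [simp]: "pair_vec s t [] = s" "pair_vec s t [undefined] = t"
  by (simp_all add: pair_vec_def)

lemma pair_vec_eq_iff [simp]: "pair_vec s t = pair_vec s' t' \<longleftrightarrow> s = s' \<and> t = t'"
  by (auto dest: fun_cong [of _ _ "[]"] fun_cong [of _ _ "[undefined]"])

lemma pair_vec_add [simp]: "(\<lambda>i. pair_vec s t i \<oplus>\<oplus> pair_vec s' t' i) = pair_vec (s \<oplus>\<oplus> s') (t \<oplus>\<oplus> t')"
  by (simp add: pair_vec_def fun_eq_iff)

lemma pair_vec_smult [simp]: "r \<in> carrier E \<Longrightarrow> (\<lambda>i. r \<odot>\<odot> pair_vec s t i) = pair_vec (r \<odot>\<odot> s) (r \<odot>\<odot> t)"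
  by (simp add: pair_vec_def fun_eq_iff)

lemma pair_vec_zero: "(\<lambda>i. \<zero>\<^bsub>E\<^esub>) = pair_vec \<zero>\<^bsub>E\<^esub> \<zero>\<^bsub>E\<^esub>"
  by (simp add: pair_vec_def fun_eq_iff)

text \<open>The side conditions on the two coordinates encode the ranks 1, 2, 2, 1 and zero from
  degree 4 on.\<close>

lemma carrier_FE: "p \<in> carrier (FE n) \<longleftrightarrow> (\<exists>s\<in>carrier E. \<exists>t\<in>carrier E.
    (3 < n \<longrightarrow> s = \<zero>\<^bsub>E\<^esub>) \<and> (n \<noteq> 1 \<and> n \<noteq> 2 \<longrightarrow> t = \<zero>\<^bsub>E\<^esub>) \<and> p = pair_vec s t)"
proof
  assume p: "p \<in> carrier (FE n)"
  show "\<exists>s\<in>carrier E. \<exists>t\<in>carrier E.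
    (3 < n \<longrightarrow> s = \<zero>\<^bsub>E\<^esub>) \<and> (n \<noteq> 1 \<and> n \<noteq> 2 \<longrightarrow> t = \<zero>\<^bsub>E\<^esub>) \<and> p = pair_vec s t"
    by (rule bexI [of _ "p []"], rule bexI [of _ "p [undefined]"])
      (use p in \<open>auto simp: carrier_free_left_module basis_def pair_vec_def fun_eq_iff split: if_splits\<close>)
next
  assume "\<exists>s\<in>carrier E. \<exists>t\<in>carrier E.
    (3 < n \<longrightarrow> s = \<zero>\<^bsub>E\<^esub>) \<and> (n \<noteq> 1 \<and> n \<noteq> 2 \<longrightarrow> t = \<zero>\<^bsub>E\<^esub>) \<and> p = pair_vec s t"
  then obtain s t where p: "s \<in> carrier E" "t \<in> carrier E" "3 < n \<longrightarrow> s = \<zero>\<^bsub>E\<^esub>"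
      "n \<noteq> 1 \<and> n \<noteq> 2 \<longrightarrow> t = \<zero>\<^bsub>E\<^esub>" "p = pair_vec s t" by blast
  have "finite {i. p i \<noteq> \<zero>\<^bsub>E\<^esub>}"
    by (rule finite_subset [of _ "{[], [undefined]}"]) (auto simp: p(5) pair_vec_def split: if_splits)
  moreover have "n = 0 \<or> n = 1 \<or> n = 2 \<or> n = 3 \<or> 3 < n" by arith
  ultimately show "p \<in> carrier (FE n)"
    using p by (auto simp: carrier_free_left_module basis_def pair_vec_def)
qed

lemma FE_cases:
  assumes "p \<in> carrier (FE n)"
  obtains s t where "s \<in> carrier E" "t \<in> carrier E" "3 < n \<longrightarrow> s = \<zero>\<^bsub>E\<^esub>"
    "n \<noteq> 1 \<and> n \<noteq> 2 \<longrightarrow> t = \<zero>\<^bsub>E\<^esub>" "p = pair_vec s t"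
  using assms unfolding carrier_FE by blast

lemma pair_vec_closed: "s \<in> carrier E \<Longrightarrow> t \<in> carrier E \<Longrightarrow> 3 < n \<longrightarrow> s = \<zero>\<^bsub>E\<^esub> \<Longrightarrow>
    n \<noteq> 1 \<and> n \<noteq> 2 \<longrightarrow> t = \<zero>\<^bsub>E\<^esub> \<Longrightarrow> pair_vec s t \<in> carrier (FE n)"
  unfolding carrier_FE by blast

lemma differential_pair_vec:
  "pair_vec s t \<in> carrier (FE (Suc n)) \<Longrightarrow> differential n (pair_vec s t) =
     pair_vec (s \<odot>\<odot> entry n False False \<oplus>\<oplus> t \<odot>\<odot> entry n True False)
       (s \<odot>\<odot> entry n False True \<oplus>\<oplus> t \<odot>\<odot> entry n True True)"
  by (simp add: differential_def)

lemma entry_zero: "3 \<le> n \<Longrightarrow> entry n i j = \<zero>\<^bsub>E\<^esub>" "n = 0 \<or> 3 \<le> n \<Longrightarrow> entry n i True = \<zero>\<^bsub>E\<^esub>"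
  by (auto simp only: entry_def if_True if_False simp_thms) simp_all

lemma differential_hom: "differential n \<in> left_module_hom E (FE (Suc n)) (FE n)"
  unfolding differential_def
proof (rule left_module_homI [OF _ _ _ left_module_free [OF E.ring_axioms]])
  fix u assume "u \<in> carrier (FE (Suc n))"
  then obtain s t where u: "s \<in> carrier E" "t \<in> carrier E" "3 < Suc n \<longrightarrow> s = \<zero>\<^bsub>E\<^esub>"
    "Suc n \<noteq> 1 \<and> Suc n \<noteq> 2 \<longrightarrow> t = \<zero>\<^bsub>E\<^esub>" "u = pair_vec s t" by (rule FE_cases)
  show "pair_vec (u [] \<odot>\<odot> entry n False False \<oplus>\<oplus> u [undefined] \<odot>\<odot> entry n True False)
       (u [] \<odot>\<odot> entry n False True \<oplus>\<oplus> u [undefined] \<odot>\<odot> entry n True True) \<in> carrier (FE n)"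
  proof (rule pair_vec_closed)
    have "n = 0 \<or> 3 \<le> n" if "n \<noteq> 1 \<and> n \<noteq> 2" using that by arith
    then show "n \<noteq> 1 \<and> n \<noteq> 2 \<longrightarrow> u [] \<odot>\<odot> entry n False True \<oplus>\<oplus> u [undefined] \<odot>\<odot> entry n True True = \<zero>\<^bsub>E\<^esub>"
      using u by (simp add: entry_zero(2))
  qed (use u in \<open>simp_all add: entry_zero(1)\<close>)
  fix v assume "v \<in> carrier (FE (Suc n))"
  then obtain s' t' where v: "s' \<in> carrier E" "t' \<in> carrier E" "v = pair_vec s' t'" by (elim FE_cases)
  show "pair_vec ((u \<oplus>\<^bsub>FE (Suc n)\<^esub> v) [] \<odot>\<odot> entry n False False \<oplus>\<oplus> (u \<oplus>\<^bsub>FE (Suc n)\<^esub> v) [undefined] \<odot>\<odot> entry n True False)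
       ((u \<oplus>\<^bsub>FE (Suc n)\<^esub> v) [] \<odot>\<odot> entry n False True \<oplus>\<oplus> (u \<oplus>\<^bsub>FE (Suc n)\<^esub> v) [undefined] \<odot>\<odot> entry n True True) =
     pair_vec (u [] \<odot>\<odot> entry n False False \<oplus>\<oplus> u [undefined] \<odot>\<odot> entry n True False)
       (u [] \<odot>\<odot> entry n False True \<oplus>\<oplus> u [undefined] \<odot>\<odot> entry n True True) \<oplus>\<^bsub>FE n\<^esub>
     pair_vec (v [] \<odot>\<odot> entry n False False \<oplus>\<oplus> v [undefined] \<odot>\<odot> entry n True False)
       (v [] \<odot>\<odot> entry n False True \<oplus>\<oplus> v [undefined] \<odot>\<odot> entry n True True)"
    using u v by (simp add: E.l_distr E.a_ac)
  fix r assume r: "r \<in> carrier E"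
  show "pair_vec ((r \<odot>\<^bsub>FE (Suc n)\<^esub> u) [] \<odot>\<odot> entry n False False \<oplus>\<oplus> (r \<odot>\<^bsub>FE (Suc n)\<^esub> u) [undefined] \<odot>\<odot> entry n True False)
       ((r \<odot>\<^bsub>FE (Suc n)\<^esub> u) [] \<odot>\<odot> entry n False True \<oplus>\<oplus> (r \<odot>\<^bsub>FE (Suc n)\<^esub> u) [undefined] \<odot>\<odot> entry n True True) =
     r \<odot>\<^bsub>FE n\<^esub> pair_vec (u [] \<odot>\<odot> entry n False False \<oplus>\<oplus> u [undefined] \<odot>\<odot> entry n True False)
       (u [] \<odot>\<odot> entry n False True \<oplus>\<oplus> u [undefined] \<odot>\<odot> entry n True True)"
    using u r by (simp add: E.r_distr E.m_assoc)
qed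

text \<open>For n = 0 this is the boundary formula for a relation, whose class is zero; for n = 1 it
  is the overlap in the form \<open>kappa_fox\<close>.\<close>

lemma entry_compose:
  "entry (Suc n) i False \<odot>\<odot> entry n False j \<oplus>\<oplus> entry (Suc n) i True \<odot>\<odot> entry n True j = \<zero>\<^bsub>E\<^esub>"
proof -
  consider "n = 0" | "n = 1" | "2 \<le> n" by arith
  then show ?thesis
  proof cases
    case 1
    have "fox GenX r \<odot>\<odot> dX \<oplus>\<oplus> fox GenY r \<odot>\<odot> dY = \<zero>\<^bsub>E\<^esub>" if "r = rel1 \<or> r = rel2" for r
    proof -
      have "r \<in> carrier free_algebra" "cs r = \<zero>\<^bsub>A\<^esub>" using that rel_ideal cs_ideal by auto
      then show ?thesis using fox_boundary [of r] tens_zero_right [of oneA] tens_zero_left [of oneA]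
        by (simp add: E.minus_eq)
    qed
    from this [of "if i then rel2 else rel1"] 1 show ?thesis by (simp add: entry_def)
  next
    case 2
    then show ?thesis by (simp add: entry_def kappa_fox E.l_minus E.r_neg)
  qed (simp add: entry_def)
qed

lemma differential_differential:
  assumes "p \<in> carrier (FE (Suc (Suc n)))"
  shows "differential n (differential (Suc n) p) = \<zero>\<^bsub>FE n\<^esub>"
proof -
  obtain s t where p: "s \<in> carrier E" "t \<in> carrier E" "p = pair_vec s t" using assms by (rule FE_cases)
  have c: "differential (Suc n) p \<in> carrier (FE (Suc n))" by (rule hom_closed [OF differential_hom assms])
  have e: "(s \<odot>\<odot> a \<oplus>\<oplus> t \<odot>\<odot> b) \<odot>\<odot> c \<oplus>\<oplus> (s \<odot>\<odot> a' \<oplus>\<oplus> t \<odot>\<odot> b') \<odot>\<odot> c' = \<zero>\<^bsub>E\<^esub>"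
    if "a \<in> carrier E" "b \<in> carrier E" "c \<in> carrier E" "a' \<in> carrier E" "b' \<in> carrier E" "c' \<in> carrier E"
      "a \<odot>\<odot> c \<oplus>\<oplus> a' \<odot>\<odot> c' = \<zero>\<^bsub>E\<^esub>" "b \<odot>\<odot> c \<oplus>\<oplus> b' \<odot>\<odot> c' = \<zero>\<^bsub>E\<^esub>" for a b c a' b' c'
  proof -
    have "(s \<odot>\<odot> a \<oplus>\<oplus> t \<odot>\<odot> b) \<odot>\<odot> c \<oplus>\<oplus> (s \<odot>\<odot> a' \<oplus>\<oplus> t \<odot>\<odot> b') \<odot>\<odot> c' =
        s \<odot>\<odot> (a \<odot>\<odot> c \<oplus>\<oplus> a' \<odot>\<odot> c') \<oplus>\<oplus> t \<odot>\<odot> (b \<odot>\<odot> c \<oplus>\<oplus> b' \<odot>\<odot> c')"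
      using that(1-6) p by (simp add: E.l_distr E.r_distr E.m_assoc E.a_ac)
    then show ?thesis using that(7,8) p by simp
  qed
  show ?thesis
    using assms c p unfolding p(3)
    by (simp add: differential_pair_vec e [OF _ _ _ _ _ _ entry_compose entry_compose] pair_vec_zero)
qed

text \<open>Exactness is \<open>mulE_kernel\<close> in degree 0 and \<open>exact_1\<close>,
  \<open>exact_2\<close>, \<open>exact_3\<close> in degrees 1 to 3; from degree 4 on the modules are
  zero.\<close>

theorem resolution: "free_resolution E (diagonal_module A) basis differential augmentation"
proof -
  have aug: "augmentation \<in> left_module_hom E (FE 0) (diagonal_module A)"
    unfolding augmentation_def
  proof (rule left_module_homI [OF _ _ _ left_module_free [OF E.ring_axioms]])
    fix u assume "u \<in> carrier (FE 0)"
    then have u: "u [] \<in> carrier E" by (simp add: carrier_free_left_module)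
    then show "mulE (u []) \<in> carrier (diagonal_module A)" by simp
    show "mulE ((r \<odot>\<^bsub>FE 0\<^esub> u) []) = r \<odot>\<^bsub>diagonal_module A\<^esub> mulE (u [])" if "r \<in> carrier E" for r
      using u that by (simp add: mulE_mult)
    fix v assume "v \<in> carrier (FE 0)"
    then have v: "v [] \<in> carrier E" by (simp add: carrier_free_left_module)
    show "mulE ((u \<oplus>\<^bsub>FE 0\<^esub> v) []) = mulE (u []) \<oplus>\<^bsub>diagonal_module A\<^esub> mulE (v [])"
      using u v by (simp add: mulE_add)
  qed
  have surj: "augmentation ` carrier (FE 0) = carrier (diagonal_module A)"
  proof
    show "augmentation ` carrier (FE 0) \<subseteq> carrier (diagonal_module A)" using hom_closed [OF aug] by blast
    show "carrier (diagonal_module A) \<subseteq> augmentation ` carrier (FE 0)"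
    proof
      fix a assume "a \<in> carrier (diagonal_module A)"
      then have a: "a \<in> carrier A" by simp
      have m: "pair_vec (a \<bowtie> oneA) \<zero>\<^bsub>E\<^esub> \<in> carrier (FE 0)" by (rule pair_vec_closed) (use a in simp_all)
      then have eq: "augmentation (pair_vec (a \<bowtie> oneA) \<zero>\<^bsub>E\<^esub>) = a"
        using a by (simp add: augmentation_def mulE_tens)
      show "a \<in> augmentation ` carrier (FE 0)" using imageI [OF m, of augmentation] unfolding eq .
    qed
  qed
  have e0: "p \<in> differential 0 ` carrier (FE (Suc 0))"
    if p: "p \<in> carrier (FE 0)" "augmentation p = \<zero>\<^bsub>A\<^esub>" for p :: "'k resolution_index \<Rightarrow> _"
  proof -
    obtain s t where s: "s \<in> carrier E" "(0::nat) \<noteq> 1 \<and> (0::nat) \<noteq> 2 \<longrightarrow> t = \<zero>\<^bsub>E\<^esub>" "p = pair_vec s t"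
      using p(1) by (rule FE_cases)
    have "mulE s = \<zero>\<^bsub>A\<^esub>" using p s by (simp add: augmentation_def)
    then have "\<exists>u\<in>carrier E. \<exists>v\<in>carrier E. s = \<zero>\<^bsub>E\<^esub> \<oplus>\<oplus> (u \<odot>\<odot> dX \<oplus>\<oplus> v \<odot>\<odot> dY)"
      using mulE_kernel [OF s(1)] by simp
    then obtain u v where uv: "u \<in> carrier E" "v \<in> carrier E" "s = \<zero>\<^bsub>E\<^esub> \<oplus>\<oplus> (u \<odot>\<odot> dX \<oplus>\<oplus> v \<odot>\<odot> dY)" by blast
    have c: "pair_vec u v \<in> carrier (FE (Suc 0))" by (rule pair_vec_closed) (use uv in simp_all)
    show ?thesis
      using imageI [OF c, of "differential 0"] s uv unfolding differential_pair_vec [OF c]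
      by (simp add: entry_def)
  qed
  have e0': "augmentation (differential 0 p) = \<zero>\<^bsub>A\<^esub>" if p0: "p \<in> carrier (FE (Suc 0))" for p :: "'k resolution_index \<Rightarrow> _"
  proof -
    obtain s t where p: "s \<in> carrier E" "t \<in> carrier E" "p = pair_vec s t" using p0 by (rule FE_cases)
    have "differential 0 p \<in> carrier (FE 0)" by (rule hom_closed [OF differential_hom p0])
    then show ?thesis using p0 p mulE_boundary
      by (simp add: augmentation_def differential_pair_vec entry_def mulE_add)
  qed
  have e1: "p \<in> differential (Suc n) ` carrier (FE (Suc (Suc n)))"
    if p: "p \<in> carrier (FE (Suc n))" "differential n p = \<zero>\<^bsub>FE n\<^esub>" for p :: "'k resolution_index \<Rightarrow> _" and n
  proof -
    obtain s t where s: "s \<in> carrier E" "t \<in> carrier E" "3 < Suc n \<longrightarrow> s = \<zero>\<^bsub>E\<^esub>"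
      "Suc n \<noteq> 1 \<and> Suc n \<noteq> 2 \<longrightarrow> t = \<zero>\<^bsub>E\<^esub>" "p = pair_vec s t" using p(1) by (rule FE_cases)
    have z: "s \<odot>\<odot> entry n False False \<oplus>\<oplus> t \<odot>\<odot> entry n True False = \<zero>\<^bsub>E\<^esub>"
      "s \<odot>\<odot> entry n False True \<oplus>\<oplus> t \<odot>\<odot> entry n True True = \<zero>\<^bsub>E\<^esub>"
      using p unfolding s(5) by (simp_all add: differential_pair_vec pair_vec_zero)
    have ex: ?thesis if "u \<in> carrier E" "v \<in> carrier E" "3 < Suc (Suc n) \<longrightarrow> u = \<zero>\<^bsub>E\<^esub>" "0 < n \<longrightarrow> v = \<zero>\<^bsub>E\<^esub>"
      "s = u \<odot>\<odot> entry (Suc n) False False \<oplus>\<oplus> v \<odot>\<odot> entry (Suc n) True False"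
      "t = u \<odot>\<odot> entry (Suc n) False True \<oplus>\<oplus> v \<odot>\<odot> entry (Suc n) True True" for u v
    proof -
      have c: "pair_vec u v \<in> carrier (FE (Suc (Suc n)))" by (rule pair_vec_closed) (use that(1-4) in simp_all)
      show ?thesis
        using imageI [OF c, of "differential (Suc n)"] unfolding differential_pair_vec [OF c] s(5) that(5,6) .
    qed
    consider "n = 0" | "n = 1" | "n = 2" | "3 \<le> n" by arith
    then show ?thesis
    proof cases
      case 1
      then have "d1_image s t" using exact_1 [OF s(1,2)] z by (simp add: entry_def)
      then obtain u v where "u \<in> carrier E" "v \<in> carrier E"
        "s = u \<odot>\<odot> fox GenX rel1 \<oplus>\<oplus> v \<odot>\<odot> fox GenX rel2" "t = u \<odot>\<odot> fox GenY rel1 \<oplus>\<oplus> v \<odot>\<odot> fox GenY rel2"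
        unfolding d1_image_def by blast
      then show ?thesis by (intro ex [of u v]) (simp_all add: 1 entry_def)
    next
      case 2
      then obtain u where "u \<in> carrier E" "s = u \<odot>\<odot> kappa1" "t = \<ominus>\<^bsub>E\<^esub> (u \<odot>\<odot> kappa2)"
        using exact_2 [OF s(1,2)] z(2) by (simp add: entry_def) blast
      then show ?thesis by (intro ex [of u "\<zero>\<^bsub>E\<^esub>"]) (simp_all add: 2 entry_def E.r_minus)
    next
      case 3
      then have "s \<odot>\<odot> kappa2 = \<zero>\<^bsub>E\<^esub>" using z(2) s by (simp add: entry_def E.r_minus)
      then have "s = \<zero>\<^bsub>E\<^esub>" by (rule exact_3 [OF s(1)])
      then show ?thesis using s(4) 3 by (intro ex [of "\<zero>\<^bsub>E\<^esub>" "\<zero>\<^bsub>E\<^esub>"]) simp_all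
    next
      case 4
      then show ?thesis using s(3,4) by (intro ex [of "\<zero>\<^bsub>E\<^esub>" "\<zero>\<^bsub>E\<^esub>"]) simp_all
    qed
  qed
  show ?thesis
    unfolding free_resolution_def
  proof (intro conjI allI aug surj differential_hom)
    show "{p \<in> carrier (FE 0). augmentation p = \<zero>\<^bsub>diagonal_module A\<^esub>} = differential 0 ` carrier (FE (Suc 0))"
    proof (intro equalityI subsetI)
      show "p \<in> differential 0 ` carrier (FE (Suc 0))"
        if "p \<in> {p \<in> carrier (FE 0). augmentation p = \<zero>\<^bsub>diagonal_module A\<^esub>}" for p
        using that e0 [of p] by simp
      show "p \<in> {p \<in> carrier (FE 0). augmentation p = \<zero>\<^bsub>diagonal_module A\<^esub>}"
        if "p \<in> differential 0 ` carrier (FE (Suc 0))" for p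
        using that e0' by (elim imageE) (simp add: hom_closed [OF differential_hom])
    qed
    show "{p \<in> carrier (FE (Suc n)). differential n p = \<zero>\<^bsub>FE n\<^esub>} = differential (Suc n) ` carrier (FE (Suc (Suc n)))" for n
    proof (intro equalityI subsetI)
      show "p \<in> differential (Suc n) ` carrier (FE (Suc (Suc n)))"
        if "p \<in> {p \<in> carrier (FE (Suc n)). differential n p = \<zero>\<^bsub>FE n\<^esub>}" for p
        using that e1 [of p n] by blast
      show "p \<in> {p \<in> carrier (FE (Suc n)). differential n p = \<zero>\<^bsub>FE n\<^esub>}"
        if "p \<in> differential (Suc n) ` carrier (FE (Suc (Suc n)))" for p
        using that by (elim imageE) (simp add: hom_closed [OF differential_hom] differential_differential del: free_left_module_simps)
    qed
  qed
qed

section \<open>The third cohomology group\<close>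

text \<open>The degree is kept in the form \<open>Suc 2\<close>, in which the lemmas of
  \<open>cochain_complex\<close> apply.\<close>

context
  notes Suc_numeral [simp del]
begin

abbreviation "AA \<equiv> carrier A \<times> carrier A"

lemma inner_action_pair [simp]: "inner_action A (a, b) t = t \<odot>\<odot> (b \<bowtie> a)"
  by (simp add: inner_action_def)

lemma left_module_E: "left_module E (regular_left_module E)"
  by (rule left_module_regular [OF E.ring_axioms])

lemma linear_actions_inner: "linear_actions E (regular_left_module E) AA (inner_action A)"
  unfolding linear_actions_def
proof
  fix s assume "s \<in> AA"
  then obtain a b where s: "s = (a, b)" "a \<in> carrier A" "b \<in> carrier A" by blast
  show "restrict (inner_action A s) (carrier (regular_left_module E))
      \<in> left_module_hom E (regular_left_module E) (regular_left_module E)"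
    by (rule left_module_homI [OF _ _ _ left_module_E])
      (use s in \<open>simp_all add: E.l_distr E.m_assoc\<close>)
qed

interpretation H: cochain_complex E "regular_left_module E" AA "inner_action A" basis differential
  by (rule cochain_complex_resolution [OF left_module_E linear_actions_inner resolution])

abbreviation "unit3 \<equiv> pair_vec \<one>\<^bsub>E\<^esub> \<zero>\<^bsub>E\<^esub>"

lemma FE3_iff: "p \<in> carrier (FE (Suc 2)) \<longleftrightarrow> (\<exists>s\<in>carrier E. p = pair_vec s \<zero>\<^bsub>E\<^esub>)"
  by (auto simp: carrier_FE)

lemma hom3_eval:
  assumes f: "f \<in> left_module_hom E (FE (Suc 2)) (regular_left_module E)" and s: "s \<in> carrier E"
  shows "f (pair_vec s \<zero>\<^bsub>E\<^esub>) = s \<odot>\<odot> f unit3"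
proof -
  have "unit3 \<in> carrier (FE (Suc 2))" unfolding FE3_iff by blast
  from hom_smult [OF f s this] show ?thesis using s by simp
qed

lemma hom3_closed:
  "f \<in> left_module_hom E (FE (Suc 2)) (regular_left_module E) \<Longrightarrow> f unit3 \<in> carrier E"
  using hom_closed [of f E "FE (Suc 2)" "regular_left_module E" unit3] unfolding FE3_iff by auto

text \<open>A homomorphism on the rank one module of degree 3 is right multiplication by its value
  at \<open>unit3\<close>, so cohomology classes are represented by elements of the enveloping
  algebra.\<close>

definition hom_of where "hom_of c = (\<lambda>p\<in>carrier (FE (Suc 2)). p [] \<odot>\<odot> c)"

lemma hom_of: "c \<in> carrier E \<Longrightarrow> hom_of c \<in> left_module_hom E (FE (Suc 2)) (regular_left_module E)"
  unfolding hom_of_def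
  by (rule left_module_homI [OF _ _ _ left_module_free [OF E.ring_axioms]])
    (simp_all add: carrier_free_left_module E.l_distr E.m_assoc)

lemma hom_of_eval: "c \<in> carrier E \<Longrightarrow> hom_of c unit3 = c"
proof -
  have "unit3 \<in> carrier (FE (Suc 2))" unfolding FE3_iff by blast
  then show "c \<in> carrier E \<Longrightarrow> hom_of c unit3 = c" by (simp add: hom_of_def)
qed

text \<open>The module of degree 4 is zero, so the cocycle condition is void.\<close>

lemma cocycle3: "f \<in> carrier (H.C 2) \<longleftrightarrow> f \<in> left_module_hom E (FE (Suc 2)) (regular_left_module E)"
proof -
  have "f (differential (Suc 2) p) = \<zero>\<^bsub>E\<^esub>"
    if f: "f \<in> left_module_hom E (FE (Suc 2)) (regular_left_module E)" and p: "p \<in> carrier (FE (Suc (Suc 2)))" for p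
  proof -
    obtain s t where st: "3 < Suc (Suc 2) \<longrightarrow> s = \<zero>\<^bsub>E\<^esub>" "Suc (Suc 2) \<noteq> 1 \<and> Suc (Suc 2) \<noteq> 2 \<longrightarrow> t = \<zero>\<^bsub>E\<^esub>" "p = pair_vec s t"
      using p by (rule FE_cases)
    have "p = \<zero>\<^bsub>FE (Suc (Suc 2))\<^esub>" using st by (simp add: pair_vec_zero)
    then have "differential (Suc 2) p = \<zero>\<^bsub>FE (Suc 2)\<^esub>"
      using hom_zero [OF left_module_free [OF E.ring_axioms] left_module_free [OF E.ring_axioms] differential_hom]
      by (simp del: free_left_module_simps)
    then show ?thesis
      using hom_zero [OF left_module_free [OF E.ring_axioms] left_module_E f] by simp
  qed
  then show ?thesis unfolding H.cocycle_carrier by auto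
qed

definition "kappa_ideal = {kappa1 \<odot>\<odot> s \<oplus>\<oplus> kappa2 \<odot>\<odot> t | s t. s \<in> carrier E \<and> t \<in> carrier E}"

lemma kappa_idealI: "s \<in> carrier E \<Longrightarrow> t \<in> carrier E \<Longrightarrow> kappa1 \<odot>\<odot> s \<oplus>\<oplus> kappa2 \<odot>\<odot> t \<in> kappa_ideal"
  unfolding kappa_ideal_def by blast

lemma kappa_ideal_closed: "u \<in> kappa_ideal \<Longrightarrow> u \<in> carrier E"
  unfolding kappa_ideal_def by (elim CollectE exE conjE) simp

lemma kappa_ideal_add: "u \<in> kappa_ideal \<Longrightarrow> v \<in> kappa_ideal \<Longrightarrow> u \<oplus>\<oplus> v \<in> kappa_ideal"
proof -
  assume "u \<in> kappa_ideal" "v \<in> kappa_ideal"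
  then obtain s t s' t' where st: "s \<in> carrier E" "t \<in> carrier E" "s' \<in> carrier E" "t' \<in> carrier E"
    "u = kappa1 \<odot>\<odot> s \<oplus>\<oplus> kappa2 \<odot>\<odot> t" "v = kappa1 \<odot>\<odot> s' \<oplus>\<oplus> kappa2 \<odot>\<odot> t'"
    unfolding kappa_ideal_def by blast
  have "u \<oplus>\<oplus> v = kappa1 \<odot>\<odot> (s \<oplus>\<oplus> s') \<oplus>\<oplus> kappa2 \<odot>\<odot> (t \<oplus>\<oplus> t')"
    using st by (simp add: E.r_distr E.a_ac)
  then show ?thesis using st kappa_idealI by simp
qed

lemma kappa_ideal_mult: "u \<in> kappa_ideal \<Longrightarrow> r \<in> carrier E \<Longrightarrow> u \<odot>\<odot> r \<in> kappa_ideal"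
proof -
  assume "u \<in> kappa_ideal" and r: "r \<in> carrier E"
  then obtain s t where st: "s \<in> carrier E" "t \<in> carrier E" "u = kappa1 \<odot>\<odot> s \<oplus>\<oplus> kappa2 \<odot>\<odot> t"
    unfolding kappa_ideal_def by blast
  have "u \<odot>\<odot> r = kappa1 \<odot>\<odot> (s \<odot>\<odot> r) \<oplus>\<oplus> kappa2 \<odot>\<odot> (t \<odot>\<odot> r)"
    using st r by (simp add: E.l_distr E.m_assoc)
  then show ?thesis using st r kappa_idealI by simp
qed

lemma kappa_ideal_kappa: "s \<in> carrier E \<Longrightarrow> kappa1 \<odot>\<odot> s \<in> kappa_ideal" "s \<in> carrier E \<Longrightarrow> kappa2 \<odot>\<odot> s \<in> kappa_ideal"
  using kappa_idealI [of s "\<zero>\<^bsub>E\<^esub>"] kappa_idealI [of "\<zero>\<^bsub>E\<^esub>" s] by simp_all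

lemma kappa_ideal_smult: "u \<in> kappa_ideal \<Longrightarrow> c \<diamondop> u \<in> kappa_ideal"
  using kappa_ideal_mult [of u "c \<diamondop> \<one>\<^bsub>E\<^esub>"] kappa_ideal_closed [of u] by (simp add: E.smult_mult_right)

lemma kappa_ideal_uminus: "u \<in> kappa_ideal \<Longrightarrow> \<ominus>\<^bsub>E\<^esub> u \<in> kappa_ideal"
  using kappa_ideal_mult [of u "\<ominus>\<^bsub>E\<^esub> \<one>\<^bsub>E\<^esub>"] kappa_ideal_closed [of u] by (simp add: E.r_minus)

lemma differential_unit3: "differential 2 unit3 = pair_vec kappa1 (\<ominus>\<^bsub>E\<^esub> kappa2)"
proof -
  have "unit3 \<in> carrier (FE (Suc 2))" unfolding FE3_iff by blast
  then show ?thesis by (simp add: differential_pair_vec entry_def)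
qed

lemma hom2_eval:
  assumes g: "g \<in> left_module_hom E (FE 2) (regular_left_module E)" and "s \<in> carrier E" "t \<in> carrier E"
  shows "g (pair_vec s t) = s \<odot>\<odot> g (pair_vec \<one>\<^bsub>E\<^esub> \<zero>\<^bsub>E\<^esub>) \<oplus>\<oplus> t \<odot>\<odot> g (pair_vec \<zero>\<^bsub>E\<^esub> \<one>\<^bsub>E\<^esub>)"
proof -
  have c: "pair_vec u v \<in> carrier (FE 2)" if "u \<in> carrier E" "v \<in> carrier E" for u v
    by (rule pair_vec_closed) (use that in simp_all)
  have "g (pair_vec s t) = g (pair_vec s \<zero>\<^bsub>E\<^esub>) \<oplus>\<oplus> g (pair_vec \<zero>\<^bsub>E\<^esub> t)"
    using hom_add [OF g c [of s "\<zero>\<^bsub>E\<^esub>"] c [of "\<zero>\<^bsub>E\<^esub>" t]] assms by simp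
  then show ?thesis
    using hom_smult [OF g assms(2) c [of "\<one>\<^bsub>E\<^esub>" "\<zero>\<^bsub>E\<^esub>"]] hom_smult [OF g assms(3) c [of "\<zero>\<^bsub>E\<^esub>" "\<one>\<^bsub>E\<^esub>"]] assms
    by simp
qed

text \<open>The last differential sends \<open>unit3\<close> to (\<open>kappa1\<close>,
  -\<open>kappa2\<close>), so its composite with g takes the value \<open>kappa1\<close> s -
  \<open>kappa2\<close> t, where s and t are the values of g at the unit vectors.\<close>

lemma coboundary3_iff:
  assumes f: "f \<in> left_module_hom E (FE (Suc 2)) (regular_left_module E)"
  shows "f \<in> H.Bd 2 \<longleftrightarrow> f unit3 \<in> kappa_ideal"
proof
  have u3: "unit3 \<in> carrier (FE (Suc 2))" unfolding FE3_iff by blast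
  show "f unit3 \<in> kappa_ideal" if bd: "f \<in> H.Bd 2"
  proof -
    obtain g where g: "g \<in> left_module_hom E (FE 2) (regular_left_module E)"
      and fg: "f = (\<lambda>p\<in>carrier (FE (Suc 2)). g (differential 2 p))"
      using bd unfolding H.coboundary_iff by blast
    have c: "g (pair_vec u v) \<in> carrier E" if "u \<in> carrier E" "v \<in> carrier E" for u v
      using hom_closed [OF g pair_vec_closed [of u v 2]] that by simp
    have "f unit3 = kappa1 \<odot>\<odot> g (pair_vec \<one>\<^bsub>E\<^esub> \<zero>\<^bsub>E\<^esub>) \<oplus>\<oplus> (\<ominus>\<^bsub>E\<^esub> kappa2) \<odot>\<odot> g (pair_vec \<zero>\<^bsub>E\<^esub> \<one>\<^bsub>E\<^esub>)"
      using u3 hom2_eval [OF g, of kappa1 "\<ominus>\<^bsub>E\<^esub> kappa2"] by (simp add: fg differential_unit3)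
    also have "\<dots> = kappa1 \<odot>\<odot> g (pair_vec \<one>\<^bsub>E\<^esub> \<zero>\<^bsub>E\<^esub>) \<oplus>\<oplus> kappa2 \<odot>\<odot> (\<ominus>\<^bsub>E\<^esub> g (pair_vec \<zero>\<^bsub>E\<^esub> \<one>\<^bsub>E\<^esub>))"
      using c [of "\<zero>\<^bsub>E\<^esub>" "\<one>\<^bsub>E\<^esub>"] by (simp add: E.l_minus E.r_minus)
    finally show ?thesis using c by (simp add: kappa_idealI)
  qed
  assume "f unit3 \<in> kappa_ideal"
  then obtain s t where st: "s \<in> carrier E" "t \<in> carrier E" "f unit3 = kappa1 \<odot>\<odot> s \<oplus>\<oplus> kappa2 \<odot>\<odot> t"
    unfolding kappa_ideal_def by blast
  define g where "g = (\<lambda>p\<in>carrier (FE 2). p [] \<odot>\<odot> s \<oplus>\<oplus> p [undefined] \<odot>\<odot> (\<ominus>\<^bsub>E\<^esub> t))"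
  have g: "g \<in> left_module_hom E (FE 2) (regular_left_module E)"
    unfolding g_def
    by (rule left_module_homI [OF _ _ _ left_module_free [OF E.ring_axioms]])
      (use st in \<open>simp_all add: carrier_free_left_module E.l_distr E.r_distr E.m_assoc E.a_ac\<close>)
  have "f p = g (differential 2 p)" if p: "p \<in> carrier (FE (Suc 2))" for p
  proof -
    obtain r where r: "r \<in> carrier E" "p = pair_vec r \<zero>\<^bsub>E\<^esub>" using p unfolding FE3_iff by blast
    have "g (pair_vec kappa1 (\<ominus>\<^bsub>E\<^esub> kappa2)) = f unit3"
      using st pair_vec_closed [of kappa1 "\<ominus>\<^bsub>E\<^esub> kappa2" 2] by (simp add: g_def E.l_minus E.r_minus)
    then have "g (differential 2 p) = r \<odot>\<odot> f unit3"
      using hom_smult [OF differential_hom r(1) u3] hom_smult [OF g r(1) hom_closed [OF differential_hom u3]] r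
      by (simp add: differential_unit3)
    then show ?thesis unfolding r(2) hom3_eval [OF f r(1)] by simp
  qed
  then have "(\<lambda>p\<in>carrier (FE (Suc 2)). g (differential 2 p)) = restrict f (carrier (FE (Suc 2)))"
    by (intro restrict_ext) simp
  also have "\<dots> = f" using f unfolding left_module_hom_def by (auto simp: PiE_def extensional_restrict)
  finally show "f \<in> H.Bd 2" using H.coboundaryI [OF g] by simp
qed

lemma cocycle3_minus:
  assumes "f \<in> carrier (H.C 2)" "g \<in> carrier (H.C 2)"
  shows "(f \<ominus>\<^bsub>H.C 2\<^esub> g) unit3 = f unit3 \<ominus>\<^bsub>E\<^esub> g unit3"
proof -
  interpret R: left_module E "regular_left_module E" by (rule left_module_E)
  have u3: "unit3 \<in> carrier (FE (Suc 2))" unfolding FE3_iff by blast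
  have c: "f unit3 \<in> carrier E" "g unit3 \<in> carrier E" using assms unfolding cocycle3 by (simp_all add: hom3_closed)
  have "\<ominus>\<^bsub>regular_left_module E\<^esub> g unit3 = \<ominus>\<^bsub>E\<^esub> g unit3"
    using R.M.minus_equality [of "\<ominus>\<^bsub>E\<^esub> g unit3" "g unit3"] c by (simp add: E.l_neg)
  then show ?thesis unfolding H.cocycle_minus [OF assms] using u3 by (simp add: a_minus_def)
qed

lemma cocycle3_ops:
  assumes f: "f \<in> carrier (H.C 2)" and g: "g \<in> carrier (H.C 2)"
  shows "(f \<oplus>\<^bsub>H.C 2\<^esub> g) unit3 = f unit3 \<oplus>\<oplus> g unit3"
    and "((a, b) \<odot>\<^bsub>H.C 2\<^esub> f) unit3 = f unit3 \<odot>\<odot> (b \<bowtie> a)"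
proof -
  have u3: "unit3 \<in> carrier (FE (Suc 2))" unfolding FE3_iff by blast
  then show "(f \<oplus>\<^bsub>H.C 2\<^esub> g) unit3 = f unit3 \<oplus>\<oplus> g unit3"
    "((a, b) \<odot>\<^bsub>H.C 2\<^esub> f) unit3 = f unit3 \<odot>\<odot> (b \<bowtie> a)"
    by (simp_all add: H.cocycle_simps)
qed

lemma coset3_eq_iff:
  assumes f: "f \<in> carrier (H.C 2)" and g: "g \<in> carrier (H.C 2)"
  shows "H.Bd 2 +>\<^bsub>H.C 2\<^esub> f = H.Bd 2 +>\<^bsub>H.C 2\<^esub> g \<longleftrightarrow> f unit3 \<ominus>\<^bsub>E\<^esub> g unit3 \<in> kappa_ideal"
proof -
  interpret C: abelian_group "H.C 2" by (rule H.abelian_group_cocycle)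
  have "f \<ominus>\<^bsub>H.C 2\<^esub> g \<in> carrier (H.C 2)" by (rule C.minus_closed [OF f g])
  then show ?thesis
    using coboundary3_iff [of "f \<ominus>\<^bsub>H.C 2\<^esub> g"] unfolding H.coset_eq_iff [OF f g] cocycle3 [symmetric]
    by (simp add: cocycle3_minus [OF f g])
qed

section \<open>The case \<beta> = -1: the cohomology is A without a twist\<close>

definition flip_mult where "flip_mult = tensor_lift A (\<lambda>u v. v \<star> u)"

lemma flip_mult_bilinear: "bilinear_map A (opposite_algebra A) A (\<lambda>u v. v \<star> u)"
  by (simp add: bilinear_map_def A.l_distr A.r_distr A.smult_mult_left A.smult_mult_right)

lemma flip_mult_closed [simp]: "t \<in> carrier E \<Longrightarrow> flip_mult t \<in> carrier A"
  unfolding flip_mult_def by (rule algebra_pair.tensor_lift_closed [OF env_pair A.left_module_field flip_mult_bilinear])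

lemma flip_mult_add: "s \<in> carrier E \<Longrightarrow> t \<in> carrier E \<Longrightarrow> flip_mult (s \<oplus>\<oplus> t) = flip_mult s \<boxplus> flip_mult t"
  unfolding flip_mult_def by (rule algebra_pair.tensor_lift_add [OF env_pair A.left_module_field flip_mult_bilinear])

lemma flip_mult_tens: "a \<in> carrier A \<Longrightarrow> b \<in> carrier A \<Longrightarrow> flip_mult (a \<bowtie> b) = b \<star> a"
  unfolding flip_mult_def
  using algebra_pair.tensor_lift_pt [OF env_pair A.left_module_field flip_mult_bilinear, of a b] by simp

lemma flip_mult_zero [simp]: "flip_mult \<zero>\<^bsub>E\<^esub> = \<zero>\<^bsub>A\<^esub>"
  using flip_mult_add [of "\<zero>\<^bsub>E\<^esub>" "\<zero>\<^bsub>E\<^esub>"] by simp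

lemma flip_mult_minus: "s \<in> carrier E \<Longrightarrow> flip_mult (\<ominus>\<^bsub>E\<^esub> s) = \<ominus>\<^bsub>A\<^esub> flip_mult s"
  using flip_mult_add [of "\<ominus>\<^bsub>E\<^esub> s" s] A.minus_equality [of "flip_mult (\<ominus>\<^bsub>E\<^esub> s)" "flip_mult s"] by (simp add: E.l_neg)

text \<open>Right multiplication by b tensor a is the inner action. It turns u tensor v into ub
  tensor av, and the flipped product avub is the two-sided multiplication on A.\<close>

lemma flip_mult_right:
  "t \<in> carrier E \<Longrightarrow> a \<in> carrier A \<Longrightarrow> b \<in> carrier A \<Longrightarrow> flip_mult (t \<odot>\<odot> (b \<bowtie> a)) = a \<star> flip_mult t \<star> b"
  by (induction t rule: env_induct)
    (simp_all add: E.l_distr flip_mult_add flip_mult_tens A.l_distr A.r_distr A.m_assoc)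

lemma kappa_minus_one:
  assumes "\<beta> = -1"
  shows "kappa1 = Y2 \<oplus>\<oplus> \<ominus>\<^bsub>E\<^esub> Y1" "kappa2 = X1 \<oplus>\<oplus> \<ominus>\<^bsub>E\<^esub> X2"
  using E.smult_uminus [of Y1 1, folded assms] E.smult_uminus [of X2 1, folded assms]
  by (simp_all add: kappa1_def kappa2_def)

text \<open>For \<beta> = -1 both generators are differences of the same letter placed in the two
  factors, and the flipped product does not see in which factor it stands.\<close>

lemma flip_mult_kappa:
  assumes b: "\<beta> = -1" and u: "u \<in> kappa_ideal"
  shows "flip_mult u = \<zero>\<^bsub>A\<^esub>"
proof -
  obtain s t where st: "s \<in> carrier E" "t \<in> carrier E" "u = kappa1 \<odot>\<odot> s \<oplus>\<oplus> kappa2 \<odot>\<odot> t"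
    using u unfolding kappa_ideal_def by blast
  note k = kappa_minus_one [OF b]
  have "flip_mult (kappa1 \<odot>\<odot> s) = \<zero>\<^bsub>A\<^esub> \<and> flip_mult (kappa2 \<odot>\<odot> s) = \<zero>\<^bsub>A\<^esub>" if "s \<in> carrier E" for s
    using that
  proof (induction s rule: env_induct)
    case (add a b s)
    have "flip_mult (kappa1 \<odot>\<odot> (a \<bowtie> b)) = \<zero>\<^bsub>A\<^esub>" "flip_mult (kappa2 \<odot>\<odot> (a \<bowtie> b)) = \<zero>\<^bsub>A\<^esub>"
      using add(1,2) unfolding k
      by (simp_all add: E.l_distr E.l_minus flip_mult_add flip_mult_minus flip_mult_tens A.m_assoc A.r_neg)
    then show ?case using add by (simp add: E.r_distr flip_mult_add)
  qed simp
  then show ?thesis using st by (simp add: flip_mult_add)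
qed

text \<open>Modulo \<open>kappa_ideal\<close> the first letter of the left factor may be moved to
  the end of the right factor. The induction is over all b, because the moved letters accumulate
  there.\<close>

lemma flip_mult_mod_kappa_monomial:
  assumes \<beta>1: "\<beta> = -1"
  shows "b \<in> carrier A \<Longrightarrow> (monomial w \<bowtie> b) \<ominus>\<^bsub>E\<^esub> (oneA \<bowtie> (b \<star> monomial w)) \<in> kappa_ideal"
proof (induction w arbitrary: b)
  case Nil
  then show ?case using kappa_ideal_kappa(1) [of "\<zero>\<^bsub>E\<^esub>"] by (simp add: monomial_Nil E.minus_eq E.r_neg)
next
  case (Cons g w)
  note k = kappa_minus_one [OF \<beta>1]
  let ?g = "down_up_generator \<alpha> \<beta> g" and ?m = "monomial w \<bowtie> b" and ?r = "oneA \<bowtie> (b \<star> monomial (g # w))"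
  have IH: "(monomial w \<bowtie> (b \<star> ?g)) \<ominus>\<^bsub>E\<^esub> ?r \<in> kappa_ideal"
    using Cons.IH [of "b \<star> ?g"] Cons.prems by (simp add: monomial_Cons A.m_assoc)
  have "(monomial (g # w) \<bowtie> b) \<ominus>\<^bsub>E\<^esub> (monomial w \<bowtie> (b \<star> ?g)) =
      (if g = GenX then kappa2 \<odot>\<odot> ?m else \<ominus>\<^bsub>E\<^esub> (kappa1 \<odot>\<odot> ?m))"
    using Cons.prems unfolding k
    by (cases g) (simp_all add: E.l_distr E.l_minus monomial_Cons E.minus_eq E.minus_add E.a_ac)
  moreover have "\<dots> \<in> kappa_ideal" using kappa_ideal_kappa [of ?m] kappa_ideal_uminus Cons.prems by simp
  ultimately have s: "(monomial (g # w) \<bowtie> b) \<ominus>\<^bsub>E\<^esub> (monomial w \<bowtie> (b \<star> ?g)) \<in> kappa_ideal" by simp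
  have alg: "(p \<ominus>\<^bsub>E\<^esub> q) \<oplus>\<oplus> (q \<ominus>\<^bsub>E\<^esub> r) = p \<ominus>\<^bsub>E\<^esub> r"
    if "p \<in> carrier E" "q \<in> carrier E" "r \<in> carrier E" for p q r
    using that by algebra
  show ?case using kappa_ideal_add [OF s IH] Cons.prems by (simp add: alg)
qed

lemma flip_mult_mod_kappa:
  assumes \<beta>1: "\<beta> = -1"
  shows "t \<in> carrier E \<Longrightarrow> t \<ominus>\<^bsub>E\<^esub> (oneA \<bowtie> flip_mult t) \<in> kappa_ideal"
proof (induction t rule: env_induct)
  case zero
  then show ?case using kappa_ideal_kappa(1) [of "\<zero>\<^bsub>E\<^esub>"] by (simp add: tens_zero_right E.minus_eq)
next
  case (add a b t)
  have alg: "(p \<oplus>\<oplus> p') \<ominus>\<^bsub>E\<^esub> (r \<oplus>\<oplus> r') = (p \<ominus>\<^bsub>E\<^esub> r) \<oplus>\<oplus> (p' \<ominus>\<^bsub>E\<^esub> r')"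
    if "p \<in> carrier E" "p' \<in> carrier E" "r \<in> carrier E" "r' \<in> carrier E" for p p' r r'
    using that by algebra
  have "(a \<bowtie> b) \<ominus>\<^bsub>E\<^esub> (oneA \<bowtie> (b \<star> a)) \<in> kappa_ideal"
    using add(1)
  proof (induction a rule: down_up_induct)
    case zero
    then show ?case using add(2) kappa_ideal_kappa(1) [of "\<zero>\<^bsub>E\<^esub>"] by (simp add: tens_zero_right E.minus_eq)
  next
    case (step c w a)
    have "((c \<cdot> monomial w \<boxplus> a) \<bowtie> b) \<ominus>\<^bsub>E\<^esub> (oneA \<bowtie> (b \<star> (c \<cdot> monomial w \<boxplus> a))) =
        c \<diamondop> ((monomial w \<bowtie> b) \<ominus>\<^bsub>E\<^esub> (oneA \<bowtie> (b \<star> monomial w))) \<oplus>\<oplus> ((a \<bowtie> b) \<ominus>\<^bsub>E\<^esub> (oneA \<bowtie> (b \<star> a)))"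
      using step(1) add(2)
      by (simp add: A.r_distr tens_add_left tens_add_right A.smult_mult_right tens_smult_left tens_smult_right alg
          E.minus_eq [of "c \<diamondop> u" for u] E.minus_eq [of "u \<bowtie> v" "oneA \<bowtie> (b \<star> monomial w)" for u v]
          E.smult_r_distr E.smult_minus)
    then show ?case
      using kappa_ideal_add [OF kappa_ideal_smult [OF flip_mult_mod_kappa_monomial [OF \<beta>1 add(2)]] step(2)] by simp
  qed
  from kappa_ideal_add [OF this add(4)] show ?case
    using add(1-3) by (simp add: flip_mult_add flip_mult_tens tens_add_right alg)
qed

text \<open>By \<open>flip_mult_kappa\<close> and \<open>flip_mult_mod_kappa\<close> the kernel of
  \<open>flip_mult\<close> is \<open>kappa_ideal\<close>, so evaluation at \<open>unit3\<close>
  followed by \<open>flip_mult\<close> identifies the cohomology with A.\<close>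

lemma calabi_yau_if:
  assumes \<beta>1: "\<beta> = -1"
  shows "calabi_yau 3 A (down_up_degree \<alpha> \<beta>)"
proof -
  have "\<exists>\<phi> \<in> equivariant_iso AA (quotient_module (H.C 2) (H.Bd 2)) (twisted_bimodule A (\<lambda>a. a)).
      \<forall>f\<in>carrier (H.C 2). \<phi> (H.Bd 2 +>\<^bsub>H.C 2\<^esub> f) = flip_mult (f unit3)"
  proof (rule equivariant_iso_quotient(1) [OF H.abelian_group_cocycle H.additive_subgroup_coboundary])
    show "flip_mult (f unit3) \<in> carrier (twisted_bimodule A (\<lambda>a. a))" if "f \<in> carrier (H.C 2)" for f
      using that unfolding cocycle3 by (simp add: twisted_bimodule_def hom3_closed)
    show "\<exists>f\<in>carrier (H.C 2). flip_mult (f unit3) = a" if "a \<in> carrier (twisted_bimodule A (\<lambda>a. a))" for a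
    proof (rule bexI [of _ "hom_of (oneA \<bowtie> a)"])
      have a: "a \<in> carrier A" using that by (simp add: twisted_bimodule_def)
      show "flip_mult (hom_of (oneA \<bowtie> a) unit3) = a" using a by (simp add: hom_of_eval flip_mult_tens)
      show "hom_of (oneA \<bowtie> a) \<in> carrier (H.C 2)" using a unfolding cocycle3 by (simp add: hom_of)
    qed
    show "flip_mult ((f \<oplus>\<^bsub>H.C 2\<^esub> g) unit3) =
        flip_mult (f unit3) \<oplus>\<^bsub>twisted_bimodule A (\<lambda>a. a)\<^esub> flip_mult (g unit3)"
      if f: "f \<in> carrier (H.C 2)" and g: "g \<in> carrier (H.C 2)" for f g
      using f g hom3_closed unfolding cocycle3_ops(1) [OF f g] cocycle3
      by (simp add: flip_mult_add twisted_bimodule_def)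
    show "flip_mult (f unit3) = flip_mult (g unit3) \<longleftrightarrow> f \<ominus>\<^bsub>H.C 2\<^esub> g \<in> H.Bd 2"
      if f: "f \<in> carrier (H.C 2)" and g: "g \<in> carrier (H.C 2)" for f g
    proof -
      have c: "f unit3 \<in> carrier E" "g unit3 \<in> carrier E"
        using f g unfolding cocycle3 by (simp_all add: hom3_closed)
      have fm: "flip_mult (f unit3 \<ominus>\<^bsub>E\<^esub> g unit3) = flip_mult (f unit3) \<ominus>\<^bsub>A\<^esub> flip_mult (g unit3)"
        using c by (simp add: E.minus_eq A.minus_eq flip_mult_add flip_mult_minus)
      have "f unit3 \<ominus>\<^bsub>E\<^esub> g unit3 \<in> kappa_ideal \<longleftrightarrow> flip_mult (f unit3 \<ominus>\<^bsub>E\<^esub> g unit3) = \<zero>\<^bsub>A\<^esub>"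
      proof
        show "flip_mult (f unit3 \<ominus>\<^bsub>E\<^esub> g unit3) = \<zero>\<^bsub>A\<^esub>" if "f unit3 \<ominus>\<^bsub>E\<^esub> g unit3 \<in> kappa_ideal"
          by (rule flip_mult_kappa [OF \<beta>1 that])
        show "f unit3 \<ominus>\<^bsub>E\<^esub> g unit3 \<in> kappa_ideal" if "flip_mult (f unit3 \<ominus>\<^bsub>E\<^esub> g unit3) = \<zero>\<^bsub>A\<^esub>"
          using flip_mult_mod_kappa [OF \<beta>1, of "f unit3 \<ominus>\<^bsub>E\<^esub> g unit3"] c that
          by (simp add: tens_zero_right E.minus_eq [of _ "\<zero>\<^bsub>E\<^esub>"])
      qed
      then show ?thesis
        using c coset3_eq_iff [OF f g] unfolding H.coset_eq_iff [OF f g] fm by simp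
    qed
    show "s \<odot>\<^bsub>H.C 2\<^esub> f \<in> carrier (H.C 2)" if "s \<in> AA" "f \<in> carrier (H.C 2)" for s f
      by (rule H.cocycle_smult_closed [OF that])
    show "flip_mult ((s \<odot>\<^bsub>H.C 2\<^esub> f) unit3) = s \<odot>\<^bsub>twisted_bimodule A (\<lambda>a. a)\<^esub> flip_mult (f unit3)"
      if s: "s \<in> AA" and f: "f \<in> carrier (H.C 2)" for s f
    proof -
      obtain a b where ab: "s = (a, b)" "a \<in> carrier A" "b \<in> carrier A" using s by blast
      have "f unit3 \<in> carrier E" using f unfolding cocycle3 by (rule hom3_closed)
      then show ?thesis
        using ab unfolding ab(1) cocycle3_ops(2) [OF f f] by (simp add: flip_mult_right twisted_bimodule_def)
    qed
  qed
  then have "equivariant_iso AA (cohomology_module E (regular_left_module E) (inner_action A) basis differential 3)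
      (twisted_bimodule A (\<lambda>a. a)) \<noteq> {}"
    unfolding cohomology_module_def numeral_3_eq_3 numeral_2_eq_2 by blast
  then have "Ext_isomorphic E 3 (diagonal_module A) (regular_left_module E) AA (inner_action A) (twisted_bimodule A (\<lambda>a. a))"
    unfolding Ext_isomorphic_def using resolution by blast
  moreover have "graded_automorphism A (down_up_degree \<alpha> \<beta>) (\<lambda>a. a)"
    unfolding graded_automorphism_def ring_iso_def by (auto simp: ring_hom_def bij_betw_def)
  ultimately show ?thesis unfolding calabi_yau_def nakayama_automorphism_def by blast
qed

end

end

lemma equivariant_iso_trans:
  assumes \<phi>: "\<phi> \<in> equivariant_iso S M N" and \<psi>: "\<psi> \<in> equivariant_iso S N L"
  shows "\<psi> \<circ> \<phi> \<in> equivariant_iso S M L"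
proof -
  have "\<phi> u \<in> carrier N" if "u \<in> carrier M" for u
    using \<phi> that bij_betw_apply [of \<phi> "carrier M" "carrier N" u] unfolding equivariant_iso_def by blast
  then show ?thesis
    using \<phi> \<psi> unfolding equivariant_iso_def by (simp add: bij_betw_trans [of \<phi> "carrier M" "carrier N" \<psi> "carrier L"])
qed

lemma equivariant_isoD:
  assumes "\<phi> \<in> equivariant_iso S M N"
  shows "bij_betw \<phi> (carrier M) (carrier N)"
    and "s \<in> S \<Longrightarrow> u \<in> carrier M \<Longrightarrow> \<phi> (s \<odot>\<^bsub>M\<^esub> u) = s \<odot>\<^bsub>N\<^esub> \<phi> u"
  using assms unfolding equivariant_iso_def by blast+

text \<open>A Nakayama automorphism is known to be the identity on the carrier only, so the twisted
  bimodules agree there but not as records.\<close>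

lemma equivariant_iso_cong:
  assumes \<phi>: "\<phi> \<in> equivariant_iso S M N" and c: "carrier N' = carrier N"
    and a: "\<And>u v. u \<oplus>\<^bsub>N'\<^esub> v = u \<oplus>\<^bsub>N\<^esub> v"
    and m: "\<And>s u. s \<in> S \<Longrightarrow> u \<in> carrier N \<Longrightarrow> s \<odot>\<^bsub>N'\<^esub> u = s \<odot>\<^bsub>N\<^esub> u"
  shows "\<phi> \<in> equivariant_iso S M N'"
proof -
  have "\<phi> u \<in> carrier N" if "u \<in> carrier M" for u
    by (rule bij_betw_apply [OF equivariant_isoD(1) [OF \<phi>] that])
  then show ?thesis using \<phi> unfolding equivariant_iso_def by (simp add: c a m)
qed

context down_up_params
begin

section \<open>Functionals of low degree and the converse\<close>

abbreviation "scalars \<equiv> regular_left_module (field_ring :: 'k ring)"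

text \<open>The coefficient of the word w. On A it makes sense for words of length at most 2,
  because the relations are homogeneous of degree 3.\<close>

definition coefficient :: "generator list \<Rightarrow> (generator list \<Rightarrow> 'k) set \<Rightarrow> 'k" where
  "coefficient w = linear_lift scalars (\<lambda>v. if v = w then 1 else 0)"

lemma left_module_scalars: "left_module field_ring scalars"
  by (rule left_module_regular [OF ring_field_ring])

context
  fixes w :: "generator list"
  assumes w: "length w \<le> 2"
begin

text \<open>Functions that vanish on words of length at least 3 are stable under translation and
  satisfy both relations trivially.\<close>

lemma coefficient_ideal:
  assumes "f \<in> down_up_ideal \<alpha> \<beta>"
  shows "lin_comb field_ring scalars (\<lambda>v. if v = w then 1 else 0) f = \<zero>\<^bsub>scalars\<^esub>"
  by (rule down_up_ideal_lin_comb_eq_zero [OF left_module_scalars _ _ _ _ _ assms,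
        where \<Gamma> = "{g. \<forall>v. 3 \<le> length v \<longrightarrow> g v = 0}"]) (use w in auto)

lemma coefficient_Pi: "(\<lambda>v. if v = w then 1 else 0) \<in> carrier word_monoid \<rightarrow> carrier scalars"
  by simp

lemmas coefficient_lift = monoid_word_monoid left_module_scalars ideal_down_up coefficient_Pi coefficient_ideal

lemma coefficient_coset:
  "f \<in> carrier free_algebra \<Longrightarrow>
    coefficient w (cs f) = lin_comb field_ring scalars (\<lambda>v. if v = w then 1 else 0) f"
  unfolding coefficient_def by (rule linear_lift_coset [OF coefficient_lift])

lemma coefficient_monomial: "coefficient w (monomial v) = (if v = w then 1 else 0)"
  unfolding monomial_def coefficient_coset [OF free_algebra_basis_elem]
  by (rule lin_comb_basis_elem [OF left_module_scalars]) simp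

lemma coefficient_add:
  assumes "a \<in> carrier A" "b \<in> carrier A"
  shows "coefficient w (a \<boxplus> b) = coefficient w a + coefficient w b"
proof -
  have "coefficient w (a \<boxplus> b) = coefficient w a \<oplus>\<^bsub>scalars\<^esub> coefficient w b"
    unfolding coefficient_def down_up_algebra_def
    by (rule linear_lift_add [OF coefficient_lift]; insert assms, unfold down_up_algebra_def, assumption)
  then show ?thesis by simp
qed

lemma coefficient_smult:
  assumes "a \<in> carrier A"
  shows "coefficient w (c \<cdot> a) = c * coefficient w a"
proof -
  have "coefficient w (c \<cdot> a) = c \<odot>\<^bsub>scalars\<^esub> coefficient w a"
    unfolding coefficient_def down_up_algebra_def
    by (rule linear_lift_smult [OF coefficient_lift]; insert assms, unfold down_up_algebra_def, assumption)
  then show ?thesis by simp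
qed

lemma coefficient_zero: "coefficient w \<zero>\<^bsub>A\<^esub> = 0"
  using coefficient_smult [of "\<zero>\<^bsub>A\<^esub>" 0] by simp

end

abbreviation "u0 \<equiv> coefficient []"
abbreviation "u1 \<equiv> coefficient [GenX]"

lemmas u_simps = coefficient_add [of "[]"] coefficient_add [of "[GenX]"] coefficient_smult [of "[]"]
  coefficient_smult [of "[GenX]"] coefficient_zero [of "[]"] coefficient_zero [of "[GenX]"]
  coefficient_monomial [of "[]"] coefficient_monomial [of "[GenX]"]

text \<open>Multiplication by a generator raises the degree, so the constant term is lost, and the
  coefficient of x can only come from x times the constant term.\<close>

lemma coefficient_generator:
  assumes "a \<in> carrier A"
  shows "u0 (down_up_generator \<alpha> \<beta> g \<star> a) = 0" "u0 (a \<star> down_up_generator \<alpha> \<beta> g) = 0"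
    "u1 (down_up_generator \<alpha> \<beta> g \<star> a) = (if g = GenX then u0 a else 0)"
    "u1 (a \<star> down_up_generator \<alpha> \<beta> g) = (if g = GenX then u0 a else 0)"
  using assms
  by (induction a rule: down_up_induct)
    (simp_all add: u_simps A.r_distr A.l_distr A.smult_mult_left A.smult_mult_right monomial_Cons [symmetric]
      monomial_snoc [symmetric])

lemma u0_one: "u0 oneA = 1"
  using u_simps(7) [of "[]"] by (simp add: monomial_Nil)

lemma u0_generator: "u0 (down_up_generator \<alpha> \<beta> g) = 0"
  using u_simps(7) [of "[g]"] by (simp add: monomial_single)

lemma u0_mult:
  assumes a: "a \<in> carrier A" and b: "b \<in> carrier A"
  shows "u0 (a \<star> b) = u0 a * u0 b"
  using a
proof (induction a rule: down_up_induct)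
  case (step c w a)
  have "u0 (monomial w \<star> b) = u0 (monomial w) * u0 b"
  proof (cases w)
    case (Cons g v)
    then show ?thesis using b by (simp add: monomial_Cons A.m_assoc coefficient_generator)
  qed (use b in \<open>simp add: monomial_Nil u0_one\<close>)
  then show ?case using step b by (simp add: u_simps A.l_distr A.smult_mult_left algebra_simps)
qed (use b in \<open>simp add: u_simps\<close>)

text \<open>\<open>Phi0\<close> reads the constant term of an element of the enveloping algebra and
  \<open>Phi1\<close> its part linear in x. The weight -\<beta> in \<open>Phi1\<close> is forced:
  modulo \<open>kappa2\<close> the element x tensor 1 equals -\<beta> (1 tensor x).\<close>

definition Phi0 where "Phi0 = tensor_lift scalars (\<lambda>u v. u0 u * u0 v)"
definition Phi1 where "Phi1 = tensor_lift scalars (\<lambda>u v. u0 u * u1 v - \<beta> * (u1 u * u0 v))"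

lemma Phi_bilinear:
  "bilinear_map A (opposite_algebra A) scalars (\<lambda>u v. u0 u * u0 v)"
  "bilinear_map A (opposite_algebra A) scalars (\<lambda>u v. u0 u * u1 v - \<beta> * (u1 u * u0 v))"
  by (simp_all add: bilinear_map_def u_simps algebra_simps)

lemma Phi_add:
  assumes "s \<in> carrier E" "t \<in> carrier E"
  shows "Phi0 (s \<oplus>\<oplus> t) = Phi0 s + Phi0 t" "Phi1 (s \<oplus>\<oplus> t) = Phi1 s + Phi1 t"
  unfolding Phi0_def Phi1_def
  using algebra_pair.tensor_lift_add [OF env_pair left_module_scalars Phi_bilinear(1) assms]
    algebra_pair.tensor_lift_add [OF env_pair left_module_scalars Phi_bilinear(2) assms] by simp_all

lemma Phi_tens:
  assumes "a \<in> carrier A" "b \<in> carrier A"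
  shows "Phi0 (a \<bowtie> b) = u0 a * u0 b" "Phi1 (a \<bowtie> b) = u0 a * u1 b - \<beta> * (u1 a * u0 b)"
  unfolding Phi0_def Phi1_def
  using algebra_pair.tensor_lift_pt [OF env_pair left_module_scalars Phi_bilinear(1), of a b]
    algebra_pair.tensor_lift_pt [OF env_pair left_module_scalars Phi_bilinear(2), of a b] assms by simp_all

lemma Phi_zero: "Phi0 \<zero>\<^bsub>E\<^esub> = 0" "Phi1 \<zero>\<^bsub>E\<^esub> = 0"
  using Phi_tens [of "\<zero>\<^bsub>A\<^esub>" oneA] by (simp_all add: u_simps)

lemma Phi_uminus:
  assumes "t \<in> carrier E"
  shows "Phi0 (\<ominus>\<^bsub>E\<^esub> t) = - Phi0 t" "Phi1 (\<ominus>\<^bsub>E\<^esub> t) = - Phi1 t"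
  using Phi_add [of "\<ominus>\<^bsub>E\<^esub> t" t] assms by (simp_all add: E.l_neg Phi_zero eq_neg_iff_add_eq_0)

text \<open>All terms vanish for reasons of degree, except under \<open>Phi1\<close> for multiples
  of \<open>kappa2\<close>, where the contributions of x tensor 1 and of \<beta> (1 tensor x) are
  opposite.\<close>

lemma Phi_kappa:
  assumes "u \<in> kappa_ideal"
  shows "Phi0 u = 0" "Phi1 u = 0"
proof -
  obtain s t where st: "s \<in> carrier E" "t \<in> carrier E" "u = kappa1 \<odot>\<odot> s \<oplus>\<oplus> kappa2 \<odot>\<odot> t"
    using assms unfolding kappa_ideal_def by blast
  have k: "Phi0 (kappa1 \<odot>\<odot> s) = 0 \<and> Phi1 (kappa1 \<odot>\<odot> s) = 0 \<and> Phi0 (kappa2 \<odot>\<odot> s) = 0 \<and> Phi1 (kappa2 \<odot>\<odot> s) = 0"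
    if "s \<in> carrier E" for s
    using that
  proof (induction s rule: env_induct)
    case (add a b s)
    have e: "kappa1 \<odot>\<odot> (a \<bowtie> b) = (a \<bowtie> (b \<star> gy)) \<oplus>\<oplus> ((\<beta> \<cdot> (gy \<star> a)) \<bowtie> b)"
      "kappa2 \<odot>\<odot> (a \<bowtie> b) = ((gx \<star> a) \<bowtie> b) \<oplus>\<oplus> ((\<beta> \<cdot> a) \<bowtie> (b \<star> gx))"
      using add(1,2) by (simp_all add: kappa1_def kappa2_def E.l_distr E.smult_mult_left tens_smult_left)
    have "Phi0 (kappa1 \<odot>\<odot> (a \<bowtie> b)) = 0 \<and> Phi1 (kappa1 \<odot>\<odot> (a \<bowtie> b)) = 0 \<and>
        Phi0 (kappa2 \<odot>\<odot> (a \<bowtie> b)) = 0 \<and> Phi1 (kappa2 \<odot>\<odot> (a \<bowtie> b)) = 0"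
      using add(1,2) unfolding e by (simp add: Phi_add Phi_tens u_simps coefficient_generator)
    then show ?case using add by (simp add: E.r_distr Phi_add)
  qed (simp add: Phi_zero)
  show "Phi0 u = 0" "Phi1 u = 0" using k st by (simp_all add: Phi_add)
qed

text \<open>Right multiplication by x in either factor shifts the constant term into the linear part
  with the weights of \<open>Phi1\<close>; the two weights differ by 1 + \<beta>.\<close>

lemma Phi_right:
  assumes t: "t \<in> carrier E"
  shows "a \<in> carrier A \<Longrightarrow> Phi0 (t \<odot>\<odot> (oneA \<bowtie> a)) = u0 a * Phi0 t"
    and "Phi1 (t \<odot>\<odot> X2) = Phi0 t" "Phi1 (t \<odot>\<odot> X1) = - \<beta> * Phi0 t"
  using t
  by (induction t rule: env_induct)
    (simp_all add: E.l_distr Phi_add Phi_tens Phi_zero u0_mult u0_generator coefficient_generator algebra_simps)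

context
  notes Suc_numeral [simp del]
begin

interpretation H: cochain_complex E "regular_left_module E" AA "inner_action A" basis differential
  by (rule cochain_complex_resolution [OF left_module_E linear_actions_inner resolution])

text \<open>The resolution hidden in \<open>Ext_isomorphic\<close> is traded for the explicit one,
  and the twist for the identity.\<close>

lemma calabi_yau_cohomology:
  assumes "calabi_yau 3 A (down_up_degree \<alpha> \<beta>)"
  shows "\<exists>\<phi>. \<phi> \<in> equivariant_iso AA (cohomology_module E (regular_left_module E) (inner_action A) basis differential (Suc 2))
    (twisted_bimodule A (\<lambda>a. a))"
proof -
  obtain \<mu> where \<mu>: "Ext_isomorphic E 3 (diagonal_module A) (regular_left_module E) AA (inner_action A) (twisted_bimodule A \<mu>)"
    "\<forall>a\<in>carrier A. \<mu> a = a"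
    using assms unfolding calabi_yau_def nakayama_automorphism_def by blast
  have three: "(3::nat) = Suc 2" by (simp add: Suc_numeral)
  from \<mu>(1) [unfolded Ext_isomorphic_def]
  obtain B d \<epsilon> where res: "free_resolution E (diagonal_module A) (B :: nat \<Rightarrow> 'k resolution_index set) d \<epsilon>"
    and ne: "equivariant_iso AA (cohomology_module E (regular_left_module E) (inner_action A) B d 3) (twisted_bimodule A \<mu>) \<noteq> {}"
    by (elim exE conjE)
  from ne obtain \<psi> where \<psi>: "\<psi> \<in> equivariant_iso AA
      (cohomology_module E (regular_left_module E) (inner_action A) B d (Suc 2)) (twisted_bimodule A \<mu>)"
    unfolding ex_in_conv [symmetric] three by (elim exE)
  have \<psi>': "\<psi> \<in> equivariant_iso AA (cohomology_module E (regular_left_module E) (inner_action A) B d (Suc 2)) (twisted_bimodule A (\<lambda>a. a))"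
  proof (rule equivariant_iso_cong [OF \<psi>])
    fix s u assume "s \<in> AA" "u \<in> carrier (twisted_bimodule A \<mu>)"
    then show "s \<odot>\<^bsub>twisted_bimodule A (\<lambda>a. a)\<^esub> u = s \<odot>\<^bsub>twisted_bimodule A \<mu>\<^esub> u"
      using \<mu>(2) by (elim SigmaE) (simp add: twisted_bimodule_def)
  qed (simp_all add: twisted_bimodule_def)
  from cohomology_resolution_independent [OF left_module_diagonal left_module_E linear_actions_inner resolution res, of 2]
  obtain \<phi> where \<phi>: "\<phi> \<in> equivariant_iso AA (cohomology_module E (regular_left_module E) (inner_action A) basis differential (Suc 2))
      (cohomology_module E (regular_left_module E) (inner_action A) B d (Suc 2))"
    unfolding ex_in_conv [symmetric] by (elim exE)
  show ?thesis by (rule exI, rule equivariant_iso_trans [OF \<phi> \<psi>'])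
qed

lemma calabi_yau_only_if:
  assumes "calabi_yau 3 A (down_up_degree \<alpha> \<beta>)"
  shows "\<beta> = -1"
proof -
  let ?H = "cohomology_module E (regular_left_module E) (inner_action A) basis differential (Suc 2)"
  let ?cl = "\<lambda>f. H.Bd 2 +>\<^bsub>H.C 2\<^esub> f"
  obtain \<phi> where \<phi>: "\<phi> \<in> equivariant_iso AA ?H (twisted_bimodule A (\<lambda>a. a))"
    using calabi_yau_cohomology [OF assms] by blast
  have bij: "bij_betw \<phi> (carrier ?H) (carrier A)"
    using equivariant_isoD(1) [OF \<phi>] by (simp add: twisted_bimodule_def)
  have carr: "?cl f \<in> carrier ?H" if "f \<in> carrier (H.C 2)" for f
    unfolding H.carrier_cohomology using that by blast
  have sm: "\<phi> (?cl ((a, b) \<odot>\<^bsub>H.C 2\<^esub> f)) = a \<star> \<phi> (?cl f) \<star> b"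
    if "a \<in> carrier A" "b \<in> carrier A" "f \<in> carrier (H.C 2)" for a b f
  proof -
    have ab: "(a, b) \<in> AA" using that by simp
    have "\<phi> ((a, b) \<odot>\<^bsub>?H\<^esub> ?cl f) = (a, b) \<odot>\<^bsub>twisted_bimodule A (\<lambda>a. a)\<^esub> \<phi> (?cl f)"
      by (rule equivariant_isoD(2) [OF \<phi> ab carr [OF that(3)]])
    then show ?thesis unfolding H.coset_smult [OF ab that(3)] by (simp add: twisted_bimodule_def)
  qed
  have eq: "f unit3 \<ominus>\<^bsub>E\<^esub> g unit3 \<in> kappa_ideal"
    if "f \<in> carrier (H.C 2)" "g \<in> carrier (H.C 2)" "\<phi> (?cl f) = \<phi> (?cl g)" for f g
    using inj_onD [OF bij_betw_imp_inj_on [OF bij] that(3) carr [OF that(1)] carr [OF that(2)]]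
    unfolding coset3_eq_iff [OF that(1,2)] .
  have smc: "(a, b) \<odot>\<^bsub>H.C 2\<^esub> f \<in> carrier (H.C 2)"
    if "a \<in> carrier A" "b \<in> carrier A" "f \<in> carrier (H.C 2)" for a b f
    by (rule H.cocycle_smult_closed) (use that in simp_all)
  \<comment> \<open>A cocycle f is chosen whose class corresponds to 1 in A; its value c at
    \<open>unit3\<close> represents the generating class.\<close>
  have "oneA \<in> \<phi> ` carrier ?H" unfolding bij_betw_imp_surj_on [OF bij] by simp
  then obtain U where U: "oneA = \<phi> U" "U \<in> carrier ?H" by (rule imageE)
  from U(2) [unfolded H.carrier_cohomology] obtain f where fU: "U = ?cl f" and f: "f \<in> carrier (H.C 2)"
    by (rule imageE)
  have f1: "\<phi> (?cl f) = oneA" using U(1) fU by simp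
  define c where "c = f unit3"
  have c: "c \<in> carrier E" using f unfolding c_def cocycle3 by (rule hom3_closed)
  \<comment> \<open>Multiplying 1 by x from the left and from the right gives the same element of A,
    so the classes agree as well. The inner action turns them into c(1 tensor x) and c(x tensor
    1).\<close>
  have "((oneA, gx) \<odot>\<^bsub>H.C 2\<^esub> f) unit3 \<ominus>\<^bsub>E\<^esub> ((gx, oneA) \<odot>\<^bsub>H.C 2\<^esub> f) unit3 \<in> kappa_ideal"
    by (rule eq) (simp_all add: smc sm f f1)
  then have 1: "c \<odot>\<odot> X1 \<ominus>\<^bsub>E\<^esub> c \<odot>\<odot> X2 \<in> kappa_ideal"
    unfolding cocycle3_ops(2) [OF f f] c_def .
  have h: "hom_of \<one>\<^bsub>E\<^esub> \<in> carrier (H.C 2)" unfolding cocycle3 by (rule hom_of) simp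
  \<comment> \<open>The class of the unit of the enveloping algebra corresponds to some a, which is
    a times 1, so it is also the class of c(1 tensor a). Under \<open>Phi0\<close> this shows that
    the constant term of c is not zero.\<close>
  define a where "a = \<phi> (?cl (hom_of \<one>\<^bsub>E\<^esub>))"
  have a: "a \<in> carrier A" unfolding a_def by (rule bij_betw_apply [OF bij carr [OF h]])
  have "hom_of \<one>\<^bsub>E\<^esub> unit3 \<ominus>\<^bsub>E\<^esub> ((a, oneA) \<odot>\<^bsub>H.C 2\<^esub> f) unit3 \<in> kappa_ideal"
    by (rule eq) (use a in \<open>simp_all add: smc sm f f1 h a_def [symmetric]\<close>)
  then have 2: "\<one>\<^bsub>E\<^esub> \<ominus>\<^bsub>E\<^esub> c \<odot>\<odot> (oneA \<bowtie> a) \<in> kappa_ideal"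
    unfolding cocycle3_ops(2) [OF f f] c_def by (simp add: hom_of_eval)
  have "Phi0 \<one>\<^bsub>E\<^esub> = 1" by (simp add: tens_one [symmetric] Phi_tens u0_one)
  then have "1 - u0 a * Phi0 c = 0"
    using Phi_kappa(1) [OF 2] c a by (simp add: E.minus_eq Phi_add Phi_uminus Phi_right)
  moreover have "- (1 + \<beta>) * Phi0 c = 0"
    using Phi_kappa(2) [OF 1] c by (simp add: E.minus_eq Phi_add Phi_uminus Phi_right algebra_simps)
  ultimately have "1 + \<beta> = 0" by auto
  then show ?thesis by (simp add: add_eq_0_iff)
qed

end

theorem calabi_yau_iff: "calabi_yau 3 A (down_up_degree \<alpha> \<beta>) \<longleftrightarrow> \<beta> = -1"
  using calabi_yau_if calabi_yau_only_if by blast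

section \<open>The canonical element\<close>

text \<open>Commuting with the generators extends to words by induction and to A by
  linearity.\<close>

lemma center_iff:
  "z \<in> algebra_center A \<longleftrightarrow> z \<in> carrier A \<and> z \<star> gx = gx \<star> z \<and> z \<star> gy = gy \<star> z"
proof
  assume "z \<in> algebra_center A"
  then show "z \<in> carrier A \<and> z \<star> gx = gx \<star> z \<and> z \<star> gy = gy \<star> z" by (simp add: algebra_center_def)
next
  assume z: "z \<in> carrier A \<and> z \<star> gx = gx \<star> z \<and> z \<star> gy = gy \<star> z"
  have g: "z \<star> down_up_generator \<alpha> \<beta> g = down_up_generator \<alpha> \<beta> g \<star> z" for g
    using z by (cases g) simp_all
  have m: "z \<star> monomial w = monomial w \<star> z" for w
  proof (induction w)
    case Nil
    then show ?case using z by (simp add: monomial_Nil)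
  next
    case (Cons h w)
    have "z \<star> (down_up_generator \<alpha> \<beta> h \<star> monomial w) = (z \<star> down_up_generator \<alpha> \<beta> h) \<star> monomial w"
      using z by (intro A.m_assoc [symmetric]) simp_all
    also have "\<dots> = down_up_generator \<alpha> \<beta> h \<star> (z \<star> monomial w)"
      unfolding g using z by (intro A.m_assoc) simp_all
    also have "\<dots> = (down_up_generator \<alpha> \<beta> h \<star> monomial w) \<star> z"
      unfolding Cons using z by (intro A.m_assoc [symmetric]) simp_all
    finally show ?case by (simp only: monomial_Cons)
  qed
  have "z \<star> a = a \<star> z" if "a \<in> carrier A" for a
    using that
  proof (induction a rule: down_up_induct)
    case (step c w a)
    then show ?case using z m [of w] by (simp add: A.l_distr A.r_distr A.smult_mult_left A.smult_mult_right)
  qed (use z in simp)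
  then show "z \<in> algebra_center A" using z by (simp add: algebra_center_def)
qed

lemma Omega_eq: "down_up_Omega \<alpha> \<beta> \<omega> = UA \<boxplus> (- \<omega>) \<cdot> VA"
  by (simp add: down_up_Omega_def Let_def A.minus_eq A.smult_uminus)

lemma Omega_closed [simp]: "down_up_Omega \<alpha> \<beta> \<omega> \<in> carrier A"
  by (simp add: Omega_eq)

text \<open>The root \<omega>' factors out because \<alpha> - \<omega> = \<omega>' and \<beta> is
  minus the product of the roots. With two monomials of degree 3 for p and q this gives the exchange
  rules with x and with y.\<close>

lemma Omega_exchange:
  assumes "\<omega> + \<omega>' = \<alpha>" "\<omega> * \<omega>' = - \<beta>" "p \<in> carrier A" "q \<in> carrier A"
  shows "(\<alpha> \<cdot> p \<boxplus> \<beta> \<cdot> q) \<boxplus> (- \<omega>) \<cdot> p = \<omega>' \<cdot> (p \<boxplus> (- \<omega>) \<cdot> q)"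
proof -
  have e: "(\<alpha> - \<omega>) = \<omega>'" "\<omega>' * (- \<omega>) = \<beta>" using assms(1,2) by (auto simp: algebra_simps)
  have "(\<alpha> \<cdot> p \<boxplus> \<beta> \<cdot> q) \<boxplus> (- \<omega>) \<cdot> p = (\<alpha> \<cdot> p \<boxplus> (- \<omega>) \<cdot> p) \<boxplus> \<beta> \<cdot> q"
    using assms(3,4) by (simp add: A.a_ac)
  also have "\<dots> = \<omega>' \<cdot> p \<boxplus> \<omega>' \<cdot> ((- \<omega>) \<cdot> q)"
    using A.smult_l_distr [of p \<alpha> "- \<omega>"] A.smult_assoc [of q \<omega>' "- \<omega>"] assms(3,4) e by simp
  finally show ?thesis using assms(3,4) by (simp add: A.smult_r_distr)
qed

context
  fixes \<omega>1 \<omega>2 :: 'k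
  assumes roots: "\<omega>1 + \<omega>2 = \<alpha>" "\<omega>1 * \<omega>2 = - \<beta>"
begin

abbreviation "O1 \<equiv> down_up_Omega \<alpha> \<beta> \<omega>1"
abbreviation "O2 \<equiv> down_up_Omega \<alpha> \<beta> \<omega>2"

lemma roots': "\<omega>2 + \<omega>1 = \<alpha>" "\<omega>2 * \<omega>1 = - \<beta>"
  using roots by (simp_all add: ac_simps)

text \<open>A factor with root \<omega> is normal with respect to x: moving x past it costs the
  other root.\<close>

lemma Omega_gx: "\<omega> + \<omega>' = \<alpha> \<Longrightarrow> \<omega> * \<omega>' = - \<beta> \<Longrightarrow>
    gx \<star> down_up_Omega \<alpha> \<beta> \<omega> = \<omega>' \<cdot> (down_up_Omega \<alpha> \<beta> \<omega> \<star> gx)"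
  using Omega_exchange [of \<omega> \<omega>' "gx \<star> (gy \<star> gx)" "gy \<star> (gx \<star> gx)"] down_up_relation(1)
  by (simp add: Omega_eq A.r_distr A.l_distr A.smult_mult_left A.smult_mult_right A.m_assoc)

lemma Omega_gy: "\<omega> + \<omega>' = \<alpha> \<Longrightarrow> \<omega> * \<omega>' = - \<beta> \<Longrightarrow>
    down_up_Omega \<alpha> \<beta> \<omega> \<star> gy = \<omega>' \<cdot> (gy \<star> down_up_Omega \<alpha> \<beta> \<omega>)"
  using Omega_exchange [of \<omega> \<omega>' "gy \<star> (gx \<star> gy)" "gy \<star> (gy \<star> gx)"] down_up_relation(2)
  by (simp add: Omega_eq A.r_distr A.l_distr A.smult_mult_left A.smult_mult_right A.m_assoc)

text \<open>Passing both factors costs both roots, and their product is -\<beta>.\<close>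

lemma canonical_gx: "gx \<star> (O1 \<star> O2) = (- \<beta>) \<cdot> ((O1 \<star> O2) \<star> gx)"
proof -
  have "gx \<star> (O1 \<star> O2) = (gx \<star> O1) \<star> O2" by (intro A.m_assoc [symmetric]) simp_all
  also have "\<dots> = \<omega>2 \<cdot> (O1 \<star> (gx \<star> O2))"
    unfolding Omega_gx [OF roots] by (simp add: A.smult_mult_left A.m_assoc)
  also have "\<dots> = (\<omega>2 * \<omega>1) \<cdot> ((O1 \<star> O2) \<star> gx)"
    unfolding Omega_gx [OF roots'] by (simp add: A.smult_mult_right A.m_assoc A.smult_assoc)
  finally show ?thesis unfolding roots' .
qed

lemma canonical_gy: "(O1 \<star> O2) \<star> gy = (- \<beta>) \<cdot> (gy \<star> (O1 \<star> O2))"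
proof -
  have "(O1 \<star> O2) \<star> gy = O1 \<star> (O2 \<star> gy)" by (intro A.m_assoc) simp_all
  also have "\<dots> = \<omega>1 \<cdot> ((O1 \<star> gy) \<star> O2)"
    unfolding Omega_gy [OF roots'] by (simp add: A.smult_mult_right A.m_assoc)
  also have "\<dots> = (\<omega>1 * \<omega>2) \<cdot> (gy \<star> (O1 \<star> O2))"
    unfolding Omega_gy [OF roots] by (simp add: A.smult_mult_left A.m_assoc A.smult_assoc)
  finally show ?thesis unfolding roots .
qed

text \<open>The element is the value at xy and yx of the product of the polynomials u - \<omega>1 v
  and u - \<omega>2 v. Its coordinates are those of 1 multiplied by this product, which is not zero
  since k[u, v] is a domain.\<close>

lemma canonical_nonzero: "O1 \<star> O2 \<noteq> \<zero>\<^bsub>A\<^esub>"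
proof
  assume z: "O1 \<star> O2 = \<zero>\<^bsub>A\<^esub>"
  define r where "r \<omega> = U2 + const2 (- \<omega>) * V2" for \<omega> :: 'k
  have ev: "down_up_Omega \<alpha> \<beta> \<omega> = ev (r \<omega>)" for \<omega>
    using ev_U2 [of 1] ev_V2 [of 1] by (simp add: Omega_eq r_def ev_add ev_const2_mult ev_1)
  have "coeff (const2 c * V2) 0 = 0" for c :: 'k
    by (simp add: V2_def coeff_mult_0)
  then have "coeff (r \<omega>) 0 = [:0, 1:]" for \<omega> by (simp add: r_def U2_def)
  then have nz: "r \<omega> \<noteq> 0" for \<omega> by (metis coeff_0 one_neq_zero pCons_eq_0_iff)
  have "theta (O1 \<star> O2) = (\<lambda>m. r \<omega>2 * theta O1 m)" unfolding ev [of \<omega>2] by (rule theta_ev) simp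
  moreover have "theta O1 = (\<lambda>m. r \<omega>1 * theta \<one>\<^bsub>A\<^esub> m)"
    using theta_ev [of "\<one>\<^bsub>A\<^esub>" "r \<omega>1"] by (simp add: ev)
  moreover have "theta \<one>\<^bsub>A\<^esub> = unit_laurent" using theta_monomial [of "[]"] by (simp add: monomial_Nil)
  ultimately have "r \<omega>2 * (r \<omega>1 * unit_laurent 0) = 0" using z theta_zero by metis
  then show False using nz by (simp add: unit_laurent_def)
qed

text \<open>If \<beta> is not -1, the exchange rule forces the product with x to vanish, and right
  multiplication by x is injective because \<open>rho\<close> undoes it.\<close>

lemma canonical_commute_gx:
  assumes "gx \<star> (O1 \<star> O2) = (O1 \<star> O2) \<star> gx" shows "\<beta> = -1"
proof (rule ccontr)
  assume "\<beta> \<noteq> -1"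
  then have nz: "1 + \<beta> \<noteq> 0" by (simp add: add_eq_0_iff)
  define z where "z = (O1 \<star> O2) \<star> gx"
  have zc: "z \<in> carrier A" by (simp add: z_def)
  have "(- \<beta>) \<cdot> z = z" using canonical_gx assms unfolding z_def by simp
  then have "(1 + \<beta>) \<cdot> z = \<zero>\<^bsub>A\<^esub>"
    using A.smult_l_distr [OF zc, of 1 \<beta>] A.smult_l_distr [OF zc, of "- \<beta>" \<beta>] zc by simp
  then have "(1 / (1 + \<beta>)) \<cdot> ((1 + \<beta>) \<cdot> z) = \<zero>\<^bsub>A\<^esub>" by simp
  then have "z = \<zero>\<^bsub>A\<^esub>" using A.smult_assoc [OF zc, of "1 / (1 + \<beta>)" "1 + \<beta>"] nz zc by simp
  then have "O1 \<star> O2 = rho \<zero>\<^bsub>A\<^esub>" using rho_gx [of "O1 \<star> O2"] unfolding z_def by simp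
  also have "rho \<zero>\<^bsub>A\<^esub> = \<zero>\<^bsub>A\<^esub>" using rho_linear(2) [of "\<zero>\<^bsub>A\<^esub>" 0] by simp
  finally show False using canonical_nonzero by simp
qed

lemma canonical_commute:
  assumes \<beta>1: "\<beta> = -1"
  shows "(O1 \<star> O2) \<star> gx = gx \<star> (O1 \<star> O2)" "(O1 \<star> O2) \<star> gy = gy \<star> (O1 \<star> O2)"
proof -
  have "- \<beta> = 1" using \<beta>1 by simp
  then show "(O1 \<star> O2) \<star> gx = gx \<star> (O1 \<star> O2)" "(O1 \<star> O2) \<star> gy = gy \<star> (O1 \<star> O2)"
    unfolding canonical_gx canonical_gy by simp_all
qed

end

end

section \<open>Base change to the algebraic closure\<close>

definition restrict_scalars :: "('k \<Rightarrow> 'l) \<Rightarrow> ('l, 'a) module \<Rightarrow> ('k, 'a) module" where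
  "restrict_scalars h M =
    \<lparr>carrier = carrier M, monoid.mult = undefined, monoid.one = undefined,
     ring.zero = \<zero>\<^bsub>M\<^esub>, ring.add = ring.add M, module.smult = (\<lambda>c. module.smult M (h c))\<rparr>"

lemma restrict_scalars_simps [simp]:
  "carrier (restrict_scalars h M) = carrier M"
  "u \<oplus>\<^bsub>restrict_scalars h M\<^esub> v = u \<oplus>\<^bsub>M\<^esub> v"
  "c \<odot>\<^bsub>restrict_scalars h M\<^esub> u = h c \<odot>\<^bsub>M\<^esub> u"
  "\<zero>\<^bsub>restrict_scalars h M\<^esub> = \<zero>\<^bsub>M\<^esub>"
  by (simp_all add: restrict_scalars_def)

text \<open>The down-up algebra over the closure has to serve as the target of k-linear maps out of
  A.\<close>

lemma left_module_restrict_scalars: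
  fixes M :: "('k::field alg_closure, 'a) module"
  assumes "k_algebra M"
  shows "left_module (field_ring :: 'k ring) (restrict_scalars to_ac M)"
proof (intro left_module.intro left_module_axioms.intro ring_field_ring)
  interpret M: k_algebra M by (rule assms)
  show "abelian_group (restrict_scalars to_ac M :: ('k, 'a) module)"
  proof (rule abelian_groupI)
    show "\<exists>b\<in>carrier (restrict_scalars to_ac M :: ('k, 'a) module).
        b \<oplus>\<^bsub>restrict_scalars to_ac M :: ('k, 'a) module\<^esub> a = \<zero>\<^bsub>restrict_scalars to_ac M :: ('k, 'a) module\<^esub>"
      if "a \<in> carrier (restrict_scalars to_ac M :: ('k, 'a) module)" for a
      by (rule bexI [of _ "\<ominus>\<^bsub>M\<^esub> a"]) (use that in \<open>simp_all add: M.l_neg\<close>)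
  qed (simp_all add: M.a_ac)
qed (simp_all add: k_algebra.smult_closed [OF assms] k_algebra.smult_l_distr [OF assms]
    k_algebra.smult_r_distr [OF assms] k_algebra.smult_assoc [OF assms] k_algebra.smult_one [OF assms])

abbreviation extend_coeffs :: "'k::field poly poly \<Rightarrow> 'k alg_closure poly poly" where
  "extend_coeffs \<equiv> map_poly (map_poly to_ac)"

lemma extend_coeffs_simps [simp]:
  fixes r s :: "'k::field poly poly" and c :: 'k
  shows "extend_coeffs (r + s) = extend_coeffs r + extend_coeffs s"
  "extend_coeffs (const2 c) = const2 (to_ac c)"
  "extend_coeffs (U2 * r) = U2 * extend_coeffs r"
  "extend_coeffs (V2 * r) = V2 * extend_coeffs r"
  "extend_coeffs (const2 c * r) = const2 (to_ac c) * extend_coeffs r"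
proof -
  have c: "coeff (map_poly to_ac p) n = to_ac (coeff p n)" for p :: "'k poly" and n
    by (simp add: coeff_map_poly)
  have cc: "coeff (coeff (extend_coeffs p) m) n = to_ac (coeff (coeff p m) n)" for p :: "'k poly poly" and m n
    by (simp add: coeff_map_poly)
  have eqI: "p = q" if "\<And>m n. coeff (coeff p m) n = coeff (coeff q m) n" for p q :: "'k alg_closure poly poly"
    using that by (intro poly_eqI) blast
  have K: "const2 c * s = smult [:c:] s" for c :: "'l::field" and s by (simp add: const2_def mult_pCons_left)
  have K': "[:c:] * t = smult c t" for c :: "'l::field" and t by (simp add: mult_pCons_left)
  have X: "[:0, 1:] * t = pCons 0 t" for t :: "'l::field poly" by (simp add: mult_pCons_left)
  show "extend_coeffs (r + s) = extend_coeffs r + extend_coeffs s" by (rule eqI) (simp add: cc)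
  show "extend_coeffs (const2 c) = const2 (to_ac c)"
    by (simp add: const2_def map_poly_pCons)
  show "extend_coeffs (U2 * r) = U2 * extend_coeffs r"
    by (rule eqI) (simp add: cc c U2_mult X coeff_pCons coeff_map_poly split: nat.split)
  show "extend_coeffs (V2 * r) = V2 * extend_coeffs r"
    by (simp add: V2_mult map_poly_pCons)
  show "extend_coeffs (const2 c * r) = const2 (to_ac c) * extend_coeffs r"
    by (rule eqI) (simp add: cc K K' coeff_map_poly)
qed

lemma extend_coeffs_inj:
  fixes r s :: "'k::field poly poly"
  shows "extend_coeffs r = extend_coeffs s \<Longrightarrow> r = s"
proof (intro poly_eqI)
  fix m n assume "extend_coeffs r = extend_coeffs s"
  then have "coeff (coeff (extend_coeffs r) m) n = coeff (coeff (extend_coeffs s) m) n" by simp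
  then show "coeff (coeff r m) n = coeff (coeff s m) n" by (simp add: coeff_map_poly)
qed

context down_up_params
begin

context
begin

interpretation L: down_up_params "to_ac \<alpha>" "to_ac \<beta>"
  by unfold_locales (simp add: \<beta>)

lemma extend_coeffs_phi: "extend_coeffs (phi r) = L.phi (extend_coeffs r)"
proof (induction r rule: bivariate_induct)
  case (U c s)
  then show ?case by (simp add: distrib_right mult.assoc)
next
  case (V s r)
  then show ?case by (simp add: distrib_right mult.assoc)
qed simp

lemma extend_coeffs_psi: "extend_coeffs (psi r) = L.psi (extend_coeffs r)"
proof (induction r rule: bivariate_induct)
  case (U c s)
  then show ?case by (simp add: distrib_right mult.assoc)
next
  case (V s r)
  then show ?case by (simp add: distrib_right mult.assoc)
qed simp

lemma extend_coeffs_op_gen: "extend_coeffs (op_gen g f m) = L.op_gen g (\<lambda>m. extend_coeffs (f m)) m"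
  by (cases g) (simp_all add: opX_def opY_def L.opX_def L.opY_def extend_coeffs_phi extend_coeffs_psi)

text \<open>The operators on coordinates are defined over k, so they commute with extension of
  coefficients.\<close>

lemma theta_monomial_extend: "L.theta (L.monomial w) = (\<lambda>m. extend_coeffs (theta (monomial w) m))"
proof (induction w rule: rev_induct)
  case Nil
  have "extend_coeffs 1 = 1" using extend_coeffs_simps(2) [of "1 :: 'k"] by simp
  then show ?case by (simp add: theta_monomial L.theta_monomial unit_laurent_def L.unit_laurent_def fun_eq_iff)
next
  case (snoc g w)
  show ?case
    unfolding monomial_snoc L.monomial_snoc theta_gen [OF monomial_closed] L.theta_gen [OF L.monomial_closed]
      snoc extend_coeffs_op_gen by (rule refl)
qed

abbreviation "LA \<equiv> restrict_scalars to_ac L.A :: ('k, (generator list \<Rightarrow> 'k alg_closure) set) module"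

lemma left_module_LA: "left_module field_ring LA"
  by (rule left_module_restrict_scalars [OF L.A.k_algebra_axioms])

lemma monomial_Pi: "L.monomial \<in> carrier word_monoid \<rightarrow> carrier LA"
  by simp

lemma monomial_relation:
  "L.monomial [GenX, GenX, GenY] = to_ac \<alpha> \<odot>\<^bsub>L.A\<^esub> L.monomial [GenX, GenY, GenX] \<oplus>\<^bsub>L.A\<^esub> to_ac \<beta> \<odot>\<^bsub>L.A\<^esub> L.monomial [GenY, GenX, GenX]"
  "L.monomial [GenX, GenY, GenY] = to_ac \<alpha> \<odot>\<^bsub>L.A\<^esub> L.monomial [GenY, GenX, GenY] \<oplus>\<^bsub>L.A\<^esub> to_ac \<beta> \<odot>\<^bsub>L.A\<^esub> L.monomial [GenY, GenY, GenX]"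
  using L.down_up_relation by (simp_all add: L.monomial_Cons L.monomial_Nil)

text \<open>The family consists of two-sided multiples of words by p and q, which absorb prefixes
  and suffixes.\<close>

lemma extension_ideal:
  assumes "f \<in> down_up_ideal \<alpha> \<beta>"
  shows "lin_comb field_ring LA L.monomial f = \<zero>\<^bsub>LA\<^esub>"
proof (rule down_up_ideal_lin_comb_eq_zero [OF left_module_LA _ _ _ _ _ assms,
      where \<Gamma> = "{\<lambda>w. p \<otimes>\<^bsub>L.A\<^esub> (L.monomial w \<otimes>\<^bsub>L.A\<^esub> q) | p q. p \<in> carrier L.A \<and> q \<in> carrier L.A}"])
  show "L.monomial \<in> {\<lambda>w. p \<otimes>\<^bsub>L.A\<^esub> (L.monomial w \<otimes>\<^bsub>L.A\<^esub> q) | p q. p \<in> carrier L.A \<and> q \<in> carrier L.A}"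
    by (rule CollectI, rule exI [of _ "\<one>\<^bsub>L.A\<^esub>"], rule exI [of _ "\<one>\<^bsub>L.A\<^esub>"]) (simp add: fun_eq_iff)
  fix g assume "g \<in> {\<lambda>w. p \<otimes>\<^bsub>L.A\<^esub> (L.monomial w \<otimes>\<^bsub>L.A\<^esub> q) | p q. p \<in> carrier L.A \<and> q \<in> carrier L.A}"
  then obtain p q where g: "g = (\<lambda>w. p \<otimes>\<^bsub>L.A\<^esub> (L.monomial w \<otimes>\<^bsub>L.A\<^esub> q))" and pq: "p \<in> carrier L.A" "q \<in> carrier L.A"
    by blast
  show "(\<lambda>v. g (u @ v)) \<in> {\<lambda>w. p \<otimes>\<^bsub>L.A\<^esub> (L.monomial w \<otimes>\<^bsub>L.A\<^esub> q) | p q. p \<in> carrier L.A \<and> q \<in> carrier L.A}" for u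
    unfolding g
    by (rule CollectI, rule exI [of _ "p \<otimes>\<^bsub>L.A\<^esub> L.monomial u"], rule exI [of _ q])
      (simp add: pq L.monomial_append L.A.m_assoc fun_eq_iff)
  show "(\<lambda>v. g (v @ u)) \<in> {\<lambda>w. p \<otimes>\<^bsub>L.A\<^esub> (L.monomial w \<otimes>\<^bsub>L.A\<^esub> q) | p q. p \<in> carrier L.A \<and> q \<in> carrier L.A}" for u
    unfolding g
    by (rule CollectI, rule exI [of _ p], rule exI [of _ "L.monomial u \<otimes>\<^bsub>L.A\<^esub> q"])
      (simp add: pq L.monomial_append L.A.m_assoc fun_eq_iff)
  show "g w \<in> carrier LA" for w unfolding g by (simp add: pq)
  show "g [GenX, GenX, GenY] = \<alpha> \<odot>\<^bsub>LA\<^esub> g [GenX, GenY, GenX] \<oplus>\<^bsub>LA\<^esub> \<beta> \<odot>\<^bsub>LA\<^esub> g [GenY, GenX, GenX]"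
    "g [GenX, GenY, GenY] = \<alpha> \<odot>\<^bsub>LA\<^esub> g [GenY, GenX, GenY] \<oplus>\<^bsub>LA\<^esub> \<beta> \<odot>\<^bsub>LA\<^esub> g [GenY, GenY, GenX]"
    unfolding g monomial_relation
    using pq by (simp_all add: L.A.l_distr L.A.r_distr L.A.smult_mult_left L.A.smult_mult_right)
qed

lemmas extension_lift = monoid_word_monoid left_module_LA ideal_down_up monomial_Pi extension_ideal

lemma extend_closed: "f \<in> carrier free_algebra \<Longrightarrow> to_ac \<circ> f \<in> carrier free_algebra"
  by (simp add: monoid_algebra_def word_monoid_def)

lemma coset_extend:
  assumes f: "f \<in> carrier free_algebra"
  shows "L.cs (to_ac \<circ> f) = lin_comb field_ring LA L.monomial f"
  using f
proof (induction f rule: monoid_algebra_induct)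
  case zero
  have "lin_comb field_ring LA L.monomial (\<lambda>w. 0) = \<zero>\<^bsub>LA\<^esub>"
    using lin_comb_monoid_algebra_smult [OF left_module_LA monomial_Pi free_algebra_basis_elem [of "[]"], where c = 0]
    by (simp add: lin_comb_basis_elem [OF left_module_LA])
  then show ?case using L.coset_zero by (simp add: comp_def)
next
  case (step c u g)
  have "to_ac \<circ> (\<lambda>w. c * basis_elem u w + g w) = (\<lambda>w. to_ac c * basis_elem u w + (to_ac \<circ> g) w)"
    by (auto simp: fun_eq_iff basis_elem_def)
  moreover have "lin_comb field_ring LA L.monomial (\<lambda>w. c * basis_elem u w + g w) =
      to_ac c \<odot>\<^bsub>L.A\<^esub> L.monomial u \<oplus>\<^bsub>L.A\<^esub> lin_comb field_ring LA L.monomial g"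
    using lin_comb_monoid_algebra_add [OF left_module_LA monomial_Pi free_algebra_scale [OF free_algebra_basis_elem [of u], of c] step(2)]
      lin_comb_monoid_algebra_smult [OF left_module_LA monomial_Pi free_algebra_basis_elem [of u], where c = c]
    by (simp add: lin_comb_basis_elem [OF left_module_LA])
  ultimately show ?case using L.coset_step [OF extend_closed [OF step(2)]] step(3) by simp
qed

text \<open>\<open>down_up_to_ac\<close> is a union over representatives. Each of them gives the
  same coset, which identifies the union with the linear map that sends words to words.\<close>

lemma to_ac_lift:
  assumes "a \<in> carrier A"
  shows "down_up_to_ac \<alpha> \<beta> a = linear_lift LA L.monomial a"
proof -
  obtain f where f: "f \<in> carrier free_algebra" "a = cs f" by (rule cs_representative [OF assms])
  have l: "linear_lift LA L.monomial (cs h) = lin_comb field_ring LA L.monomial h" if "h \<in> carrier free_algebra" for h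
    by (rule linear_lift_coset [OF extension_lift that])
  have "L.cs (to_ac \<circ> g) = linear_lift LA L.monomial a" if g: "g \<in> a" for g
  proof -
    interpret F: k_algebra "free_algebra :: ('k, generator list \<Rightarrow> 'k) module" by (rule k_algebra_free)
    interpret I: ideal "down_up_ideal \<alpha> \<beta>" free_algebra by (rule ideal_down_up)
    have gc: "g \<in> carrier free_algebra" by (rule I.a_elemrcos_carrier [OF f(1) g [unfolded f(2)]])
    have "cs f = cs g" by (rule I.a_repr_independence' [OF g [unfolded f(2)] f(1)])
    then show ?thesis using l [OF gc] coset_extend [OF gc] f(2) by simp
  qed
  moreover have "a \<noteq> {}"
  proof -
    interpret I: ideal "down_up_ideal \<alpha> \<beta>" free_algebra by (rule ideal_down_up)
    show ?thesis using I.a_rcos_self [OF f(1)] f(2) by blast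
  qed
  ultimately show ?thesis unfolding down_up_to_ac_def by simp
qed

lemma to_ac_closed:
  assumes "a \<in> carrier A"
  shows "down_up_to_ac \<alpha> \<beta> a \<in> carrier L.A"
proof -
  have "linear_lift LA L.monomial a \<in> carrier LA"
    by (rule linear_lift_closed [OF extension_lift]; insert assms, unfold down_up_algebra_def, assumption)
  then show ?thesis by (simp add: to_ac_lift [OF assms])
qed

lemma to_ac_step:
  assumes "a \<in> carrier A"
  shows "down_up_to_ac \<alpha> \<beta> (c \<cdot> monomial w \<boxplus> a) = to_ac c \<odot>\<^bsub>L.A\<^esub> L.monomial w \<oplus>\<^bsub>L.A\<^esub> down_up_to_ac \<alpha> \<beta> a"
proof -
  obtain f where f: "f \<in> carrier free_algebra" "a = cs f" by (rule cs_representative [OF assms])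
  have l: "down_up_to_ac \<alpha> \<beta> (cs h) = L.cs (to_ac \<circ> h)" if "h \<in> carrier free_algebra" for h
    unfolding to_ac_lift [OF cs_closed [OF that]] coset_extend [OF that]
    by (rule linear_lift_coset [OF extension_lift that])
  have e: "to_ac \<circ> (\<lambda>v. c * basis_elem w v + f v) = (\<lambda>v. to_ac c * basis_elem w v + (to_ac \<circ> f) v)"
    by (auto simp: fun_eq_iff basis_elem_def)
  show ?thesis
    unfolding f(2) coset_step [OF f(1), symmetric] l [OF f(1)] l [OF free_step_closed [OF f(1)]] e
    by (rule L.coset_step [OF extend_closed [OF f(1)]])
qed

lemma to_ac_zero: "down_up_to_ac \<alpha> \<beta> \<zero>\<^bsub>A\<^esub> = \<zero>\<^bsub>L.A\<^esub>"
proof -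
  have "linear_lift LA L.monomial (0 \<cdot> \<zero>\<^bsub>A\<^esub>) = 0 \<odot>\<^bsub>LA\<^esub> linear_lift LA L.monomial \<zero>\<^bsub>A\<^esub>"
    unfolding down_up_algebra_def [of \<alpha> \<beta>]
    by (rule linear_lift_smult [OF extension_lift]; insert A.zero_closed, unfold down_up_algebra_def, assumption)
  then show ?thesis using to_ac_closed [of "\<zero>\<^bsub>A\<^esub>"] by (simp add: to_ac_lift)
qed

text \<open>Centrality is tested on the generators, so this is the amount of multiplicativity that
  has to be transported.\<close>

lemma to_ac_generator:
  "a \<in> carrier A \<Longrightarrow> down_up_to_ac \<alpha> \<beta> (a \<star> down_up_generator \<alpha> \<beta> g) =
    down_up_to_ac \<alpha> \<beta> a \<otimes>\<^bsub>L.A\<^esub> down_up_generator (to_ac \<alpha>) (to_ac \<beta>) g"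
  "a \<in> carrier A \<Longrightarrow> down_up_to_ac \<alpha> \<beta> (down_up_generator \<alpha> \<beta> g \<star> a) =
    down_up_generator (to_ac \<alpha>) (to_ac \<beta>) g \<otimes>\<^bsub>L.A\<^esub> down_up_to_ac \<alpha> \<beta> a"
  by (induction a rule: down_up_induct)
    (simp_all add: to_ac_zero to_ac_step to_ac_closed A.l_distr A.r_distr A.smult_mult_left A.smult_mult_right
      L.A.l_distr L.A.r_distr L.A.smult_mult_left L.A.smult_mult_right
      flip: monomial_Cons monomial_snoc L.monomial_Cons L.monomial_snoc)

lemma theta_to_ac: "a \<in> carrier A \<Longrightarrow> L.theta (down_up_to_ac \<alpha> \<beta> a) = (\<lambda>m. extend_coeffs (theta a m))"
  by (induction a rule: down_up_induct)
    (simp_all add: to_ac_zero to_ac_step to_ac_closed theta_zero L.theta_zero theta_add L.theta_add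
      theta_smult L.theta_smult theta_monomial_extend)

text \<open>Injectivity is seen on coordinates: extending the coefficients of polynomials is
  injective, and \<open>theta\<close> is faithful.\<close>

lemma to_ac_inj:
  assumes "a \<in> carrier A" "b \<in> carrier A" "down_up_to_ac \<alpha> \<beta> a = down_up_to_ac \<alpha> \<beta> b"
  shows "a = b"
proof (rule theta_inj [OF assms(1,2)])
  have "extend_coeffs (theta a m) = extend_coeffs (theta b m)" for m
    using theta_to_ac [OF assms(1)] theta_to_ac [OF assms(2)] assms(3) by metis
  then show "theta a = theta b" using extend_coeffs_inj by blast
qed

theorem canonical_central_iff:
  assumes "is_canonical_element \<alpha> \<beta> b"
  shows "b \<in> algebra_center A \<longleftrightarrow> \<beta> = -1"
proof -
  obtain \<omega>1 \<omega>2 where b: "b \<in> carrier A"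
    and poly: "[: - to_ac \<beta>, - to_ac \<alpha>, 1 :] = [: - \<omega>1, 1 :] * [: - \<omega>2, 1 :]"
    and img: "down_up_to_ac \<alpha> \<beta> b = down_up_Omega (to_ac \<alpha>) (to_ac \<beta>) \<omega>1 \<otimes>\<^bsub>L.A\<^esub> down_up_Omega (to_ac \<alpha>) (to_ac \<beta>) \<omega>2"
    using assms unfolding is_canonical_element_def by blast
  \<comment> \<open>Comparison of the coefficients of the quadratic polynomial with those of its
    factorisation.\<close>
  have roots: "\<omega>1 + \<omega>2 = to_ac \<alpha>" "\<omega>1 * \<omega>2 = - to_ac \<beta>"
    using poly by (simp_all add: mult_pCons_left add_eq_0_iff algebra_simps)
  have "to_ac \<beta> = -1 \<longleftrightarrow> to_ac \<beta> = to_ac (-1)" by simp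
  then have ac: "to_ac \<beta> = -1 \<longleftrightarrow> \<beta> = -1" unfolding to_ac_eq_iff .
  note gen = to_ac_generator [OF b]
  show ?thesis
  proof
    assume "b \<in> algebra_center A"
    then have "gx \<star> b = b \<star> gx" unfolding center_iff by simp
    then show "\<beta> = -1"
      using L.canonical_commute_gx [OF roots] gen(1) [of GenX] gen(2) [of GenX] unfolding img ac by simp
  next
    assume "\<beta> = -1"
    then have ac1: "to_ac \<beta> = -1" unfolding ac .
    \<comment> \<open>The identity is checked over the closure, where the two factors exist, and
      descends by injectivity.\<close>
    have "b \<star> gx = gx \<star> b"
    proof (rule to_ac_inj)
      show "down_up_to_ac \<alpha> \<beta> (b \<star> gx) = down_up_to_ac \<alpha> \<beta> (gx \<star> b)"
        unfolding gen img by (rule L.canonical_commute(1) [OF roots ac1])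
    qed (use b in simp_all)
    moreover have "b \<star> gy = gy \<star> b"
    proof (rule to_ac_inj)
      show "down_up_to_ac \<alpha> \<beta> (b \<star> gy) = down_up_to_ac \<alpha> \<beta> (gy \<star> b)"
        unfolding gen img by (rule L.canonical_commute(2) [OF roots ac1])
    qed (use b in simp_all)
    ultimately show "b \<in> algebra_center A" using b unfolding center_iff by simp
  qed
qed

end

end

theorem proposition6p3:
  fixes \<alpha> \<beta> :: "'k::field_char_0" and b :: "(generator list \<Rightarrow> 'k) set"
  assumes "\<beta> \<noteq> 0"
    and "polynomial_identity_algebra (down_up_algebra \<alpha> \<beta>)"
    and "is_canonical_element \<alpha> \<beta> b"
  shows "calabi_yau 3 (down_up_algebra \<alpha> \<beta>) (down_up_degree \<alpha> \<beta>)
           \<longleftrightarrow> b \<in> algebra_center (down_up_algebra \<alpha> \<beta>)"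
proof -
  interpret down_up_params \<alpha> \<beta> by unfold_locales (rule assms(1))
  show ?thesis unfolding calabi_yau_iff canonical_central_iff [OF assms(3)] ..
qed

end
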